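(* Let $(\Sigma_A,T)$ be a topologically mixing subshift of finite type, let $\Psi\in\mathcal C_{aa}^-(\Sigma_A,T)$, let $\Phi\in \mathcal C_{aa}(\Sigma_A,T,d)$, and endow $\Sigma_A$ with the metric $d_\Psi$. Write $\mathcal D(\alpha)=\dim_H E_\Phi(\alpha)$. (1) For $\alpha\in\mathbb R^d$, $E_\Phi(\alpha)\neq\emptyset$ if and only if $\alpha\in L_\Phi$. For every $\alpha\in L_\Phi$, $$\mathcal D(\alpha)=\Lambda(\alpha)=\mathcal E(\alpha),$$ and the function $\mathcal D:L_\Phi\to\mathbb R$ is weakly concave. (2) $\dim_H\Sigma_A=\dim_B\Sigma_A=D(\Psi)=\max\{\mathcal D(\alpha):\alpha\in L_\Phi\}$.
   Context: Subshift. $A$ is an $m\times m$ matrix with entries in $\{0,1\}$ such that all entries of $A^{p_0}$ are positive for some $p_0\in\mathbb N$; $\Sigma_A=\{x=x_1x_2\cdots\in\{1,\dots,m\}^{\mathbb N}:A(x_i,x_{i+1})=1\ \forall i\}$ with the product topology, and $T$ is the shift. $\mathcal M(\Sigma_A,T)$ is the set of $T$-invariant Borel probability measures and $h_\mu(T)$ is the measure-theoretic entropy. $\Sigma_{A,n}$ is the set of admissible words of length $n$, $\Sigma_{A,*}=\bigcup_{n\ge0}\Sigma_{A,n}$, $|w|$ is the length of $w$, $x|_n$ is the prefix of length $n$, $[w]=\{x\in\Sigma_A:x|_{|w|}=w\}$, $x\wedge y$ is the longest common prefix of $x\ne y$, and $w^*$ is $w$ with its last letter deleted. Almost additive potentials.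 $\mathcal C_{aa}(\Sigma_A,T)$ is the set of sequences $\Phi=(\phi_n)_{n\ge1}$ of continuous functions $\phi_n:\Sigma_A\to\mathbb R$ for which there is a constant $C(\Phi)$ (fixed along with $\Phi$) with $-C(\Phi)+\phi_n+\phi_p\circ T^n\le\phi_{n+p}\le C(\Phi)+\phi_n+\phi_p\circ T^n$ for all $n,p\in\mathbb N$. Put $\Phi_{\max}=\max\phi_1+C(\Phi)$, $\Phi_{\min}=\min\phi_1-C(\Phi)$; $\mathcal C_{aa}^-(\Sigma_A,T)=\{\Phi\in\mathcal C_{aa}(\Sigma_A,T):\Phi_{\max}<0\}$. $\mathcal C_{aa}(\Sigma_A,T,d)$ is the set of $\Phi=(\Phi^1,\dots,\Phi^d)$ with each $\Phi^i\in\mathcal C_{aa}(\Sigma_A,T)$, regarded as a sequence of maps $\phi_n:\Sigma_A\to\mathbb R^d$. $\Phi_*(\mu)=\lim_{n\to\infty}\int\frac{\phi_n}{n}\,d\mu$ and $L_\Phi=\{\Phi_*(\mu):\mu\in\mathcal M(\Sigma_A,T)\}$, a compact convex subset of $\mathbb R^d$. Metric. For $\Psi=(\psi_n)\in\mathcal C_{aa}^-(\Sigma_A,T)$ and $w\in\Sigma_{A,n}$, $\Psi[w]=\sup\{\exp(\psi_n(x)):x\in[w]\}$, with $\Psi[w]=1$ for the empty word. $d_\Psi(x,y)=\Psi[x\wedge y]$ if $x\neq y$, and $0$ if $x=y$; this is an ultrametric. $\dim_H,\dim_B$ are Hausdorff and box dimensions for $d_\Psi$. $E_\Phi(\alpha)=\{x\in\Sigma_A:\lim_{n\to\infty}\phi_n(x)/n=\alpha\}$.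 Box counting. $\mathcal B_n(\Psi)$ is the set of $w\in\Sigma_{A,*}$ such that $[w]$ is a closed ball of radius $e^{-n}$, i.e. $\Psi[w]\le e^{-n}$ and ($w$ is empty or $\Psi[w^*]>e^{-n}$). $D(\Psi)=\lim_{n\to\infty}\frac1n\log\#\mathcal B_n(\Psi)$ (the limit exists). For $\alpha\in L_\Phi$, $f(\alpha,n,\epsilon)$ is the number of $u\in\mathcal B_n(\Psi)$ for which there is $x\in[u]$ with $\left|\phi_{|u|}(x)/|u|-\alpha\right|<\epsilon$, and $\Lambda(\alpha)=\lim_{\epsilon\to0}\liminf_{n\to\infty}\frac{\log f(\alpha,n,\epsilon)}n=\lim_{\epsilon\to0}\limsup_{n\to\infty}\frac{\log f(\alpha,n,\epsilon)}n$ (the two are equal). Variational function. $\mathcal E(\alpha)=\sup\left\{\frac{h_\mu(T)}{-\Psi_*(\mu)}:\mu\in\mathcal M(\Sigma_A,T),\ \Phi_*(\mu)=\alpha\right\}$. Weak concavity. For $B\subset\mathbb R^d$ convex, $h:B\to\mathbb R$ is weakly concave if there is $c\ge1$ such that for all $\alpha,\beta\in B$ there are $\gamma_1,\gamma_2\in[c^{-1},c]$ (depending on $\alpha,\beta$) such that for all $\lambda\in[0,1]$, $\lambda h(\alpha)+(1-\lambda)h(\beta)\le h\left(\frac{\lambda\gamma_1\alpha+(1-\lambda)\gamma_2\beta}{\lambda\gamma_1+(1-\lambda)\gamma_2}\right)$. *)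

theory Defs
  imports
    "HOL-Analysis.Analysis"
    "HOL-Probability.Probability_Measure"
    "HOL-Library.Disjoint_Sets"
    "Jordan_Normal_Form.Matrix"
begin

no_notation vec_index (infixl "$" 100)

section \<open>Subshifts of finite type\<close>

text \<open>The alphabet is \<open>{0..<m}\<close> (the row indices of the \<open>m \<times> m\<close> matrix) instead of
  \<open>{1..m}\<close>, and sequences are indexed from \<open>0\<close>, so that \<open>x n\<close> is the letter \<open>x\<^sub>n\<^sub>+\<^sub>1\<close>. The topology
  and the Borel sets of \<^typ>\<open>nat \<Rightarrow> nat\<close> are those of the product of discrete spaces.\<close>

definition primitive_01_mat :: "nat mat \<Rightarrow> bool" where
  "primitive_01_mat A \<longleftrightarrow>
     dim_row A \<ge> 1 \<and> square_mat A \<and>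
     (\<forall>i<dim_row A. \<forall>j<dim_row A. A $$ (i, j) \<in> {0, 1}) \<and>
     (\<exists>p\<ge>1. \<forall>i<dim_row A. \<forall>j<dim_row A. 0 < (A ^\<^sub>m p) $$ (i, j))"

definition subshift :: "nat mat \<Rightarrow> (nat \<Rightarrow> nat) set" where
  "subshift A = {x. (\<forall>n. x n < dim_row A) \<and> (\<forall>n. A $$ (x n, x (Suc n)) = 1)}"

definition shift :: "(nat \<Rightarrow> nat) \<Rightarrow> nat \<Rightarrow> nat" where
  "shift x = (\<lambda>n. x (Suc n))"

definition admissible_words :: "nat mat \<Rightarrow> nat list set" where
  "admissible_words A =
     {w. set w \<subseteq> {..<dim_row A} \<and> (\<forall>i. Suc i < length w \<longrightarrow> A $$ (w ! i, w ! Suc i) = 1)}"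

definition seq_prefix :: "(nat \<Rightarrow> nat) \<Rightarrow> nat \<Rightarrow> nat list" where
  "seq_prefix x n = map x [0..<n]"

definition cylinder :: "nat mat \<Rightarrow> nat list \<Rightarrow> (nat \<Rightarrow> nat) set" where
  "cylinder A w = {x \<in> subshift A. seq_prefix x (length w) = w}"

text \<open>Only meaningful for \<open>x \<noteq> y\<close>.\<close>

definition common_prefix :: "(nat \<Rightarrow> nat) \<Rightarrow> (nat \<Rightarrow> nat) \<Rightarrow> nat list" where
  "common_prefix x y = seq_prefix x (LEAST n. x n \<noteq> y n)"

section \<open>Invariant measures and entropy\<close>

definition invariant_measures :: "nat mat \<Rightarrow> (nat \<Rightarrow> nat) measure set" where
  "invariant_measures A =
     {M. prob_space M \<and> sets M = sets (restrict_space borel (subshift A)) \<and>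
         shift \<in> measurable M M \<and> distr M M shift = M}"

definition partition_entropy :: "'a measure \<Rightarrow> 'a set set \<Rightarrow> real" where
  "partition_entropy M P = - (\<Sum>B\<in>P. measure M B * ln (measure M B))"

text \<open>The join \<open>P \<or> T\<inverse> P \<or> \<dots> \<or> T\<^sup>-\<^sup>(\<^sup>n\<^sup>-\<^sup>1\<^sup>) P\<close>. It may contain the empty set, which does not
  contribute to the entropy since \<open>0 * ln 0 = 0\<close>.\<close>

definition iterated_join :: "'a measure \<Rightarrow> ('a \<Rightarrow> 'a) \<Rightarrow> 'a set set \<Rightarrow> nat \<Rightarrow> 'a set set" where
  "iterated_join M T P n = {{x \<in> space M. \<forall>i<n. (T ^^ i) x \<in> s i} |s. \<forall>i<n. s i \<in> P}"

definition finite_measurable_partition :: "'a measure \<Rightarrow> 'a set set \<Rightarrow> bool" where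
  "finite_measurable_partition M P \<longleftrightarrow> finite P \<and> P \<subseteq> sets M \<and> partition_on (space M) P"

text \<open>Kolmogorov--Sinai entropy. The inner limit exists by subadditivity.\<close>

definition measure_entropy :: "'a measure \<Rightarrow> ('a \<Rightarrow> 'a) \<Rightarrow> ereal" where
  "measure_entropy M T =
     (SUP P\<in>Collect (finite_measurable_partition M).
        ereal (lim (\<lambda>n. partition_entropy M (iterated_join M T P n) / real n)))"

section \<open>Almost additive potentials\<close>

text \<open>Sequences \<open>(\<phi>\<^sub>n)\<^sub>n\<^sub>\<ge>\<^sub>1\<close> are functions on \<^typ>\<open>nat\<close> whose value at \<open>0\<close> is irrelevant. Values
  outside the subshift are irrelevant as well.\<close>

definition almost_additive_with ::
  "nat mat \<Rightarrow> real \<Rightarrow> (nat \<Rightarrow> (nat \<Rightarrow> nat) \<Rightarrow> real) \<Rightarrow> bool" where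
  "almost_additive_with A C \<phi> \<longleftrightarrow>
     (\<forall>n\<ge>1. continuous_on (subshift A) (\<phi> n)) \<and>
     (\<forall>n\<ge>1. \<forall>p\<ge>1. \<forall>x\<in>subshift A.
        - C + \<phi> n x + \<phi> p ((shift ^^ n) x) \<le> \<phi> (n + p) x \<and>
        \<phi> (n + p) x \<le> C + \<phi> n x + \<phi> p ((shift ^^ n) x))"

definition Caa :: "nat mat \<Rightarrow> (nat \<Rightarrow> (nat \<Rightarrow> nat) \<Rightarrow> real) set" where
  "Caa A = {\<phi>. \<exists>C. almost_additive_with A C \<phi>}"

text \<open>The condition is \<open>\<Psi>\<^sub>m\<^sub>a\<^sub>x = max \<psi>\<^sub>1 + C(\<Psi>) < 0\<close> for some admissible choice of the constant
  \<open>C(\<Psi>)\<close>; the supremum is attained because the subshift is compact.\<close>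

definition Caa_neg :: "nat mat \<Rightarrow> (nat \<Rightarrow> (nat \<Rightarrow> nat) \<Rightarrow> real) set" where
  "Caa_neg A = {\<psi>. \<exists>C. almost_additive_with A C \<psi> \<and> (SUP x\<in>subshift A. \<psi> 1 x) + C < 0}"

definition Caa_vec :: "nat mat \<Rightarrow> (nat \<Rightarrow> (nat \<Rightarrow> nat) \<Rightarrow> real ^ 'd) set" where
  "Caa_vec A = {\<phi>. \<forall>i. (\<lambda>n x. \<phi> n x $ i) \<in> Caa A}"

text \<open>The limit \<open>\<Phi>\<^sub>*(\<mu>)\<close>, which exists by almost additivity; used for scalar and for vector-valued
  potentials.\<close>

definition asymptotic_mean ::
  "(nat \<Rightarrow> 'a \<Rightarrow> 'b::{banach, second_countable_topology}) \<Rightarrow> 'a measure \<Rightarrow> 'b" where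
  "asymptotic_mean \<phi> M = lim (\<lambda>n. \<integral>x. \<phi> n x /\<^sub>R real n \<partial>M)"

definition mean_set :: "nat mat \<Rightarrow> (nat \<Rightarrow> (nat \<Rightarrow> nat) \<Rightarrow> real ^ 'd) \<Rightarrow> (real ^ 'd) set" where
  "mean_set A \<phi> = asymptotic_mean \<phi> ` invariant_measures A"

definition level_set ::
  "nat mat \<Rightarrow> (nat \<Rightarrow> (nat \<Rightarrow> nat) \<Rightarrow> real ^ 'd) \<Rightarrow> real ^ 'd \<Rightarrow> (nat \<Rightarrow> nat) set" where
  "level_set A \<phi> \<alpha> = {x \<in> subshift A. (\<lambda>n. \<phi> n x /\<^sub>R real n) \<longlonglongrightarrow> \<alpha>}"

section \<open>The metric\<close>

definition word_weight ::
  "nat mat \<Rightarrow> (nat \<Rightarrow> (nat \<Rightarrow> nat) \<Rightarrow> real) \<Rightarrow> nat list \<Rightarrow> real" where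
  "word_weight A \<psi> w = (if w = [] then 1 else (SUP x\<in>cylinder A w. exp (\<psi> (length w) x)))"

definition gauge_dist ::
  "nat mat \<Rightarrow> (nat \<Rightarrow> (nat \<Rightarrow> nat) \<Rightarrow> real) \<Rightarrow> (nat \<Rightarrow> nat) \<Rightarrow> (nat \<Rightarrow> nat) \<Rightarrow> real" where
  "gauge_dist A \<psi> x y = (if x = y then 0 else word_weight A \<psi> (common_prefix x y))"

section \<open>Hausdorff and box dimension\<close>

text \<open>Both dimensions are defined for a subset of a metric space that is given by a carrier \<open>X\<close> and
  a distance function \<open>d\<close>.\<close>

definition diam_le :: "('a \<Rightarrow> 'a \<Rightarrow> real) \<Rightarrow> real \<Rightarrow> 'a set \<Rightarrow> bool" where
  "diam_le d \<delta> U \<longleftrightarrow> (\<forall>x\<in>U. \<forall>y\<in>U. d x y \<le> \<delta>)"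

definition set_diam :: "('a \<Rightarrow> 'a \<Rightarrow> real) \<Rightarrow> 'a set \<Rightarrow> real" where
  "set_diam d U = (if U = {} then 0 else SUP (x, y)\<in>U \<times> U. d x y)"

definition hausdorff_premeasure ::
  "'a set \<Rightarrow> ('a \<Rightarrow> 'a \<Rightarrow> real) \<Rightarrow> real \<Rightarrow> real \<Rightarrow> 'a set \<Rightarrow> ennreal" where
  "hausdorff_premeasure X d s \<delta> F =
     (INF U\<in>{U :: nat \<Rightarrow> 'a set. F \<subseteq> (\<Union>i. U i) \<and> (\<forall>i. U i \<subseteq> X \<and> diam_le d \<delta> (U i))}.
        \<Sum>i. ennreal (set_diam d (U i) powr s))"

definition hausdorff_outer_measure ::
  "'a set \<Rightarrow> ('a \<Rightarrow> 'a \<Rightarrow> real) \<Rightarrow> real \<Rightarrow> 'a set \<Rightarrow> ennreal" where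
  "hausdorff_outer_measure X d s F = (SUP \<delta>\<in>{0<..}. hausdorff_premeasure X d s \<delta> F)"

text \<open>Restricting to \<open>s > 0\<close> does not change the infimum and avoids the convention for \<open>0\<^sup>0\<close>.\<close>

definition hausdorff_dim :: "'a set \<Rightarrow> ('a \<Rightarrow> 'a \<Rightarrow> real) \<Rightarrow> 'a set \<Rightarrow> ereal" where
  "hausdorff_dim X d F = Inf {ereal s |s. s > 0 \<and> hausdorff_outer_measure X d s F = 0}"

text \<open>The logarithm with \<open>log 0 = -\<infinity>\<close> and \<open>log \<infinity> = \<infinity>\<close>.\<close>

definition ereal_log :: "ereal \<Rightarrow> ereal" where
  "ereal_log t = (if t \<le> 0 then -\<infinity> else if t = \<infinity> then \<infinity> else ereal (ln (real_of_ereal t)))"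

definition covering_number ::
  "'a set \<Rightarrow> ('a \<Rightarrow> 'a \<Rightarrow> real) \<Rightarrow> real \<Rightarrow> 'a set \<Rightarrow> ereal" where
  "covering_number X d \<delta> F =
     (INF \<U>\<in>{\<U>. finite \<U> \<and> F \<subseteq> \<Union>\<U> \<and> (\<forall>U\<in>\<U>. U \<subseteq> X \<and> diam_le d \<delta> U)}. ereal (real (card \<U>)))"

definition lower_box_dim :: "'a set \<Rightarrow> ('a \<Rightarrow> 'a \<Rightarrow> real) \<Rightarrow> 'a set \<Rightarrow> ereal" where
  "lower_box_dim X d F =
     Liminf (at_right 0) (\<lambda>\<delta>. ereal_log (covering_number X d \<delta> F) / ereal (- ln \<delta>))"

definition upper_box_dim :: "'a set \<Rightarrow> ('a \<Rightarrow> 'a \<Rightarrow> real) \<Rightarrow> 'a set \<Rightarrow> ereal" where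
  "upper_box_dim X d F =
     Limsup (at_right 0) (\<lambda>\<delta>. ereal_log (covering_number X d \<delta> F) / ereal (- ln \<delta>))"

section \<open>Box counting and the variational function\<close>

definition ball_words ::
  "nat mat \<Rightarrow> (nat \<Rightarrow> (nat \<Rightarrow> nat) \<Rightarrow> real) \<Rightarrow> nat \<Rightarrow> nat list set" where
  "ball_words A \<psi> n =
     {w \<in> admissible_words A. word_weight A \<psi> w \<le> exp (- real n) \<and>
        (w = [] \<or> word_weight A \<psi> (butlast w) > exp (- real n))}"

definition ball_growth :: "nat mat \<Rightarrow> (nat \<Rightarrow> (nat \<Rightarrow> nat) \<Rightarrow> real) \<Rightarrow> nat \<Rightarrow> real" where
  "ball_growth A \<psi> n = ln (real (card (ball_words A \<psi> n))) / real n"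

definition ball_growth_rate :: "nat mat \<Rightarrow> (nat \<Rightarrow> (nat \<Rightarrow> nat) \<Rightarrow> real) \<Rightarrow> real" where
  "ball_growth_rate A \<psi> = lim (ball_growth A \<psi>)"

definition level_count ::
  "nat mat \<Rightarrow> (nat \<Rightarrow> (nat \<Rightarrow> nat) \<Rightarrow> real) \<Rightarrow> (nat \<Rightarrow> (nat \<Rightarrow> nat) \<Rightarrow> real ^ 'd) \<Rightarrow>
   real ^ 'd \<Rightarrow> nat \<Rightarrow> real \<Rightarrow> nat" where
  "level_count A \<psi> \<phi> \<alpha> n \<epsilon> =
     card {u \<in> ball_words A \<psi> n.
             \<exists>x\<in>cylinder A u. norm (\<phi> (length u) x /\<^sub>R real (length u) - \<alpha>) < \<epsilon>}"

text \<open>The two expressions for \<open>\<Lambda>\<close>, one with the lower and one with the upper limit in \<open>n\<close>.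
  Both are monotone in \<open>\<epsilon>\<close>, so the limits as \<open>\<epsilon> \<rightarrow> 0\<close> exist in the extended reals.\<close>

definition Lambda_lower ::
  "nat mat \<Rightarrow> (nat \<Rightarrow> (nat \<Rightarrow> nat) \<Rightarrow> real) \<Rightarrow> (nat \<Rightarrow> (nat \<Rightarrow> nat) \<Rightarrow> real ^ 'd) \<Rightarrow>
   real ^ 'd \<Rightarrow> ereal" where
  "Lambda_lower A \<psi> \<phi> \<alpha> =
     Lim (at_right 0)
       (\<lambda>\<epsilon>. liminf (\<lambda>n. ereal_log (ereal (real (level_count A \<psi> \<phi> \<alpha> n \<epsilon>))) / ereal (real n)))"

definition Lambda_upper ::
  "nat mat \<Rightarrow> (nat \<Rightarrow> (nat \<Rightarrow> nat) \<Rightarrow> real) \<Rightarrow> (nat \<Rightarrow> (nat \<Rightarrow> nat) \<Rightarrow> real ^ 'd) \<Rightarrow>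
   real ^ 'd \<Rightarrow> ereal" where
  "Lambda_upper A \<psi> \<phi> \<alpha> =
     Lim (at_right 0)
       (\<lambda>\<epsilon>. limsup (\<lambda>n. ereal_log (ereal (real (level_count A \<psi> \<phi> \<alpha> n \<epsilon>))) / ereal (real n)))"

definition variational ::
  "nat mat \<Rightarrow> (nat \<Rightarrow> (nat \<Rightarrow> nat) \<Rightarrow> real) \<Rightarrow> (nat \<Rightarrow> (nat \<Rightarrow> nat) \<Rightarrow> real ^ 'd) \<Rightarrow>
   real ^ 'd \<Rightarrow> ereal" where
  "variational A \<psi> \<phi> \<alpha> =
     (SUP M\<in>{M \<in> invariant_measures A. asymptotic_mean \<phi> M = \<alpha>}.
        measure_entropy M shift / ereal (- asymptotic_mean \<psi> M))"

definition weakly_concave_on :: "'a::real_vector set \<Rightarrow> ('a \<Rightarrow> real) \<Rightarrow> bool" where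
  "weakly_concave_on B h \<longleftrightarrow>
     convex B \<and>
     (\<exists>c\<ge>1. \<forall>\<alpha>\<in>B. \<forall>\<beta>\<in>B. \<exists>\<gamma>\<^sub>1\<in>{1 / c..c}. \<exists>\<gamma>\<^sub>2\<in>{1 / c..c}. \<forall>t\<in>{0..1}.
        t * h \<alpha> + (1 - t) * h \<beta>
        \<le> h (((t * \<gamma>\<^sub>1) *\<^sub>R \<alpha> + ((1 - t) * \<gamma>\<^sub>2) *\<^sub>R \<beta>) /\<^sub>R (t * \<gamma>\<^sub>1 + (1 - t) * \<gamma>\<^sub>2)))"

abbreviation spectrum_dim ::
  "nat mat \<Rightarrow> (nat \<Rightarrow> (nat \<Rightarrow> nat) \<Rightarrow> real) \<Rightarrow> (nat \<Rightarrow> (nat \<Rightarrow> nat) \<Rightarrow> real ^ 'd) \<Rightarrow>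
   real ^ 'd \<Rightarrow> ereal" where
  "spectrum_dim A \<psi> \<phi> \<alpha> \<equiv> hausdorff_dim (subshift A) (gauge_dist A \<psi>) (level_set A \<phi> \<alpha>)"

end

theory Submission
  imports
    Defs
    "HOL-Probability.Projective_Limit"
    "HOL-Probability.Probability_Mass_Function"
    "HOL-Probability.Infinite_Product_Measure"
    "HOL-Combinatorics.Multiset_Permutations"
    "HOL-Analysis.Regularity"
    "HOL-Real_Asymp.Real_Asymp"
begin

text \<open>
  The proof compares four quantities for a mean value \<open>\<alpha>\<close>: the Hausdorff dimension of the level set, the
  lower and the upper growth rate of the number of balls with averages near \<open>\<alpha>\<close>, and the quotients
  \<open>h / P\<close> of the entropy \<open>h\<close> and of \<open>P\<close>, the negative of the mean of \<open>\<Psi>\<close>, for the invariant measures with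
  mean \<open>\<alpha>\<close>. They turn out to form a closed chain of inequalities.

  Everything is expressed by finite words. An almost additive potential is, up to an error
  \<open>\<eta> n + K\<close> with arbitrarily small \<open>\<eta>\<close>, a Birkhoff sum of a function of finitely many letters
  (\<open>Caa_asymp_additive\<close>, \<open>Caa_vec_asymp_additive\<close>). Hence the mean of a potential depends on the
  probabilities of words only, up to \<open>\<eta>\<close> (\<open>asymptotic_mean_approx\<close>). The word probabilities also determine
  the entropy, which is the growth rate of the Shannon entropies of long words (\<open>kolmogorov_sinai\<close>). Conversely, every consistent
  and stationary family of word probabilities comes from an invariant measure
  (\<open>measure_of_stationary\<close>), so that invariant measures can be constructed by combinatorics.

  For the lower bound on the dimension, take an invariant measure and arrange words of a large length \<open>N\<close>, each as often as its
  probability prescribes, in all possible orders. Since the matrix is primitive, connecting words of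
  a fixed length make the results freely concatenable. They are about \<open>exp (h l)\<close> many, where \<open>l\<close> is
  their length, and all of them have averages close to the means of the measure (\<open>typical_loops\<close>).
  Infinite concatenations of better and better words, with slowly growing lengths, form a Moran set
  inside the level set. The uniform mass on it satisfies the mass distribution principle for every
  exponent below \<open>h / P\<close> (\<open>level_set_dimension_ge\<close>).

  For the upper bound, the counted balls cover the level set; so its dimension is at most the lower growth
  rate (\<open>spectrum_dim_le_Lambda\<close>). To bound the upper growth rate by a quotient \<open>h / P\<close>, pick many balls
  of radius \<open>exp (- n)\<close> whose words have a common length \<open>l\<close>. On such a ball \<open>\<Psi>\<close> is about \<open>- n\<close>. The empirical
  word frequencies of the corresponding orbit segments have a limit along a subsequence, which is
  stationary; the invariant measure it defines has mean \<open>\<alpha>\<close>, its \<open>P\<close> is the limit of \<open>n / l\<close>, and its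
  entropy is at least the limit of \<open>log (number of balls) / l\<close> (\<open>empirical_limit\<close>,
  \<open>measure_of_ball_families\<close>). So the chain closes up, the supremum of the quotients is attained, and
  a nonempty level set forces \<open>\<alpha>\<close> to be a mean (\<open>level_set_nonempty_iff\<close>, \<open>spectrum_eq\<close>).

  Weak concavity holds since means are affine and entropy is concave in the measure; the weights of a
  mixture have to be corrected by the values of \<open>P\<close> because the spectrum is a quotient
  (\<open>weakly_concave_spectrum\<close>). For the whole subshift, apply the upper bound to the zero potential: some
  invariant measure has a quotient \<open>h / P\<close> at least as large as the upper growth rate of the number of all balls.
  For the mean value of this measure, the dimension of the level set is squeezed between this
  growth rate and the dimension of the whole space (\<open>full_dimension\<close>).
\<close>

section \<open>Sequences and admissible words\<close>

text \<open>The discrete metric makes the alphabet a Polish space, as Kolmogorov's extension theorem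
  requires.\<close>

instantiation nat :: metric_space
begin

definition dist_nat :: "nat \<Rightarrow> nat \<Rightarrow> real"
  where "dist_nat n m = (if n = m then 0 else 1)"

definition uniformity_nat :: "(nat \<times> nat) filter" where
  "uniformity_nat = (INF e\<in>{0 <..}. principal {(x, y). dist x y < e})"

instance
proof
  fix U :: "nat set"
  have "\<forall>x\<in>U. eventually (\<lambda>(x', y). x' = x \<longrightarrow> y \<in> U) uniformity"
  proof
    fix x assume "x \<in> U"
    have "eventually (\<lambda>(x', y). x' = x \<longrightarrow> y \<in> U) (principal {(x :: nat, y). dist x y < 1})"
      using \<open>x \<in> U\<close> by (auto simp: eventually_principal dist_nat_def split: if_splits)
    then show "eventually (\<lambda>(x', y). x' = x \<longrightarrow> y \<in> U) uniformity"
      unfolding uniformity_nat_def by (intro eventually_INF1[of 1]) auto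
  qed
  then show "open U = (\<forall>x\<in>U. eventually (\<lambda>(x', y). x' = x \<longrightarrow> y \<in> U) uniformity)"
    by (simp add: open_discrete)
qed (auto simp: uniformity_nat_def dist_nat_def)

end

instance nat :: complete_space
proof
  fix X :: "nat \<Rightarrow> nat" assume "Cauchy X"
  then have "\<exists>N. \<forall>m\<ge>N. \<forall>n\<ge>N. dist (X m) (X n) < 1" using metric_CauchyD[of X 1] by auto
  then obtain N where "\<forall>m\<ge>N. \<forall>n\<ge>N. dist (X m) (X n) < 1" by blast
  then have "\<forall>n\<ge>N. X n = X N" by (auto simp: dist_nat_def split: if_splits)
  then have "X \<longlonglongrightarrow> X N" by (intro tendsto_eventually eventually_sequentiallyI[of N]) blast
  then show "convergent X" unfolding convergent_def by blast
qed

instance nat :: polish_space ..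

lemma shift_pow: "(shift ^^ k) x = (\<lambda>n. x (n + k))"
  by (induction k) (auto simp: shift_def)

lemma shift_pow_add: "(shift ^^ k) ((shift ^^ j) x) = (shift ^^ (k + j)) x"
  by (simp add: funpow_add)

lemma length_seq_prefix [simp]: "length (seq_prefix x n) = n"
  by (simp add: seq_prefix_def)

lemma nth_seq_prefix [simp]: "i < n \<Longrightarrow> seq_prefix x n ! i = x i"
  by (simp add: seq_prefix_def)

lemma seq_prefix_0 [simp]: "seq_prefix x 0 = []"
  by (simp add: seq_prefix_def)

lemma seq_prefix_eq_iff: "seq_prefix x n = seq_prefix y n \<longleftrightarrow> (\<forall>i<n. x i = y i)"
  by (auto simp: seq_prefix_def)

lemma seq_prefix_eq_list: "seq_prefix x (length w) = w \<longleftrightarrow> (\<forall>i<length w. x i = w ! i)"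
  unfolding list_eq_iff_nth_eq by auto

lemma seq_prefix_Suc: "seq_prefix x (Suc n) = seq_prefix x n @ [x n]"
  by (simp add: seq_prefix_def)

lemma seq_prefix_Suc_Cons: "seq_prefix x (Suc n) = x 0 # seq_prefix (shift x) n"
  unfolding seq_prefix_def map_upt_Suc by (simp add: shift_def)

lemma take_seq_prefix: "n \<le> k \<Longrightarrow> take n (seq_prefix x k) = seq_prefix x n"
  by (auto simp: seq_prefix_def take_map)

lemma seq_prefix_mono: "seq_prefix x k = seq_prefix y k \<Longrightarrow> n \<le> k \<Longrightarrow> seq_prefix x n = seq_prefix y n"
  by (auto simp: seq_prefix_eq_iff)

lemma seq_prefix_shift_eq:
  "seq_prefix x (k + n) = seq_prefix y (k + n) \<Longrightarrow> seq_prefix ((shift ^^ k) x) n = seq_prefix ((shift ^^ k) y) n"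
  by (auto simp: seq_prefix_eq_iff shift_pow)

lemma admissible_append:
  "u @ v \<in> admissible_words A \<longleftrightarrow> u \<in> admissible_words A \<and> v \<in> admissible_words A \<and>
     (u = [] \<or> v = [] \<or> A $$ (last u, hd v) = 1)"
proof (cases "u = [] \<or> v = []")
  case True then show ?thesis by (auto simp: admissible_words_def)
next
  case False
  then have ne: "u \<noteq> []" "v \<noteq> []" by auto
  let ?P = "\<lambda>w. \<forall>i. Suc i < length w \<longrightarrow> A $$ (w ! i, w ! Suc i) = 1"
  have "?P (u @ v) \<longleftrightarrow> ?P u \<and> ?P v \<and> A $$ (last u, hd v) = 1"
  proof safe
    fix i assume P: "?P (u @ v)" and i: "Suc i < length u"
    show "A $$ (u ! i, u ! Suc i) = 1" using P[rule_format, of i] i by (simp add: nth_append)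
  next
    fix i assume P: "?P (u @ v)" and i: "Suc i < length v"
    show "A $$ (v ! i, v ! Suc i) = 1" using P[rule_format, of "length u + i"] i by (simp add: nth_append)
  next
    assume P: "?P (u @ v)"
    show "A $$ (last u, hd v) = 1" using P[rule_format, of "length u - 1"] ne
      by (auto simp: nth_append last_conv_nth hd_conv_nth)
  next
    fix i assume Pu: "?P u" and Pv: "?P v" and l: "A $$ (last u, hd v) = 1" and i: "Suc i < length (u @ v)"
    consider "Suc i < length u" | "Suc i = length u" | "i \<ge> length u" by linarith
    then show "A $$ ((u @ v) ! i, (u @ v) ! Suc i) = 1"
    proof cases
      case 1 then show ?thesis using Pu by (simp add: nth_append)
    next
      case 2
      then have "i = length u - 1" by simp
      then show ?thesis using 2 l ne by (simp add: nth_append last_conv_nth hd_conv_nth)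
    next
      case 3 then show ?thesis using Pv[rule_format, of "i - length u"] i by (simp add: nth_append Suc_diff_le)
    qed
  qed
  then show ?thesis using ne by (auto simp: admissible_words_def)
qed

lemma admissible_Nil [simp]: "[] \<in> admissible_words A"
  by (simp add: admissible_words_def)

lemma admissible_take: "w \<in> admissible_words A \<Longrightarrow> take n w \<in> admissible_words A"
  using admissible_append[of "take n w" "drop n w"] by simp

lemma admissible_drop: "w \<in> admissible_words A \<Longrightarrow> drop n w \<in> admissible_words A"
  using admissible_append[of "take n w" "drop n w"] by simp

lemma subshift_iff: "x \<in> subshift A \<longleftrightarrow> (\<forall>n. seq_prefix x n \<in> admissible_words A)"
proof
  assume "x \<in> subshift A"
  then show "\<forall>n. seq_prefix x n \<in> admissible_words A"
    by (auto simp: subshift_def admissible_words_def seq_prefix_def)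
next
  assume P: "\<forall>n. seq_prefix x n \<in> admissible_words A"
  show "x \<in> subshift A" unfolding subshift_def
  proof safe
    fix n
    show "x n < dim_row A" using P[rule_format, of "Suc n"]
      by (auto simp: admissible_words_def seq_prefix_def)
    show "A $$ (x n, x (Suc n)) = 1" using P[rule_format, of "Suc (Suc n)"]
      unfolding admissible_words_def by (auto dest!: spec[of _ n])
  qed
qed

lemma seq_prefix_admissible [intro]: "x \<in> subshift A \<Longrightarrow> seq_prefix x n \<in> admissible_words A"
  by (simp add: subshift_iff)

lemma shift_subshift [intro]: "x \<in> subshift A \<Longrightarrow> shift x \<in> subshift A"
  by (auto simp: subshift_def shift_def)

lemma shift_pow_subshift [intro]: "x \<in> subshift A \<Longrightarrow> (shift ^^ k) x \<in> subshift A"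
  by (auto simp: subshift_def shift_pow)

lemma finite_admissible: "finite {w \<in> admissible_words A. length w = n}"
proof -
  have "{w \<in> admissible_words A. length w = n} \<subseteq> {w. set w \<subseteq> {..<dim_row A} \<and> length w = n}"
    by (auto simp: admissible_words_def)
  then show ?thesis by (rule finite_subset) (rule finite_lists_length_eq, simp)
qed

lemma card_admissible_le: "card {w \<in> admissible_words A. length w = n} \<le> dim_row A ^ n"
proof -
  have "{w \<in> admissible_words A. length w = n} \<subseteq> {w. set w \<subseteq> {..<dim_row A} \<and> length w = n}"
    by (auto simp: admissible_words_def)
  then have "card {w \<in> admissible_words A. length w = n} \<le> card {w. set w \<subseteq> {..<dim_row A} \<and> length w = n}"
    by (intro card_mono finite_lists_length_eq) simp_all
  then show ?thesis by (simp add: card_lists_length_eq)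
qed

lemma cylinder_subset: "cylinder A w \<subseteq> subshift A"
  by (auto simp: cylinder_def)

lemma in_cylinder_iff: "x \<in> cylinder A w \<longleftrightarrow> x \<in> subshift A \<and> seq_prefix x (length w) = w"
  by (simp add: cylinder_def)

lemma in_cylinder_prefix [intro]: "x \<in> subshift A \<Longrightarrow> x \<in> cylinder A (seq_prefix x n)"
  by (simp add: cylinder_def)

lemma compact_PiE_UNIV:
  fixes S :: "'i \<Rightarrow> 'a::topological_space set"
  assumes "\<And>i. compact (S i)"
  shows "compact (Pi\<^sub>E UNIV S)"
proof -
  have "compactin (product_topology (\<lambda>i. euclidean) UNIV) (Pi\<^sub>E UNIV S)"
    using assms by (auto simp: compactin_PiE)
  then show ?thesis by (simp add: euclidean_product_topology)
qed

lemma open_coordinate_preimage: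
  fixes S :: "'a::topological_space set"
  assumes "open S"
  shows "open {x :: 'i \<Rightarrow> 'a. x i \<in> S}"
proof -
  have "continuous_on UNIV (\<lambda>x :: 'i \<Rightarrow> 'a. x i)" by (rule continuous_on_product_coordinates)
  from open_vimage[OF assms this] show ?thesis by (simp add: vimage_def)
qed

lemma open_seq_prefix: "open {x :: nat \<Rightarrow> nat. P (seq_prefix x n)}"
proof -
  have *: "open {x :: nat \<Rightarrow> nat. seq_prefix x n = w}" for w
  proof (cases "length w = n")
    case True
    have "{x :: nat \<Rightarrow> nat. seq_prefix x n = w} = (\<Inter>i<n. {x. x i \<in> {w ! i}})"
      using True by (auto simp: seq_prefix_eq_list)
    also have "open \<dots>" by (intro open_INT ballI open_coordinate_preimage open_discrete) auto
    finally show ?thesis .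
  next
    case False
    then have "{x :: nat \<Rightarrow> nat. seq_prefix x n = w} = {}" by auto
    then show ?thesis by simp
  qed
  have "{x :: nat \<Rightarrow> nat. P (seq_prefix x n)} = (\<Union>w\<in>Collect P. {x. seq_prefix x n = w})" by auto
  also have "open \<dots>" by (intro open_UN ballI *)
  finally show ?thesis .
qed

lemma closed_seq_prefix: "closed {x :: nat \<Rightarrow> nat. P (seq_prefix x n)}"
proof -
  have "- {x :: nat \<Rightarrow> nat. P (seq_prefix x n)} = {x. \<not> P (seq_prefix x n)}" by blast
  then show ?thesis using open_seq_prefix[of "\<lambda>w. \<not> P w" n] unfolding closed_def by metis
qed

lemma closed_subshift: "closed (subshift A)"
proof -
  have "subshift A = (\<Inter>n. {x. seq_prefix x n \<in> admissible_words A})"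
    by (simp add: set_eq_iff subshift_iff)
  also have "closed \<dots>" by (intro closed_INT ballI closed_seq_prefix)
  finally show ?thesis .
qed

lemma compact_subshift: "compact (subshift A)"
proof -
  have "subshift A \<subseteq> Pi\<^sub>E UNIV (\<lambda>_. {..<dim_row A})" by (auto simp: subshift_def)
  moreover have "compact (Pi\<^sub>E (UNIV::nat set) (\<lambda>_. {..<dim_row A}))"
    by (intro compact_PiE_UNIV finite_imp_compact) auto
  ultimately show ?thesis using closed_subshift compact_Int_closed[of "Pi\<^sub>E (UNIV::nat set) (\<lambda>_. {..<dim_row A})" "subshift A"]
    by (simp add: Int_absorb1)
qed

lemma tendsto_fun_discrete:
  fixes X :: "nat \<Rightarrow> nat \<Rightarrow> nat"
  assumes "X \<longlonglongrightarrow> x"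
  shows "eventually (\<lambda>k. seq_prefix (X k) n = seq_prefix x n) sequentially"
proof -
  have "open {y. seq_prefix y n = seq_prefix x n}" by (rule open_seq_prefix)
  then show ?thesis using topological_tendstoD[OF assms] by fastforce
qed

lemma tendsto_coordinatewise:
  fixes X :: "'c \<Rightarrow> 'i \<Rightarrow> 'a::topological_space"
  assumes "\<And>i. ((\<lambda>k. X k i) \<longlongrightarrow> x i) F"
  shows "(X \<longlongrightarrow> x) F"
proof -
  have "limitin (product_topology (\<lambda>i. euclidean) UNIV) X x F"
    unfolding limitin_componentwise using assms by auto
  then show ?thesis by (simp add: euclidean_product_topology)
qed

lemma tendsto_fun_discreteI:
  fixes X :: "nat \<Rightarrow> nat \<Rightarrow> nat"
  assumes "\<And>n. eventually (\<lambda>k. seq_prefix (X k) n = seq_prefix x n) sequentially"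
  shows "X \<longlonglongrightarrow> x"
proof (rule tendsto_coordinatewise)
  fix i
  have "eventually (\<lambda>k. X k i = x i) sequentially"
    using assms[of "Suc i"] by eventually_elim (auto simp: seq_prefix_eq_iff)
  then show "(\<lambda>k. X k i) \<longlonglongrightarrow> x i" by (rule tendsto_eventually)
qed

text \<open>By compactness, continuity on the subshift is uniform. Closeness is measured by common
  prefixes instead of a metric.\<close>

lemma uniform_on_prefixes:
  fixes f :: "(nat \<Rightarrow> nat) \<Rightarrow> 'b::metric_space"
  assumes f: "continuous_on (subshift A) f" and e: "e > 0"
  obtains q where "\<And>x y. x \<in> subshift A \<Longrightarrow> y \<in> subshift A \<Longrightarrow> seq_prefix x q = seq_prefix y q \<Longrightarrow> dist (f x) (f y) < e"
proof -
  have "\<exists>q. \<forall>x\<in>subshift A. \<forall>y\<in>subshift A. seq_prefix x q = seq_prefix y q \<longrightarrow> dist (f x) (f y) < e"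
  proof (rule ccontr)
    assume "\<not> ?thesis"
    then have "\<forall>q. \<exists>x y. x \<in> subshift A \<and> y \<in> subshift A \<and> seq_prefix x q = seq_prefix y q \<and> dist (f x) (f y) \<ge> e"
      by (simp add: not_less Bex_def)
    then obtain X Y where XY: "\<And>q. X q \<in> subshift A" "\<And>q. Y q \<in> subshift A"
      "\<And>q. seq_prefix (X q) q = seq_prefix (Y q) q" "\<And>q. dist (f (X q)) (f (Y q)) \<ge> e" by metis
    have "seq_compact (subshift A)" using compact_subshift by (simp add: compact_eq_seq_compact_metric)
    then obtain z r where z: "z \<in> subshift A" and r: "strict_mono r" and lim: "(X \<circ> r) \<longlonglongrightarrow> z"
      using XY(1) unfolding seq_compact_def by blast
    have limY: "(Y \<circ> r) \<longlonglongrightarrow> z"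
    proof (rule tendsto_fun_discreteI)
      fix n
      show "eventually (\<lambda>k. seq_prefix ((Y \<circ> r) k) n = seq_prefix z n) sequentially"
        using tendsto_fun_discrete[OF lim, of n] eventually_ge_at_top[of n]
      proof eventually_elim
        case (elim k)
        then have "n \<le> r k" using seq_suble[OF r, of k] by simp
        then have "seq_prefix (X (r k)) n = seq_prefix (Y (r k)) n" using XY(3) seq_prefix_mono by blast
        then show ?case using elim by simp
      qed
    qed
    have "(\<lambda>k. f ((X \<circ> r) k)) \<longlonglongrightarrow> f z" "(\<lambda>k. f ((Y \<circ> r) k)) \<longlonglongrightarrow> f z"
      using continuous_on_tendsto_compose[OF f lim z] continuous_on_tendsto_compose[OF f limY z] XY by auto
    then have "(\<lambda>k. dist (f ((X \<circ> r) k)) (f ((Y \<circ> r) k))) \<longlonglongrightarrow> dist (f z) (f z)"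
      by (intro tendsto_dist)
    then have "eventually (\<lambda>k. dist (f ((X \<circ> r) k)) (f ((Y \<circ> r) k)) < e) sequentially"
      using e by (intro order_tendstoD(2)) auto
    then obtain k where "dist (f (X (r k))) (f (Y (r k))) < e" by (auto simp: eventually_sequentially)
    then show False using XY(4)[of "r k"] by simp
  qed
  then show ?thesis using that by blast
qed

lemma bounded_on_subshift:
  fixes f :: "(nat \<Rightarrow> nat) \<Rightarrow> 'b::real_normed_vector"
  assumes f: "continuous_on (subshift A) f"
  obtains B where "B \<ge> 0" "\<And>x. x \<in> subshift A \<Longrightarrow> norm (f x) \<le> B"
proof -
  have "bounded (f ` subshift A)" using compact_continuous_image[OF f compact_subshift] by (rule compact_imp_bounded)
  then obtain B where "\<forall>x\<in>f ` subshift A. norm x \<le> B" by (auto simp: bounded_iff)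
  then show ?thesis using that[of "max B 0"] by fastforce
qed

section \<open>Primitive transition matrices\<close>

locale sft =
  fixes A :: "nat mat"
  assumes prim: "primitive_01_mat A"
begin

abbreviation m :: nat where "m \<equiv> dim_row A"
abbreviation X :: "(nat \<Rightarrow> nat) set" where "X \<equiv> subshift A"
abbreviation adm :: "nat list set" where "adm \<equiv> admissible_words A"
definition words :: "nat \<Rightarrow> nat list set" where "words n = {w \<in> adm. length w = n}"

lemma finite_words [simp]: "finite (words n)"
  by (simp add: words_def finite_admissible)

lemma prefix_in_words [intro]: "x \<in> X \<Longrightarrow> seq_prefix x n \<in> words n"
  by (auto simp: words_def)

lemma m_pos: "m > 0"
  using prim[unfolded primitive_01_mat_def] by linarith

lemma A_carrier: "A \<in> carrier_mat m m"
proof -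
  have "square_mat A" using prim unfolding primitive_01_mat_def by blast
  then show ?thesis unfolding carrier_mat_def by simp
qed

text \<open>A positive entry of a matrix product has a positive summand, whose index provides one
  more letter of the path.\<close>

lemma path_of_power:
  assumes "i < m" "j < m" "0 < (A ^\<^sub>m k) $$ (i, j)"
  shows "\<exists>c. length c = k \<and> c @ [j] \<in> adm \<and> hd (c @ [j]) = i"
  using assms
proof (induction k arbitrary: j)
  case 0
  then have "i = j" by (simp split: if_splits)
  then show ?case using 0 by (auto simp: admissible_words_def)
next
  case (Suc k)
  have "(A ^\<^sub>m Suc k) $$ (i, j) = (\<Sum>l<m. (A ^\<^sub>m k) $$ (i, l) * A $$ (l, j))"
  proof -
    have d: "dim_row (A ^\<^sub>m k) = m" "dim_col (A ^\<^sub>m k) = m" "dim_col A = m"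
      using carrier_matD[OF pow_carrier_mat[OF A_carrier, of k]] carrier_matD(2)[OF A_carrier] by blast+
    have "(A ^\<^sub>m Suc k) $$ (i, j) = scalar_prod (Matrix.row (A ^\<^sub>m k) i) (Matrix.col A j)"
      using Suc.prems d by simp
    also have "\<dots> = (\<Sum>l<m. vec_index (Matrix.row (A ^\<^sub>m k) i) l * vec_index (Matrix.col A j) l)"
      by (simp add: scalar_prod_def lessThan_atLeast0)
    also have "\<dots> = (\<Sum>l<m. (A ^\<^sub>m k) $$ (i, l) * A $$ (l, j))"
      using Suc.prems d by (intro sum.cong) simp_all
    finally show ?thesis .
  qed
  with Suc.prems(3) have "(\<Sum>l<m. (A ^\<^sub>m k) $$ (i, l) * A $$ (l, j)) \<noteq> 0" by linarith
  then obtain l where l: "l < m" "(A ^\<^sub>m k) $$ (i, l) * A $$ (l, j) \<noteq> 0"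
    using sum.not_neutral_contains_not_neutral[of "\<lambda>l. (A ^\<^sub>m k) $$ (i, l) * A $$ (l, j)" "{..<m}"] by blast
  have "A $$ (l, j) \<in> {0, 1}" using prim l(1) Suc.prems(2) unfolding primitive_01_mat_def by blast
  then have "A $$ (l, j) = 1" using l(2) by force
  have pos: "0 < (A ^\<^sub>m k) $$ (i, l)" using l(2) by simp
  obtain c where c: "length c = k" "c @ [l] \<in> adm" "hd (c @ [l]) = i"
    using Suc.IH[OF Suc.prems(1) l(1) pos] by blast
  have "(c @ [l]) @ [j] \<in> adm"
    unfolding admissible_append[of "c @ [l]"] using c \<open>A $$ (l, j) = 1\<close> Suc.prems by (auto simp: admissible_words_def)
  then show ?case using c by (intro exI[of _ "c @ [l]"]) (auto simp: hd_append split: if_splits)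
qed

definition gap :: nat where
  "gap = (SOME p. p \<ge> 1 \<and> (\<forall>i<m. \<forall>j<m. 0 < (A ^\<^sub>m p) $$ (i, j)))"

lemma gap: "gap \<ge> 1" "i < m \<Longrightarrow> j < m \<Longrightarrow> 0 < (A ^\<^sub>m gap) $$ (i, j)"
proof -
  have "\<exists>p. p \<ge> 1 \<and> (\<forall>i<m. \<forall>j<m. 0 < (A ^\<^sub>m p) $$ (i, j))"
    using prim by (auto simp: primitive_01_mat_def)
  from someI_ex[OF this] show "gap \<ge> 1" "i < m \<Longrightarrow> j < m \<Longrightarrow> 0 < (A ^\<^sub>m gap) $$ (i, j)"
    unfolding gap_def by auto
qed

text \<open>The final letter \<open>j\<close> is left out, so that the connector can be put in front
  of any word that begins with \<open>j\<close>.\<close>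

definition connector :: "nat \<Rightarrow> nat \<Rightarrow> nat list" where
  "connector i j = (SOME c. length c = gap \<and> c @ [j] \<in> adm \<and> hd (c @ [j]) = i)"

lemma connector:
  assumes "i < m" "j < m"
  shows "length (connector i j) = gap" "connector i j @ [j] \<in> adm" "hd (connector i j) = i" "connector i j \<noteq> []"
proof -
  have *: "length (connector i j) = gap \<and> connector i j @ [j] \<in> adm \<and> hd (connector i j @ [j]) = i"
    using path_of_power[OF assms gap(2)[OF assms]] unfolding connector_def by (rule someI_ex)
  then show "length (connector i j) = gap" "connector i j @ [j] \<in> adm" by auto
  show "connector i j \<noteq> []" using * gap(1) by auto
  then show "hd (connector i j) = i" using * by (auto simp: hd_append)
qed

lemma successor_ex:
  assumes "i < m" shows "\<exists>j<m. A $$ (i, j) = 1"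
proof -
  let ?c = "connector i 0 @ [0]"
  have "?c \<in> adm" "?c ! 0 = i" "length ?c > 1"
    using connector[OF assms m_pos] gap(1) by (auto simp: nth_append hd_conv_nth)
  moreover from this have "?c ! 1 \<in> set ?c" by (intro nth_mem) simp
  ultimately have "A $$ (?c ! 0, ?c ! 1) = 1" "?c ! 1 < m"
    unfolding admissible_words_def by (auto dest!: spec[of _ 0] subsetD simp del: set_append)
  then show ?thesis using \<open>?c ! 0 = i\<close> by auto
qed

text \<open>By primitivity every letter has a successor, so a word can be continued letter by
  letter.\<close>

lemma extend_word:
  assumes "w \<in> adm"
  shows "\<exists>x\<in>X. seq_prefix x (length w) = w"
proof -
  define s where "s i = (SOME j. j < m \<and> A $$ (i, j) = 1)" for i
  have s: "s i < m" "A $$ (i, s i) = 1" if "i < m" for i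
    using someI_ex[OF successor_ex[OF that]] by (auto simp: s_def)
  have ex: "\<exists>x\<in>X. seq_prefix x (length v) = v" if v: "v \<in> adm" "v \<noteq> []" for v
  proof -
    define x where "x n = (if n < length v then v ! n else (s ^^ (Suc n - length v)) (last v))" for n
    have lv: "last v < m" using v by (auto simp: admissible_words_def subset_iff)
    have sl: "(s ^^ k) (last v) < m" for k by (induction k) (use lv s in auto)
    have vm: "v ! n < m" if "n < length v" for n using v that by (auto simp: admissible_words_def subset_iff)
    have "x \<in> X" unfolding subshift_def
    proof safe
      fix n show "x n < m" using sl vm by (auto simp: x_def)
      consider "Suc n < length v" | "Suc n = length v" | "length v \<le> n" by linarith
      then show "A $$ (x n, x (Suc n)) = 1"
      proof cases
        case 1 then show ?thesis using v by (auto simp: x_def admissible_words_def)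
      next
        case 2
        then have "v ! n = last v" using v by (metis diff_Suc_1 last_conv_nth)
        then show ?thesis using 2 s[OF lv] by (simp add: x_def)
      next
        case 3
        then have "Suc (Suc n) - length v = Suc (Suc n - length v)" by simp
        then show ?thesis using 3 s[OF sl] by (simp add: x_def)
      qed
    qed
    moreover have "seq_prefix x (length v) = v" by (simp add: seq_prefix_eq_list x_def)
    ultimately show ?thesis by blast
  qed
  show ?thesis
  proof (cases "w = []")
    case True
    have "[0] \<in> adm" using m_pos by (auto simp: admissible_words_def)
    then show ?thesis using ex[of "[0]"] True by auto
  next
    case False then show ?thesis using ex assms by blast
  qed
qed

lemma cylinder_nonempty: "w \<in> adm \<Longrightarrow> cylinder A w \<noteq> {}"
  using extend_word[of w] by (auto simp: cylinder_def)

lemma X_nonempty: "X \<noteq> {}"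
  using extend_word[of "[]"] by auto

lemma cylinder_empty: "w \<notin> adm \<Longrightarrow> cylinder A w = {}"
  by (auto simp: cylinder_def) (metis seq_prefix_admissible)

text \<open>Any two of these words may follow each other. Concatenating them freely is the source of
  all the points constructed below.\<close>

definition loops :: "nat list set" where
  "loops = {w \<in> adm. w \<noteq> [] \<and> hd w = 0 \<and> A $$ (last w, 0) = 1}"

lemma concat_loops:
  assumes "set ws \<subseteq> loops" "ws \<noteq> []"
  shows "concat ws \<in> loops"
  using assms
proof (induction ws)
  case (Cons w ws)
  show ?case
  proof (cases "ws = []")
    case True then show ?thesis using Cons by auto
  next
    case False
    then have "concat ws \<in> loops" "w \<in> loops" using Cons by auto
    then show ?thesis using admissible_append[of w "concat ws"] by (auto simp: loops_def)
  qed
qed simp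

text \<open>The last letter of \<open>w\<close> is the first one of the second connector and
  therefore deleted from the middle part.\<close>

definition loop_of :: "nat list \<Rightarrow> nat list" where
  "loop_of w = connector 0 (hd w) @ butlast w @ connector (last w) 0"

lemma loop_of:
  assumes "w \<in> adm" "w \<noteq> []"
  shows "loop_of w \<in> loops" "length (loop_of w) = length w - 1 + 2 * gap"
    "take (length w) (drop gap (loop_of w)) = w"
proof -
  have hl: "hd w < m" "last w < m" using assms by (auto simp: admissible_words_def subset_iff)
  note c1 = connector[OF m_pos hl(1)] and c2 = connector[OF hl(2) m_pos]
  show "length (loop_of w) = length w - 1 + 2 * gap" by (simp add: loop_of_def c1 c2)
  have w: "w = butlast w @ [last w]" using assms by simp
  have c2': "connector (last w) 0 = last w # tl (connector (last w) 0)" using c2 by (metis list.collapse)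
  have bw: "butlast w @ connector (last w) 0 = w @ tl (connector (last w) 0)"
  proof -
    have "butlast w @ connector (last w) 0 = (butlast w @ [last w]) @ tl (connector (last w) 0)"
      by (subst c2') simp
    then show ?thesis using w by simp
  qed
  show "take (length w) (drop gap (loop_of w)) = w" by (simp add: loop_of_def c1 bw)
  have a2: "connector (last w) 0 \<in> adm" "A $$ (last (connector (last w) 0), 0) = 1"
    using c2 admissible_append[of "connector (last w) 0" "[0]"] by auto
  have a1: "connector 0 (hd w) \<in> adm" "A $$ (last (connector 0 (hd w)), hd w) = 1"
    using c1 admissible_append[of "connector 0 (hd w)" "[hd w]"] by auto
  have "butlast w @ connector (last w) 0 \<in> adm"
  proof (cases "butlast w = []")
    case False
    have "butlast w @ [last w] \<in> adm" using assms by simp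
    then show ?thesis using a2 c2 False by (auto simp: admissible_append)
  qed (use a2 in auto)
  moreover have "hd (butlast w @ connector (last w) 0) = hd w"
    using bw assms by (simp add: hd_append)
  ultimately have "loop_of w \<in> adm" unfolding loop_of_def using a1 admissible_append by metis
  then show "loop_of w \<in> loops" using a2 c1 c2 by (auto simp: loops_def loop_of_def)
qed

end

section \<open>Asymptotically additive potentials\<close>

text \<open>Approximation by Birkhoff sums of functions of finitely many letters. Unlike almost
  additivity, it makes sense for vectors without reference to coordinates, and since
  \<open>\<eta>\<close> is arbitrary, the errors disappear in the limits of averages.\<close>

definition asymp_additive :: "nat mat \<Rightarrow> (nat \<Rightarrow> (nat \<Rightarrow> nat) \<Rightarrow> 'b::real_normed_vector) \<Rightarrow> bool" where
  "asymp_additive A \<phi> \<longleftrightarrow> (\<forall>n\<ge>1. continuous_on (subshift A) (\<phi> n)) \<and>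
     (\<forall>\<eta>>0. \<exists>q G K. \<forall>n\<ge>1. \<forall>x\<in>subshift A.
        norm (\<phi> n x - (\<Sum>i<n. G (seq_prefix ((shift ^^ i) x) q))) \<le> \<eta> * real n + K)"

lemma asymp_additiveD:
  assumes "asymp_additive A \<phi>" "\<eta> > 0"
  obtains q G K where "K \<ge> 0" "\<And>n x. n \<ge> 1 \<Longrightarrow> x \<in> subshift A \<Longrightarrow>
    norm (\<phi> n x - (\<Sum>i<n. G (seq_prefix ((shift ^^ i) x) q))) \<le> \<eta> * real n + K"
proof -
  obtain q G K where *: "\<And>n x. n \<ge> 1 \<Longrightarrow> x \<in> subshift A \<Longrightarrow>
    norm (\<phi> n x - (\<Sum>i<n. G (seq_prefix ((shift ^^ i) x) q))) \<le> \<eta> * real n + K"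
    using assms unfolding asymp_additive_def by blast
  show ?thesis
  proof (rule that[of "max K 0" G q])
    fix n :: nat and x assume "n \<ge> 1" "x \<in> subshift A"
    from *[OF this] show "norm (\<phi> n x - (\<Sum>i<n. G (seq_prefix ((shift ^^ i) x) q))) \<le> \<eta> * real n + max K 0"
      by linarith
  qed simp
qed

lemma telescope_lag:
  fixes u :: "nat \<Rightarrow> real"
  shows "(\<Sum>n<N. u (n + p) - u n) = (\<Sum>j<p. u (N + j) - u j)"
proof -
  have *: "(\<Sum>n<a + b. u n) = (\<Sum>n<a. u n) + (\<Sum>n<b. u (a + n))" for a b
    by (induction b) (simp_all add: algebra_simps)
  from *[of p N] *[of N p] show ?thesis
    by (simp add: sum_subtractf add.commute)
qed

text \<open>Almost additivity relates \<open>\<phi> (n + p) x\<close> to \<open>\<phi> n x\<close>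
  and \<open>\<phi> p\<close> at the \<open>n\<close>-th shift of \<open>x\<close>. In the sum over
  \<open>n < N\<close> the differences \<open>\<phi> (n + p) x - \<phi> n x\<close> telescope with
  lag \<open>p\<close>. What is left are \<open>p\<close> terms, each at a bounded distance from
  \<open>\<phi> N x\<close>.\<close>

lemma almost_additive_comparison:
  assumes aa: "almost_additive_with A C \<phi>" and C: "C \<ge> 0" and p: "p \<ge> 1"
  obtains K where "\<And>N x. N \<ge> 1 \<Longrightarrow> x \<in> subshift A \<Longrightarrow>
    \<bar>real p * \<phi> N x - (\<Sum>i<N. \<phi> p ((shift ^^ i) x))\<bar> \<le> C * real N + K"
proof -
  have cont: "continuous_on (subshift A) (\<phi> n)" if "n \<ge> 1" for n
    using aa that by (simp add: almost_additive_with_def)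
  have "\<exists>B. B \<ge> 0 \<and> (\<forall>x\<in>subshift A. n \<ge> 1 \<longrightarrow> \<bar>\<phi> n x\<bar> \<le> B)" for n
  proof (cases "n \<ge> 1")
    case True
    obtain B where "B \<ge> 0" "\<And>x. x \<in> subshift A \<Longrightarrow> norm (\<phi> n x) \<le> B"
      using bounded_on_subshift[OF cont[OF True]] by blast
    then show ?thesis by auto
  qed auto
  then obtain B where B0: "\<And>n. B n \<ge> 0" and B: "\<And>n x. x \<in> subshift A \<Longrightarrow> n \<ge> 1 \<Longrightarrow> \<bar>\<phi> n x\<bar> \<le> B n" by metis
  have add: "\<bar>\<phi> (n + k) x - \<phi> n x - \<phi> k ((shift ^^ n) x)\<bar> \<le> C" if "n \<ge> 1" "k \<ge> 1" "x \<in> subshift A" for n k x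
    using aa that unfolding almost_additive_with_def by (smt (verit, best))
  show ?thesis
  proof (rule that[of "\<Sum>j<p. C + 2 * B j"])
    fix N :: nat and x assume N: "N \<ge> 1" and x: "x \<in> subshift A"
    \<comment> \<open>With the value 0 at index 0 the relation also holds for \<open>n =
      0\<close>.\<close>
    define u where "u n = (if n = 0 then 0 else \<phi> n x)" for n
    have 1: "\<bar>(u (n + p) - u n) - \<phi> p ((shift ^^ n) x)\<bar> \<le> C" for n
      using add[of n p x] p x C by (cases "n = 0") (auto simp: u_def)
    have "\<bar>(\<Sum>n<N. u (n + p) - u n) - (\<Sum>n<N. \<phi> p ((shift ^^ n) x))\<bar> \<le> (\<Sum>n<N. C)"
      unfolding sum_subtractf[symmetric] by (intro order_trans[OF sum_abs] sum_mono 1)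
    then have 2: "\<bar>(\<Sum>j<p. u (N + j) - u j) - (\<Sum>n<N. \<phi> p ((shift ^^ n) x))\<bar> \<le> C * real N"
      by (simp add: telescope_lag mult.commute)
    have 3: "\<bar>u (N + j) - u j - u N\<bar> \<le> C + 2 * B j" for j
    proof (cases "j = 0")
      case True then show ?thesis using C B0[of 0] by (simp add: u_def)
    next
      case False
      have "\<bar>\<phi> j x\<bar> \<le> B j" "\<bar>\<phi> j ((shift ^^ N) x)\<bar> \<le> B j" using B[of x j] B[of "(shift ^^ N) x" j] False x shift_pow_subshift by auto
      then show ?thesis using add[of N j x] False N x by (simp add: u_def)
    qed
    have "\<bar>(\<Sum>j<p. u (N + j) - u j) - (\<Sum>j<p. u N)\<bar> \<le> (\<Sum>j<p. C + 2 * B j)"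
      unfolding sum_subtractf[symmetric] by (intro order_trans[OF sum_abs] sum_mono 3)
    then have "\<bar>(\<Sum>j<p. u (N + j) - u j) - real p * \<phi> N x\<bar> \<le> (\<Sum>j<p. C + 2 * B j)"
      using N by (simp add: u_def)
    with 2 show "\<bar>real p * \<phi> N x - (\<Sum>i<N. \<phi> p ((shift ^^ i) x))\<bar> \<le> C * real N + (\<Sum>j<p. C + 2 * B j)"
      by linarith
  qed
qed

text \<open>One value of \<open>f\<close> is chosen for each cylinder of the length provided by
  uniform continuity.\<close>

lemma locally_constant_approximation:
  fixes f :: "(nat \<Rightarrow> nat) \<Rightarrow> 'b::real_normed_vector"
  assumes f: "continuous_on (subshift A) f" and e: "e > 0"
  obtains q G where "\<And>x. x \<in> subshift A \<Longrightarrow> norm (f x - G (seq_prefix x q)) \<le> e"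
proof -
  obtain q where q: "\<And>x y. x \<in> subshift A \<Longrightarrow> y \<in> subshift A \<Longrightarrow> seq_prefix x q = seq_prefix y q \<Longrightarrow> dist (f x) (f y) < e"
    using uniform_on_prefixes[OF f e] by blast
  show ?thesis
  proof (rule that[of "\<lambda>w. f (SOME x. x \<in> cylinder A w)" q])
    fix x assume x: "x \<in> subshift A"
    then have "x \<in> cylinder A (seq_prefix x q)" by (rule in_cylinder_prefix)
    then have "(SOME x'. x' \<in> cylinder A (seq_prefix x q)) \<in> cylinder A (seq_prefix x q)" (is "?y \<in> _")
      by (rule someI[where P = "\<lambda>x'. x' \<in> cylinder A (seq_prefix x q)"])
    then have "?y \<in> subshift A" "seq_prefix ?y q = seq_prefix x q" by (auto simp: in_cylinder_iff)
    from q[OF x this(1)] this(2) show "norm (f x - f ?y) \<le> e" by (simp add: dist_norm)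
  qed
qed

lemma almost_additive_nonneg:
  assumes "almost_additive_with A C \<phi>" "subshift A \<noteq> {}"
  shows "C \<ge> 0"
proof -
  obtain x where "x \<in> subshift A" using assms by blast
  then have "- C + \<phi> 1 x + \<phi> 1 ((shift ^^ 1) x) \<le> \<phi> (1 + 1) x \<and> \<phi> (1 + 1) x \<le> C + \<phi> 1 x + \<phi> 1 ((shift ^^ 1) x)"
    using assms unfolding almost_additive_with_def by blast
  then show ?thesis by linarith
qed

text \<open>Dividing the preceding comparison by \<open>p\<close> makes the error per letter
  \<open>C / p\<close>, which is small for large \<open>p\<close>. The continuous function
  \<open>\<phi> p / p\<close> is then replaced by a function of finitely many letters.\<close>

lemma Caa_asymp_additive:
  assumes "\<phi> \<in> Caa A"
  shows "asymp_additive A \<phi>"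
proof (cases "subshift A = {}")
  case True
  then show ?thesis by (auto simp: asymp_additive_def)
next
  case False
  obtain C where aa: "almost_additive_with A C \<phi>" using assms by (auto simp: Caa_def)
  have C: "C \<ge> 0" by (rule almost_additive_nonneg[OF aa False])
  have cont: "continuous_on (subshift A) (\<phi> n)" if "n \<ge> 1" for n
    using aa that by (simp add: almost_additive_with_def)
  show ?thesis unfolding asymp_additive_def
  proof (intro conjI allI impI)
    fix \<eta> :: real assume \<eta>: "\<eta> > 0"
    obtain p :: nat where "2 * C / \<eta> + 1 < real p" using reals_Archimedean2 by blast
    moreover have "2 * C / \<eta> \<ge> 0" using C \<eta> by simp
    ultimately have "real p > 0" "2 * C / \<eta> \<le> real p" by linarith+
    then have p: "p \<ge> 1" "C \<le> (\<eta> / 2) * real p" using \<eta> by (simp_all add: field_simps)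
    obtain K where K: "\<And>N x. N \<ge> 1 \<Longrightarrow> x \<in> subshift A \<Longrightarrow>
      \<bar>real p * \<phi> N x - (\<Sum>i<N. \<phi> p ((shift ^^ i) x))\<bar> \<le> C * real N + K"
      using almost_additive_comparison[OF aa C p(1)] by blast
    have "continuous_on (subshift A) (\<lambda>x. \<phi> p x / real p)"
      using cont[OF p(1)] p(1) by (intro continuous_intros) auto
    from locally_constant_approximation[OF this half_gt_zero[OF \<eta>]]
    obtain q G where G: "\<And>x. x \<in> subshift A \<Longrightarrow> norm (\<phi> p x / real p - G (seq_prefix x q)) \<le> \<eta> / 2" by metis
    show "\<exists>q G K. \<forall>n\<ge>1. \<forall>x\<in>subshift A.
        norm (\<phi> n x - (\<Sum>i<n. G (seq_prefix ((shift ^^ i) x) q))) \<le> \<eta> * real n + K"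
    proof (rule exI[of _ q], rule exI[of _ G], rule exI[of _ "K / real p"], intro allI impI ballI)
      fix N :: nat and x assume N: "N \<ge> 1" and x: "x \<in> subshift A"
      have p0: "real p > 0" using p by simp
      have "\<bar>\<phi> N x - (\<Sum>i<N. \<phi> p ((shift ^^ i) x) / real p)\<bar> = \<bar>real p * \<phi> N x - (\<Sum>i<N. \<phi> p ((shift ^^ i) x))\<bar> / real p"
        using p0 by (simp add: sum_divide_distrib[symmetric] field_simps abs_div_pos[symmetric])
      also have "\<dots> \<le> (C * real N + K) / real p"
        using K[OF N x] p0 by (simp add: divide_right_mono)
      also have "\<dots> = C / real p * real N + K / real p" by (simp add: add_divide_distrib)
      also have "\<dots> \<le> \<eta> / 2 * real N + K / real p"
        using p p0 by (intro add_mono mult_right_mono) (auto simp: field_simps)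
      finally have 1: "\<bar>\<phi> N x - (\<Sum>i<N. \<phi> p ((shift ^^ i) x) / real p)\<bar> \<le> \<eta> / 2 * real N + K / real p" .
      have "\<bar>(\<Sum>i<N. \<phi> p ((shift ^^ i) x) / real p) - (\<Sum>i<N. G (seq_prefix ((shift ^^ i) x) q))\<bar> \<le> (\<Sum>i<N. \<eta> / 2)"
        unfolding sum_subtractf[symmetric] using G x by (intro order_trans[OF sum_abs] sum_mono) auto
      then have 2: "\<bar>(\<Sum>i<N. \<phi> p ((shift ^^ i) x) / real p) - (\<Sum>i<N. G (seq_prefix ((shift ^^ i) x) q))\<bar> \<le> \<eta> / 2 * real N"
        by (simp add: mult.commute)
      have "\<eta> * real N = \<eta> / 2 * real N + \<eta> / 2 * real N" by simp
      with 1 2 show "norm (\<phi> N x - (\<Sum>i<N. G (seq_prefix ((shift ^^ i) x) q))) \<le> \<eta> * real N + K / real p"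
        unfolding real_norm_def by linarith
    qed
  qed (use cont in auto)
qed

lemma Caa_vec_asymp_additive:
  fixes \<phi> :: "nat \<Rightarrow> (nat \<Rightarrow> nat) \<Rightarrow> real ^ 'd"
  assumes "\<phi> \<in> Caa_vec A"
  shows "asymp_additive A \<phi>"
  unfolding asymp_additive_def
proof (intro conjI allI impI)
  have comp: "asymp_additive A (\<lambda>n x. \<phi> n x $ i)" for i
    using assms by (intro Caa_asymp_additive) (auto simp: Caa_vec_def)
  fix n :: nat assume "n \<ge> 1"
  then have "continuous_on (subshift A) (\<lambda>x. \<chi> i. \<phi> n x $ i)"
    using comp by (intro continuous_on_vec_lambda) (simp add: asymp_additive_def)
  then show "continuous_on (subshift A) (\<phi> n)" by simp
next
  have comp: "asymp_additive A (\<lambda>n x. \<phi> n x $ i)" for i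
    using assms by (intro Caa_asymp_additive) (auto simp: Caa_vec_def)
  fix \<eta> :: real assume \<eta>: "\<eta> > 0"
  define d where "d = real CARD('d)"
  have d: "d > 0" by (simp add: d_def)
  have "\<exists>q G K. \<forall>n\<ge>1. \<forall>x\<in>subshift A.
     norm (\<phi> n x $ i - (\<Sum>j<n. G (seq_prefix ((shift ^^ j) x) q))) \<le> \<eta> / d * real n + K" for i
    using comp[of i] \<eta> d unfolding asymp_additive_def by (meson divide_pos_pos)
  then obtain q G K where G: "\<And>i n x. n \<ge> 1 \<Longrightarrow> x \<in> subshift A \<Longrightarrow>
     norm (\<phi> n x $ i - (\<Sum>j<n. G i (seq_prefix ((shift ^^ j) x) (q i)))) \<le> \<eta> / d * real n + K i" by metis
  define Q where "Q = (\<Sum>i\<in>UNIV. q i)"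
  have qQ: "q i \<le> Q" for i unfolding Q_def by (intro member_le_sum) auto
  show "\<exists>q G K. \<forall>n\<ge>1. \<forall>x\<in>subshift A.
        norm (\<phi> n x - (\<Sum>i<n. G (seq_prefix ((shift ^^ i) x) q))) \<le> \<eta> * real n + K"
  proof (rule exI[of _ Q], rule exI[of _ "\<lambda>w. \<chi> i. G i (take (q i) w)"], rule exI[of _ "\<Sum>i\<in>UNIV. K i"], intro allI impI ballI)
    fix n :: nat and x assume n: "n \<ge> 1" and x: "x \<in> subshift A"
    let ?v = "\<phi> n x - (\<Sum>j<n. \<chi> i. G i (take (q i) (seq_prefix ((shift ^^ j) x) Q)))"
    have "norm ?v \<le> (\<Sum>i\<in>UNIV. \<bar>?v $ i\<bar>)" by (rule norm_le_l1_cart)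
    also have "\<dots> \<le> (\<Sum>i\<in>UNIV. \<eta> / d * real n + K i)"
      using G[OF n x] by (intro sum_mono) (simp add: take_seq_prefix[OF qQ])
    also have "\<dots> = \<eta> * real n + (\<Sum>i\<in>UNIV. K i)"
      by (simp add: sum.distrib d_def)
    finally show "norm ?v \<le> \<eta> * real n + (\<Sum>i\<in>UNIV. K i)" .
  qed
qed

lemma sum_Pair: "(\<Sum>i\<in>I. (f i, g i)) = (sum f I, sum g I)"
  by (rule prod_eqI) (simp_all add: fst_sum snd_sum)

text \<open>With this, a single family of words or a single limit controls the averages of
  \<open>\<Phi>\<close> and \<open>\<Psi>\<close> at the same time.\<close>

lemma asymp_additive_Pair:
  assumes "asymp_additive A \<phi>" "asymp_additive A \<psi>"
  shows "asymp_additive A (\<lambda>n x. (\<phi> n x, \<psi> n x))"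
  unfolding asymp_additive_def
proof (intro conjI allI impI)
  fix n :: nat assume "n \<ge> 1"
  then show "continuous_on (subshift A) (\<lambda>x. (\<phi> n x, \<psi> n x))"
    using assms by (intro continuous_on_Pair) (auto simp: asymp_additive_def)
next
  fix \<eta> :: real assume "\<eta> > 0"
  then have \<eta>: "\<eta> / 2 > 0" by simp
  obtain q G K where 1: "\<And>n x. n \<ge> 1 \<Longrightarrow> x \<in> subshift A \<Longrightarrow>
    norm (\<phi> n x - (\<Sum>i<n. G (seq_prefix ((shift ^^ i) x) q))) \<le> \<eta> / 2 * real n + K"
    using asymp_additiveD[OF assms(1) \<eta>] by metis
  obtain q' G' K' where 2: "\<And>n x. n \<ge> 1 \<Longrightarrow> x \<in> subshift A \<Longrightarrow>
    norm (\<psi> n x - (\<Sum>i<n. G' (seq_prefix ((shift ^^ i) x) q'))) \<le> \<eta> / 2 * real n + K'"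
    using asymp_additiveD[OF assms(2) \<eta>] by metis
  show "\<exists>q G K. \<forall>n\<ge>1. \<forall>x\<in>subshift A.
        norm ((\<phi> n x, \<psi> n x) - (\<Sum>i<n. G (seq_prefix ((shift ^^ i) x) q))) \<le> \<eta> * real n + K"
  proof (rule exI[of _ "max q q'"], rule exI[of _ "\<lambda>w. (G (take q w), G' (take q' w))"], rule exI[of _ "K + K'"], intro allI impI ballI)
    fix n :: nat and x assume n: "n \<ge> 1" and x: "x \<in> subshift A"
    let ?a = "\<phi> n x - (\<Sum>i<n. G (seq_prefix ((shift ^^ i) x) q))"
    let ?b = "\<psi> n x - (\<Sum>i<n. G' (seq_prefix ((shift ^^ i) x) q'))"
    have "norm (?a, ?b) \<le> norm ?a + norm ?b" by (rule norm_Pair_le)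
    also have "\<dots> \<le> \<eta> * real n + (K + K')" using 1[OF n x] 2[OF n x] by (simp add: field_simps)
    finally show "norm ((\<phi> n x, \<psi> n x) - (\<Sum>i<n. (G (take q (seq_prefix ((shift ^^ i) x) (max q q'))),
        G' (take q' (seq_prefix ((shift ^^ i) x) (max q q')))))) \<le> \<eta> * real n + (K + K')"
      by (simp add: sum_Pair take_seq_prefix)
  qed
qed

context sft
begin

definition word_bound :: "nat \<Rightarrow> (nat list \<Rightarrow> 'b::real_normed_vector) \<Rightarrow> real" where
  "word_bound q G = (\<Sum>w\<in>words q. norm (G w))"

lemma word_bound_nonneg: "word_bound q G \<ge> 0"
  by (simp add: word_bound_def sum_nonneg)

lemma norm_le_word_bound: "w \<in> words q \<Longrightarrow> norm (G w) \<le> word_bound q G"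
  unfolding word_bound_def by (intro member_le_sum) auto

lemma norm_le_word_bound_prefix: "x \<in> X \<Longrightarrow> norm (G (seq_prefix x q)) \<le> word_bound q G"
  by (intro norm_le_word_bound) auto

lemma norm_birkhoff_le:
  assumes "x \<in> X"
  shows "norm (\<Sum>i<n. G (seq_prefix ((shift ^^ i) x) q)) \<le> real n * word_bound q G"
proof -
  have "norm (\<Sum>i<n. G (seq_prefix ((shift ^^ i) x) q)) \<le> (\<Sum>i<n. word_bound q G)"
    using assms by (intro order_trans[OF norm_sum] sum_mono norm_le_word_bound_prefix) auto
  then show ?thesis by simp
qed

text \<open>Only the last \<open>q\<close> windows reach beyond the common prefix.\<close>

lemma birkhoff_same_prefix:
  assumes x: "x \<in> X" and y: "y \<in> X" and eq: "seq_prefix x n = seq_prefix y n"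
  shows "norm ((\<Sum>i<n. G (seq_prefix ((shift ^^ i) x) q)) - (\<Sum>i<n. G (seq_prefix ((shift ^^ i) y) q)))
    \<le> real q * (2 * word_bound q G)"
proof -
  have "norm ((\<Sum>i<n. G (seq_prefix ((shift ^^ i) x) q)) - (\<Sum>i<n. G (seq_prefix ((shift ^^ i) y) q)))
    \<le> (\<Sum>i<n. norm (G (seq_prefix ((shift ^^ i) x) q) - G (seq_prefix ((shift ^^ i) y) q)))"
    unfolding sum_subtractf[symmetric] by (rule norm_sum)
  also have "\<dots> = (\<Sum>i\<in>{n - q..<n}. norm (G (seq_prefix ((shift ^^ i) x) q) - G (seq_prefix ((shift ^^ i) y) q)))"
  proof (rule sum.mono_neutral_right)
    show "\<forall>i\<in>{..<n} - {n - q..<n}. norm (G (seq_prefix ((shift ^^ i) x) q) - G (seq_prefix ((shift ^^ i) y) q)) = 0"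
    proof
      fix i assume "i \<in> {..<n} - {n - q..<n}"
      then have "i + q \<le> n" by auto
      then have "seq_prefix x (i + q) = seq_prefix y (i + q)" using eq seq_prefix_mono by blast
      then have "seq_prefix ((shift ^^ i) x) q = seq_prefix ((shift ^^ i) y) q" by (rule seq_prefix_shift_eq)
      then show "norm (G (seq_prefix ((shift ^^ i) x) q) - G (seq_prefix ((shift ^^ i) y) q)) = 0" by simp
    qed
  qed auto
  also have "\<dots> \<le> (\<Sum>i\<in>{n - q..<n}. 2 * word_bound q G)"
  proof (rule sum_mono)
    fix i
    show "norm (G (seq_prefix ((shift ^^ i) x) q) - G (seq_prefix ((shift ^^ i) y) q)) \<le> 2 * word_bound q G"
      using norm_le_word_bound_prefix[of "(shift ^^ i) x" G q] norm_le_word_bound_prefix[of "(shift ^^ i) y" G q] x y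
        norm_triangle_ineq4[of "G (seq_prefix ((shift ^^ i) x) q)" "G (seq_prefix ((shift ^^ i) y) q)"]
      by (smt (verit) shift_pow_subshift)
  qed
  also have "\<dots> \<le> real q * (2 * word_bound q G)"
    using word_bound_nonneg[of q G] by (auto intro!: mult_right_mono)
  finally show ?thesis .
qed

text \<open>The approximating Birkhoff sums of two such points differ by a bounded amount.\<close>

lemma small_variation:
  assumes "asymp_additive A \<phi>" "\<eta> > 0"
  obtains K where "K \<ge> 0" "\<And>n x y. n \<ge> 1 \<Longrightarrow> x \<in> X \<Longrightarrow> y \<in> X \<Longrightarrow> seq_prefix x n = seq_prefix y n \<Longrightarrow>
    norm (\<phi> n x - \<phi> n y) \<le> \<eta> * real n + K"
proof -
  obtain q G K where K: "K \<ge> 0" and G: "\<And>n x. n \<ge> 1 \<Longrightarrow> x \<in> X \<Longrightarrow>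
    norm (\<phi> n x - (\<Sum>i<n. G (seq_prefix ((shift ^^ i) x) q))) \<le> (\<eta> / 2) * real n + K"
    using asymp_additiveD[OF assms(1) half_gt_zero[OF assms(2)]] by metis
  show ?thesis
  proof (rule that[of "2 * K + real q * (2 * word_bound q G)"])
    show "2 * K + real q * (2 * word_bound q G) \<ge> 0" using K word_bound_nonneg[of q G] by simp
    fix n :: nat and x y assume n: "n \<ge> 1" and x: "x \<in> X" and y: "y \<in> X" and eq: "seq_prefix x n = seq_prefix y n"
    let ?S = "\<lambda>x. \<Sum>i<n. G (seq_prefix ((shift ^^ i) x) q)"
    have "norm (\<phi> n x - \<phi> n y) = norm ((\<phi> n x - ?S x) + (?S x - ?S y) - (\<phi> n y - ?S y))" by simp
    also have "\<dots> \<le> norm (\<phi> n x - ?S x) + norm (?S x - ?S y) + norm (\<phi> n y - ?S y)"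
      by (meson norm_triangle_ineq norm_triangle_ineq4 order_trans add_right_mono)
    also have "\<dots> \<le> (\<eta> / 2 * real n + K) + real q * (2 * word_bound q G) + (\<eta> / 2 * real n + K)"
      using G[OF n x] G[OF n y] birkhoff_same_prefix[OF x y eq] by (intro add_mono)
    finally show "norm (\<phi> n x - \<phi> n y) \<le> \<eta> * real n + (2 * K + real q * (2 * word_bound q G))" by simp
  qed
qed

end

lemma asymp_additive_continuous: "asymp_additive A \<phi> \<Longrightarrow> n \<ge> 1 \<Longrightarrow> continuous_on (subshift A) (\<phi> n)"
  unfolding asymp_additive_def by blast

section \<open>Invariant measures and stationary families of word probabilities\<close>

lemma open_prefix_neighbourhood:
  fixes U :: "(nat \<Rightarrow> nat) set"
  assumes "open U" "x \<in> U"
  obtains n where "\<And>y. seq_prefix y n = seq_prefix x n \<Longrightarrow> y \<in> U"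
proof -
  have "\<exists>n. \<forall>y. seq_prefix y n = seq_prefix x n \<longrightarrow> y \<in> U"
  proof (rule ccontr)
    assume "\<not> ?thesis"
    then obtain y where y: "\<And>n. seq_prefix (y n) n = seq_prefix x n" "\<And>n. y n \<notin> U" by metis
    have "y \<longlonglongrightarrow> x"
    proof (rule tendsto_fun_discreteI)
      fix n
      show "\<forall>\<^sub>F k in sequentially. seq_prefix (y k) n = seq_prefix x n"
        by (rule eventually_sequentiallyI[of n]) (use y(1) seq_prefix_mono in blast)
    qed
    then have "eventually (\<lambda>k. y k \<in> U) sequentially" using assms topological_tendstoD by blast
    then show False using y(2) by simp
  qed
  then show ?thesis using that by blast
qed

context sft
begin

lemma X_borel: "X \<in> sets borel"
  using closed_subshift by (rule borel_closed)

lemma space_inv: "sets M = sets (restrict_space borel X) \<Longrightarrow> space M = X"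
  using sets_eq_imp_space_eq[of M "restrict_space borel X"] by (simp add: space_restrict_space)

lemma prefix_set_measurable:
  assumes "sets M = sets (restrict_space borel X)"
  shows "{x \<in> X. P (seq_prefix x n)} \<in> sets M"
proof -
  have "{x \<in> X. P (seq_prefix x n)} = X \<inter> {x. P (seq_prefix x n)}" by blast
  moreover have "{x. P (seq_prefix x n)} \<in> sets borel" using open_seq_prefix by (rule borel_open)
  ultimately show ?thesis unfolding assms sets_restrict_space by blast
qed

lemma cylinder_measurable:
  assumes "sets M = sets (restrict_space borel X)"
  shows "cylinder A w \<in> sets M"
  using prefix_set_measurable[OF assms, of "\<lambda>v. v = w" "length w"] by (simp add: cylinder_def)

lemma cylinder_Int:
  assumes "length u \<le> length v"
  shows "cylinder A u \<inter> cylinder A v = (if take (length u) v = u then cylinder A v else {})"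
proof -
  have "seq_prefix x (length u) = take (length u) v" if "seq_prefix x (length v) = v" for x
    using take_seq_prefix[OF assms, of x] that by simp
  then show ?thesis by (auto simp: cylinder_def)
qed

text \<open>An open set is the union of the cylinders inside it, and there are only countably many
  cylinders.\<close>

lemma sets_eq_sigma_cylinders:
  "sets (restrict_space borel X) = sigma_sets X (insert {} (range (cylinder A)))"
proof -
  have "sets (restrict_space borel X) = (\<inter>) X ` sigma_sets UNIV {S. open S}"
    by (simp add: sets_restrict_space borel_def)
  also have "\<dots> = sigma_sets X ((\<inter>) X ` {S. open S})"
    using X_borel by (intro sigma_sets_Int) (auto simp: borel_def)
  also have "\<dots> = sigma_sets X (insert {} (range (cylinder A)))"
  proof (rule sigma_sets_eqI)
    fix S assume "S \<in> (\<inter>) X ` {S. open S}"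
    then obtain U where U: "open U" "S = X \<inter> U" by auto
    define C where "C = {w. cylinder A w \<subseteq> U}"
    have "S = (\<Union>w\<in>C. cylinder A w)"
    proof safe
      fix x assume x: "x \<in> S"
      then obtain n where "\<And>y. seq_prefix y n = seq_prefix x n \<Longrightarrow> y \<in> U"
        using open_prefix_neighbourhood[OF U(1), of x] U(2) by blast
      then have "seq_prefix x n \<in> C" by (auto simp: C_def cylinder_def)
      then show "x \<in> (\<Union>w\<in>C. cylinder A w)" using x U(2) by blast
    qed (auto simp: U C_def cylinder_def)
    moreover have "countable (cylinder A ` C)" by simp
    ultimately show "S \<in> sigma_sets X (insert {} (range (cylinder A)))"
      by (auto intro!: sigma_sets_UNION intro: sigma_sets.Basic)
  next
    fix S assume "S \<in> insert {} (range (cylinder A))"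
    then consider "S = {}" | w where "S = cylinder A w" by blast
    then show "S \<in> sigma_sets X ((\<inter>) X ` {S. open S})"
    proof cases
      case 1 then show ?thesis by (simp add: sigma_sets.Empty)
    next
      case 2
      have "S = X \<inter> {x. seq_prefix x (length w) = w}" by (auto simp: 2 cylinder_def)
      then show ?thesis using open_seq_prefix[of "\<lambda>v. v = w" "length w"] by (blast intro: sigma_sets.Basic)
    qed
  qed
  finally show ?thesis .
qed

text \<open>Together with the empty set, the cylinders form a generator that is closed under
  intersections.\<close>

lemma measure_eq_on_cylinders:
  assumes M: "finite_measure M" "sets M = sets (restrict_space borel X)"
    and N: "sets N = sets (restrict_space borel X)"
    and eq: "\<And>w. emeasure M (cylinder A w) = emeasure N (cylinder A w)"
  shows "M = N"
proof (rule measure_eqI_generator_eq[where E = "insert {} (range (cylinder A))" and \<Omega> = X and A = "\<lambda>_. cylinder A []"])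
  show "Int_stable (insert {} (range (cylinder A)))"
  proof (rule Int_stableI)
    fix a b assume "a \<in> insert {} (range (cylinder A))" "b \<in> insert {} (range (cylinder A))"
    moreover have "cylinder A u \<inter> cylinder A v \<in> insert {} (range (cylinder A))" for u v
      using cylinder_Int[of u v] cylinder_Int[of v u]
      by (cases "length u \<le> length v") (auto simp: Int_commute)
    ultimately show "a \<inter> b \<in> insert {} (range (cylinder A))" by auto
  qed
  show "insert {} (range (cylinder A)) \<subseteq> Pow X" using cylinder_subset by auto
  show "sets M = sigma_sets X (insert {} (range (cylinder A)))" "sets N = sigma_sets X (insert {} (range (cylinder A)))"
    using M N sets_eq_sigma_cylinders by simp_all
  show "emeasure M Y = emeasure N Y" if "Y \<in> insert {} (range (cylinder A))" for Y
    using that eq by auto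
  show "emeasure M (cylinder A []) \<noteq> \<infinity>" using M(1) by (simp add: finite_measure.emeasure_finite)
  show "range (\<lambda>_::nat. cylinder A []) \<subseteq> insert {} (range (cylinder A))" by blast
  show "(\<Union>_::nat. cylinder A []) = X" by (simp add: cylinder_def)
qed

lemma invD:
  assumes "M \<in> invariant_measures A"
  shows "prob_space M" "sets M = sets (restrict_space borel X)" "space M = X"
    "shift \<in> measurable M M" "distr M M shift = M"
  using assms space_inv[of M] by (auto simp: invariant_measures_def)

definition word_prob :: "(nat \<Rightarrow> nat) measure \<Rightarrow> nat list \<Rightarrow> real" where
  "word_prob M w = measure M (cylinder A w)"

lemma measurable_shift_pow: "M \<in> invariant_measures A \<Longrightarrow> (shift ^^ i) \<in> measurable M M"
proof (induction i)
  case (Suc i)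
  then have "(shift ^^ i) \<in> measurable M M" by simp
  from measurable_comp[OF this invD(4)[OF Suc.prems]] show ?case by (simp add: comp_def)
qed (simp add: id_def)

lemma distr_shift_pow:
  assumes M: "M \<in> invariant_measures A"
  shows "distr M M (shift ^^ i) = M"
proof (induction i)
  case (Suc i)
  have "distr M M (shift ^^ Suc i) = distr (distr M M (shift ^^ i)) M shift"
    using invD(4)[OF M] measurable_shift_pow[OF M] by (simp add: distr_distr comp_def)
  then show ?case using Suc invD(5)[OF M] by (simp add: comp_def)
qed (simp add: id_def)

lemma integral_shift_pow:
  fixes f :: "(nat \<Rightarrow> nat) \<Rightarrow> 'b::{banach, second_countable_topology}"
  assumes M: "M \<in> invariant_measures A" and f: "f \<in> borel_measurable M"
  shows "(\<integral>x. f ((shift ^^ i) x) \<partial>M) = (\<integral>x. f x \<partial>M)"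
  using integral_distr[OF measurable_shift_pow[OF M] f, of i] distr_shift_pow[OF M] by simp

lemma continuous_measurable:
  fixes f :: "(nat \<Rightarrow> nat) \<Rightarrow> 'b::{topological_space}"
  assumes M: "M \<in> invariant_measures A" and f: "continuous_on X f"
  shows "f \<in> borel_measurable M"
  using borel_measurable_continuous_on_restrict[OF f] invD(2)[OF M] measurable_cong_sets by blast

lemma continuous_integrable:
  fixes f :: "(nat \<Rightarrow> nat) \<Rightarrow> 'b::{banach, second_countable_topology}"
  assumes M: "M \<in> invariant_measures A" and f: "continuous_on X f"
  shows "integrable M f"
proof -
  interpret prob_space M using invD[OF M] by simp
  obtain B where "\<And>x. x \<in> X \<Longrightarrow> norm (f x) \<le> B" using bounded_on_subshift[OF f] by blast
  then show ?thesis using continuous_measurable[OF M f] invD(3)[OF M]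
    by (intro integrable_const_bound[of f B]) auto
qed

lemma has_integral_prefix:
  fixes G :: "nat list \<Rightarrow> 'b::{banach, second_countable_topology}"
  assumes M: "M \<in> invariant_measures A"
  shows "has_bochner_integral M (\<lambda>x. G (seq_prefix x q)) (\<Sum>w\<in>words q. word_prob M w *\<^sub>R G w)"
proof -
  interpret prob_space M using invD[OF M] by simp
  have "has_bochner_integral M (\<lambda>x. \<Sum>w\<in>words q. indicator (cylinder A w) x *\<^sub>R G w) (\<Sum>w\<in>words q. word_prob M w *\<^sub>R G w)"
    unfolding word_prob_def
    by (intro has_bochner_integral_sum has_bochner_integral_indicator cylinder_measurable[OF invD(2)[OF M]])
       (simp add: emeasure_finite less_top[symmetric])
  moreover have "(\<Sum>w\<in>words q. indicator (cylinder A w) x *\<^sub>R G w) = G (seq_prefix x q)" if "x \<in> X" for x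
  proof -
    have "(\<Sum>w\<in>words q. indicator (cylinder A w) x *\<^sub>R G w) = (\<Sum>w\<in>words q. if w = seq_prefix x q then G w else 0)"
      using that by (intro sum.cong refl) (auto simp: cylinder_def words_def indicator_def)
    also have "\<dots> = G (seq_prefix x q)" using that by (auto simp: sum.delta)
    finally show ?thesis .
  qed
  ultimately show ?thesis using invD(3)[OF M] by (subst (asm) has_bochner_integral_cong) auto
qed

lemma integral_prefix:
  fixes G :: "nat list \<Rightarrow> 'b::{banach, second_countable_topology}"
  assumes M: "M \<in> invariant_measures A"
  shows "(\<integral>x. G (seq_prefix ((shift ^^ i) x) q) \<partial>M) = (\<Sum>w\<in>words q. word_prob M w *\<^sub>R G w)"
    "integrable M (\<lambda>x. G (seq_prefix ((shift ^^ i) x) q))"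
proof -
  note * = has_integral_prefix[OF M, of G q]
  have meas: "(\<lambda>x. G (seq_prefix x q)) \<in> borel_measurable M" using * by (auto simp: has_bochner_integral_iff)
  show "(\<integral>x. G (seq_prefix ((shift ^^ i) x) q) \<partial>M) = (\<Sum>w\<in>words q. word_prob M w *\<^sub>R G w)"
    using integral_shift_pow[OF M meas] * by (simp add: has_bochner_integral_iff)
  have "integrable (distr M M (shift ^^ i)) (\<lambda>x. G (seq_prefix x q))"
    using distr_shift_pow[OF M] * by (simp add: has_bochner_integral_iff)
  then show "integrable M (\<lambda>x. G (seq_prefix ((shift ^^ i) x) q))"
    by (subst (asm) integrable_distr_eq[OF measurable_shift_pow[OF M] meas])
qed

subsection \<open>Asymptotic means\<close>

lemma mean_approx_n:
  fixes \<phi> :: "nat \<Rightarrow> (nat \<Rightarrow> nat) \<Rightarrow> 'b::euclidean_space"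
  assumes M: "M \<in> invariant_measures A" and aa: "asymp_additive A \<phi>"
    and G: "\<And>n x. n \<ge> 1 \<Longrightarrow> x \<in> X \<Longrightarrow> norm (\<phi> n x - (\<Sum>i<n. G (seq_prefix ((shift ^^ i) x) q))) \<le> \<eta> * real n + K"
    and n: "n \<ge> 1"
  shows "norm ((\<integral>x. \<phi> n x /\<^sub>R real n \<partial>M) - (\<Sum>w\<in>words q. word_prob M w *\<^sub>R G w)) \<le> \<eta> + K / real n"
proof -
  interpret prob_space M using invD[OF M] by simp
  let ?S = "\<lambda>x. (\<Sum>i<n. G (seq_prefix ((shift ^^ i) x) q))"
  have int1: "integrable M (\<phi> n)"
    using asymp_additive_continuous[OF aa n] by (rule continuous_integrable[OF M])
  have int2: "integrable M ?S" by (intro Bochner_Integration.integrable_sum integral_prefix(2)[OF M])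
  have "(\<integral>x. ?S x \<partial>M) = (\<Sum>i<n. \<Sum>w\<in>words q. word_prob M w *\<^sub>R G w)"
    by (subst Bochner_Integration.integral_sum) (simp_all only: integral_prefix[OF M])
  then have S: "(\<Sum>w\<in>words q. word_prob M w *\<^sub>R G w) = (\<integral>x. ?S x /\<^sub>R real n \<partial>M)"
    using n by (simp add: sum_constant_scaleR)
  have "(\<integral>x. \<phi> n x /\<^sub>R real n \<partial>M) - (\<Sum>w\<in>words q. word_prob M w *\<^sub>R G w) = (\<integral>x. (\<phi> n x - ?S x) /\<^sub>R real n \<partial>M)"
    unfolding S using int1 int2 by (simp add: scaleR_diff_right Bochner_Integration.integral_diff)
  also have "norm \<dots> \<le> (\<integral>x. norm ((\<phi> n x - ?S x) /\<^sub>R real n) \<partial>M)" by (rule integral_norm_bound)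
  also have "\<dots> \<le> (\<integral>x. \<eta> + K / real n \<partial>M)"
  proof (rule integral_mono)
    show "integrable M (\<lambda>x. norm ((\<phi> n x - ?S x) /\<^sub>R real n))" using int1 int2 by auto
    fix x assume "x \<in> space M"
    then have "norm (\<phi> n x - ?S x) \<le> \<eta> * real n + K" using G n invD(3)[OF M] by simp
    then have "norm (\<phi> n x - ?S x) / real n \<le> (\<eta> * real n + K) / real n" by (intro divide_right_mono) auto
    moreover have "norm ((\<phi> n x - ?S x) /\<^sub>R real n) = norm (\<phi> n x - ?S x) / real n"
      by (simp add: divide_inverse mult.commute)
    moreover have "(\<eta> * real n + K) / real n = \<eta> + K / real n" using n by (simp add: add_divide_distrib)
    ultimately show "norm ((\<phi> n x - ?S x) /\<^sub>R real n) \<le> \<eta> + K / real n" by linarith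
  qed simp
  also have "\<dots> = \<eta> + K / real n" by (simp add: prob_space)
  finally show ?thesis .
qed

text \<open>By invariance, the integral of a Birkhoff sum divided by \<open>n\<close> does not
  depend on \<open>n\<close>. The integrals in question therefore vary by at most \<open>2
  \<eta>\<close> in the long run, for every \<open>\<eta>\<close>.\<close>

lemma asymptotic_mean_tendsto:
  fixes \<phi> :: "nat \<Rightarrow> (nat \<Rightarrow> nat) \<Rightarrow> 'b::euclidean_space"
  assumes M: "M \<in> invariant_measures A" and aa: "asymp_additive A \<phi>"
  shows "(\<lambda>n. \<integral>x. \<phi> n x /\<^sub>R real n \<partial>M) \<longlonglongrightarrow> asymptotic_mean \<phi> M"
proof -
  let ?I = "\<lambda>n. \<integral>x. \<phi> n x /\<^sub>R real n \<partial>M"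
  have "Cauchy ?I"
  proof (rule metric_CauchyI)
    fix e :: real assume e: "e > 0"
    then have e4: "e / 4 > 0" by simp
    obtain q G K where K: "K \<ge> 0" and G: "\<And>n x. n \<ge> 1 \<Longrightarrow> x \<in> X \<Longrightarrow>
      norm (\<phi> n x - (\<Sum>i<n. G (seq_prefix ((shift ^^ i) x) q))) \<le> (e / 4) * real n + K"
      using asymp_additiveD[OF aa e4] by metis
    obtain N :: nat where N: "4 * K / e < real N" using reals_Archimedean2 by blast
    have close: "dist (?I n) (\<Sum>w\<in>words q. word_prob M w *\<^sub>R G w) < e / 2" if n: "n \<ge> Suc N" for n
    proof -
      have "4 * K / e < real n" using N n by linarith
      then have "K / real n < e / 4" using e n K by (simp add: field_simps)
      moreover have "norm (?I n - (\<Sum>w\<in>words q. word_prob M w *\<^sub>R G w)) \<le> e / 4 + K / real n"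
        using n by (intro mean_approx_n[OF M aa G]) auto
      ultimately show ?thesis unfolding dist_norm by linarith
    qed
    show "\<exists>N. \<forall>n\<ge>N. \<forall>k\<ge>N. dist (?I n) (?I k) < e"
      using close dist_triangle_half_l by blast
  qed
  then have "convergent ?I" by (simp add: Cauchy_convergent_iff)
  then show ?thesis unfolding asymptotic_mean_def by (simp add: convergent_LIMSEQ_iff)
qed

text \<open>This is how means of different measures are compared: up to \<open>\<eta>\<close>, the
  mean is a fixed linear function of finitely many word probabilities.\<close>

lemma asymptotic_mean_approx:
  fixes \<phi> :: "nat \<Rightarrow> (nat \<Rightarrow> nat) \<Rightarrow> 'b::euclidean_space"
  assumes M: "M \<in> invariant_measures A" and aa: "asymp_additive A \<phi>"
    and G: "\<And>n x. n \<ge> 1 \<Longrightarrow> x \<in> X \<Longrightarrow> norm (\<phi> n x - (\<Sum>i<n. G (seq_prefix ((shift ^^ i) x) q))) \<le> \<eta> * real n + K"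
  shows "norm (asymptotic_mean \<phi> M - (\<Sum>w\<in>words q. word_prob M w *\<^sub>R G w)) \<le> \<eta>"
proof (rule LIMSEQ_le)
  show "(\<lambda>n. norm ((\<integral>x. \<phi> n x /\<^sub>R real n \<partial>M) - (\<Sum>w\<in>words q. word_prob M w *\<^sub>R G w)))
    \<longlonglongrightarrow> norm (asymptotic_mean \<phi> M - (\<Sum>w\<in>words q. word_prob M w *\<^sub>R G w))"
    by (intro tendsto_norm tendsto_diff asymptotic_mean_tendsto[OF M aa] tendsto_const)
  have "(\<lambda>n. K / real n) \<longlonglongrightarrow> 0" by (rule lim_const_over_n)
  then show "(\<lambda>n. \<eta> + K / real n) \<longlonglongrightarrow> \<eta>" using tendsto_add[OF tendsto_const, of "\<lambda>n. K / real n" 0 sequentially \<eta>] by simp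
  show "\<exists>N. \<forall>n\<ge>N. norm ((\<integral>x. \<phi> n x /\<^sub>R real n \<partial>M) - (\<Sum>w\<in>words q. word_prob M w *\<^sub>R G w)) \<le> \<eta> + K / real n"
    using mean_approx_n[OF M aa G] by blast
qed

lemma asymptotic_mean_Pair:
  fixes \<phi> :: "nat \<Rightarrow> (nat \<Rightarrow> nat) \<Rightarrow> 'b::euclidean_space" and \<psi> :: "nat \<Rightarrow> (nat \<Rightarrow> nat) \<Rightarrow> 'c::euclidean_space"
  assumes M: "M \<in> invariant_measures A" and aa: "asymp_additive A \<phi>" "asymp_additive A \<psi>"
  shows "asymptotic_mean (\<lambda>n x. (\<phi> n x, \<psi> n x)) M = (asymptotic_mean \<phi> M, asymptotic_mean \<psi> M)"
proof -
  have aap: "asymp_additive A (\<lambda>n x. (\<phi> n x, \<psi> n x))" using aa by (rule asymp_additive_Pair)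
  let ?I = "\<lambda>n. \<integral>x. (\<phi> n x, \<psi> n x) /\<^sub>R real n \<partial>M"
  have int: "integrable M (\<lambda>x. (\<phi> n x, \<psi> n x) /\<^sub>R real n)" if "n \<ge> 1" for n
    using continuous_integrable[OF M asymp_additive_continuous[OF aap that]] by (intro integrable_scaleR_right)
  have f: "fst (?I n) = (\<integral>x. \<phi> n x /\<^sub>R real n \<partial>M)" if "n \<ge> 1" for n
    using integral_bounded_linear[OF bounded_linear_fst int[OF that]] by simp
  have s: "snd (?I n) = (\<integral>x. \<psi> n x /\<^sub>R real n \<partial>M)" if "n \<ge> 1" for n
    using integral_bounded_linear[OF bounded_linear_snd int[OF that]] by simp
  note lim = asymptotic_mean_tendsto[OF M aap]
  have "(\<lambda>n. \<integral>x. \<phi> n x /\<^sub>R real n \<partial>M) \<longlonglongrightarrow> fst (asymptotic_mean (\<lambda>n x. (\<phi> n x, \<psi> n x)) M)"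
    by (rule Lim_transform_eventually[OF tendsto_fst[OF lim]]) (use f in \<open>auto simp: eventually_sequentially\<close>)
  moreover have "(\<lambda>n. \<integral>x. \<psi> n x /\<^sub>R real n \<partial>M) \<longlonglongrightarrow> snd (asymptotic_mean (\<lambda>n x. (\<phi> n x, \<psi> n x)) M)"
    by (rule Lim_transform_eventually[OF tendsto_snd[OF lim]]) (use s in \<open>auto simp: eventually_sequentially\<close>)
  ultimately show ?thesis
    using LIMSEQ_unique[OF _ asymptotic_mean_tendsto[OF M aa(1)]] LIMSEQ_unique[OF _ asymptotic_mean_tendsto[OF M aa(2)]]
    by (intro prod_eqI) simp_all
qed

subsection \<open>Stationary families\<close>

text \<open>These are the properties of the word probabilities of an invariant measure. The first
  sum says that a cylinder is split by the next letter, the second one is invariance: it adds a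
  letter in front.\<close>

definition stationary :: "(nat list \<Rightarrow> real) \<Rightarrow> bool" where
  "stationary g \<longleftrightarrow> g [] = 1 \<and> (\<forall>w. g w \<ge> 0) \<and> (\<forall>w. w \<notin> adm \<longrightarrow> g w = 0) \<and>
     (\<forall>w. g w = (\<Sum>a<m. g (w @ [a]))) \<and> (\<forall>w. g w = (\<Sum>a<m. g (a # w)))"

lemma stationaryD:
  assumes "stationary g"
  shows "g [] = 1" "g w \<ge> 0" "w \<notin> adm \<Longrightarrow> g w = 0" "(\<Sum>a<m. g (w @ [a])) = g w" "(\<Sum>a<m. g (a # w)) = g w"
proof -
  note * = assms[unfolded stationary_def]
  show "g [] = 1" "g w \<ge> 0" "w \<notin> adm \<Longrightarrow> g w = 0" using * by blast+
  have "\<forall>w. g w = (\<Sum>a<m. g (w @ [a]))" "\<forall>w. g w = (\<Sum>a<m. g (a # w))" using * by blast+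
  from spec[OF this(1), of w, symmetric] spec[OF this(2), of w, symmetric]
  show "(\<Sum>a<m. g (w @ [a])) = g w" "(\<Sum>a<m. g (a # w)) = g w" .
qed

lemma shift_vimage_cylinder:
  assumes M: "M \<in> invariant_measures A"
  shows "word_prob M w = measure M {x \<in> X. seq_prefix (shift x) (length w) = w}"
proof -
  have "word_prob M w = measure (distr M M shift) (cylinder A w)" using invD(5)[OF M] by (simp add: word_prob_def)
  also have "\<dots> = measure M (shift -` cylinder A w \<inter> space M)"
    using invD[OF M] cylinder_measurable[OF invD(2)[OF M]] by (intro measure_distr) auto
  also have "shift -` cylinder A w \<inter> space M = {x \<in> X. seq_prefix (shift x) (length w) = w}"
    using invD(3)[OF M] by (auto simp: cylinder_def)
  finally show ?thesis .
qed

lemma stationary_word_prob: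
  assumes M: "M \<in> invariant_measures A"
  shows "stationary (word_prob M)"
proof -
  interpret prob_space M using invD[OF M] by simp
  note cm = cylinder_measurable[OF invD(2)[OF M]]
  have "word_prob M [] = 1" using prob_space invD(3)[OF M] by (simp add: word_prob_def cylinder_def)
  moreover have "word_prob M w = (\<Sum>a<m. word_prob M (w @ [a]))" for w
  proof -
    have "cylinder A w = (\<Union>a<m. cylinder A (w @ [a]))"
      by (auto simp: cylinder_def seq_prefix_Suc subshift_def)
    then have "word_prob M w = measure M (\<Union>a<m. cylinder A (w @ [a]))" by (simp add: word_prob_def)
    also have "\<dots> = (\<Sum>a<m. word_prob M (w @ [a]))" unfolding word_prob_def
    proof (rule finite_measure_finite_Union)
      show "disjoint_family_on (\<lambda>a. cylinder A (w @ [a])) {..<m}"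
        by (auto simp: disjoint_family_on_def cylinder_def seq_prefix_Suc)
    qed (use cm in auto)
    finally show ?thesis .
  qed
  moreover have "word_prob M w = (\<Sum>a<m. word_prob M (a # w))" for w
  proof -
    have "{x \<in> X. seq_prefix (shift x) (length w) = w} = (\<Union>a<m. cylinder A (a # w))"
      by (auto simp: cylinder_def seq_prefix_Suc_Cons subshift_def)
    then have "word_prob M w = measure M (\<Union>a<m. cylinder A (a # w))" using shift_vimage_cylinder[OF M] by simp
    also have "\<dots> = (\<Sum>a<m. word_prob M (a # w))" unfolding word_prob_def
    proof (rule finite_measure_finite_Union)
      show "disjoint_family_on (\<lambda>a. cylinder A (a # w)) {..<m}"
        by (auto simp: disjoint_family_on_def cylinder_def seq_prefix_Suc_Cons)
    qed (use cm in auto)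
    finally show ?thesis .
  qed
  moreover have "w \<notin> adm \<Longrightarrow> word_prob M w = 0" for w by (simp add: word_prob_def cylinder_empty)
  moreover have "word_prob M w \<ge> 0" for w by (simp add: word_prob_def)
  ultimately show ?thesis unfolding stationary_def by blast
qed

lemma sum_words_Suc:
  fixes f :: "nat list \<Rightarrow> 'b::comm_monoid_add"
  assumes "\<And>w. w \<notin> adm \<Longrightarrow> f w = 0"
  shows "(\<Sum>w\<in>words (Suc n). f w) = (\<Sum>w\<in>words n. \<Sum>a<m. f (w @ [a]))"
proof -
  have "(\<Sum>w\<in>words n. \<Sum>a<m. f (w @ [a])) = (\<Sum>(w, a)\<in>words n \<times> {..<m}. f (w @ [a]))"
    by (simp add: sum.cartesian_product)
  also have "\<dots> = (\<Sum>v\<in>(\<lambda>(w, a). w @ [a]) ` (words n \<times> {..<m}). f v)"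
    by (subst sum.reindex) (auto simp: inj_on_def case_prod_unfold)
  also have "\<dots> = (\<Sum>w\<in>words (Suc n). f w)"
  proof (rule sum.mono_neutral_right)
    show "words (Suc n) \<subseteq> (\<lambda>(w, a). w @ [a]) ` (words n \<times> {..<m})"
    proof
      fix v assume v: "v \<in> words (Suc n)"
      then have "v \<noteq> []" by (auto simp: words_def)
      then have v': "v = butlast v @ [last v]" by simp
      have "butlast v @ [last v] \<in> adm" using v v' by (simp add: words_def)
      then have "butlast v \<in> adm" "[last v] \<in> adm" by (simp_all add: admissible_append)
      then have "butlast v \<in> words n" "last v < m"
        using v by (auto simp: words_def) (simp add: admissible_words_def)
      then show "v \<in> (\<lambda>(w, a). w @ [a]) ` (words n \<times> {..<m})" using v' by (auto simp: image_iff intro!: bexI[of _ "butlast v"])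
    qed
    show "\<forall>i\<in>(\<lambda>(w, a). w @ [a]) ` (words n \<times> {..<m}) - words (Suc n). f i = 0"
      using assms by (auto simp: words_def)
  qed auto
  finally show ?thesis by simp
qed

lemma stationary_sum_words:
  assumes "stationary g"
  shows "(\<Sum>w\<in>words n. g w) = 1"
proof (induction n)
  case 0
  have "words 0 = {[]}" by (auto simp: words_def)
  then show ?case using stationaryD(1)[OF assms] by simp
next
  case (Suc n)
  have "(\<Sum>w\<in>words (Suc n). g w) = (\<Sum>w\<in>words n. \<Sum>a<m. g (w @ [a]))"
    using stationaryD(3)[OF assms] by (intro sum_words_Suc)
  also have "\<dots> = (\<Sum>w\<in>words n. g w)" using stationaryD(4)[OF assms] by simp
  finally show ?case using Suc by simp
qed

subsection \<open>The measure of a stationary family\<close>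

definition word_pmf :: "(nat list \<Rightarrow> real) \<Rightarrow> nat \<Rightarrow> nat list pmf" where
  "word_pmf g n = embed_pmf (\<lambda>w. if length w = n then g w else 0)"

lemma pmf_word_pmf:
  assumes "stationary g"
  shows "pmf (word_pmf g n) w = (if length w = n then g w else 0)"
  unfolding word_pmf_def
proof (rule pmf_embed_pmf)
  show "0 \<le> (if length w = n then g w else 0)" for w using stationaryD(2)[OF assms] by simp
  have "(\<integral>\<^sup>+w. ennreal (if length w = n then g w else 0) \<partial>count_space UNIV) = (\<Sum>w\<in>words n. ennreal (if length w = n then g w else 0))"
    using stationaryD(3)[OF assms] by (intro nn_integral_count_space') (auto simp: words_def finite_admissible)
  also have "\<dots> = (\<Sum>w\<in>words n. ennreal (g w))" by (intro sum.cong) (auto simp: words_def)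
  also have "\<dots> = ennreal (\<Sum>w\<in>words n. g w)" using stationaryD(2)[OF assms] by (intro sum_ennreal) auto
  finally show "(\<integral>\<^sup>+w. ennreal (if length w = n then g w else 0) \<partial>count_space UNIV) = 1"
    using stationary_sum_words[OF assms] by simp
qed

lemma set_word_pmf:
  assumes "stationary g" "w \<in> set_pmf (word_pmf g n)"
  shows "length w = n" "w \<in> adm"
  using assms(2) stationaryD(3)[OF assms(1), of w] by (auto simp: set_pmf_eq pmf_word_pmf[OF assms(1)] split: if_splits)

lemma map_butlast_word_pmf:
  assumes g: "stationary g"
  shows "map_pmf butlast (word_pmf g (Suc n)) = word_pmf g n"
proof (rule pmf_eqI)
  fix v
  let ?p = "word_pmf g (Suc n)"
  show "pmf (map_pmf butlast ?p) v = pmf (word_pmf g n) v"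
  proof (cases "length v = n")
    case True
    have eq: "butlast -` {v} \<inter> set_pmf ?p = (\<lambda>a. v @ [a]) ` {..<m} \<inter> set_pmf ?p"
    proof (intro Set.set_eqI iffI)
      fix w assume w: "w \<in> butlast -` {v} \<inter> set_pmf ?p"
      then have "length w = Suc n" "w \<in> adm" "butlast w = v" using set_word_pmf[OF g] by blast+
      moreover from this have "w = v @ [last w]" by (metis append_butlast_last_id list.size(3) nat.distinct(1))
      moreover from calculation have "last w < m"
        unfolding admissible_words_def by (metis (no_types, lifting) in_set_conv_decomp lessThan_iff mem_Collect_eq subsetD)
      ultimately show "w \<in> (\<lambda>a. v @ [a]) ` {..<m} \<inter> set_pmf ?p" using w by blast
    qed auto
    have "pmf (map_pmf butlast ?p) v = measure ?p (butlast -` {v} \<inter> set_pmf ?p)"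
      by (simp add: pmf_map measure_Int_set_pmf)
    also have "\<dots> = measure ?p ((\<lambda>a. v @ [a]) ` {..<m})" unfolding eq by (rule measure_Int_set_pmf)
    also have "\<dots> = (\<Sum>a<m. pmf ?p (v @ [a]))"
      by (subst measure_measure_pmf_finite) (auto simp: sum.reindex inj_on_def)
    also have "\<dots> = g v" using True stationaryD(4)[OF g] by (simp add: pmf_word_pmf[OF g])
    finally show ?thesis using True by (simp add: pmf_word_pmf[OF g])
  next
    case False
    then have "butlast -` {v} \<inter> set_pmf ?p = {}" using set_word_pmf[OF g] by fastforce
    then have "measure ?p (butlast -` {v}) = 0" by (metis measure_Int_set_pmf measure_empty)
    then show ?thesis using False by (simp add: pmf_map pmf_word_pmf[OF g])
  qed
qed

lemma map_take_word_pmf: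
  assumes g: "stationary g"
  shows "map_pmf (take n) (word_pmf g (n + k)) = word_pmf g n"
proof (induction k)
  case 0
  have "map_pmf (take n) (word_pmf g n) = map_pmf (\<lambda>w. w) (word_pmf g n)"
    using set_word_pmf[OF g] by (intro map_pmf_cong refl) auto
  then show ?case by simp
next
  case (Suc k)
  have "map_pmf (take n) (word_pmf g (n + Suc k)) = map_pmf (take n \<circ> butlast) (word_pmf g (Suc (n + k)))"
    using set_word_pmf(1)[OF g] by (intro map_pmf_cong) (auto simp: butlast_conv_take)
  also have "\<dots> = map_pmf (take n) (word_pmf g (n + k))"
    using map_butlast_word_pmf[OF g, of "n + k"] by (simp add: pmf.map_comp[symmetric])
  finally show ?case using Suc by simp
qed

text \<open>The least length for which all positions in \<open>J\<close> occur in a word.\<close>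

definition needed :: "nat set \<Rightarrow> nat" where
  "needed J = (if J = {} then 0 else Suc (Max J))"

definition marginal :: "(nat list \<Rightarrow> real) \<Rightarrow> nat set \<Rightarrow> (nat \<Rightarrow> nat) measure" where
  "marginal g J = distr (measure_pmf (word_pmf g (needed J))) (PiM J (\<lambda>_. borel)) (\<lambda>w. \<lambda>j\<in>J. w ! j)"

lemma less_needed: "finite J \<Longrightarrow> j \<in> J \<Longrightarrow> j < needed J"
  by (auto simp: needed_def less_Suc_eq_le)

lemma needed_mono: "finite H \<Longrightarrow> J \<subseteq> H \<Longrightarrow> needed J \<le> needed H"
  by (auto simp: needed_def intro: Max_mono)

lemma space_PiM_borel: "space (PiM J (\<lambda>_. borel :: nat measure)) = extensional J"
  by (simp add: space_PiM PiE_def)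

lemma marginal_eq:
  assumes g: "stationary g" and J: "finite J" and n: "needed J \<le> n"
  shows "marginal g J = distr (measure_pmf (word_pmf g n)) (PiM J (\<lambda>_. borel)) (\<lambda>w. \<lambda>j\<in>J. w ! j)"
proof -
  have eq: "word_pmf g (needed J) = map_pmf (take (needed J)) (word_pmf g n)"
    using map_take_word_pmf[OF g, of "needed J" "n - needed J"] n by simp
  have "marginal g J = distr (distr (measure_pmf (word_pmf g n)) (count_space UNIV) (take (needed J))) (PiM J (\<lambda>_. borel)) (\<lambda>w. \<lambda>j\<in>J. w ! j)"
    unfolding marginal_def eq map_pmf_rep_eq ..
  also have "\<dots> = distr (measure_pmf (word_pmf g n)) (PiM J (\<lambda>_. borel)) ((\<lambda>w. \<lambda>j\<in>J. w ! j) \<circ> take (needed J))"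
    by (intro distr_distr) (auto simp: space_PiM_borel)
  also have "(\<lambda>w. \<lambda>j\<in>J. w ! j) \<circ> take (needed J) = (\<lambda>w. \<lambda>j\<in>J. w ! j)"
    using less_needed[OF J] by (auto simp: fun_eq_iff restrict_def)
  finally show ?thesis .
qed

text \<open>Deleting the last letter of a random word of length \<open>n + 1\<close> gives a random
  word of length \<open>n\<close>; so the marginals are projections of each other.\<close>

lemma polish_projective_marginal:
  assumes g: "stationary g"
  shows "polish_projective UNIV (marginal g)"
  unfolding polish_projective_def
proof (rule projective_family.intro)
  fix J H :: "nat set" assume JH: "J \<subseteq> H" "finite H"
  then have J: "finite J" by (rule finite_subset)
  have "distr (marginal g H) (PiM J (\<lambda>_. borel)) (\<lambda>f. restrict f J)
    = distr (measure_pmf (word_pmf g (needed H))) (PiM J (\<lambda>_. borel)) ((\<lambda>f. restrict f J) \<circ> (\<lambda>w. \<lambda>j\<in>H. w ! j))"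
    unfolding marginal_def using JH by (intro distr_distr measurable_restrict_subset) (auto simp: space_PiM_borel)
  also have "(\<lambda>f. restrict f J) \<circ> (\<lambda>w. \<lambda>j\<in>H. w ! j) = (\<lambda>w. \<lambda>j\<in>J. (w ! j :: nat))"
    using JH by (auto simp: fun_eq_iff restrict_def)
  also have "distr (measure_pmf (word_pmf g (needed H))) (PiM J (\<lambda>_. borel)) (\<lambda>w. \<lambda>j\<in>J. w ! j) = marginal g J"
    using marginal_eq[OF g J needed_mono[OF JH(2,1)]] by simp
  finally show "marginal g J = distr (marginal g H) (PiM J (\<lambda>_. borel)) (\<lambda>f. restrict f J)" by (rule sym)
next
  fix J :: "nat set"
  show "prob_space (marginal g J)" unfolding marginal_def
    by (intro prob_space.prob_space_distr measure_pmf.prob_space_axioms) (auto simp: space_PiM_borel)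
qed

text \<open>Kolmogorov's extension theorem gives a measure on all sequences. Since the countably
  many inadmissible words have probability zero, it lives on the subshift. Invariance needs to be
  checked on cylinders only, where it is the summation condition for the preceding letter.\<close>

lemma measure_of_stationary:
  assumes g: "stationary g"
  obtains M where "M \<in> invariant_measures A" "\<And>w. word_prob M w = g w"
proof -
  interpret P: polish_projective UNIV "marginal g" by (rule polish_projective_marginal[OF g])
  define L where "L = projective_family.lim UNIV (marginal g) (\<lambda>_. borel :: nat measure)"
  have prob_L: "prob_space L" unfolding L_def by (rule P.P.prob_space_axioms)
  have sets_L: "sets L = sets borel" unfolding L_def by (simp add: sets_PiM_equal_borel)
  have space_L: "space L = UNIV" using sets_eq_imp_space_eq[OF sets_L] by simp
  have pre: "{x. seq_prefix x n = w} \<in> sets L" for n w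
    unfolding sets_L using open_seq_prefix[of "\<lambda>v. v = w"] by (rule borel_open)
  have eL: "emeasure L {x. seq_prefix x (length w) = w} = ennreal (g w)" for w
  proof -
    define n where "n = length w"
    define S where "S = {f \<in> extensional {..<n}. \<forall>i\<in>{..<n}. f i = w ! i}"
    have S': "S = Pi\<^sub>E {..<n} (\<lambda>i. {w ! i})"
      by (auto simp: S_def PiE_def extensional_def Pi_def)
    have S: "S \<in> sets (PiM {..<n} (\<lambda>_. borel :: nat measure))"
      unfolding S' by (intro sets_PiM_I_finite) auto
    have "prod_emb UNIV (\<lambda>_. borel :: nat measure) {..<n} S = {x. seq_prefix x n = w}"
      unfolding S' by (subst prod_emb_PiE) (auto simp: n_def seq_prefix_eq_list PiE_def Pi_def)
    then have "emeasure L {x. seq_prefix x n = w} = emeasure (marginal g {..<n}) S"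
      unfolding L_def using P.emeasure_lim_emb[of "{..<n}" S] S by simp
    also have "needed {..<n} = n"
    proof (cases n)
      case (Suc k)
      have "Max {..<Suc k} = k" by (intro Max_eqI) auto
      moreover have "{..<Suc k} \<noteq> {}" by auto
      ultimately show ?thesis using Suc by (simp add: needed_def)
    qed (simp add: needed_def)
    then have "emeasure (marginal g {..<n}) S = emeasure (measure_pmf (word_pmf g n)) ((\<lambda>w. \<lambda>j\<in>{..<n}. w ! j) -` S)"
      unfolding marginal_def using S by (subst emeasure_distr) (auto simp: space_PiM_borel)
    also have "\<dots> = emeasure (measure_pmf (word_pmf g n)) ((\<lambda>w. \<lambda>j\<in>{..<n}. w ! j) -` S \<inter> set_pmf (word_pmf g n))"
      by (rule emeasure_Int_set_pmf[symmetric])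
    also have "(\<lambda>w. \<lambda>j\<in>{..<n}. w ! j) -` S \<inter> set_pmf (word_pmf g n) = {w} \<inter> set_pmf (word_pmf g n)"
      using set_word_pmf(1)[OF g, of _ n] by (auto simp: S_def n_def intro!: nth_equalityI)
    also have "emeasure (measure_pmf (word_pmf g n)) \<dots> = emeasure (measure_pmf (word_pmf g n)) {w}"
      by (rule emeasure_Int_set_pmf)
    also have "\<dots> = ennreal (g w)" by (simp add: emeasure_pmf_single pmf_word_pmf[OF g] n_def)
    finally show ?thesis by (simp add: n_def)
  qed
  interpret L: prob_space L by (rule prob_L)
  have X_L: "X \<in> sets L" using X_borel sets_L by simp
  \<comment> \<open>A sequence outside the subshift has an inadmissible prefix.\<close>
  have "emeasure L (UNIV - X) = 0"
  proof -
    have "UNIV - X = (\<Union>w\<in>- adm. {x. seq_prefix x (length w) = w})"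
    proof (intro Set.set_eqI iffI)
      fix x assume "x \<in> UNIV - X"
      then have "x \<notin> X" by simp
      then obtain n where "seq_prefix x n \<notin> adm" unfolding subshift_iff by blast
      then show "x \<in> (\<Union>w\<in>- adm. {x. seq_prefix x (length w) = w})" by (intro UN_I[of "seq_prefix x n"]) auto
    next
      fix x assume "x \<in> (\<Union>w\<in>- adm. {x. seq_prefix x (length w) = w})"
      then obtain w where "w \<in> - adm" "x \<in> {x. seq_prefix x (length w) = w}" by blast
      then have "seq_prefix x (length w) \<notin> adm" by simp
      then show "x \<in> UNIV - X" using subshift_iff[of x A] by blast
    qed
    moreover have "emeasure L (\<Union>w\<in>- adm. {x. seq_prefix x (length w) = w}) = 0"
    proof -
      have "(\<Union>w\<in>- adm. {x. seq_prefix x (length w) = w}) \<in> null_sets L"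
      proof (rule null_sets_UN')
        fix w assume "w \<in> - adm"
        then show "{x. seq_prefix x (length w) = w} \<in> null_sets L"
          using eL stationaryD(3)[OF g] pre by (intro null_setsI) simp_all
      qed simp
      then show ?thesis by (rule null_setsD1)
    qed
    ultimately show ?thesis by simp
  qed
  then have null: "measure L (UNIV - X) = 0" by (simp add: measure_def)
  have "measure L (space L - X) = 1 - measure L X" by (rule L.prob_compl[OF X_L])
  then have "measure L X = 1" using null space_L by simp
  then have L_X: "emeasure L X = 1" by (simp add: L.emeasure_eq_measure)
  define M where "M = restrict_space L X"
  have sets_M: "sets M = sets (restrict_space borel X)" unfolding M_def using sets_L by (simp add: sets_restrict_space)
  have prob_M: "prob_space M" unfolding M_def using L_X X_L space_L by (intro prob_space_restrict_space) auto
  have space_M: "space M = X" by (rule space_inv[OF sets_M])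
  interpret M: prob_space M by (rule prob_M)
  have eM: "emeasure M (cylinder A w) = ennreal (g w)" for w
  proof -
    have c: "cylinder A w = {x. seq_prefix x (length w) = w} \<inter> X" by (auto simp: cylinder_def)
    have "emeasure M (cylinder A w) = emeasure L (cylinder A w)" unfolding M_def
      using X_L space_L cylinder_subset by (intro emeasure_restrict_space) auto
    also have "\<dots> = emeasure L {x. seq_prefix x (length w) = w}" unfolding c
    proof (rule emeasure_eq_AE)
      show "AE x in L. (x \<in> {x. seq_prefix x (length w) = w} \<inter> X) = (x \<in> {x. seq_prefix x (length w) = w})"
        by (rule AE_I[of _ _ "UNIV - X"]) (use \<open>emeasure L (UNIV - X) = 0\<close> sets.compl_sets[OF X_L] space_L in auto)
    qed (use pre X_L in auto)
    finally show ?thesis using eL by simp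
  qed
  have shift_meas: "shift \<in> measurable M M"
  proof -
    have "continuous_on X shift"
    proof (rule continuous_on_coordinatewise_then_product)
      fix i
      show "continuous_on X (\<lambda>x. shift x i)" unfolding shift_def
        by (rule continuous_on_subset[OF continuous_on_product_coordinates]) simp
    qed
    then have "shift \<in> borel_measurable (restrict_space borel X)"
      by (rule borel_measurable_continuous_on_restrict)
    then have "shift \<in> measurable (restrict_space borel X) (restrict_space borel X)"
      by (intro measurable_restrict_space2) (auto simp: space_restrict_space)
    then show ?thesis using sets_M measurable_cong_sets by blast
  qed
  have "M = distr M M shift"
  proof (rule measure_eq_on_cylinders)
    show "finite_measure M" by (rule M.finite_measure_axioms)
    fix w
    have S: "shift -` cylinder A w \<inter> space M = (\<Union>a<m. cylinder A (a # w))"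
      unfolding space_M by (auto simp: cylinder_def seq_prefix_Suc_Cons subshift_def shift_def)
    have "emeasure (distr M M shift) (cylinder A w) = emeasure M (\<Union>a<m. cylinder A (a # w))"
      using emeasure_distr[OF shift_meas cylinder_measurable[OF sets_M]] S by simp
    also have "\<dots> = (\<Sum>a<m. emeasure M (cylinder A (a # w)))"
      using cylinder_measurable[OF sets_M] by (intro sum_emeasure[symmetric]) (auto simp: disjoint_family_on_def in_cylinder_iff seq_prefix_Suc_Cons)
    also have "\<dots> = ennreal (\<Sum>a<m. g (a # w))" using stationaryD(2)[OF g] by (simp add: eM sum_ennreal)
    also have "\<dots> = emeasure M (cylinder A w)" using stationaryD(5)[OF g] eM by simp
    finally show "emeasure M (cylinder A w) = emeasure (distr M M shift) (cylinder A w)" by simp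
  qed (simp_all add: sets_M)
  then have "M \<in> invariant_measures A"
    using prob_M sets_M shift_meas by (simp add: invariant_measures_def)
  moreover have "word_prob M w = g w" for w
    using eM[of w] stationaryD(2)[OF g, of w] by (simp add: word_prob_def measure_def)
  ultimately show ?thesis using that by blast
qed

end

section \<open>Shannon entropy of simple functions\<close>

definition eta :: "real \<Rightarrow> real" where
  "eta p = - (p * ln p)"

lemma eta_0 [simp]: "eta 0 = 0" and eta_1 [simp]: "eta 1 = 0"
  by (simp_all add: eta_def)

lemma eta_nonneg: "0 \<le> p \<Longrightarrow> p \<le> 1 \<Longrightarrow> eta p \<ge> 0"
  by (cases "p = 0") (auto simp: eta_def mult_nonneg_nonpos)

text \<open>The concave function \<open>eta\<close> lies below its tangent at \<open>a\<close>,
  which amounts to \<open>ln (a / p) \<le> a / p - 1\<close>. All convexity arguments for entropy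
  below rest on this inequality or a variant of it.\<close>

lemma eta_le_tangent:
  assumes "p \<ge> 0" "a > 0"
  shows "eta p \<le> - (p * ln a) + (a - p)"
proof (cases "p = 0")
  case False
  then have p: "p > 0" using assms by simp
  have "ln (a / p) \<le> a / p - 1" using assms p by (intro ln_le_minus_one) simp
  then have "p * (ln a - ln p) \<le> p * (a / p - 1)" using assms p by (simp add: ln_div)
  then show ?thesis using p by (simp add: eta_def algebra_simps)
qed (use assms in simp)

lemma eta_concave:
  assumes "p \<ge> 0" "q \<ge> 0" "0 \<le> s" "s \<le> 1"
  shows "s * eta p + (1 - s) * eta q \<le> eta (s * p + (1 - s) * q)"
proof -
  define a where "a = s * p + (1 - s) * q"
  have nn: "s * p \<ge> 0" "(1 - s) * q \<ge> 0" using assms by auto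
  show ?thesis
  proof (cases "a = 0")
    case True
    then have "s * p = 0" "(1 - s) * q = 0" using nn by (simp_all add: a_def add_nonneg_eq_0_iff)
    then have z: "s * eta p = 0" "(1 - s) * eta q = 0" by auto
    show ?thesis unfolding z a_def[symmetric] True by simp
  next
    case False
    then have a: "a > 0" using nn by (simp add: a_def)
    have "s * eta p + (1 - s) * eta q \<le> s * (- (p * ln a) + (a - p)) + (1 - s) * (- (q * ln a) + (a - q))"
      using assms a by (intro add_mono mult_left_mono eta_le_tangent) auto
    also have "\<dots> = - ((s * p + (1 - s) * q) * ln a) + (a - (s * p + (1 - s) * q))" by (simp add: algebra_simps)
    also have "\<dots> = eta a" by (simp add: a_def[symmetric] eta_def)
    finally show ?thesis by (simp add: a_def)
  qed
qed

text \<open>The inequality \<open>ln t \<le> t - 1\<close> for \<open>t = a b / (q s)\<close>,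
  multiplied by \<open>q\<close>. When \<open>a\<close> and \<open>b\<close> are the marginals of
  \<open>q\<close> and \<open>s\<close> is the total mass, the left-hand sides add up to
  zero.\<close>

lemma gibbs_term:
  fixes q a b s :: real
  assumes "0 \<le> q" "q \<le> a" "q \<le> b" "a \<le> s"
  shows "q - a * b / s \<le> q * ln q + q * ln s - q * ln a - q * ln b"
proof (cases "q = 0")
  case True
  then show ?thesis using assms by simp
next
  case False
  then have pos: "q > 0" "a > 0" "b > 0" "s > 0" using assms by auto
  have "ln (a * b / (q * s)) \<le> a * b / (q * s) - 1" using pos by (intro ln_le_minus_one) simp
  moreover have "ln (a * b / (q * s)) = ln a + ln b - ln q - ln s" using pos by (simp add: ln_div ln_mult)
  ultimately have "q * (ln a + ln b - ln q - ln s) \<le> q * (a * b / (q * s) - 1)" using pos by simp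
  also have "\<dots> = a * b / s - q" using pos by (simp add: field_simps)
  finally show ?thesis by (simp add: algebra_simps)
qed

text \<open>Mutual information is nonnegative. The weights \<open>q\<close> need not sum up to 1, so
  that this can be used for the restriction of a distribution to the event that a third variable has
  a certain value.\<close>

lemma mutual_information_nonneg:
  fixes q :: "'x \<Rightarrow> 'y \<Rightarrow> real"
  assumes fin: "finite U" "finite V" and q: "\<And>x y. x \<in> U \<Longrightarrow> y \<in> V \<Longrightarrow> 0 \<le> q x y"
  shows "(\<Sum>x\<in>U. \<Sum>y\<in>V. eta (q x y)) + eta (\<Sum>x\<in>U. \<Sum>y\<in>V. q x y)
    \<le> (\<Sum>x\<in>U. eta (\<Sum>y\<in>V. q x y)) + (\<Sum>y\<in>V. eta (\<Sum>x\<in>U. q x y))"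
proof -
  define a where "a x = (\<Sum>y\<in>V. q x y)" for x
  define b where "b y = (\<Sum>x\<in>U. q x y)" for y
  define s where "s = (\<Sum>x\<in>U. a x)"
  have sb: "s = (\<Sum>y\<in>V. b y)" unfolding s_def a_def b_def by (rule sum.swap)
  have a0: "a x \<ge> 0" if "x \<in> U" for x unfolding a_def using q that by (intro sum_nonneg) auto
  have "(\<Sum>x\<in>U. \<Sum>y\<in>V. q x y - a x * b y / s) \<le> (\<Sum>x\<in>U. \<Sum>y\<in>V. q x y * ln (q x y) + q x y * ln s - q x y * ln (a x) - q x y * ln (b y))"
  proof (intro sum_mono gibbs_term)
    fix x y assume xy: "x \<in> U" "y \<in> V"
    show "0 \<le> q x y" using q xy by simp
    show "q x y \<le> a x" unfolding a_def using q xy fin by (intro member_le_sum) auto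
    show "q x y \<le> b y" unfolding b_def using q xy fin by (intro member_le_sum) auto
    show "a x \<le> s" unfolding s_def using a0 xy fin by (intro member_le_sum) auto
  qed
  moreover have "(\<Sum>x\<in>U. \<Sum>y\<in>V. q x y - a x * b y / s) = 0"
  proof -
    have "(\<Sum>x\<in>U. \<Sum>y\<in>V. a x * b y / s) = (\<Sum>x\<in>U. a x) * (\<Sum>y\<in>V. b y) / s"
      by (simp add: sum_product sum_divide_distrib)
    then have "(\<Sum>x\<in>U. \<Sum>y\<in>V. a x * b y / s) = s * s / s"
      unfolding s_def[symmetric] sb[symmetric] .
    moreover have "(\<Sum>x\<in>U. \<Sum>y\<in>V. q x y) = s" by (simp add: s_def a_def)
    ultimately show ?thesis by (simp add: sum_subtractf)
  qed
  moreover have "(\<Sum>x\<in>U. \<Sum>y\<in>V. q x y * ln s) = s * ln s"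
    by (simp add: s_def a_def sum_distrib_right)
  moreover have "(\<Sum>x\<in>U. \<Sum>y\<in>V. q x y * ln (a x)) = (\<Sum>x\<in>U. a x * ln (a x))"
    by (simp add: a_def sum_distrib_right)
  moreover have "(\<Sum>x\<in>U. \<Sum>y\<in>V. q x y * ln (b y)) = (\<Sum>y\<in>V. b y * ln (b y))"
    by (subst sum.swap) (simp add: b_def sum_distrib_right)
  ultimately have "0 \<le> (\<Sum>x\<in>U. \<Sum>y\<in>V. q x y * ln (q x y)) + s * ln s - (\<Sum>x\<in>U. a x * ln (a x)) - (\<Sum>y\<in>V. b y * ln (b y))"
    by (simp add: sum.distrib sum_subtractf)
  then show ?thesis
    by (simp add: eta_def sum_negf a_def[symmetric] b_def[symmetric] s_def[symmetric])
qed

lemma eta_sum_le: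
  assumes fin: "finite V" and p: "\<And>y. y \<in> V \<Longrightarrow> 0 \<le> p y"
  shows "eta (\<Sum>y\<in>V. p y) \<le> (\<Sum>y\<in>V. eta (p y))"
proof -
  have "(\<Sum>y\<in>V. p y * ln (p y)) \<le> (\<Sum>y\<in>V. p y * ln (\<Sum>y\<in>V. p y))"
  proof (rule sum_mono)
    fix y assume y: "y \<in> V"
    show "p y * ln (p y) \<le> p y * ln (\<Sum>y\<in>V. p y)"
    proof (cases "p y = 0")
      case False
      then have "0 < p y" "p y \<le> (\<Sum>y\<in>V. p y)" using p y fin by (auto intro: member_le_sum simp: less_le)
      then show ?thesis by (intro mult_left_mono) auto
    qed simp
  qed
  then show ?thesis by (simp add: eta_def sum_negf sum_distrib_right)
qed

lemma eta_uniform_le: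
  assumes fin: "finite V" "V \<noteq> {}" and p: "\<And>y. y \<in> V \<Longrightarrow> 0 \<le> p y" and sum: "(\<Sum>y\<in>V. p y) = 1"
  shows "(\<Sum>y\<in>V. eta (p y)) \<le> ln (real (card V))"
proof -
  define k where "k = real (card V)"
  have k: "k > 0" using fin by (simp add: k_def card_gt_0_iff)
  have "eta (p y) - p y * ln k \<le> 1 / k - p y" if y: "y \<in> V" for y
    using eta_le_tangent[OF p[OF y], of "1 / k"] k by (simp add: ln_div)
  then have "(\<Sum>y\<in>V. eta (p y) - p y * ln k) \<le> (\<Sum>y\<in>V. 1 / k - p y)" by (rule sum_mono)
  also have "\<dots> = 0" using k sum by (simp add: sum_subtractf k_def)
  finally show ?thesis using sum by (simp add: sum_subtractf sum_distrib_right[symmetric] k_def)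
qed

context prob_space
begin

definition law :: "('a \<Rightarrow> 'b) \<Rightarrow> 'b \<Rightarrow> real" where
  "law Y v = prob (Y -` {v} \<inter> space M)"

text \<open>Random variables are used in place of partitions since joins are then simply
  pairs.\<close>

definition shannon :: "('a \<Rightarrow> 'b) \<Rightarrow> real" where
  "shannon Y = (\<Sum>v\<in>Y ` space M. eta (law Y v))"

lemma law_nonneg: "law Y v \<ge> 0" by (simp add: law_def)
lemma law_le_1: "law Y v \<le> 1" by (simp add: law_def)

lemma law_zero: "v \<notin> Y ` space M \<Longrightarrow> law Y v = 0"
proof -
  assume "v \<notin> Y ` space M"
  then have "Y -` {v} \<inter> space M = {}" by auto
  then show ?thesis by (simp add: law_def)
qed

lemma shannon_superset:
  assumes "finite S" "Y ` space M \<subseteq> S"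
  shows "shannon Y = (\<Sum>v\<in>S. eta (law Y v))"
  unfolding shannon_def using assms by (intro sum.mono_neutral_left) (auto simp: law_zero)

lemma simple_function_PairI:
  "simple_function M Y \<Longrightarrow> simple_function M Z \<Longrightarrow> simple_function M (\<lambda>\<omega>. (Y \<omega>, Z \<omega>))"
  by (rule simple_function_Pair)

lemma simple_fibre: "simple_function M Y \<Longrightarrow> Y -` {v} \<inter> space M \<in> events"
  using simple_functionD(2)[of M Y "{v}"] by simp

lemma law_marginal:
  assumes Y: "simple_function M Y" and Z: "simple_function M Z"
  shows "law Z z = (\<Sum>y\<in>Y ` space M. law (\<lambda>\<omega>. (Y \<omega>, Z \<omega>)) (y, z))"
proof -
  have "Z -` {z} \<inter> space M = (\<Union>y\<in>Y ` space M. (\<lambda>\<omega>. (Y \<omega>, Z \<omega>)) -` {(y, z)} \<inter> space M)" by auto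
  then have "law Z z = prob (\<Union>y\<in>Y ` space M. (\<lambda>\<omega>. (Y \<omega>, Z \<omega>)) -` {(y, z)} \<inter> space M)" by (simp add: law_def)
  also have "\<dots> = (\<Sum>y\<in>Y ` space M. law (\<lambda>\<omega>. (Y \<omega>, Z \<omega>)) (y, z))" unfolding law_def
  proof (rule finite_measure_finite_Union)
    show "finite (Y ` space M)" using Y by (rule simple_functionD)
    show "(\<lambda>y. (\<lambda>\<omega>. (Y \<omega>, Z \<omega>)) -` {(y, z)} \<inter> space M) ` Y ` space M \<subseteq> events"
      using simple_fibre[OF simple_function_PairI[OF Y Z]] by auto
    show "disjoint_family_on (\<lambda>y. (\<lambda>\<omega>. (Y \<omega>, Z \<omega>)) -` {(y, z)} \<inter> space M) (Y ` space M)"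
      by (auto simp: disjoint_family_on_def)
  qed
  finally show ?thesis .
qed

definition fibres :: "('a \<Rightarrow> 'b) \<Rightarrow> 'a set set" where
  "fibres Y = (\<lambda>v. Y -` {v} \<inter> space M) ` Y ` space M"

lemma shannon_fibres: "shannon Y = (\<Sum>B\<in>fibres Y. eta (prob B))"
proof -
  have "inj_on (\<lambda>v. Y -` {v} \<inter> space M) (Y ` space M)" by (auto simp: inj_on_def)
  then show ?thesis unfolding fibres_def shannon_def law_def by (simp add: sum.reindex)
qed

lemma shannon_cong_fibres:
  assumes "\<And>\<omega> \<omega>'. \<omega> \<in> space M \<Longrightarrow> \<omega>' \<in> space M \<Longrightarrow> Y \<omega> = Y \<omega>' \<longleftrightarrow> Z \<omega> = Z \<omega>'"
  shows "shannon Y = shannon Z"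
proof -
  have "Y -` {Y \<omega>} \<inter> space M = Z -` {Z \<omega>} \<inter> space M" if "\<omega> \<in> space M" for \<omega>
    using assms[OF _ that] by auto
  then have "fibres Y = fibres Z" unfolding fibres_def image_image by (intro image_cong) auto
  then show ?thesis by (simp add: shannon_fibres)
qed

lemma shannon_pair_sum:
  assumes Y: "simple_function M Y" and Z: "simple_function M Z"
  shows "shannon (\<lambda>\<omega>. (Y \<omega>, Z \<omega>)) = (\<Sum>y\<in>Y ` space M. \<Sum>z\<in>Z ` space M. eta (law (\<lambda>\<omega>. (Y \<omega>, Z \<omega>)) (y, z)))"
proof -
  have "shannon (\<lambda>\<omega>. (Y \<omega>, Z \<omega>)) = (\<Sum>v\<in>Y ` space M \<times> Z ` space M. eta (law (\<lambda>\<omega>. (Y \<omega>, Z \<omega>)) v))"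
    using simple_functionD(1)[OF Y] simple_functionD(1)[OF Z] by (intro shannon_superset) auto
  then show ?thesis by (simp add: sum.cartesian_product case_prod_unfold)
qed

text \<open>The law of a pair refines the law of a component, and splitting a probability increases
  \<open>eta\<close>.\<close>

lemma shannon_mono_pair:
  assumes Y: "simple_function M Y" and Z: "simple_function M Z"
  shows "shannon Z \<le> shannon (\<lambda>\<omega>. (Y \<omega>, Z \<omega>))"
proof -
  have "shannon Z = (\<Sum>z\<in>Z ` space M. eta (\<Sum>y\<in>Y ` space M. law (\<lambda>\<omega>. (Y \<omega>, Z \<omega>)) (y, z)))"
    unfolding shannon_def by (intro sum.cong refl arg_cong[of _ _ eta] law_marginal Y Z)
  also have "\<dots> \<le> (\<Sum>z\<in>Z ` space M. \<Sum>y\<in>Y ` space M. eta (law (\<lambda>\<omega>. (Y \<omega>, Z \<omega>)) (y, z)))"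
    by (intro sum_mono eta_sum_le simple_functionD(1)[OF Y] law_nonneg)
  also have "\<dots> = shannon (\<lambda>\<omega>. (Y \<omega>, Z \<omega>))"
    unfolding shannon_pair_sum[OF Y Z] by (rule sum.swap)
  finally show ?thesis .
qed

text \<open>For each value of \<open>Z\<close>, the mutual information of \<open>W\<close> and
  \<open>Y\<close> on the event that \<open>Z\<close> has this value is nonnegative.\<close>

lemma strong_subadditivity:
  assumes W: "simple_function M W" and Y: "simple_function M Y" and Z: "simple_function M Z"
  shows "shannon (\<lambda>\<omega>. (W \<omega>, Y \<omega>, Z \<omega>)) + shannon Z \<le> shannon (\<lambda>\<omega>. (W \<omega>, Z \<omega>)) + shannon (\<lambda>\<omega>. (Y \<omega>, Z \<omega>))"
proof -
  define p where "p z w y = law (\<lambda>\<omega>. (W \<omega>, Y \<omega>, Z \<omega>)) (w, y, z)" for z w y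
  let ?W = "W ` space M" and ?Y = "Y ` space M" and ?Z = "Z ` space M"
  note fin = simple_functionD(1)[OF W] simple_functionD(1)[OF Y] simple_functionD(1)[OF Z]
  note YZ = simple_function_PairI[OF Y Z] and WZ = simple_function_PairI[OF W Z]
  have 1: "law (\<lambda>\<omega>. (Y \<omega>, Z \<omega>)) (y, z) = (\<Sum>w\<in>?W. p z w y)" for y z
    unfolding p_def by (rule law_marginal[OF W YZ])
  have 2: "law (\<lambda>\<omega>. (W \<omega>, Z \<omega>)) (w, z) = (\<Sum>y\<in>?Y. p z w y)" for w z
  proof -
    have "law (\<lambda>\<omega>. (Y \<omega>, W \<omega>, Z \<omega>)) (y, w, z) = p z w y" for y
      unfolding p_def law_def by (rule arg_cong[of _ _ prob]) auto
    then show ?thesis using law_marginal[OF Y WZ, of "(w, z)"] by simp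
  qed
  have 3: "law Z z = (\<Sum>w\<in>?W. \<Sum>y\<in>?Y. p z w y)" for z
    using law_marginal[OF W Z, of z] by (simp add: 2)
  have e0: "shannon (\<lambda>\<omega>. (W \<omega>, Y \<omega>, Z \<omega>)) = (\<Sum>z\<in>?Z. \<Sum>w\<in>?W. \<Sum>y\<in>?Y. eta (p z w y))"
  proof -
    have "shannon (\<lambda>\<omega>. (W \<omega>, Y \<omega>, Z \<omega>)) = (\<Sum>v\<in>?W \<times> ?Y \<times> ?Z. eta (law (\<lambda>\<omega>. (W \<omega>, Y \<omega>, Z \<omega>)) v))"
      using fin by (intro shannon_superset) auto
    also have "\<dots> = (\<Sum>w\<in>?W. \<Sum>y\<in>?Y. \<Sum>z\<in>?Z. eta (p z w y))"
      by (simp add: sum.cartesian_product case_prod_unfold p_def)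
    also have "\<dots> = (\<Sum>w\<in>?W. \<Sum>z\<in>?Z. \<Sum>y\<in>?Y. eta (p z w y))" by (intro sum.cong refl sum.swap)
    also have "\<dots> = (\<Sum>z\<in>?Z. \<Sum>w\<in>?W. \<Sum>y\<in>?Y. eta (p z w y))" by (rule sum.swap)
    finally show ?thesis .
  qed
  have e1: "shannon (\<lambda>\<omega>. (W \<omega>, Z \<omega>)) = (\<Sum>z\<in>?Z. \<Sum>w\<in>?W. eta (\<Sum>y\<in>?Y. p z w y))"
    unfolding shannon_pair_sum[OF W Z] 2 by (rule sum.swap)
  have e2: "shannon (\<lambda>\<omega>. (Y \<omega>, Z \<omega>)) = (\<Sum>z\<in>?Z. \<Sum>y\<in>?Y. eta (\<Sum>w\<in>?W. p z w y))"
    unfolding shannon_pair_sum[OF Y Z] 1 by (rule sum.swap)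
  have e3: "shannon Z = (\<Sum>z\<in>?Z. eta (\<Sum>w\<in>?W. \<Sum>y\<in>?Y. p z w y))"
    unfolding shannon_def 3 ..
  show ?thesis unfolding e0 e1 e2 e3 sum.distrib[symmetric]
    by (intro sum_mono mutual_information_nonneg fin) (simp add: p_def law_nonneg)
qed

lemma shannon_const: "shannon (\<lambda>_. c) = 0"
proof -
  have "space M \<noteq> {}" by (rule not_empty)
  then show ?thesis by (simp add: shannon_def law_def prob_space image_constant_conv)
qed

lemma shannon_pair_le:
  assumes Y: "simple_function M Y" and Z: "simple_function M Z"
  shows "shannon (\<lambda>\<omega>. (Y \<omega>, Z \<omega>)) \<le> shannon Y + shannon Z"
proof -
  have "shannon (\<lambda>\<omega>. (Y \<omega>, Z \<omega>, ())) + shannon (\<lambda>_. ()) \<le> shannon (\<lambda>\<omega>. (Y \<omega>, ())) + shannon (\<lambda>\<omega>. (Z \<omega>, ()))"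
    by (intro strong_subadditivity Y Z simple_function_const)
  moreover have "shannon (\<lambda>\<omega>. (Y \<omega>, Z \<omega>, ())) = shannon (\<lambda>\<omega>. (Y \<omega>, Z \<omega>))"
    "shannon (\<lambda>\<omega>. (Y \<omega>, ())) = shannon Y" "shannon (\<lambda>\<omega>. (Z \<omega>, ())) = shannon Z"
    by (rule shannon_cong_fibres; simp)+
  ultimately show ?thesis by (simp add: shannon_const)
qed

lemma shannon_nonneg: "shannon Y \<ge> 0"
  unfolding shannon_def by (intro sum_nonneg eta_nonneg law_nonneg law_le_1)

lemma sum_law:
  assumes Y: "simple_function M Y"
  shows "(\<Sum>v\<in>Y ` space M. law Y v) = 1"
proof -
  have "law (\<lambda>_. ()) () = (\<Sum>v\<in>Y ` space M. law (\<lambda>\<omega>. (Y \<omega>, ())) (v, ()))"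
    by (intro law_marginal Y simple_function_const)
  moreover have "law (\<lambda>\<omega>. (Y \<omega>, ())) (v, ()) = law Y v" for v
    unfolding law_def by (rule arg_cong[of _ _ prob]) auto
  ultimately show ?thesis by (simp add: law_def prob_space)
qed

lemma shannon_le_ln_card:
  assumes "finite S" "Y ` space M \<subseteq> S" and Y: "simple_function M Y"
  shows "shannon Y \<le> ln (real (card S))"
proof -
  have "shannon Y \<le> ln (real (card (Y ` space M)))" unfolding shannon_def
    using simple_functionD(1)[OF Y] not_empty sum_law[OF Y] by (intro eta_uniform_le law_nonneg) auto
  also have "\<dots> \<le> ln (real (card S))"
  proof -
    have "card (Y ` space M) \<le> card S" using assms by (intro card_mono)
    moreover have "card (Y ` space M) > 0" using simple_functionD(1)[OF Y] not_empty by (simp add: card_gt_0_iff)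
    ultimately show ?thesis by (subst ln_le_cancel_iff) auto
  qed
  finally show ?thesis .
qed

lemma shannon_measure_preserving:
  assumes Y: "simple_function M Y" and T: "T \<in> measurable M M" "distr M M T = M"
  shows "shannon (\<lambda>\<omega>. Y (T \<omega>)) = shannon Y" "simple_function M (\<lambda>\<omega>. Y (T \<omega>))"
proof -
  have sub: "(\<lambda>\<omega>. Y (T \<omega>)) ` space M \<subseteq> Y ` space M" using measurable_space[OF T(1)] by auto
  have pre: "(\<lambda>\<omega>. Y (T \<omega>)) -` S \<inter> space M = T -` (Y -` S \<inter> space M) \<inter> space M" for S
    using measurable_space[OF T(1)] by auto
  have "law (\<lambda>\<omega>. Y (T \<omega>)) v = law Y v" for v
  proof -
    have "law Y v = measure (distr M M T) (Y -` {v} \<inter> space M)" using T(2) by (simp add: law_def)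
    also have "\<dots> = prob (T -` (Y -` {v} \<inter> space M) \<inter> space M)" by (intro measure_distr T simple_fibre Y)
    finally show ?thesis unfolding law_def pre by simp
  qed
  then have "shannon (\<lambda>\<omega>. Y (T \<omega>)) = (\<Sum>v\<in>Y ` space M. eta (law Y v))"
    using shannon_superset[OF simple_functionD(1)[OF Y] sub] by simp
  then show "shannon (\<lambda>\<omega>. Y (T \<omega>)) = shannon Y" by (simp add: shannon_def)
  show "simple_function M (\<lambda>\<omega>. Y (T \<omega>))" unfolding simple_function_def
  proof (intro conjI ballI)
    show "finite ((\<lambda>\<omega>. Y (T \<omega>)) ` space M)" using sub simple_functionD(1)[OF Y] by (rule finite_subset)
    show "(\<lambda>\<omega>. Y (T \<omega>)) -` {x} \<inter> space M \<in> events" for x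
      unfolding pre using T(1) simple_fibre[OF Y] by (rule measurable_sets)
  qed
qed

end

text \<open>Fekete's lemma: with \<open>n = q k + r\<close> and \<open>r < k\<close>, subadditivity
  bounds \<open>a n\<close> by \<open>q (a k)\<close> plus a constant, so that the limit is the
  infimum of the quotients.\<close>

lemma fekete:
  fixes a :: "nat \<Rightarrow> real"
  assumes nn: "\<And>n. a n \<ge> 0" and sub: "\<And>n k. a (n + k) \<le> a n + a k"
  obtains L where "(\<lambda>n. a n / real n) \<longlonglongrightarrow> L" "\<And>k. k \<ge> 1 \<Longrightarrow> L \<le> a k / real k" "L \<ge> 0"
proof -
  define L where "L = (INF k\<in>{1..}. a k / real k)"
  have bdd: "bdd_below ((\<lambda>k. a k / real k) ` {1..})" using nn by (intro bdd_belowI[of _ 0]) auto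
  have L_le: "L \<le> a k / real k" if "k \<ge> 1" for k
    unfolding L_def using that by (intro cINF_lower bdd) auto
  have L0: "L \<ge> 0" unfolding L_def using nn by (intro cINF_greatest) auto
  have mult: "a (q * k) \<le> real q * a k + a 0" for q k
  proof (induction q)
    case (Suc q)
    have "a (Suc q * k) \<le> a k + a (q * k)" using sub[of k "q * k"] by simp
    then show ?case using Suc by (simp add: algebra_simps)
  qed simp
  have "(\<lambda>n. a n / real n) \<longlonglongrightarrow> L"
  proof (rule LIMSEQ_I)
    fix e :: real assume e: "e > 0"
    have "\<exists>k\<in>{1..}. a k / real k < L + e / 2"
      using e cINF_less_iff[OF _ bdd, of "L + e / 2"] unfolding L_def by auto
    then obtain k where k: "k \<ge> 1" "a k / real k < L + e / 2" by auto
    define B where "B = a 0 + (\<Sum>r<k. a r)"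
    have B0: "B \<ge> 0" unfolding B_def using nn by (intro add_nonneg_nonneg sum_nonneg) auto
    have up: "a n / real n \<le> a k / real k + B / real n" if n: "n \<ge> 1" for n
    proof -
      have "a n \<le> a (n div k * k) + a (n mod k)" using sub[of "n div k * k" "n mod k"] by simp
      also have "a (n mod k) \<le> (\<Sum>r<k. a r)" using k nn by (intro member_le_sum) auto
      finally have "a n \<le> real (n div k) * a k + B" using mult[of "n div k" k] by (simp add: B_def)
      also have "real (n div k) * a k = real (n div k * k) * (a k / real k)" using k by simp
      also have "\<dots> \<le> real n * (a k / real k)"
        using nn[of k] by (intro mult_right_mono) (auto simp del: of_nat_mult)
      finally have "a n / real n \<le> (real n * (a k / real k) + B) / real n" by (simp add: divide_right_mono)
      then show ?thesis using n by (simp add: add_divide_distrib)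
    qed
    obtain N :: nat where N: "2 * B / e < real N" using reals_Archimedean2 by blast
    show "\<exists>N. \<forall>n\<ge>N. norm (a n / real n - L) < e"
    proof (intro exI[of _ "Suc N"] allI impI)
      fix n assume n: "n \<ge> Suc N"
      then have "2 * B / e < real n" using N by linarith
      then have "B / real n < e / 2" using e n by (simp add: field_simps)
      then have "a n / real n < L + e" using up[of n] n k(2) by linarith
      moreover have "L \<le> a n / real n" using L_le n by simp
      ultimately show "norm (a n / real n - L) < e" by simp
    qed
  qed
  then show ?thesis using that L_le L0 by blast
qed

section \<open>Entropy of the shift\<close>

locale measure_preserving = prob_space +
  fixes T
  assumes T: "T \<in> measurable M M" and distr_T: "distr M M T = M"
begin

lemma T_pow: "(T ^^ i) \<in> measurable M M" "distr M M (T ^^ i) = M"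
proof (induction i)
  case 0
  show "(T ^^ 0) \<in> measurable M M" "distr M M (T ^^ 0) = M" by (simp_all add: id_def)
next
  case (Suc i)
  show "(T ^^ Suc i) \<in> measurable M M" using measurable_comp[OF Suc(1) T] by (simp add: comp_def)
  have "distr M M (T ^^ Suc i) = distr (distr M M (T ^^ i)) M T"
    using T Suc(1) by (simp add: distr_distr comp_def)
  then show "distr M M (T ^^ Suc i) = M" using Suc(2) distr_T by simp
qed

lemma T_pow_space: "\<omega> \<in> space M \<Longrightarrow> (T ^^ i) \<omega> \<in> space M"
  using measurable_space[OF T_pow(1)] .

definition itinerary :: "('a \<Rightarrow> 'b) \<Rightarrow> nat \<Rightarrow> 'a \<Rightarrow> 'b list" where
  "itinerary Y n \<omega> = map (\<lambda>i. Y ((T ^^ i) \<omega>)) [0..<n]"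

lemma itinerary_eq_iff: "itinerary Y n \<omega> = itinerary Y n \<omega>' \<longleftrightarrow> (\<forall>i<n. Y ((T ^^ i) \<omega>) = Y ((T ^^ i) \<omega>'))"
  by (auto simp: itinerary_def)

lemma simple_pow: "simple_function M Y \<Longrightarrow> simple_function M (\<lambda>\<omega>. Y ((T ^^ i) \<omega>))"
  by (rule shannon_measure_preserving(2)[OF _ T_pow])

lemma shannon_pow: "simple_function M Y \<Longrightarrow> shannon (\<lambda>\<omega>. Y ((T ^^ i) \<omega>)) = shannon Y"
  by (rule shannon_measure_preserving(1)[OF _ T_pow])

lemma simple_itinerary:
  assumes "simple_function M Y"
  shows "simple_function M (itinerary Y n)"
proof (induction n)
  case 0
  then show ?case by (simp add: itinerary_def[abs_def])
next
  case (Suc n)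
  have "simple_function M ((\<lambda>(l, y). l @ [y]) \<circ> (\<lambda>\<omega>. (itinerary Y n \<omega>, Y ((T ^^ n) \<omega>))))"
    by (intro simple_function_compose simple_function_PairI Suc simple_pow assms)
  then show ?case by (simp add: itinerary_def[abs_def] comp_def)
qed

lemma all_less_add_split: "(\<forall>i<n + k. P i) \<longleftrightarrow> (\<forall>i<n. P i) \<and> (\<forall>i<k. P (i + n :: nat))"
proof safe
  fix i assume *: "\<forall>i<n. P i" "\<forall>i<k. P (i + n)" and i: "i < n + k"
  show "P i"
  proof (cases "i < n")
    case False
    then have "i - n < k" "i = (i - n) + n" using i by auto
    then show ?thesis using *(2) by metis
  qed (use * in blast)
qed auto

lemma shannon_itinerary_add:
  assumes Y: "simple_function M Y"
  shows "shannon (itinerary Y (n + k)) \<le> shannon (itinerary Y n) + shannon (itinerary Y k)"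
proof -
  have "shannon (itinerary Y (n + k)) = shannon (\<lambda>\<omega>. (itinerary Y n \<omega>, itinerary Y k ((T ^^ n) \<omega>)))"
    by (rule shannon_cong_fibres) (simp add: itinerary_eq_iff all_less_add_split funpow_add)
  also have "\<dots> \<le> shannon (itinerary Y n) + shannon (\<lambda>\<omega>. itinerary Y k ((T ^^ n) \<omega>))"
    by (intro shannon_pair_le simple_itinerary simple_pow Y)
  also have "shannon (\<lambda>\<omega>. itinerary Y k ((T ^^ n) \<omega>)) = shannon (itinerary Y k)"
    by (intro shannon_pow simple_itinerary Y)
  finally show ?thesis .
qed

text \<open>The entropy of the itinerary of \<open>Y\<close>, given \<open>V\<close>, is at most the
  sum of the conditional entropies of its letters. For the \<open>i\<close>-th letter,
  \<open>V\<close> may be replaced by the coarser variable \<open>W\<close> at time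
  \<open>i\<close>, and by invariance the result does not depend on \<open>i\<close>.\<close>

lemma conditional_entropy_bound:
  assumes Y: "simple_function M Y" and W: "simple_function M W" and V: "simple_function M V"
    and fn: "\<And>i \<omega> \<omega>'. i < n \<Longrightarrow> \<omega> \<in> space M \<Longrightarrow> \<omega>' \<in> space M \<Longrightarrow> V \<omega> = V \<omega>' \<Longrightarrow> W ((T ^^ i) \<omega>) = W ((T ^^ i) \<omega>')"
  shows "shannon (\<lambda>\<omega>. (itinerary Y n \<omega>, V \<omega>)) \<le> shannon V + real n * (shannon (\<lambda>\<omega>. (Y \<omega>, W \<omega>)) - shannon W)"
  using fn
proof (induction n)
  case 0
  have "shannon (\<lambda>\<omega>. (itinerary Y 0 \<omega>, V \<omega>)) = shannon V" by (rule shannon_cong_fibres) (simp add: itinerary_def)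
  then show ?case by simp
next
  case (Suc n)
  let ?Y = "\<lambda>\<omega>. Y ((T ^^ n) \<omega>)" and ?W = "\<lambda>\<omega>. W ((T ^^ n) \<omega>)"
  note fnW = Suc.prems[OF lessI]
  note sY = simple_pow[OF Y, of n] and sW = simple_pow[OF W, of n]
  have "shannon (\<lambda>\<omega>. (itinerary Y (Suc n) \<omega>, V \<omega>)) = shannon (\<lambda>\<omega>. (itinerary Y n \<omega>, ?Y \<omega>, V \<omega>))"
    by (rule shannon_cong_fibres) (auto simp: itinerary_eq_iff less_Suc_eq)
  moreover have "shannon (\<lambda>\<omega>. (itinerary Y n \<omega>, ?Y \<omega>, V \<omega>)) + shannon V
      \<le> shannon (\<lambda>\<omega>. (itinerary Y n \<omega>, V \<omega>)) + shannon (\<lambda>\<omega>. (?Y \<omega>, V \<omega>))"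
    by (intro strong_subadditivity simple_itinerary Y sY V)
  moreover have "shannon (\<lambda>\<omega>. (?Y \<omega>, V \<omega>, ?W \<omega>)) + shannon ?W \<le> shannon (\<lambda>\<omega>. (?Y \<omega>, ?W \<omega>)) + shannon (\<lambda>\<omega>. (V \<omega>, ?W \<omega>))"
    by (intro strong_subadditivity sY sW V)
  moreover have "shannon (\<lambda>\<omega>. (?Y \<omega>, V \<omega>, ?W \<omega>)) = shannon (\<lambda>\<omega>. (?Y \<omega>, V \<omega>))"
    by (rule shannon_cong_fibres) (simp, use fnW in blast)
  moreover have "shannon (\<lambda>\<omega>. (V \<omega>, ?W \<omega>)) = shannon V"
    by (rule shannon_cong_fibres) (simp, use fnW in blast)
  moreover have "shannon ?W = shannon W" by (rule shannon_pow[OF W])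
  moreover have "shannon (\<lambda>\<omega>. (?Y \<omega>, ?W \<omega>)) = shannon (\<lambda>\<omega>. (Y \<omega>, W \<omega>))"
    by (rule shannon_pow[OF simple_function_PairI[OF Y W]])
  moreover have "shannon (\<lambda>\<omega>. (itinerary Y n \<omega>, V \<omega>)) \<le> shannon V + real n * (shannon (\<lambda>\<omega>. (Y \<omega>, W \<omega>)) - shannon W)"
    by (intro Suc.IH Suc.prems[OF less_SucI])
  ultimately show ?case by (simp add: algebra_simps)
qed

end

lemma eta_le_sqrt:
  assumes "0 \<le> p"
  shows "eta p \<le> 2 * sqrt p"
proof (cases "p = 0")
  case False
  then have p: "p > 0" using assms by simp
  have "ln (1 / sqrt p) \<le> 1 / sqrt p - 1" using p by (intro ln_le_minus_one) simp
  moreover have "ln (1 / sqrt p) = - (ln p / 2)" using p by (simp add: ln_div ln_sqrt)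
  ultimately have "- ln p \<le> 2 * (1 / sqrt p)" by simp
  then have "p * (- ln p) \<le> p * (2 * (1 / sqrt p))" using p by (intro mult_left_mono) auto
  also have "\<dots> = 2 * (p / sqrt p)" by simp
  also have "\<dots> = 2 * sqrt p" using p by (simp only: real_div_sqrt)
  finally show ?thesis by (simp add: eta_def)
qed simp

lemma tendsto_eta:
  assumes lim: "p \<longlonglongrightarrow> l" and p: "\<And>k::nat. 0 \<le> p k" "\<And>k. p k \<le> 1"
  shows "(\<lambda>k. eta (p k)) \<longlonglongrightarrow> eta l"
proof -
  have l: "l \<ge> 0" using lim p(1) by (intro LIMSEQ_le_const) auto
  show ?thesis
  proof (cases "l = 0")
    case True
    have "(\<lambda>k. 2 * sqrt (p k)) \<longlonglongrightarrow> 2 * sqrt 0" using lim True by (intro tendsto_intros) auto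
    then have "(\<lambda>k. 2 * sqrt (p k)) \<longlonglongrightarrow> 0" by simp
    from tendsto_sandwich[OF _ _ tendsto_const this, of "\<lambda>k. eta (p k)"] have "(\<lambda>k. eta (p k)) \<longlonglongrightarrow> 0"
      using p eta_nonneg eta_le_sqrt by (simp add: always_eventually)
    then show ?thesis using True by simp
  next
    case False
    then show ?thesis unfolding eta_def using lim l by (intro tendsto_intros) auto
  qed
qed

context measure_preserving
begin

text \<open>The nonempty members of the iterated join are the fibres of the itinerary.\<close>

lemma partition_entropy_join:
  assumes Y: "simple_function M Y"
  shows "partition_entropy M (iterated_join M T (fibres Y) n) = shannon (itinerary Y n)"
proof -
  let ?J = "iterated_join M T (fibres Y) n" and ?F = "fibres (itinerary Y n)"
  have fib: "itinerary Y n -` {itinerary Y n \<omega>} \<inter> space M = {\<omega>' \<in> space M. \<forall>i<n. (T ^^ i) \<omega>' \<in> Y -` {Y ((T ^^ i) \<omega>)} \<inter> space M}" for \<omega>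
    using T_pow_space by (auto simp: itinerary_eq_iff)
  have sub1: "?F \<subseteq> ?J"
  proof
    fix B assume "B \<in> ?F"
    then obtain \<omega> where \<omega>: "\<omega> \<in> space M" "B = itinerary Y n -` {itinerary Y n \<omega>} \<inter> space M"
      by (auto simp: fibres_def)
    have "\<forall>i<n. Y -` {Y ((T ^^ i) \<omega>)} \<inter> space M \<in> fibres Y" using T_pow_space[OF \<omega>(1)] by (auto simp: fibres_def)
    then show "B \<in> ?J" unfolding iterated_join_def \<omega>(2) fib
      by (intro CollectI exI[of _ "\<lambda>i. Y -` {Y ((T ^^ i) \<omega>)} \<inter> space M"] conjI refl)
  qed
  have sub2: "?J \<subseteq> insert {} ?F"
  proof
    fix B assume "B \<in> ?J"
    then obtain s where s: "\<forall>i<n. s i \<in> fibres Y" "B = {\<omega> \<in> space M. \<forall>i<n. (T ^^ i) \<omega> \<in> s i}"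
      by (auto simp: iterated_join_def)
    show "B \<in> insert {} ?F"
    proof (cases "B = {}")
      case False
      then obtain \<omega> where \<omega>: "\<omega> \<in> B" by blast
      have "s i = Y -` {Y ((T ^^ i) \<omega>)} \<inter> space M" if "i < n" for i
      proof -
        have "(T ^^ i) \<omega> \<in> s i" "s i \<in> fibres Y" using \<omega> s that by auto
        then show ?thesis by (auto simp: fibres_def)
      qed
      then have "B = itinerary Y n -` {itinerary Y n \<omega>} \<inter> space M" unfolding fib s(2) by auto
      moreover have "\<omega> \<in> space M" using \<omega> s by simp
      ultimately show ?thesis by (auto simp: fibres_def)
    qed simp
  qed
  have fin: "finite ?F" unfolding fibres_def using simple_functionD(1)[OF simple_itinerary[OF Y]] by simp
  have "partition_entropy M ?J = (\<Sum>B\<in>?J. eta (prob B))" by (simp add: partition_entropy_def eta_def sum_negf)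
  also have "\<dots> = (\<Sum>B\<in>?F. eta (prob B))"
    using sub1 sub2 fin by (intro sum.mono_neutral_right) (auto intro: finite_subset)
  finally show ?thesis by (simp add: shannon_fibres)
qed

text \<open>The variable maps a point to the block that contains it.\<close>

lemma partition_is_fibres:
  assumes P: "finite_measurable_partition M P"
  obtains Y :: "'a \<Rightarrow> 'a set" where "simple_function M Y" "fibres Y = P"
proof -
  have P': "finite P" "P \<subseteq> sets M" "\<Union>P = space M" "disjoint P" "{} \<notin> P"
    using P by (auto simp: finite_measurable_partition_def partition_on_def)
  define Y where "Y \<omega> = (THE B. B \<in> P \<and> \<omega> \<in> B)" for \<omega>
  have Y: "Y \<omega> = B" if "B \<in> P" "\<omega> \<in> B" for \<omega> B
    unfolding Y_def using that P'(4) by (intro the_equality) (auto simp: disjoint_def)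
  have im: "Y ` space M = P"
  proof (intro equalityI subsetI)
    fix B assume "B \<in> Y ` space M"
    then obtain \<omega> where \<omega>: "\<omega> \<in> space M" "B = Y \<omega>" by blast
    then obtain C where C: "C \<in> P" "\<omega> \<in> C" using P'(3) by blast
    then show "B \<in> P" using Y[OF C] \<omega> by simp
  next
    fix B assume B: "B \<in> P"
    then have "B \<noteq> {}" using P'(5) by blast
    then obtain \<omega> where \<omega>: "\<omega> \<in> B" by blast
    then have "\<omega> \<in> space M" using B P'(3) by blast
    then show "B \<in> Y ` space M" using Y[OF B \<omega>] by (intro image_eqI[of _ _ \<omega>]) simp_all
  qed
  have fib: "Y -` {B} \<inter> space M = B" if B: "B \<in> P" for B
  proof (intro equalityI subsetI)
    fix \<omega> assume "\<omega> \<in> Y -` {B} \<inter> space M"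
    then have \<omega>: "Y \<omega> = B" "\<omega> \<in> space M" by auto
    then obtain C where C: "C \<in> P" "\<omega> \<in> C" using P'(3) by blast
    then show "\<omega> \<in> B" using Y[OF C] \<omega> by simp
  next
    fix \<omega> assume "\<omega> \<in> B"
    then show "\<omega> \<in> Y -` {B} \<inter> space M" using Y[OF B \<open>\<omega> \<in> B\<close>] B P'(3) by auto
  qed
  have "simple_function M Y" unfolding simple_function_def im
  proof (intro conjI ballI)
    show "finite P" by (rule P'(1))
    fix B assume B: "B \<in> P"
    show "Y -` {B} \<inter> space M \<in> sets M" unfolding fib[OF B] using B P'(2) by blast
  qed
  moreover have "fibres Y = P" unfolding fibres_def im using fib by simp
  ultimately show ?thesis by (rule that)
qed

lemma fibres_partition:
  assumes Y: "simple_function M Y"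
  shows "finite_measurable_partition M (fibres Y)"
  unfolding finite_measurable_partition_def
proof (intro conjI)
  show "finite (fibres Y)" unfolding fibres_def using simple_functionD(1)[OF Y] by simp
  show "fibres Y \<subseteq> sets M" unfolding fibres_def using simple_fibre[OF Y] by auto
  show "partition_on (space M) (fibres Y)"
    by (rule partition_onI) (auto simp: fibres_def disjnt_def)
qed

lemma itinerary_entropy_limit:
  assumes Y: "simple_function M Y"
  obtains L where "(\<lambda>n. shannon (itinerary Y n) / real n) \<longlonglongrightarrow> L"
    "\<And>k. k \<ge> 1 \<Longrightarrow> L \<le> shannon (itinerary Y k) / real k" "L \<ge> 0"
  using fekete[of "\<lambda>n. shannon (itinerary Y n)"] shannon_nonneg shannon_itinerary_add[OF Y] by metis

lemma measure_entropy_eqI: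
  assumes Y: "simple_function M Y" and h: "(\<lambda>n. shannon (itinerary Y n) / real n) \<longlonglongrightarrow> h"
    and le: "\<And>Z :: 'a \<Rightarrow> 'a set. \<And>L. simple_function M Z \<Longrightarrow> (\<lambda>n. shannon (itinerary Z n) / real n) \<longlonglongrightarrow> L \<Longrightarrow> L \<le> h"
  shows "measure_entropy M T = ereal h"
  unfolding measure_entropy_def
proof (rule antisym)
  show "(SUP P\<in>Collect (finite_measurable_partition M). ereal (lim (\<lambda>n. partition_entropy M (iterated_join M T P n) / real n))) \<le> ereal h"
  proof (rule SUP_least)
    fix P assume "P \<in> Collect (finite_measurable_partition M)"
    then obtain Z :: "'a \<Rightarrow> 'a set" where Z: "simple_function M Z" "fibres Z = P" using partition_is_fibres by blast
    obtain L where L: "(\<lambda>n. shannon (itinerary Z n) / real n) \<longlonglongrightarrow> L" using itinerary_entropy_limit[OF Z(1)] by blast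
    then show "ereal (lim (\<lambda>n. partition_entropy M (iterated_join M T P n) / real n)) \<le> ereal h"
      using le[OF Z(1) L] partition_entropy_join[OF Z(1)] Z(2) by (simp add: limI)
  qed
  show "ereal h \<le> (SUP P\<in>Collect (finite_measurable_partition M). ereal (lim (\<lambda>n. partition_entropy M (iterated_join M T P n) / real n)))"
    using fibres_partition[OF Y] partition_entropy_join[OF Y] limI[OF h]
    by (intro SUP_upper2[of "fibres Y"]) simp_all
qed

text \<open>Conditioning on more information decreases the entropy.\<close>

lemma conditional_entropy_function:
  assumes Y: "simple_function M Y" and V: "simple_function M V" and W: "simple_function M W"
    and fn: "\<And>\<omega> \<omega>'. \<omega> \<in> space M \<Longrightarrow> \<omega>' \<in> space M \<Longrightarrow> V \<omega> = V \<omega>' \<Longrightarrow> W \<omega> = W \<omega>'"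
  shows "shannon (\<lambda>\<omega>. (Y \<omega>, V \<omega>)) - shannon V \<le> shannon (\<lambda>\<omega>. (Y \<omega>, W \<omega>)) - shannon W"
proof -
  have "shannon (\<lambda>\<omega>. (Y \<omega>, V \<omega>, W \<omega>)) + shannon W \<le> shannon (\<lambda>\<omega>. (Y \<omega>, W \<omega>)) + shannon (\<lambda>\<omega>. (V \<omega>, W \<omega>))"
    by (intro strong_subadditivity Y V W)
  moreover have "shannon (\<lambda>\<omega>. (Y \<omega>, V \<omega>, W \<omega>)) = shannon (\<lambda>\<omega>. (Y \<omega>, V \<omega>))"
    by (rule shannon_cong_fibres) (simp, use fn in blast)
  moreover have "shannon (\<lambda>\<omega>. (V \<omega>, W \<omega>)) = shannon V"
    by (rule shannon_cong_fibres) (simp, use fn in blast)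
  ultimately show ?thesis by simp
qed

text \<open>The joint law of \<open>Y\<close> and \<open>W k\<close> converges to that of
  \<open>Y\<close> and \<open>Y\<close>, and \<open>eta\<close> is continuous.\<close>

lemma conditional_entropy_tendsto_0:
  assumes Y: "simple_function M Y" and W: "\<And>k::nat. simple_function M (W k)" "\<And>k. W k ` space M \<subseteq> Y ` space M"
    and ae: "\<And>k. prob {\<omega> \<in> space M. Y \<omega> \<noteq> W k \<omega>} \<le> 1 / real (Suc k)"
  shows "(\<lambda>k. shannon (\<lambda>\<omega>. (Y \<omega>, W k \<omega>)) - shannon (W k)) \<longlonglongrightarrow> 0"
proof -
  let ?R = "Y ` space M"
  have fin: "finite ?R" using Y by (rule simple_functionD)
  note YW = simple_function_PairI[OF Y W(1)]
  have bad: "{\<omega> \<in> space M. Y \<omega> \<noteq> W k \<omega>} \<in> events" for k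
  proof -
    have "(\<lambda>\<omega>. (Y \<omega>, W k \<omega>)) -` {v. fst v \<noteq> snd v} \<inter> space M \<in> events" by (rule simple_functionD(2)[OF YW])
    moreover have "(\<lambda>\<omega>. (Y \<omega>, W k \<omega>)) -` {v. fst v \<noteq> snd v} \<inter> space M = {\<omega> \<in> space M. Y \<omega> \<noteq> W k \<omega>}" by auto
    ultimately show ?thesis by simp
  qed
  have close: "\<bar>prob E - prob F\<bar> \<le> 1 / real (Suc k)"
    if E: "E \<in> events" and F: "F \<in> events" and sub: "E \<subseteq> F \<union> {\<omega> \<in> space M. Y \<omega> \<noteq> W k \<omega>}" "F \<subseteq> E \<union> {\<omega> \<in> space M. Y \<omega> \<noteq> W k \<omega>}" for E F k
  proof -
    have "prob E \<le> prob (F \<union> {\<omega> \<in> space M. Y \<omega> \<noteq> W k \<omega>})" using sub(1) E F bad by (intro finite_measure_mono) auto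
    also have "\<dots> \<le> prob F + prob {\<omega> \<in> space M. Y \<omega> \<noteq> W k \<omega>}" using F bad by (intro measure_Un_le)
    finally have 1: "prob E \<le> prob F + 1 / real (Suc k)" using ae[of k] by linarith
    have "prob F \<le> prob (E \<union> {\<omega> \<in> space M. Y \<omega> \<noteq> W k \<omega>})" using sub(2) E F bad by (intro finite_measure_mono) auto
    also have "\<dots> \<le> prob E + prob {\<omega> \<in> space M. Y \<omega> \<noteq> W k \<omega>}" using E bad by (intro measure_Un_le)
    finally have 2: "prob F \<le> prob E + 1 / real (Suc k)" using ae[of k] by linarith
    show ?thesis using 1 2 by linarith
  qed
  have tends: "f \<longlonglongrightarrow> l" if "\<And>k. \<bar>f k - l\<bar> \<le> 1 / real (Suc k)" for f :: "nat \<Rightarrow> real" and l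
  proof -
    have "(\<lambda>k. \<bar>f k - l\<bar>) \<longlonglongrightarrow> 0"
      using that by (intro tendsto_sandwich[OF _ _ tendsto_const LIMSEQ_inverse_real_of_nat]) (auto simp: inverse_eq_divide)
    then show ?thesis by (rule LIM_zero_cancel[OF tendsto_rabs_zero_cancel])
  qed
  have l1: "(\<lambda>k. law (\<lambda>\<omega>. (Y \<omega>, W k \<omega>)) (v, u)) \<longlonglongrightarrow> (if v = u then law Y v else 0)" for v u
  proof (rule tends)
    fix k
    let ?E = "(\<lambda>\<omega>. (Y \<omega>, W k \<omega>)) -` {(v, u)} \<inter> space M"
    have E: "?E \<in> events" by (rule simple_fibre[OF YW])
    show "\<bar>law (\<lambda>\<omega>. (Y \<omega>, W k \<omega>)) (v, u) - (if v = u then law Y v else 0)\<bar> \<le> 1 / real (Suc k)"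
    proof (cases "v = u")
      case True
      have "\<bar>prob ?E - prob (Y -` {v} \<inter> space M)\<bar> \<le> 1 / real (Suc k)"
        by (rule close[OF E simple_fibre[OF Y]]) (use True in auto)
      then show ?thesis using True by (simp add: law_def)
    next
      case False
      have "\<bar>prob ?E - prob {}\<bar> \<le> 1 / real (Suc k)"
        by (rule close[OF E]) (use False in auto)
      then show ?thesis using False by (simp add: law_def)
    qed
  qed
  have l2: "(\<lambda>k. law (W k) u) \<longlonglongrightarrow> law Y u" for u
  proof (rule tends)
    fix k
    have "\<bar>prob (W k -` {u} \<inter> space M) - prob (Y -` {u} \<inter> space M)\<bar> \<le> 1 / real (Suc k)"
      by (rule close[OF simple_fibre[OF W(1)] simple_fibre[OF Y]]) auto
    then show "\<bar>law (W k) u - law Y u\<bar> \<le> 1 / real (Suc k)" by (simp add: law_def)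
  qed
  have "(\<lambda>k. (\<Sum>v\<in>?R. \<Sum>u\<in>?R. eta (law (\<lambda>\<omega>. (Y \<omega>, W k \<omega>)) (v, u))) - (\<Sum>u\<in>?R. eta (law (W k) u)))
    \<longlonglongrightarrow> (\<Sum>v\<in>?R. \<Sum>u\<in>?R. eta (if v = u then law Y v else 0)) - (\<Sum>u\<in>?R. eta (law Y u))"
    by (intro tendsto_diff tendsto_sum tendsto_eta l1 l2 law_nonneg law_le_1)
  moreover have "(\<Sum>u\<in>?R. eta (if v = u then law Y v else 0)) = eta (law Y v)" if "v \<in> ?R" for v
  proof -
    have "(\<Sum>u\<in>?R. eta (if v = u then law Y v else 0)) = (\<Sum>u\<in>?R. if v = u then eta (law Y v) else 0)"
      by (intro sum.cong) auto
    then show ?thesis using that fin by simp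
  qed
  moreover have "shannon (W k) = (\<Sum>u\<in>?R. eta (law (W k) u))" for k
    using shannon_superset[OF fin W(2)] .
  moreover have "shannon (\<lambda>\<omega>. (Y \<omega>, W k \<omega>)) = (\<Sum>v\<in>?R. \<Sum>u\<in>?R. eta (law (\<lambda>\<omega>. (Y \<omega>, W k \<omega>)) (v, u)))" for k
  proof -
    have "shannon (\<lambda>\<omega>. (Y \<omega>, W k \<omega>)) = (\<Sum>v\<in>?R \<times> ?R. eta (law (\<lambda>\<omega>. (Y \<omega>, W k \<omega>)) v))"
      using W(2)[of k] fin by (intro shannon_superset) auto
    then show ?thesis by (simp add: sum.cartesian_product case_prod_unfold)
  qed
  ultimately show ?thesis by simp
qed

end

context sft
begin

lemma inv_measure_preserving:
  assumes "M \<in> invariant_measures A"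
  shows "measure_preserving M shift"
  using invD[OF assms] by (simp add: measure_preserving_def measure_preserving_axioms_def)

definition block_entropy :: "(nat list \<Rightarrow> real) \<Rightarrow> nat \<Rightarrow> real" where
  "block_entropy g n = (\<Sum>w\<in>words n. eta (g w))"

definition entropy_rate :: "(nat list \<Rightarrow> real) \<Rightarrow> real" where
  "entropy_rate g = lim (\<lambda>n. block_entropy g n / real n)"

lemma simple_prefix:
  assumes M: "M \<in> invariant_measures A"
  shows "simple_function M (\<lambda>x. seq_prefix x n)"
  unfolding simple_function_def
proof (intro conjI ballI)
  have "(\<lambda>x. seq_prefix x n) ` space M \<subseteq> words n" using invD(3)[OF M] by auto
  then show "finite ((\<lambda>x. seq_prefix x n) ` space M)" by (rule finite_subset) simp
  fix v
  have "(\<lambda>x. seq_prefix x n) -` {v} \<inter> space M = {x \<in> X. seq_prefix x n = v}" using invD(3)[OF M] by auto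
  then show "(\<lambda>x. seq_prefix x n) -` {v} \<inter> space M \<in> sets M"
    using prefix_set_measurable[OF invD(2)[OF M], of "\<lambda>w. w = v"] by simp
qed

lemma shannon_prefix:
  assumes M: "M \<in> invariant_measures A"
  shows "prob_space.shannon M (\<lambda>x. seq_prefix x n) = block_entropy (word_prob M) n"
proof -
  interpret measure_preserving M shift by (rule inv_measure_preserving[OF M])
  have "shannon (\<lambda>x. seq_prefix x n) = (\<Sum>w\<in>words n. eta (law (\<lambda>x. seq_prefix x n) w))"
    using invD(3)[OF M] by (intro shannon_superset) auto
  also have "\<dots> = (\<Sum>w\<in>words n. eta (word_prob M w))"
  proof (intro sum.cong refl arg_cong[of _ _ eta])
    fix w assume "w \<in> words n"
    then have "(\<lambda>x. seq_prefix x n) -` {w} \<inter> space M = cylinder A w" using invD(3)[OF M] by (auto simp: words_def cylinder_def)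
    then show "law (\<lambda>x. seq_prefix x n) w = word_prob M w" by (simp add: law_def word_prob_def)
  qed
  finally show ?thesis by (simp add: block_entropy_def)
qed

lemma shannon_itinerary_prefix:
  assumes M: "M \<in> invariant_measures A"
  shows "prob_space.shannon M (measure_preserving.itinerary shift (\<lambda>x. seq_prefix x 1) n) = block_entropy (word_prob M) n"
proof -
  interpret measure_preserving M shift by (rule inv_measure_preserving[OF M])
  have "shannon (itinerary (\<lambda>x. seq_prefix x 1) n) = shannon (\<lambda>x. seq_prefix x n)"
    by (rule shannon_cong_fibres) (auto simp: itinerary_eq_iff seq_prefix_eq_iff shift_pow)
  then show ?thesis using shannon_prefix[OF M] by simp
qed

text \<open>A stationary family comes from a measure, and its block entropies are the entropies of
  the itineraries of the first letter, which are subadditive.\<close>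

lemma entropy_rate_limit:
  assumes "stationary g"
  shows "(\<lambda>n. block_entropy g n / real n) \<longlonglongrightarrow> entropy_rate g"
    "k \<ge> 1 \<Longrightarrow> entropy_rate g \<le> block_entropy g k / real k" "entropy_rate g \<ge> 0"
proof -
  obtain M where M: "M \<in> invariant_measures A" and g: "word_prob M = g"
    using measure_of_stationary[OF assms] by (metis ext)
  interpret measure_preserving M shift by (rule inv_measure_preserving[OF M])
  obtain L where L: "(\<lambda>n. shannon (itinerary (\<lambda>x. seq_prefix x 1) n) / real n) \<longlonglongrightarrow> L"
    "\<And>k. k \<ge> 1 \<Longrightarrow> L \<le> shannon (itinerary (\<lambda>x. seq_prefix x 1) k) / real k" "L \<ge> 0"
    using itinerary_entropy_limit[OF simple_prefix[OF M]] by blast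
  then have L1: "(\<lambda>n. block_entropy g n / real n) \<longlonglongrightarrow> L" using shannon_itinerary_prefix[OF M] g by simp
  then have "entropy_rate g = L" unfolding entropy_rate_def by (rule limI)
  then show "(\<lambda>n. block_entropy g n / real n) \<longlonglongrightarrow> entropy_rate g"
    "k \<ge> 1 \<Longrightarrow> entropy_rate g \<le> block_entropy g k / real k" "entropy_rate g \<ge> 0"
    using L1 L(2)[of k] L(3) shannon_itinerary_prefix[OF M] g by simp_all
qed

lemma separate_compacts:
  assumes fin: "finite R" and K: "\<And>v. v \<in> R \<Longrightarrow> compact (K v)" "disjoint_family_on K R"
  obtains N where "\<And>x y u v. u \<in> R \<Longrightarrow> v \<in> R \<Longrightarrow> x \<in> K u \<Longrightarrow> y \<in> K v \<Longrightarrow> seq_prefix x N = seq_prefix y N \<Longrightarrow> u = v"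
proof -
  have "\<exists>N. \<forall>u\<in>R. \<forall>v\<in>R. \<forall>x\<in>K u. \<forall>y\<in>K v. seq_prefix x N = seq_prefix y N \<longrightarrow> u = v"
  proof (rule ccontr)
    assume "\<not> ?thesis"
    then have "\<forall>N. \<exists>u v x y. u \<in> R \<and> v \<in> R \<and> x \<in> K u \<and> y \<in> K v \<and> seq_prefix x N = seq_prefix y N \<and> u \<noteq> v" by blast
    then obtain u v x y where *: "\<And>N. u N \<in> R" "\<And>N. v N \<in> R" "\<And>N. x N \<in> K (u N)" "\<And>N. y N \<in> K (v N)"
      "\<And>N. seq_prefix (x N) N = seq_prefix (y N) N" "\<And>N. u N \<noteq> v N" by metis
    have "compact (\<Union>v\<in>R. K v)" using fin K by (intro compact_UN) auto
    then have "seq_compact (\<Union>v\<in>R. K v)" by (simp add: compact_eq_seq_compact_metric)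
    moreover have "\<forall>n. x n \<in> (\<Union>v\<in>R. K v)" using * by blast
    ultimately obtain z r where z: "z \<in> (\<Union>v\<in>R. K v)" and r: "strict_mono r" and lim: "(x \<circ> r) \<longlonglongrightarrow> z"
      unfolding seq_compact_def by metis
    then obtain w where w: "w \<in> R" "z \<in> K w" by blast
    have limY: "(y \<circ> r) \<longlonglongrightarrow> z"
    proof (rule tendsto_fun_discreteI)
      fix n
      show "eventually (\<lambda>k. seq_prefix ((y \<circ> r) k) n = seq_prefix z n) sequentially"
        using tendsto_fun_discrete[OF lim, of n] eventually_ge_at_top[of n]
      proof eventually_elim
        case (elim k)
        then have "n \<le> r k" using seq_suble[OF r, of k] by simp
        then have "seq_prefix (x (r k)) n = seq_prefix (y (r k)) n" using *(5) seq_prefix_mono by blast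
        then show ?case using elim by simp
      qed
    qed
    have "closed (\<Union>v\<in>R - {w}. K v)" using fin K by (intro closed_UN compact_imp_closed) auto
    then have op: "open (- (\<Union>v\<in>R - {w}. K v))" by (rule open_Compl)
    have zin: "z \<in> - (\<Union>v\<in>R - {w}. K v)" using w K(2) by (auto simp: disjoint_family_on_def)
    have "eventually (\<lambda>k. x (r k) \<in> - (\<Union>v\<in>R - {w}. K v) \<and> y (r k) \<in> - (\<Union>v\<in>R - {w}. K v)) sequentially"
      using topological_tendstoD[OF lim op zin] topological_tendstoD[OF limY op zin] by (auto intro: eventually_conj)
    then obtain k where "x (r k) \<in> - (\<Union>v\<in>R - {w}. K v)" "y (r k) \<in> - (\<Union>v\<in>R - {w}. K v)"
      by (auto simp: eventually_sequentially)
    then have "u (r k) = w" "v (r k) = w" using *(1-4)[of "r k"] by blast+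
    then show False using *(6)[of "r k"] by simp
  qed
  then show ?thesis using that by blast
qed

lemma compact_approximation:
  assumes M: "M \<in> invariant_measures A" and B: "B \<in> sets M" and e: "e > 0"
  obtains K where "compact K" "K \<subseteq> B" "K \<in> sets M" "measure M (B - K) < e"
proof -
  interpret prob_space M using invD[OF M] by simp
  have sp: "space M = X" by (rule invD(3)[OF M])
  have BX: "B \<subseteq> X" using sets.sets_into_space[OF B] sp by simp
  have sets_iff: "S \<in> sets M \<longleftrightarrow> S \<subseteq> X \<and> S \<in> sets borel" for S
    unfolding invD(2)[OF M] using X_borel by (subst sets_restrict_space_iff) auto
  have id: "(\<lambda>x. x) \<in> measurable M borel"
    by (rule measurableI) (use sets_iff sp X_borel in \<open>auto intro: sets.Int\<close>)
  define N where "N = distr M borel (\<lambda>x. x)"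
  have N: "emeasure N S = emeasure M S" if "S \<in> sets borel" "S \<subseteq> X" for S
    using emeasure_distr[OF id that(1)] that(2) sp by (simp add: N_def Int_absorb2)
  have fin: "emeasure N (space N) \<noteq> \<infinity>" using emeasure_distr[OF id, of UNIV] by (simp add: N_def)
  have "(SUP K\<in>{K. K \<subseteq> B \<and> compact K}. emeasure N K) = emeasure N B"
    using inner_regular[of N B] fin sets_iff B by (simp add: N_def)
  moreover have "emeasure N B \<noteq> \<infinity>" using N[of B] sets_iff B by simp
  ultimately have "\<exists>K\<in>{K. K \<subseteq> B \<and> compact K}. emeasure N B < emeasure N K + ennreal e"
    using e by (intro SUP_approx_ennreal) (auto simp: infinity_ennreal_def)
  then obtain K where K: "K \<subseteq> B" "compact K" "emeasure N B < emeasure N K + ennreal e" by blast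
  have Kb: "K \<in> sets borel" using K by (intro borel_closed compact_imp_closed)
  have KM: "K \<in> sets M" using Kb K BX sets_iff by blast
  have "ennreal (measure M B) < ennreal (measure M K + e)"
    using K(3) N[of B] N[of K] Kb B sets_iff BX K(1) e by (simp add: emeasure_eq_measure ennreal_plus[symmetric] del: ennreal_plus)
  then have "measure M B < measure M K + e" using e by (subst (asm) ennreal_less_iff) simp_all
  moreover have "measure M (B - K) = measure M B - measure M K" using finite_measure_Diff[OF B KM K(1)] .
  ultimately show ?thesis using that[OF K(2,1) KM] by simp
qed

text \<open>By inner regularity each of the finitely many fibres of \<open>Y\<close> contains a
  compact set of almost the same measure. Disjoint compact sets are distinguished by prefixes of
  some length \<open>N\<close>.\<close>

lemma approximate_by_prefix_function:
  assumes M: "M \<in> invariant_measures A" and Y: "simple_function M Y" and e: "e > 0"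
  obtains N f where "\<And>w. f w \<in> Y ` X" "measure M {x \<in> X. Y x \<noteq> f (seq_prefix x N)} \<le> e"
proof -
  interpret prob_space M using invD[OF M] by simp
  have sp: "space M = X" by (rule invD(3)[OF M])
  let ?R = "Y ` X"
  have fin: "finite ?R" using simple_functionD(1)[OF Y] sp by simp
  obtain x0 where x0: "x0 \<in> X" using X_nonempty by blast
  define c where "c = real (card ?R)"
  have c: "c > 0" using fin x0 unfolding c_def by (auto simp: card_gt_0_iff)
  have B: "Y -` {v} \<inter> X \<in> sets M" for v using simple_fibre[OF Y] sp by simp
  have "\<exists>K. compact K \<and> K \<subseteq> Y -` {v} \<inter> X \<and> K \<in> sets M \<and> measure M (Y -` {v} \<inter> X - K) < e / c" for v
    using compact_approximation[OF M B, of "e / c"] e c by (metis divide_pos_pos)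
  then obtain K where K: "\<And>v. compact (K v)" "\<And>v. K v \<subseteq> Y -` {v} \<inter> X" "\<And>v. K v \<in> sets M"
    "\<And>v. measure M (Y -` {v} \<inter> X - K v) < e / c" by metis
  have disj: "disjoint_family_on K ?R"
  proof -
    have "K u \<inter> K v = {}" if "u \<noteq> v" for u v using K(2)[of u] K(2)[of v] that by auto
    then show ?thesis by (simp add: disjoint_family_on_def)
  qed
  obtain N where N: "\<And>x y u v. u \<in> ?R \<Longrightarrow> v \<in> ?R \<Longrightarrow> x \<in> K u \<Longrightarrow> y \<in> K v \<Longrightarrow> seq_prefix x N = seq_prefix y N \<Longrightarrow> u = v"
    using separate_compacts[OF fin K(1) disj] by metis
  define Q where "Q w v \<longleftrightarrow> v \<in> ?R \<and> (\<exists>y\<in>K v. seq_prefix y N = w)" for w v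
  define f where "f w = (if \<exists>v. Q w v then SOME v. Q w v else Y x0)" for w
  have fR: "f w \<in> ?R" for w
  proof (cases "\<exists>v. Q w v")
    case True
    then have "Q w (f w)" unfolding f_def using someI_ex[OF True] by simp
    then show ?thesis by (simp add: Q_def)
  qed (use x0 in \<open>simp add: f_def\<close>)
  have good: "f (seq_prefix x N) = Y x" if x: "x \<in> X" "x \<in> K (Y x)" for x
  proof -
    have q: "Q (seq_prefix x N) (Y x)" using x by (auto simp: Q_def)
    then have ex: "\<exists>v. Q (seq_prefix x N) v" by blast
    then have "Q (seq_prefix x N) (f (seq_prefix x N))" unfolding f_def using someI_ex[OF ex] by simp
    then obtain y where "f (seq_prefix x N) \<in> ?R" "y \<in> K (f (seq_prefix x N))" "seq_prefix y N = seq_prefix x N"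
      by (auto simp: Q_def)
    then show ?thesis using N[of "f (seq_prefix x N)" "Y x" y x] x by auto
  qed
  have "measure M {x \<in> X. Y x \<noteq> f (seq_prefix x N)} \<le> measure M (\<Union>v\<in>?R. Y -` {v} \<inter> X - K v)"
  proof (rule finite_measure_mono)
    show "{x \<in> X. Y x \<noteq> f (seq_prefix x N)} \<subseteq> (\<Union>v\<in>?R. Y -` {v} \<inter> X - K v)"
    proof
      fix x assume "x \<in> {x \<in> X. Y x \<noteq> f (seq_prefix x N)}"
      then have "x \<in> X" "x \<notin> K (Y x)" using good[of x] by auto
      then show "x \<in> (\<Union>v\<in>?R. Y -` {v} \<inter> X - K v)" by blast
    qed
    show "(\<Union>v\<in>?R. Y -` {v} \<inter> X - K v) \<in> sets M" using fin B K(3) by (intro sets.finite_UN) auto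
  qed
  also have "\<dots> \<le> (\<Sum>v\<in>?R. measure M (Y -` {v} \<inter> X - K v))"
    using fin B K(3) by (intro measure_UNION_le) auto
  also have "\<dots> \<le> (\<Sum>v\<in>?R. e / c)" using K(4) by (intro sum_mono less_imp_le)
  also have "\<dots> = e" using c by (simp add: c_def)
  finally show ?thesis using that[of f N] fR by blast
qed

text \<open>Prefixes generate all measurable sets: \<open>Y\<close> is almost a function of a
  prefix, and replacing this function by the prefix itself only lowers the conditional
  entropy.\<close>

lemma prefix_generates:
  assumes M: "M \<in> invariant_measures A" and Y: "simple_function M Y" and e: "e > 0"
  obtains N where "prob_space.shannon M (\<lambda>x. (Y x, seq_prefix x N)) - prob_space.shannon M (\<lambda>x. seq_prefix x N) < e"
proof -
  interpret measure_preserving M shift by (rule inv_measure_preserving[OF M])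
  have sp: "space M = X" by (rule invD(3)[OF M])
  have "\<exists>q. (\<forall>w. snd q w \<in> Y ` X) \<and> measure M {x \<in> X. Y x \<noteq> snd q (seq_prefix x (fst q))} \<le> 1 / real (Suc k)" for k
  proof -
    have pos: "1 / real (Suc k) > 0" by simp
    show ?thesis
    proof (rule approximate_by_prefix_function[OF M Y pos])
      fix f and N :: nat
      assume *: "\<And>w. f w \<in> Y ` X" "measure M {x \<in> X. Y x \<noteq> f (seq_prefix x N)} \<le> 1 / real (Suc k)"
      show ?thesis by (rule exI[of _ "(N, f)"]) (simp only: fst_conv snd_conv *, simp)
    qed
  qed
  then obtain q where q: "\<forall>k. (\<forall>w. snd (q k) w \<in> Y ` X) \<and>
      measure M {x \<in> X. Y x \<noteq> snd (q k) (seq_prefix x (fst (q k)))} \<le> 1 / real (Suc k)"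
    using choice[of "\<lambda>k q. (\<forall>w. snd q w \<in> Y ` X) \<and> measure M {x \<in> X. Y x \<noteq> snd q (seq_prefix x (fst q))} \<le> 1 / real (Suc k)"]
    by blast
  define N f where "N k = fst (q k)" and "f k = snd (q k)" for k
  have f: "f k w \<in> Y ` X" "measure M {x \<in> X. Y x \<noteq> f k (seq_prefix x (N k))} \<le> 1 / real (Suc k)" for k w
    using q unfolding N_def f_def by blast+
  define W where "W k x = f k (seq_prefix x (N k))" for k x
  have W: "simple_function M (W k)" for k
    using simple_function_compose[OF simple_prefix[OF M], of "f k" "N k"] by (simp add: comp_def W_def[abs_def])
  have "(\<lambda>k. shannon (\<lambda>x. (Y x, W k x)) - shannon (W k)) \<longlonglongrightarrow> 0"
    using f by (intro conditional_entropy_tendsto_0 Y W) (auto simp: W_def sp)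
  then have "eventually (\<lambda>k. shannon (\<lambda>x. (Y x, W k x)) - shannon (W k) < e) sequentially"
    using e by (rule order_tendstoD)
  then obtain k where k: "shannon (\<lambda>x. (Y x, W k x)) - shannon (W k) < e" by (auto simp: eventually_sequentially)
  have "shannon (\<lambda>x. (Y x, seq_prefix x (N k))) - shannon (\<lambda>x. seq_prefix x (N k)) \<le> shannon (\<lambda>x. (Y x, W k x)) - shannon (W k)"
    by (intro conditional_entropy_function Y simple_prefix[OF M] W) (simp add: W_def)
  then show ?thesis using that[of "N k"] k by linarith
qed

text \<open>Up to an entropy of \<open>e\<close> per letter, the itinerary of length
  \<open>n\<close> of any finite-valued variable is determined by the prefix of length \<open>n +
  N\<close>. So no partition has a larger entropy than the one by the first letter.\<close>

theorem kolmogorov_sinai: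
  assumes M: "M \<in> invariant_measures A"
  shows "measure_entropy M shift = ereal (entropy_rate (word_prob M))"
proof -
  interpret measure_preserving M shift by (rule inv_measure_preserving[OF M])
  note st = stationary_word_prob[OF M]
  let ?h = "entropy_rate (word_prob M)" and ?H = "block_entropy (word_prob M)"
  show ?thesis
  proof (rule measure_entropy_eqI[OF simple_prefix[OF M, of 1]])
    show "(\<lambda>n. shannon (itinerary (\<lambda>x. seq_prefix x 1) n) / real n) \<longlonglongrightarrow> ?h"
      using entropy_rate_limit(1)[OF st] shannon_itinerary_prefix[OF M] by simp
    fix Z :: "(nat \<Rightarrow> nat) \<Rightarrow> (nat \<Rightarrow> nat) set" and L
    assume Z: "simple_function M Z" and L: "(\<lambda>n. shannon (itinerary Z n) / real n) \<longlonglongrightarrow> L"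
    show "L \<le> ?h"
    proof (rule field_le_epsilon)
      fix e :: real assume "e > 0"
      then obtain N where N: "shannon (\<lambda>x. (Z x, seq_prefix x N)) - shannon (\<lambda>x. seq_prefix x N) < e"
        using prefix_generates[OF M Z] by blast
      have bound: "shannon (itinerary Z n) / real n \<le> ?H n / real n + ?H N / real n + e" if n: "n \<ge> 1" for n
      proof -
        have "shannon (itinerary Z n) \<le> shannon (\<lambda>x. (seq_prefix x (n + N), itinerary Z n x))"
          by (intro shannon_mono_pair simple_prefix[OF M] simple_itinerary Z)
        also have "\<dots> = shannon (\<lambda>x. (itinerary Z n x, seq_prefix x (n + N)))"
          by (rule shannon_cong_fibres) auto
        also have "\<dots> \<le> shannon (\<lambda>x. seq_prefix x (n + N)) + real n * (shannon (\<lambda>x. (Z x, seq_prefix x N)) - shannon (\<lambda>x. seq_prefix x N))"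
        proof (intro conditional_entropy_bound simple_prefix[OF M] Z)
          fix i x y assume "i < n" "seq_prefix x (n + N) = seq_prefix y (n + N)"
          then have "seq_prefix x (i + N) = seq_prefix y (i + N)" using seq_prefix_mono by (metis add_le_mono less_imp_le order_refl)
          then show "seq_prefix ((shift ^^ i) x) N = seq_prefix ((shift ^^ i) y) N" by (rule seq_prefix_shift_eq)
        qed
        also have "\<dots> \<le> shannon (\<lambda>x. seq_prefix x (n + N)) + real n * e"
          using N by (intro add_left_mono mult_left_mono) auto
        also have "shannon (\<lambda>x. seq_prefix x (n + N)) = shannon (itinerary (\<lambda>x. seq_prefix x 1) (n + N))"
          using shannon_prefix[OF M] shannon_itinerary_prefix[OF M] by simp
        also have "\<dots> \<le> ?H n + ?H N"
          using shannon_itinerary_add[OF simple_prefix[OF M], of 1 n N] shannon_itinerary_prefix[OF M] by simp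
        finally have "shannon (itinerary Z n) / real n \<le> (?H n + ?H N + real n * e) / real n"
          by (simp add: divide_right_mono)
        then show ?thesis using n by (simp add: add_divide_distrib)
      qed
      have "(\<lambda>n. ?H n / real n + ?H N / real n + e) \<longlonglongrightarrow> ?h + 0 + e"
        by (intro tendsto_add entropy_rate_limit(1)[OF st] tendsto_const lim_const_over_n)
      then have "L \<le> ?h + 0 + e"
        using L bound by (intro LIMSEQ_le[of _ L]) auto
      then show "L \<le> ?h + e" by simp
    qed
  qed
qed

end

section \<open>Counting words with prescribed statistics\<close>

lemma ln_fact_lower: "real n * ln (real n) - real n \<le> ln (fact n)"
proof (induction n)
  case (Suc n)
  show ?case
  proof (cases "n = 0")
    case False
    then have n: "real n > 0" by simp
    have "ln (1 + 1 / real n) \<le> 1 / real n" using n by (intro ln_add_one_self_le_self) simp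
    moreover have "1 + 1 / real n = real (Suc n) / real n" using n by (simp add: field_simps)
    ultimately have "ln (real (Suc n)) - ln (real n) \<le> 1 / real n" using n by (simp add: ln_div)
    then have "real n * (ln (real (Suc n)) - ln (real n)) \<le> real n * (1 / real n)" using n by (intro mult_left_mono) auto
    then have "real n * ln (real (Suc n)) - real n * ln (real n) \<le> 1" using n by (simp add: right_diff_distrib)
    moreover have "ln (fact (Suc n)) = ln (real (Suc n)) + ln (fact n)" by (simp add: ln_mult)
    moreover have "real (Suc n) * ln (real (Suc n)) = real n * ln (real (Suc n)) + ln (real (Suc n))"
      by (simp add: algebra_simps)
    ultimately show ?thesis using Suc by simp
  qed simp
qed simp

lemma ln_fact_upper: "n \<ge> 1 \<Longrightarrow> ln (fact n) \<le> real n * ln (real n) - real n + ln (real n) + 1"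
proof (induction n rule: nat_induct_at_least)
  case (Suc n)
  then have n: "real n > 0" by simp
  have "ln (real n / real (Suc n)) \<le> real n / real (Suc n) - 1" using n by (intro ln_le_minus_one) simp
  also have "\<dots> = - (1 / real (Suc n))" by (simp add: field_simps)
  finally have "1 / real (Suc n) \<le> ln (real (Suc n)) - ln (real n)" using n by (simp add: ln_div)
  then have "real (Suc n) * (1 / real (Suc n)) \<le> real (Suc n) * (ln (real (Suc n)) - ln (real n))" by (intro mult_left_mono) auto
  then have "1 \<le> real (Suc n) * ln (real (Suc n)) - real (Suc n) * ln (real n)" by (simp add: right_diff_distrib)
  moreover have "real (Suc n) * ln (real n) = real n * ln (real n) + ln (real n)" by (simp add: algebra_simps)
  moreover have "ln (fact (Suc n)) = ln (real (Suc n)) + ln (fact n)" by (simp add: ln_mult)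
  ultimately show ?case using Suc by simp
qed simp

text \<open>The number of permutations is a multinomial coefficient. Stirling's bounds show that it
  is the exponential of the entropy of the frequencies, up to a factor which is polynomial in
  \<open>Q\<close>.\<close>

lemma ln_card_permutations_ge:
  fixes c :: "'a \<Rightarrow> nat"
  assumes S: "finite S" and N: "\<And>w. count N w = (if w \<in> S then c w else 0)" and Q: "Q = (\<Sum>w\<in>S. c w)" "Q \<ge> 1"
  shows "real Q * (\<Sum>w\<in>S. eta (real (c w) / real Q)) - real (card S) * (ln (real Q) + 1)
    \<le> ln (real (card (permutations_of_multiset N)))"
proof -
  let ?P = "permutations_of_multiset N"
  define S' where "S' = set_mset N"
  have S': "S' \<subseteq> S" unfolding S'_def using N by (metis count_eq_zero_iff subsetI)
  have fS': "finite S'" by (simp add: S'_def)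
  have cS': "count N w = c w" "c w \<ge> 1" if "w \<in> S'" for w
  proof -
    have "w \<in> S" using S' that by blast
    then show "count N w = c w" using N by simp
    moreover have "count N w > 0" using that by (simp add: S'_def)
    ultimately show "c w \<ge> 1" by linarith
  qed
  have c0: "c w = 0" if "w \<in> S - S'" for w
    using that N[of w] by (auto simp: S'_def not_in_iff split: if_splits)
  have sizeN: "size N = Q"
  proof -
    have "size N = (\<Sum>w\<in>S'. c w)" unfolding size_multiset_overloaded_eq S'_def[symmetric]
      using cS' by (intro sum.cong) auto
    also have "\<dots> = Q" unfolding Q(1) using S' S c0 by (intro sum.mono_neutral_left) auto
    finally show ?thesis .
  qed
  have prodeq: "real (card ?P) * (\<Prod>x\<in>S'. fact (c x)) = fact Q"
  proof -
    have "card ?P * (\<Prod>x\<in>S'. fact (count N x)) = fact (size N)"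
      unfolding S'_def by (rule card_permutations_of_multiset_aux)
    moreover have "(\<Prod>x\<in>S'. fact (count N x) :: nat) = (\<Prod>x\<in>S'. fact (c x))" using cS' by (intro prod.cong) auto
    ultimately have "card ?P * (\<Prod>x\<in>S'. fact (c x)) = (fact Q :: nat)" using sizeN by simp
    then have "real (card ?P * (\<Prod>x\<in>S'. fact (c x))) = real (fact Q)" by simp
    then show ?thesis by simp
  qed
  then have cardpos: "real (card ?P) > 0" by (metis fact_gt_zero less_eq_real_def mult_zero_left of_nat_0_le_iff)
  have "ln (real (card ?P)) + (\<Sum>x\<in>S'. ln (fact (c x))) = ln (fact Q)"
  proof -
    have "ln (fact Q) = ln (real (card ?P) * (\<Prod>x\<in>S'. fact (c x)))" using prodeq by simp
    also have "\<dots> = ln (real (card ?P)) + ln (\<Prod>x\<in>S'. fact (c x))"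
      using cardpos by (intro ln_mult_pos) (auto intro: prod_pos)
    also have "ln (\<Prod>x\<in>S'. fact (c x)) = (\<Sum>x\<in>S'. ln (fact (c x) :: real))"
      using fS' by (intro ln_prod) auto
    finally show ?thesis by simp
  qed
  moreover have "(\<Sum>x\<in>S'. ln (fact (c x))) \<le> (\<Sum>x\<in>S'. real (c x) * ln (real (c x)) - real (c x) + ln (real Q) + 1)"
  proof (rule sum_mono)
    fix x assume x: "x \<in> S'"
    have "c x \<le> Q" unfolding Q(1) using S' x S by (intro member_le_sum) auto
    then have "ln (real (c x)) \<le> ln (real Q)" using cS'(2)[OF x] by simp
    then show "ln (fact (c x)) \<le> real (c x) * ln (real (c x)) - real (c x) + ln (real Q) + 1"
      using ln_fact_upper[OF cS'(2)[OF x]] by linarith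
  qed
  moreover have "(\<Sum>x\<in>S'. real (c x) * ln (real (c x)) - real (c x) + ln (real Q) + 1)
      = (\<Sum>x\<in>S. real (c x) * ln (real (c x))) - real Q + real (card S') * (ln (real Q) + 1)"
  proof -
    have "(\<Sum>x\<in>S'. real (c x) * ln (real (c x))) = (\<Sum>x\<in>S. real (c x) * ln (real (c x)))"
      using S' S c0 by (intro sum.mono_neutral_left) auto
    moreover have "(\<Sum>x\<in>S'. real (c x)) = real Q"
      unfolding Q(1) of_nat_sum using S' S c0 by (intro sum.mono_neutral_left) auto
    ultimately show ?thesis by (simp add: sum.distrib sum_subtractf algebra_simps)
  qed
  moreover have "real (card S') * (ln (real Q) + 1) \<le> real (card S) * (ln (real Q) + 1)"
    using card_mono[OF S S'] Q(2) by (intro mult_right_mono) auto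
  moreover have "real Q * (\<Sum>w\<in>S. eta (real (c w) / real Q)) = real Q * ln (real Q) - (\<Sum>x\<in>S. real (c x) * ln (real (c x)))"
  proof -
    have "real Q * eta (real (c w) / real Q) = real (c w) * ln (real Q) - real (c w) * ln (real (c w))" for w
      using Q(2) by (cases "c w = 0") (simp_all add: eta_def ln_div field_simps)
    then have "real Q * (\<Sum>w\<in>S. eta (real (c w) / real Q)) = (\<Sum>w\<in>S. real (c w) * ln (real Q) - real (c w) * ln (real (c w)))"
      by (simp add: sum_distrib_left)
    also have "\<dots> = (\<Sum>w\<in>S. real (c w)) * ln (real Q) - (\<Sum>x\<in>S. real (c x) * ln (real (c x)))"
      by (simp add: sum_subtractf sum_distrib_right)
    finally show ?thesis by (simp add: Q(1))
  qed
  ultimately show ?thesis using ln_fact_lower[of Q] by linarith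
qed

section \<open>Birkhoff sums along concatenations\<close>

lemma birkhoff_add:
  fixes F :: "(nat \<Rightarrow> nat) \<Rightarrow> 'b::comm_monoid_add"
  shows "(\<Sum>i<a + b. F ((shift ^^ i) x)) = (\<Sum>i<a. F ((shift ^^ i) x)) + (\<Sum>i<b. F ((shift ^^ i) ((shift ^^ a) x)))"
  by (induction b) (simp_all add: add.assoc shift_pow ac_simps)

lemma seq_prefix_add: "seq_prefix x (a + b) = seq_prefix x a @ seq_prefix ((shift ^^ a) x) b"
  by (induction b) (simp_all add: seq_prefix_Suc shift_pow add.commute)

lemma seq_prefix_shift: "a + b \<le> n \<Longrightarrow> seq_prefix ((shift ^^ a) x) b = take b (drop a (seq_prefix x n))"
  by (auto simp: list_eq_iff_nth_eq shift_pow add.commute)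

context sft
begin

lemma birkhoff_concat:
  fixes F :: "(nat \<Rightarrow> nat) \<Rightarrow> 'b::real_normed_vector"
  assumes x: "x \<in> X" "seq_prefix x (length (concat us)) = concat us"
    and F: "\<And>u y. u \<in> set us \<Longrightarrow> y \<in> X \<Longrightarrow> seq_prefix y (length u) = u \<Longrightarrow>
      norm ((\<Sum>i<length u. F ((shift ^^ i) y)) - v u) \<le> e u"
  shows "norm ((\<Sum>i<length (concat us). F ((shift ^^ i) x)) - (\<Sum>u\<leftarrow>us. v u)) \<le> (\<Sum>u\<leftarrow>us. e u)"
  using assms
proof (induction us arbitrary: x)
  case (Cons u us)
  let ?y = "(shift ^^ length u) x"
  have split: "seq_prefix x (length u) = u" "seq_prefix ?y (length (concat us)) = concat us"
    using Cons.prems(2) by (simp_all add: seq_prefix_add)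
  have y: "?y \<in> X" using Cons.prems(1) by (rule shift_pow_subshift)
  have 1: "norm ((\<Sum>i<length u. F ((shift ^^ i) x)) - v u) \<le> e u"
    using Cons.prems(1,3) split(1) by simp
  have 2: "norm ((\<Sum>i<length (concat us). F ((shift ^^ i) ?y)) - (\<Sum>u\<leftarrow>us. v u)) \<le> (\<Sum>u\<leftarrow>us. e u)"
    by (rule Cons.IH[OF y split(2)]) (use Cons.prems(3) in auto)
  have eq: "(\<Sum>i<length (concat (u # us)). F ((shift ^^ i) x)) - (\<Sum>u\<leftarrow>u # us. v u)
    = ((\<Sum>i<length u. F ((shift ^^ i) x)) - v u) + ((\<Sum>i<length (concat us). F ((shift ^^ i) ?y)) - (\<Sum>u\<leftarrow>us. v u))"
    by (simp add: birkhoff_add)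
  show ?case unfolding eq using norm_triangle_le[OF add_mono[OF 1 2]] by simp
qed simp

definition window_sum :: "nat \<Rightarrow> (nat list \<Rightarrow> 'b::real_normed_vector) \<Rightarrow> nat \<Rightarrow> nat list \<Rightarrow> 'b" where
  "window_sum q G N w = (\<Sum>i<N - q. G (take q (drop i w)))"

text \<open>The sums differ by the windows which meet the connectors or the end of the word.\<close>

lemma birkhoff_loop_of:
  assumes w: "w \<in> words N" and N: "N \<ge> 1" "q \<le> N"
    and y: "y \<in> X" "seq_prefix y (length (loop_of w)) = loop_of w"
  shows "norm ((\<Sum>i<length (loop_of w). G (seq_prefix ((shift ^^ i) y) q)) - window_sum q G N w) \<le> real (2 * gap + q) * word_bound q G"
proof -
  have w': "w \<in> adm" "w \<noteq> []" "length w = N" using w N by (auto simp: words_def)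
  note lo = loop_of[OF w'(1,2)]
  define L where "L = length (loop_of w)"
  define c where "c = gap + q - 1"
  have L: "L = gap + (N - q) + c" using lo(2) w'(3) N gap(1) by (simp add: L_def c_def)
  let ?F = "\<lambda>x. G (seq_prefix x q)"
  let ?z = "(shift ^^ (gap + (N - q))) y"
  have sum: "(\<Sum>i<L. ?F ((shift ^^ i) y)) = (\<Sum>i<gap. ?F ((shift ^^ i) y)) + (\<Sum>i<N - q. ?F ((shift ^^ i) ((shift ^^ gap) y))) + (\<Sum>i<c. ?F ((shift ^^ i) ?z))"
    unfolding L by (simp only: birkhoff_add[of ?F])
  have mid: "(\<Sum>i<N - q. ?F ((shift ^^ i) ((shift ^^ gap) y))) = window_sum q G N w"
    unfolding window_sum_def
  proof (intro sum.cong refl)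
    fix i assume i: "i \<in> {..<N - q}"
    then have le: "(i + gap) + q \<le> L" using L N gap(1) by (simp add: c_def)
    have "seq_prefix ((shift ^^ i) ((shift ^^ gap) y)) q = take q (drop (i + gap) (loop_of w))"
      using seq_prefix_shift[OF le, of y] y(2) by (simp add: shift_pow_add L_def)
    also have "\<dots> = take q (drop i (take N (drop gap (loop_of w))))"
      using i by (simp add: drop_take min_def add.commute)
    also have "\<dots> = take q (drop i w)" using lo(3) w'(3) by simp
    finally show "?F ((shift ^^ i) ((shift ^^ gap) y)) = G (take q (drop i w))" by simp
  qed
  have "norm ((\<Sum>i<L. ?F ((shift ^^ i) y)) - window_sum q G N w) = norm ((\<Sum>i<gap. ?F ((shift ^^ i) y)) + (\<Sum>i<c. ?F ((shift ^^ i) ?z)))"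
    unfolding sum mid by (simp add: algebra_simps)
  also have "\<dots> \<le> real gap * word_bound q G + real c * word_bound q G"
    by (intro norm_triangle_le add_mono norm_birkhoff_le y(1) shift_pow_subshift)
  also have "\<dots> = real (gap + c) * word_bound q G" by (simp add: algebra_simps)
  also have "\<dots> \<le> real (2 * gap + q) * word_bound q G"
    by (intro mult_right_mono word_bound_nonneg) (simp add: c_def)
  finally show ?thesis by (simp add: L_def)
qed

text \<open>By stationarity, every window of a random word is distributed like a prefix.\<close>

lemma mean_window_sum:
  fixes G :: "nat list \<Rightarrow> 'b::{banach, second_countable_topology}"
  assumes M: "M \<in> invariant_measures A" and q: "q \<le> N"
  shows "(\<Sum>w\<in>words N. word_prob M w *\<^sub>R window_sum q G N w) = real (N - q) *\<^sub>R (\<Sum>v\<in>words q. word_prob M v *\<^sub>R G v)"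
proof -
  have "(\<Sum>w\<in>words N. word_prob M w *\<^sub>R window_sum q G N w) = (\<integral>x. window_sum q G N (seq_prefix x N) \<partial>M)"
    using integral_prefix(1)[OF M, of "window_sum q G N" 0 N] by simp
  also have "\<dots> = (\<integral>x. (\<Sum>i<N - q. G (seq_prefix ((shift ^^ i) x) q)) \<partial>M)"
  proof (intro Bochner_Integration.integral_cong refl)
    fix x
    have "seq_prefix ((shift ^^ i) x) q = take q (drop i (seq_prefix x N))" if "i < N - q" for i
      using that by (intro seq_prefix_shift) simp
    then show "window_sum q G N (seq_prefix x N) = (\<Sum>i<N - q. G (seq_prefix ((shift ^^ i) x) q))"
      unfolding window_sum_def by (intro sum.cong) auto
  qed
  also have "\<dots> = (\<Sum>i<N - q. \<integral>x. G (seq_prefix ((shift ^^ i) x) q) \<partial>M)"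
    by (intro Bochner_Integration.integral_sum integral_prefix(2)[OF M])
  also have "\<dots> = (\<Sum>i<N - q. \<Sum>v\<in>words q. word_prob M v *\<^sub>R G v)"
    by (intro sum.cong refl integral_prefix(1)[OF M])
  finally show ?thesis by (simp add: sum_constant_scaleR)
qed

text \<open>The concatenation can be cut back into pieces because the loops have equal length, and
  each loop contains its word.\<close>

lemma inj_concat_loops: "inj_on (\<lambda>ws. concat (map loop_of ws)) {ws. set ws \<subseteq> words N \<and> length ws = Q}" if N: "N \<ge> 1"
proof (rule inj_onI)
  fix ws vs assume ws: "ws \<in> {ws. set ws \<subseteq> words N \<and> length ws = Q}" and vs: "vs \<in> {ws. set ws \<subseteq> words N \<and> length ws = Q}"
    and eq: "concat (map loop_of ws) = concat (map loop_of vs)"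
  have w: "u \<in> adm" "u \<noteq> []" "length u = N" if "u \<in> set ws \<union> set vs" for u
    using that ws vs N by (auto simp: words_def)
  have len: "length (loop_of u) = N - 1 + 2 * gap" if "u \<in> set ws \<union> set vs" for u
    using loop_of(2)[OF w(1,2)[OF that]] w(3)[OF that] by simp
  have "map loop_of ws = map loop_of vs"
  proof (rule concat_injective[OF eq])
    show "length (map loop_of ws) = length (map loop_of vs)" using ws vs by simp
    show "\<forall>(x, y)\<in>set (zip (map loop_of ws) (map loop_of vs)). length x = length y"
      using len by (auto simp: set_zip)
  qed
  moreover have "inj_on loop_of (set ws \<union> set vs)"
  proof (rule inj_onI)
    fix u v assume u: "u \<in> set ws \<union> set vs" and v: "v \<in> set ws \<union> set vs" and e: "loop_of u = loop_of v"
    show "u = v" using loop_of(3)[OF w(1,2)[OF u]] loop_of(3)[OF w(1,2)[OF v]] w(3)[OF u] w(3)[OF v] e by simp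
  qed
  ultimately show "ws = vs" by (rule map_inj_on)
qed

text \<open>Multiplicities that realise the probabilities of the words of length \<open>N\<close>
  approximately; the larger \<open>R\<close>, the better.\<close>

definition copies :: "(nat list \<Rightarrow> real) \<Rightarrow> nat \<Rightarrow> nat list \<Rightarrow> nat" where
  "copies g R w = nat \<lfloor>real R * g w\<rfloor>"

definition total :: "(nat list \<Rightarrow> real) \<Rightarrow> nat \<Rightarrow> nat \<Rightarrow> nat" where
  "total g N R = (\<Sum>w\<in>words N. copies g R w)"

lemma copies_bounds:
  assumes "stationary g"
  shows "real (copies g R w) \<le> real R * g w" "real R * g w - 1 \<le> real (copies g R w)"
proof -
  have "real R * g w \<ge> 0" using stationaryD(2)[OF assms] by simp
  then show "real (copies g R w) \<le> real R * g w" "real R * g w - 1 \<le> real (copies g R w)"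
    unfolding copies_def by linarith+
qed

lemma total_bounds:
  assumes g: "stationary g"
  shows "real (total g N R) \<le> real R" "real R - real (card (words N)) \<le> real (total g N R)"
proof -
  have s: "(\<Sum>w\<in>words N. real R * g w) = real R"
    using stationary_sum_words[OF g, of N] by (simp add: sum_distrib_left[symmetric])
  have "real (total g N R) \<le> (\<Sum>w\<in>words N. real R * g w)"
    unfolding total_def of_nat_sum by (intro sum_mono copies_bounds g)
  then show "real (total g N R) \<le> real R" using s by simp
  have "(\<Sum>w\<in>words N. real R * g w - 1) \<le> real (total g N R)"
    unfolding total_def of_nat_sum by (intro sum_mono copies_bounds g)
  then show "real R - real (card (words N)) \<le> real (total g N R)" using s by (simp add: sum_subtractf)
qed

text \<open>Rounding changes each multiplicity by at most 1, hence the total by at most the number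
  of words.\<close>

lemma copies_total:
  assumes g: "stationary g" and w: "w \<in> words N"
  shows "\<bar>real (copies g R w) - real (total g N R) * g w\<bar> \<le> 1 + real (card (words N))"
proof -
  have gw: "0 \<le> g w" "g w \<le> 1"
  proof -
    show "0 \<le> g w" by (rule stationaryD(2)[OF g])
    have "g w \<le> (\<Sum>w\<in>words N. g w)" using w stationaryD(2)[OF g] by (intro member_le_sum) auto
    then show "g w \<le> 1" using stationary_sum_words[OF g] by simp
  qed
  have t: "0 \<le> real R - real (total g N R)" "real R - real (total g N R) \<le> real (card (words N))"
    using total_bounds[OF g, where N = N and R = R] by auto
  have "\<bar>(real R - real (total g N R)) * g w\<bar> \<le> real (card (words N)) * 1"
    unfolding abs_mult using t gw by (intro mult_mono) auto
  moreover have "\<bar>real (copies g R w) - real R * g w\<bar> \<le> 1" using copies_bounds[OF g, of R w] by linarith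
  ultimately show ?thesis by (simp add: left_diff_distrib)
qed

lemma total_at_top:
  assumes g: "stationary g"
  shows "filterlim (total g N) at_top sequentially"
proof (rule filterlim_at_top[THEN iffD2], rule allI)
  fix Z :: nat
  show "eventually (\<lambda>R. Z \<le> total g N R) sequentially"
  proof (rule eventually_sequentiallyI)
    fix R assume "Z + card (words N) \<le> R"
    then show "Z \<le> total g N R" using total_bounds(2)[OF g, of R N] by linarith
  qed
qed

lemma frequencies_tendsto:
  assumes g: "stationary g" and w: "w \<in> words N"
  shows "(\<lambda>R. real (copies g R w) / real (total g N R)) \<longlonglongrightarrow> g w"
proof -
  let ?c = "1 + real (card (words N))"
  have top: "filterlim (\<lambda>R. real (total g N R)) at_top sequentially"
    using total_at_top[OF g] by (rule filterlim_compose[OF filterlim_real_sequentially])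
  have "(\<lambda>R. ?c / real (total g N R)) \<longlonglongrightarrow> 0"
    by (rule tendsto_divide_0[OF tendsto_const]) (rule filterlim_at_top_imp_at_infinity[OF top])
  moreover have ev: "eventually (\<lambda>R. 1 \<le> total g N R) sequentially"
    using total_at_top[OF g, of N] by (simp add: filterlim_at_top)
  have "eventually (\<lambda>R. norm (real (copies g R w) / real (total g N R) - g w) \<le> ?c / real (total g N R)) sequentially"
    using ev
  proof eventually_elim
    case (elim R)
    then have t: "real (total g N R) > 0" by simp
    have "real (copies g R w) / real (total g N R) - g w = (real (copies g R w) - real (total g N R) * g w) / real (total g N R)"
      using t by (simp add: field_simps)
    then show ?case using copies_total[OF g w, of R] t by (simp add: divide_right_mono)
  qed
  ultimately have "(\<lambda>R. real (copies g R w) / real (total g N R) - g w) \<longlonglongrightarrow> 0"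
    by (rule Lim_null_comparison[rotated])
  then show ?thesis by (rule LIM_zero_cancel)
qed

lemma empirical_entropy_tendsto:
  assumes g: "stationary g"
  shows "(\<lambda>R. (\<Sum>w\<in>words N. eta (real (copies g R w) / real (total g N R)))
     - real (card (words N)) * (ln (real (total g N R)) + 1) / real (total g N R)) \<longlonglongrightarrow> block_entropy g N"
proof -
  have le1: "real (copies g R w) / real (total g N R) \<le> 1" if "w \<in> words N" for R w
  proof -
    have "copies g R w \<le> total g N R" unfolding total_def using that by (intro member_le_sum) auto
    then show ?thesis by (cases "total g N R = 0") (simp_all add: divide_le_eq_1)
  qed
  have "(\<lambda>R. \<Sum>w\<in>words N. eta (real (copies g R w) / real (total g N R))) \<longlonglongrightarrow> (\<Sum>w\<in>words N. eta (g w))"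
    by (intro tendsto_sum tendsto_eta frequencies_tendsto g) (auto simp: le1)
  moreover have "(\<lambda>R. real (card (words N)) * (ln (real (total g N R)) / real (total g N R) + 1 / real (total g N R))) \<longlonglongrightarrow> real (card (words N)) * (0 + 0)"
    by (intro tendsto_intros filterlim_compose[OF lim_ln_over_n total_at_top[OF g]] filterlim_compose[OF lim_1_over_n total_at_top[OF g]])
  ultimately have "(\<lambda>R. (\<Sum>w\<in>words N. eta (real (copies g R w) / real (total g N R)))
     - real (card (words N)) * (ln (real (total g N R)) / real (total g N R) + 1 / real (total g N R))) \<longlonglongrightarrow> block_entropy g N - real (card (words N)) * (0 + 0)"
    unfolding block_entropy_def by (rule tendsto_diff)
  then show ?thesis by (simp only: add_divide_distrib[symmetric] times_divide_eq_right) simp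
qed

definition type_multiset :: "(nat list \<Rightarrow> real) \<Rightarrow> nat \<Rightarrow> nat \<Rightarrow> nat list multiset" where
  "type_multiset g N R = (\<Sum>w\<in>words N. replicate_mset (copies g R w) w)"

lemma count_type_multiset: "count (type_multiset g N R) w = (if w \<in> words N then copies g R w else 0)"
proof -
  have "count (type_multiset g N R) w = (\<Sum>v\<in>words N. if v = w then copies g R v else 0)"
    unfolding type_multiset_def count_sum by (intro sum.cong) auto
  then show ?thesis by simp
qed

text \<open>The words from which the Moran sets are built: all arrangements of words of length
  \<open>N\<close> with prescribed multiplicities, each of them made concatenable by
  connectors.\<close>

definition type_words :: "(nat list \<Rightarrow> real) \<Rightarrow> nat \<Rightarrow> nat \<Rightarrow> nat list set" where
  "type_words g N R = (\<lambda>ws. concat (map loop_of ws)) ` permutations_of_multiset (type_multiset g N R)"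

lemma permutations_type_multiset:
  assumes "ws \<in> permutations_of_multiset (type_multiset g N R)"
  shows "set ws \<subseteq> words N" "length ws = total g N R"
    "(\<Sum>w\<leftarrow>ws. f w) = (\<Sum>w\<in>words N. real (copies g R w) *\<^sub>R (f w :: 'b::real_vector))"
proof -
  have ms: "mset ws = type_multiset g N R" using assms by (simp add: permutations_of_multiset_def)
  show sub: "set ws \<subseteq> words N"
  proof
    fix w assume "w \<in> set ws"
    then have "count (mset ws) w \<noteq> 0" by simp
    then show "w \<in> words N" unfolding ms count_type_multiset by (simp split: if_splits)
  qed
  have cnt: "count_list ws w = (if w \<in> words N then copies g R w else 0)" for w
    using ms count_type_multiset[of g N R w] by (metis count_mset)
  have sl: "(\<Sum>w\<leftarrow>ws. f' w) = (\<Sum>w\<in>words N. real (count_list ws w) *\<^sub>R (f' w :: 'c::real_vector))" for f'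
    using sub
  proof (induction ws)
    case (Cons a ws)
    have "(\<Sum>w\<in>words N. real (count_list (a # ws) w) *\<^sub>R f' w) = (\<Sum>w\<in>words N. (if w = a then f' w else 0) + real (count_list ws w) *\<^sub>R f' w)"
      by (intro sum.cong) (auto simp: scaleR_left_distrib)
    then show ?case using Cons by (simp add: sum.distrib)
  qed simp
  show "(\<Sum>w\<leftarrow>ws. f w) = (\<Sum>w\<in>words N. real (copies g R w) *\<^sub>R f w)"
    unfolding sl using cnt by (intro sum.cong) auto
  have "length ws = size (type_multiset g N R)" using ms by (metis size_mset)
  also have "\<dots> = total g N R"
    unfolding type_multiset_def total_def by (simp add: size_multiset_sum)
  finally show "length ws = total g N R" .
qed

lemma type_words_props:
  assumes N: "N \<ge> 1" and g: "stationary g" and Q: "total g N R \<ge> 1"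
  shows "finite (type_words g N R)" "type_words g N R \<subseteq> loops"
    "\<And>u. u \<in> type_words g N R \<Longrightarrow> length u = total g N R * (N - 1 + 2 * gap)"
    "real (total g N R) * (\<Sum>w\<in>words N. eta (real (copies g R w) / real (total g N R)))
      - real (card (words N)) * (ln (real (total g N R)) + 1) \<le> ln (real (card (type_words g N R)))"
    "type_words g N R \<noteq> {}"
proof -
  let ?P = "permutations_of_multiset (type_multiset g N R)"
  show "finite (type_words g N R)" "type_words g N R \<noteq> {}" by (simp_all add: type_words_def)
  show "type_words g N R \<subseteq> loops"
  proof
    fix u assume "u \<in> type_words g N R"
    then obtain ws where ws: "ws \<in> ?P" "u = concat (map loop_of ws)" by (auto simp: type_words_def)
    note p = permutations_type_multiset[OF ws(1)]
    show "u \<in> loops" unfolding ws(2)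
    proof (rule concat_loops)
      show "map loop_of ws \<noteq> []" using p(2) Q by auto
      show "set (map loop_of ws) \<subseteq> loops"
      proof
        fix l assume "l \<in> set (map loop_of ws)"
        then obtain w where "w \<in> words N" "l = loop_of w" using p(1) by auto
        then show "l \<in> loops" using N loop_of(1)[of w] by (cases w) (auto simp: words_def)
      qed
    qed
  qed
  show "length u = total g N R * (N - 1 + 2 * gap)" if u: "u \<in> type_words g N R" for u
  proof -
    obtain ws where ws: "ws \<in> ?P" "u = concat (map loop_of ws)" using u by (auto simp: type_words_def)
    note p = permutations_type_multiset[OF ws(1)]
    have "length (loop_of w) = N - 1 + 2 * gap" if "w \<in> set ws" for w
    proof -
      have "w \<in> adm" "w \<noteq> []" "length w = N" using p(1) that N by (auto simp: words_def)
      then show ?thesis using loop_of(2)[of w] by simp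
    qed
    then have eq: "map (length \<circ> loop_of) ws = map (\<lambda>_. N - 1 + 2 * gap) ws" by simp
    have "length u = sum_list (map (length \<circ> loop_of) ws)" unfolding ws(2) length_concat map_map ..
    then have "length u = (\<Sum>w\<leftarrow>ws. N - 1 + 2 * gap)" unfolding eq .
    then show ?thesis using p(2) by (simp add: sum_list_triv)
  qed
  have "?P \<subseteq> {ws. set ws \<subseteq> words N \<and> length ws = total g N R}" using permutations_type_multiset(1,2) by blast
  then have "inj_on (\<lambda>ws. concat (map loop_of ws)) ?P" using inj_concat_loops[OF N] inj_on_subset by blast
  then have "card (type_words g N R) = card ?P" unfolding type_words_def by (rule card_image)
  moreover have "real (total g N R) * (\<Sum>w\<in>words N. eta (real (copies g R w) / real (total g N R)))
      - real (card (words N)) * (ln (real (total g N R)) + 1) \<le> ln (real (card ?P))"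
    using Q by (intro ln_card_permutations_ge count_type_multiset) (simp_all add: total_def)
  ultimately show "real (total g N R) * (\<Sum>w\<in>words N. eta (real (copies g R w) / real (total g N R)))
      - real (card (words N)) * (ln (real (total g N R)) + 1) \<le> ln (real (card (type_words g N R)))" by simp
qed

text \<open>Every word \<open>w\<close> contributes its window sum, as often as it occurs. With
  exact frequencies \<open>g w\<close>, the result would be the mean of the window sums.\<close>

lemma birkhoff_type_words:
  fixes G :: "nat list \<Rightarrow> 'b::{banach, second_countable_topology}"
  assumes M: "M \<in> invariant_measures A" and N: "N \<ge> 1" "q \<le> N"
    and u: "u \<in> type_words (word_prob M) N R" and x: "x \<in> X" "seq_prefix x (length u) = u"
  shows "norm ((\<Sum>i<length u. G (seq_prefix ((shift ^^ i) x) q))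
      - real (total (word_prob M) N R * (N - q)) *\<^sub>R (\<Sum>v\<in>words q. word_prob M v *\<^sub>R G v))
    \<le> real (total (word_prob M) N R) * (real (2 * gap + q) * word_bound q G)
      + real (card (words N)) * (1 + real (card (words N))) * (real N * word_bound q G)"
proof -
  let ?g = "word_prob M"
  note g = stationary_word_prob[OF M]
  let ?Q = "total ?g N R" and ?s = "window_sum q G N"
  obtain ws where ws: "ws \<in> permutations_of_multiset (type_multiset ?g N R)" "u = concat (map loop_of ws)"
    using u by (auto simp: type_words_def)
  note p = permutations_type_multiset[OF ws(1)]
  define v where "v l = ?s (take N (drop gap l))" for l
  have lw: "w \<in> adm \<and> w \<noteq> [] \<and> length w = N" if "w \<in> set ws" for w
    using p(1) that N by (auto simp: words_def)
  have vl: "v (loop_of w) = ?s w" if "w \<in> set ws" for w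
    using loop_of(3)[of w] lw[OF that] by (auto simp: v_def)
  have "norm ((\<Sum>i<length (concat (map loop_of ws)). G (seq_prefix ((shift ^^ i) x) q)) - (\<Sum>l\<leftarrow>map loop_of ws. v l))
    \<le> (\<Sum>l\<leftarrow>map loop_of ws. real (2 * gap + q) * word_bound q G)"
  proof (rule birkhoff_concat[OF x(1)])
    show "seq_prefix x (length (concat (map loop_of ws))) = concat (map loop_of ws)" using x(2) ws(2) by simp
    fix l y assume l: "l \<in> set (map loop_of ws)" and y: "y \<in> X" "seq_prefix y (length l) = l"
    obtain w where w: "w \<in> set ws" "l = loop_of w" using l by auto
    have "w \<in> words N" using p(1) w by blast
    from birkhoff_loop_of[OF this N, of y G] y w vl[OF w(1)]
    show "norm ((\<Sum>i<length l. G (seq_prefix ((shift ^^ i) y) q)) - v l) \<le> real (2 * gap + q) * word_bound q G" by simp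
  qed
  moreover have "(\<Sum>l\<leftarrow>map loop_of ws. real (2 * gap + q) * word_bound q G) = real ?Q * (real (2 * gap + q) * word_bound q G)"
    by (simp add: sum_list_triv p(2))
  moreover have "(\<Sum>l\<leftarrow>map loop_of ws. v l) = (\<Sum>w\<in>words N. real (copies ?g R w) *\<^sub>R ?s w)"
  proof -
    have eq: "map v (map loop_of ws) = map ?s ws" using vl by simp
    show ?thesis unfolding eq by (rule p(3))
  qed
  ultimately have 1: "norm ((\<Sum>i<length u. G (seq_prefix ((shift ^^ i) x) q)) - (\<Sum>w\<in>words N. real (copies ?g R w) *\<^sub>R ?s w))
    \<le> real ?Q * (real (2 * gap + q) * word_bound q G)" by (simp only: ws(2))
  have s: "norm (?s w) \<le> real N * word_bound q G" if w: "w \<in> words N" for w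
  proof -
    have "norm (?s w) \<le> (\<Sum>i<N - q. word_bound q G)" unfolding window_sum_def
    proof (intro order_trans[OF norm_sum] sum_mono norm_le_word_bound)
      fix i assume "i \<in> {..<N - q}"
      then show "take q (drop i w) \<in> words q" using w by (auto simp: words_def intro: admissible_take admissible_drop)
    qed
    also have "\<dots> \<le> real N * word_bound q G" using word_bound_nonneg[of q G] by (auto intro: mult_right_mono)
    finally show ?thesis .
  qed
  have "(\<Sum>w\<in>words N. (real ?Q * ?g w) *\<^sub>R ?s w) = real ?Q *\<^sub>R (\<Sum>w\<in>words N. ?g w *\<^sub>R ?s w)"
    by (simp add: scaleR_sum_right)
  also have "\<dots> = real (?Q * (N - q)) *\<^sub>R (\<Sum>v\<in>words q. ?g v *\<^sub>R G v)"
    unfolding mean_window_sum[OF M N(2)] by simp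
  finally have m: "(\<Sum>w\<in>words N. (real ?Q * ?g w) *\<^sub>R ?s w) = real (?Q * (N - q)) *\<^sub>R (\<Sum>v\<in>words q. ?g v *\<^sub>R G v)" .
  have "(\<Sum>w\<in>words N. real (copies ?g R w) *\<^sub>R ?s w) - (\<Sum>w\<in>words N. (real ?Q * ?g w) *\<^sub>R ?s w)
     = (\<Sum>w\<in>words N. (real (copies ?g R w) - real ?Q * ?g w) *\<^sub>R ?s w)"
    by (simp add: sum_subtractf scaleR_left_diff_distrib)
  also have "norm \<dots> \<le> (\<Sum>w\<in>words N. (1 + real (card (words N))) * (real N * word_bound q G))"
  proof (intro order_trans[OF norm_sum] sum_mono)
    fix w assume w: "w \<in> words N"
    show "norm ((real (copies ?g R w) - real ?Q * ?g w) *\<^sub>R ?s w) \<le> (1 + real (card (words N))) * (real N * word_bound q G)"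
      unfolding norm_scaleR using copies_total[OF g w, of R] s[OF w] by (intro mult_mono) auto
  qed
  finally have 2: "norm ((\<Sum>w\<in>words N. real (copies ?g R w) *\<^sub>R ?s w) - real (?Q * (N - q)) *\<^sub>R (\<Sum>v\<in>words q. ?g v *\<^sub>R G v))
    \<le> real (card (words N)) * (1 + real (card (words N))) * (real N * word_bound q G)"
    unfolding m by (simp add: mult.assoc)
  show ?thesis using norm_triangle_le[OF add_mono[OF 1 2]] by simp
qed

text \<open>The number of arrangements is governed by the block entropy, which is at least \<open>N
  h\<close>; the averages are almost the same for all arrangements. The connectors and the
  incomplete windows affect a fixed number of positions for each of the words of length
  \<open>N\<close>, hence little if \<open>N\<close> is large.\<close>

lemma typical_loops:
  fixes \<theta> :: "nat \<Rightarrow> (nat \<Rightarrow> nat) \<Rightarrow> 'b::euclidean_space"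
  assumes M: "M \<in> invariant_measures A" and aa: "asymp_additive A \<theta>" and \<delta>: "\<delta> > 0"
  obtains l W where "real l \<ge> 1 / \<delta>" "l \<ge> 1" "finite W" "W \<noteq> {}" "W \<subseteq> loops" "\<And>u. u \<in> W \<Longrightarrow> length u = l"
    "real l * (entropy_rate (word_prob M) - \<delta>) \<le> ln (real (card W))"
    "\<And>u x. u \<in> W \<Longrightarrow> x \<in> X \<Longrightarrow> seq_prefix x l = u \<Longrightarrow> norm (\<theta> l x - real l *\<^sub>R asymptotic_mean \<theta> M) \<le> \<delta> * real l"
proof -
  let ?g = "word_prob M" and ?\<mu> = "asymptotic_mean \<theta> M"
  note g = stationary_word_prob[OF M]
  define h where "h = entropy_rate ?g"
  have h0: "h \<ge> 0" unfolding h_def by (rule entropy_rate_limit[OF g])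
  define \<eta> where "\<eta> = \<delta> / 4"
  have \<eta>: "\<eta> > 0" using \<delta> by (simp add: \<eta>_def)
  obtain q G K where K: "K \<ge> 0" and G: "\<And>n x. n \<ge> 1 \<Longrightarrow> x \<in> X \<Longrightarrow>
    norm (\<theta> n x - (\<Sum>i<n. G (seq_prefix ((shift ^^ i) x) q))) \<le> \<eta> * real n + K"
    using asymp_additiveD[OF aa \<eta>] by metis
  define B where "B = word_bound q G"
  have B: "B \<ge> 0" by (simp add: B_def word_bound_nonneg)
  define \<gamma> where "\<gamma> = (\<Sum>v\<in>words q. ?g v *\<^sub>R G v)"
  have \<gamma>\<mu>: "norm (?\<mu> - \<gamma>) \<le> \<eta>" unfolding \<gamma>_def by (rule asymptotic_mean_approx[OF M aa G])
  have \<gamma>B: "norm \<gamma> \<le> B"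
  proof -
    have "norm \<gamma> \<le> (\<Sum>v\<in>words q. ?g v * B)" unfolding \<gamma>_def B_def
      using stationaryD(2)[OF g] by (intro order_trans[OF norm_sum] sum_mono) (auto intro!: mult_mono norm_le_word_bound)
    then show ?thesis using stationary_sum_words[OF g, of q] by (simp add: sum_distrib_right[symmetric])
  qed
  \<comment> \<open>This length makes the connectors negligible for the averages as well as for the
    entropy per letter.\<close>
  obtain N0 :: nat where N0: "max (2 * real (2 * gap + q) * B / \<eta>) (real (2 * gap) * h / \<delta>) < real N0" using reals_Archimedean2 by blast
  define N where "N = Suc (N0 + q)"
  have N: "N \<ge> 1" "q \<le> N" by (simp_all add: N_def)
  have N1: "2 * real (2 * gap + q) * B \<le> \<eta> * real N"
  proof -
    have "2 * real (2 * gap + q) * B / \<eta> < real N" using N0 by (simp add: N_def)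
    then show ?thesis using \<eta> by (simp add: field_simps)
  qed
  define L where "L = N - 1 + 2 * gap"
  have L: "L \<ge> N" "L \<ge> 1" using gap(1) N by (simp_all add: L_def)
  have N2: "real L * (h - \<delta>) < block_entropy ?g N"
  proof -
    have "real (2 * gap) * h / \<delta> < real N" using N0 by (simp add: N_def)
    then have "real (2 * gap) * h < \<delta> * real N" using \<delta> by (simp add: field_simps)
    moreover have "\<delta> * real N \<le> \<delta> * real L" using L \<delta> by simp
    moreover have "real L \<le> real N + real (2 * gap)" by (simp add: L_def)
    then have "real L * h \<le> (real N + real (2 * gap)) * h" using h0 by (intro mult_right_mono)
    moreover have "h \<le> block_entropy ?g N / real N" unfolding h_def by (rule entropy_rate_limit(2)[OF g N(1)])
    then have "real N * h \<le> block_entropy ?g N" using N by (simp add: field_simps)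
    ultimately show ?thesis by (simp add: algebra_simps)
  qed
  define E where "E = real (card (words N)) * (1 + real (card (words N))) * (real N * B)"
  have E: "E \<ge> 0" using B by (simp add: E_def)
  let ?Q = "\<lambda>R. total ?g N R"
  \<comment> \<open>With that many words, the rounding errors \<open>E\<close> and the constant
    \<open>K\<close> are negligible.\<close>
  obtain Q0 :: nat where Q0: "max (1 / \<delta>) ((K + E) / \<eta>) < real Q0" using reals_Archimedean2 by blast
  have ev1: "eventually (\<lambda>R. Suc Q0 \<le> ?Q R) sequentially" using total_at_top[OF g, of N] by (simp add: filterlim_at_top)
  have ev2: "eventually (\<lambda>R. real L * (h - \<delta>) < (\<Sum>w\<in>words N. eta (real (copies ?g R w) / real (?Q R)))
     - real (card (words N)) * (ln (real (?Q R)) + 1) / real (?Q R)) sequentially"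
    using order_tendstoD(1)[OF empirical_entropy_tendsto[OF g] N2] .
  obtain R where R: "Suc Q0 \<le> ?Q R" "real L * (h - \<delta>) < (\<Sum>w\<in>words N. eta (real (copies ?g R w) / real (?Q R)))
     - real (card (words N)) * (ln (real (?Q R)) + 1) / real (?Q R)"
    using eventually_happens[OF eventually_conj[OF ev1 ev2]] by auto
  define Q where "Q = ?Q R"
  have Q: "Q \<ge> 1" "1 / \<delta> \<le> real Q" "K + E \<le> \<eta> * real Q"
  proof -
    show "Q \<ge> 1" using R(1) by (simp add: Q_def)
    have "real Q0 \<le> real Q" using R(1) by (simp add: Q_def)
    then show "1 / \<delta> \<le> real Q" using Q0 by linarith
    have "(K + E) / \<eta> \<le> real Q" using Q0 \<open>real Q0 \<le> real Q\<close> by linarith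
    then show "K + E \<le> \<eta> * real Q" using \<eta> by (simp add: field_simps)
  qed
  note tw = type_words_props[OF N(1) g, of R]
  define l where "l = Q * L"
  have "Q \<le> Q * L" using L(2) by simp
  then have Ql: "real Q \<le> real l" unfolding l_def of_nat_le_iff .
  show ?thesis
  proof (rule that[of l "type_words ?g N R"])
    show "real l \<ge> 1 / \<delta>" using Q Ql by linarith
    show "l \<ge> 1" using Q L by (simp add: l_def)
    show "finite (type_words ?g N R)" "type_words ?g N R \<noteq> {}" "type_words ?g N R \<subseteq> loops"
      using tw Q by (simp_all add: Q_def)
    show len: "length u = l" if "u \<in> type_words ?g N R" for u
      using tw(3) that Q by (simp add: Q_def l_def L_def)
    have "real Q * (real L * (h - \<delta>)) \<le> real Q * ((\<Sum>w\<in>words N. eta (real (copies ?g R w) / real Q))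
     - real (card (words N)) * (ln (real Q) + 1) / real Q)"
      using R(2) by (intro mult_left_mono) (auto simp: Q_def)
    also have "\<dots> = real Q * (\<Sum>w\<in>words N. eta (real (copies ?g R w) / real Q)) - real (card (words N)) * (ln (real Q) + 1)"
      using Q(1) by (simp add: right_diff_distrib)
    also have "\<dots> \<le> ln (real (card (type_words ?g N R)))" using tw(4) Q(1) by (simp add: Q_def)
    finally show "real l * (entropy_rate ?g - \<delta>) \<le> ln (real (card (type_words ?g N R)))"
      by (simp add: l_def h_def mult.assoc)
    fix u x assume u: "u \<in> type_words ?g N R" and x: "x \<in> X" "seq_prefix x l = u"
    let ?S = "\<Sum>i<l. G (seq_prefix ((shift ^^ i) x) q)"
    have 1: "norm (\<theta> l x - ?S) \<le> \<eta> * real l + K" using \<open>l \<ge> 1\<close> x by (intro G)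
    have 2: "norm (?S - real (Q * (N - q)) *\<^sub>R \<gamma>) \<le> real Q * (real (2 * gap + q) * B) + E"
      using birkhoff_type_words[OF M N u x(1), of G] len[OF u] x(2) by (simp add: Q_def \<gamma>_def B_def E_def)
    have 3: "norm (real (Q * (N - q)) *\<^sub>R \<gamma> - real l *\<^sub>R \<gamma>) \<le> real Q * (real (2 * gap + q) * B)"
    proof -
      have "real (Q * (N - q)) - real l = - (real Q * real (2 * gap + q - 1))"
      proof -
        have r1: "real L = real N - 1 + 2 * real gap" using N by (simp add: L_def of_nat_diff)
        have r2: "real (N - q) = real N - real q" using N by (simp add: of_nat_diff)
        have r3: "real (2 * gap + q - 1) = 2 * real gap + real q - 1" using gap(1) by (simp add: of_nat_diff)
        show ?thesis unfolding l_def of_nat_mult r1 r2 r3 by (simp add: algebra_simps)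
      qed
      then have "real (Q * (N - q)) *\<^sub>R \<gamma> - real l *\<^sub>R \<gamma> = - (real Q * real (2 * gap + q - 1)) *\<^sub>R \<gamma>"
        by (metis scaleR_left_diff_distrib)
      then have "norm (real (Q * (N - q)) *\<^sub>R \<gamma> - real l *\<^sub>R \<gamma>) = real Q * (real (2 * gap + q - 1) * norm \<gamma>)"
        by (simp add: mult.assoc)
      also have "\<dots> \<le> real Q * (real (2 * gap + q) * B)"
        using \<gamma>B B by (intro mult_left_mono mult_mono) auto
      finally show ?thesis .
    qed
    have 4: "norm (real l *\<^sub>R \<gamma> - real l *\<^sub>R ?\<mu>) \<le> \<eta> * real l"
    proof -
      have "norm (real l *\<^sub>R \<gamma> - real l *\<^sub>R ?\<mu>) = real l * norm (?\<mu> - \<gamma>)"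
        by (simp add: scaleR_diff_right[symmetric] norm_minus_commute)
      also have "\<dots> \<le> real l * \<eta>" using \<gamma>\<mu> by (intro mult_left_mono) auto
      finally show ?thesis by (simp add: mult.commute)
    qed
    have "norm (\<theta> l x - real l *\<^sub>R ?\<mu>) \<le> (\<eta> * real l + K) + (real Q * (real (2 * gap + q) * B) + E)
        + real Q * (real (2 * gap + q) * B) + \<eta> * real l"
      using norm_triangle_le[OF add_mono[OF norm_triangle_le[OF add_mono[OF norm_triangle_le[OF add_mono[OF 1 2]] 3]] 4]] by simp
    also have "\<dots> = 2 * (\<eta> * real l) + (K + E) + real Q * (2 * real (2 * gap + q) * B)" by (simp add: algebra_simps)
    also have "\<dots> \<le> 2 * (\<eta> * real l) + \<eta> * real l + \<eta> * real l"
    proof (intro add_mono order_refl)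
      have "\<eta> * real Q \<le> \<eta> * real l" using Ql \<eta> by simp
      then show "K + E \<le> \<eta> * real l" using Q(3) by linarith
      have "real Q * (2 * real (2 * gap + q) * B) \<le> real Q * (\<eta> * real N)" using N1 by (intro mult_left_mono) auto
      also have "\<dots> \<le> real Q * (\<eta> * real L)" using L \<eta> by (intro mult_left_mono) auto
      finally show "real Q * (2 * real (2 * gap + q) * B) \<le> \<eta> * real l" by (simp add: l_def mult_ac)
    qed
    also have "\<dots> = \<delta> * real l" by (simp add: \<eta>_def)
    finally show "norm (\<theta> l x - real l *\<^sub>R ?\<mu>) \<le> \<delta> * real l" .
  qed
qed

end

section \<open>The metric of a negative potential\<close>

locale neg_potential = sft +
  fixes \<psi> :: "nat \<Rightarrow> (nat \<Rightarrow> nat) \<Rightarrow> real"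
  assumes neg: "\<psi> \<in> Caa_neg A"
begin

abbreviation W :: "nat list \<Rightarrow> real" where "W \<equiv> word_weight A \<psi>"
abbreviation d :: "(nat \<Rightarrow> nat) \<Rightarrow> (nat \<Rightarrow> nat) \<Rightarrow> real" where "d \<equiv> gauge_dist A \<psi>"

lemma psi_asymp_additive: "asymp_additive A \<psi>"
  using neg by (intro Caa_asymp_additive) (auto simp: Caa_neg_def Caa_def)

lemma psi_continuous: "n \<ge> 1 \<Longrightarrow> continuous_on X (\<psi> n)"
  using psi_asymp_additive by (rule asymp_additive_continuous)

text \<open>By almost additivity, one more letter changes \<open>\<psi>\<close> by \<open>\<psi>
  1\<close> up to \<open>C\<close>, and the negativity condition says that \<open>\<psi> 1 +
  C\<close> is bounded away from 0.\<close>

lemma psi_steps: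
  obtains a b where "0 < a" "a \<le> b"
    "\<And>n x. n \<ge> 1 \<Longrightarrow> x \<in> X \<Longrightarrow> \<psi> (Suc n) x \<le> \<psi> n x - a"
    "\<And>n x. n \<ge> 1 \<Longrightarrow> x \<in> X \<Longrightarrow> \<psi> n x - b \<le> \<psi> (Suc n) x"
    "\<And>n x. n \<ge> 1 \<Longrightarrow> x \<in> X \<Longrightarrow> \<psi> n x \<le> - a * real n"
    "\<And>n x. n \<ge> 1 \<Longrightarrow> x \<in> X \<Longrightarrow> - b * real n \<le> \<psi> n x"
proof -
  obtain C where aa: "almost_additive_with A C \<psi>" and lt: "(SUP x\<in>X. \<psi> 1 x) + C < 0"
    using neg by (auto simp: Caa_neg_def)
  have C: "C \<ge> 0" by (rule almost_additive_nonneg[OF aa X_nonempty])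
  obtain B where B: "B \<ge> 0" "\<And>x. x \<in> X \<Longrightarrow> norm (\<psi> 1 x) \<le> B"
    using bounded_on_subshift[OF psi_continuous[of 1]] by auto
  define s where "s = (SUP x\<in>X. \<psi> 1 x)"
  have s: "\<psi> 1 x \<le> s" if "x \<in> X" for x
    unfolding s_def using B that by (intro cSUP_upper bdd_aboveI[of _ B]) (auto simp: abs_le_iff)
  define a where "a = - (s + C)"
  define b where "b = B + C"
  have a: "a > 0" using lt by (simp add: a_def s_def)
  have st: "- C + \<psi> n x + \<psi> 1 ((shift ^^ n) x) \<le> \<psi> (Suc n) x" "\<psi> (Suc n) x \<le> C + \<psi> n x + \<psi> 1 ((shift ^^ n) x)"
    if "n \<ge> 1" "x \<in> X" for n x
  proof -
    have "- C + \<psi> n x + \<psi> 1 ((shift ^^ n) x) \<le> \<psi> (n + 1) x \<and> \<psi> (n + 1) x \<le> C + \<psi> n x + \<psi> 1 ((shift ^^ n) x)"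
      using aa that unfolding almost_additive_with_def by blast
    then show "- C + \<psi> n x + \<psi> 1 ((shift ^^ n) x) \<le> \<psi> (Suc n) x" "\<psi> (Suc n) x \<le> C + \<psi> n x + \<psi> 1 ((shift ^^ n) x)" by simp_all
  qed
  have up: "\<psi> (Suc n) x \<le> \<psi> n x - a" if "n \<ge> 1" "x \<in> X" for n x
    using st(2)[OF that] s[OF shift_pow_subshift[OF that(2)], of n] by (simp add: a_def)
  have lo: "\<psi> n x - b \<le> \<psi> (Suc n) x" if "n \<ge> 1" "x \<in> X" for n x
    using st(1)[OF that] B(2)[OF shift_pow_subshift[OF that(2)], of n] by (simp add: b_def)
  have up': "\<psi> n x \<le> - a * real n" if "n \<ge> 1" "x \<in> X" for n x
    using that
  proof (induction n rule: nat_induct_at_least)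
    case base
    then show ?case using s[of x] C by (simp add: a_def)
  next
    case (Suc n)
    then show ?case using up[OF Suc.hyps Suc.prems] by (simp add: algebra_simps)
  qed
  have lo': "- b * real n \<le> \<psi> n x" if "n \<ge> 1" "x \<in> X" for n x
    using that
  proof (induction n rule: nat_induct_at_least)
    case base
    then show ?case using B(2)[of x] C by (simp add: b_def)
  next
    case (Suc n)
    then show ?case using lo[OF Suc.hyps Suc.prems] by (simp add: algebra_simps)
  qed
  obtain x where x: "x \<in> X" using X_nonempty by blast
  have "a \<le> b" using up'[of 1 x] lo'[of 1 x] x by simp
  then show ?thesis using that[OF a _ up lo up' lo'] by blast
qed

lemma weight_Nil [simp]: "W [] = 1"
  by (simp add: word_weight_def)

lemma weight_bdd: "n \<ge> 1 \<Longrightarrow> S \<subseteq> X \<Longrightarrow> bdd_above ((\<lambda>x. exp (\<psi> n x)) ` S)"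
proof -
  assume n: "n \<ge> 1" and S: "S \<subseteq> X"
  obtain B where "B \<ge> 0" "\<And>x. x \<in> X \<Longrightarrow> norm (\<psi> n x) \<le> B" using bounded_on_subshift[OF psi_continuous[OF n]] by blast
  then show ?thesis using S by (intro bdd_aboveI[of _ "exp B"]) (auto simp: abs_le_iff)
qed

lemma weight_ge: "n \<ge> 1 \<Longrightarrow> x \<in> X \<Longrightarrow> exp (\<psi> n x) \<le> W (seq_prefix x n)"
proof -
  assume n: "n \<ge> 1" and x: "x \<in> X"
  have "exp (\<psi> n x) \<le> (SUP y\<in>cylinder A (seq_prefix x n). exp (\<psi> n y))"
    using x n by (intro cSUP_upper weight_bdd cylinder_subset in_cylinder_prefix)
  moreover have "seq_prefix x n \<noteq> []" using n by (metis length_seq_prefix list.size(3) not_one_le_zero)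
  ultimately show ?thesis by (simp add: word_weight_def)
qed

lemma weight_leI:
  assumes "w \<in> adm" "w \<noteq> []" "\<And>x. x \<in> cylinder A w \<Longrightarrow> exp (\<psi> (length w) x) \<le> r"
  shows "W w \<le> r"
  using assms cylinder_nonempty[of w] unfolding word_weight_def by (auto intro!: cSUP_least)

lemma weight_pos: "w \<in> adm \<Longrightarrow> W w > 0"
proof (cases "w = []")
  case False
  assume w: "w \<in> adm"
  then obtain x where "x \<in> X" "seq_prefix x (length w) = w" using extend_word by blast
  then have "exp (\<psi> (length w) x) \<le> W w" using weight_ge[of "length w" x] False by (simp add: Suc_le_eq)
  then show ?thesis using exp_gt_zero less_le_trans by blast
qed simp

lemma weight_attained:
  assumes "w \<in> adm" "w \<noteq> []" "r < W w"
  obtains x where "x \<in> cylinder A w" "r < exp (\<psi> (length w) x)"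
proof -
  have "length w \<ge> 1" using assms(2) by (simp add: Suc_le_eq)
  then have "\<exists>x\<in>cylinder A w. r < exp (\<psi> (length w) x)"
    using assms cylinder_nonempty[of w] less_cSUP_iff[OF _ weight_bdd[OF _ cylinder_subset], of w "length w" r]
    by (auto simp: word_weight_def)
  then show ?thesis using that by blast
qed

lemma weight_Suc_le:
  assumes x: "x \<in> X"
  shows "W (seq_prefix x (Suc n)) \<le> W (seq_prefix x n)"
proof -
  obtain a b where ab: "0 < a" "\<And>n x. n \<ge> 1 \<Longrightarrow> x \<in> X \<Longrightarrow> \<psi> (Suc n) x \<le> \<psi> n x - a" "\<And>n x. n \<ge> 1 \<Longrightarrow> x \<in> X \<Longrightarrow> \<psi> n x \<le> - a * real n"
    using psi_steps by metis
  show ?thesis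
  proof (rule weight_leI)
    show "seq_prefix x (Suc n) \<in> adm" using x by (rule seq_prefix_admissible)
    show "seq_prefix x (Suc n) \<noteq> []" by (simp add: seq_prefix_Suc)
    fix y assume "y \<in> cylinder A (seq_prefix x (Suc n))"
    then have y: "y \<in> X" "seq_prefix y (Suc n) = seq_prefix x (Suc n)" by (auto simp: cylinder_def)
    show "exp (\<psi> (length (seq_prefix x (Suc n))) y) \<le> W (seq_prefix x n)"
    proof (cases "n = 0")
      case True
      then show ?thesis using ab(3)[of 1 y] y ab(1) by simp
    next
      case False
      have "exp (\<psi> (Suc n) y) \<le> exp (\<psi> n y)" using ab(2)[of n y] ab(1) False y by simp
      also have "\<dots> \<le> W (seq_prefix y n)" using False y by (intro weight_ge) auto
      also have "seq_prefix y n = seq_prefix x n" using y(2) seq_prefix_mono by (metis lessI less_imp_le)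
      finally show ?thesis by simp
    qed
  qed
qed

lemma weight_antimono:
  assumes x: "x \<in> X" and "n \<le> k"
  shows "W (seq_prefix x k) \<le> W (seq_prefix x n)"
  using \<open>n \<le> k\<close> by (induction rule: dec_induct) (auto intro: order_trans[OF weight_Suc_le[OF x]])

lemma weight_le_1: "w \<in> adm \<Longrightarrow> W w \<le> 1"
proof -
  assume "w \<in> adm"
  then obtain x where "x \<in> X" "seq_prefix x (length w) = w" using extend_word by blast
  then show ?thesis using weight_antimono[of x 0 "length w"] by simp
qed

lemma weight_decay:
  obtains a where "a > 0" "\<And>x n. x \<in> X \<Longrightarrow> W (seq_prefix x n) \<le> exp (- a * real n)"
proof -
  obtain a b where ab: "0 < a" "\<And>n x. n \<ge> 1 \<Longrightarrow> x \<in> X \<Longrightarrow> \<psi> n x \<le> - a * real n"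
    using psi_steps by metis
  show ?thesis
  proof (rule that[OF ab(1)])
    fix x n assume x: "x \<in> X"
    show "W (seq_prefix x n) \<le> exp (- a * real n)"
    proof (cases "n = 0")
      case False
      then have "seq_prefix x n \<noteq> []" by (metis length_seq_prefix list.size(3))
      then show ?thesis using x ab(2) False
        by (intro weight_leI) (auto simp: cylinder_def intro: seq_prefix_admissible)
    qed simp
  qed
qed

lemma gauge_dist_prefix:
  assumes "x \<in> X" "y \<in> X" "x \<noteq> y"
  obtains k where "d x y = W (seq_prefix x k)" "seq_prefix x k = seq_prefix y k" "x k \<noteq> y k"
proof -
  define k where "k = (LEAST n. x n \<noteq> y n)"
  have ex: "\<exists>n. x n \<noteq> y n" using assms(3) by (auto simp: fun_eq_iff)
  have k: "x k \<noteq> y k" unfolding k_def using LeastI_ex[OF ex] .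
  have "seq_prefix x k = seq_prefix y k" unfolding seq_prefix_eq_iff
    using not_less_Least[of _ "\<lambda>n. x n \<noteq> y n"] unfolding k_def by blast
  moreover have "d x y = W (seq_prefix x k)" using assms(3) by (simp add: gauge_dist_def common_prefix_def k_def)
  ultimately show ?thesis using that k by blast
qed

lemma gauge_dist_bounds: "x \<in> X \<Longrightarrow> y \<in> X \<Longrightarrow> 0 \<le> d x y \<and> d x y \<le> 1"
proof (cases "x = y")
  case False
  assume xy: "x \<in> X" "y \<in> X"
  obtain k where k: "d x y = W (seq_prefix x k)" using gauge_dist_prefix[OF xy False] by blast
  show ?thesis unfolding k using weight_pos[of "seq_prefix x k"] weight_le_1[of "seq_prefix x k"] seq_prefix_admissible[OF xy(1), of k] by auto
qed (simp add: gauge_dist_def)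

lemma gauge_dist_cylinder: "x \<in> cylinder A w \<Longrightarrow> y \<in> cylinder A w \<Longrightarrow> w \<in> adm \<Longrightarrow> d x y \<le> W w"
proof (cases "x = y")
  case True
  assume "w \<in> adm"
  then show ?thesis using True weight_pos[of w] by (simp add: gauge_dist_def)
next
  case False
  assume "x \<in> cylinder A w" "y \<in> cylinder A w"
  then have xy: "x \<in> X" "y \<in> X" "seq_prefix x (length w) = w" "seq_prefix y (length w) = w" by (auto simp: cylinder_def)
  obtain k where k: "d x y = W (seq_prefix x k)" "x k \<noteq> y k" using gauge_dist_prefix[OF xy(1,2) False] by blast
  have "seq_prefix x (length w) = seq_prefix y (length w)" using xy by simp
  then have "length w \<le> k" using k(2) unfolding seq_prefix_eq_iff by (metis not_less)
  then show ?thesis using weight_antimono[OF xy(1)] k(1) xy(3) by metis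
qed

lemma set_diam_ge: "U \<subseteq> X \<Longrightarrow> x \<in> U \<Longrightarrow> y \<in> U \<Longrightarrow> d x y \<le> set_diam d U"
proof -
  assume U: "U \<subseteq> X" and xy: "x \<in> U" "y \<in> U"
  have "(case (x, y) of (x, y) \<Rightarrow> d x y) \<le> (SUP (x, y)\<in>U \<times> U. d x y)"
    using U xy gauge_dist_bounds by (intro cSUP_upper bdd_aboveI[of _ 1]) auto
  then show ?thesis using xy by (auto simp: set_diam_def)
qed

lemma set_diam_nonneg: "U \<subseteq> X \<Longrightarrow> set_diam d U \<ge> 0"
proof (cases "U = {}")
  case False
  assume U: "U \<subseteq> X"
  then obtain x where "x \<in> U" using False by blast
  then show ?thesis using set_diam_ge[OF U, of x x] gauge_dist_bounds[of x x] U by auto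
qed (simp add: set_diam_def)

lemma set_diam_le: "(\<And>x y. x \<in> U \<Longrightarrow> y \<in> U \<Longrightarrow> d x y \<le> r) \<Longrightarrow> r \<ge> 0 \<Longrightarrow> set_diam d U \<le> r"
  by (auto simp: set_diam_def intro!: cSUP_least)

lemma set_diam_cylinder: "w \<in> adm \<Longrightarrow> set_diam d (cylinder A w) \<le> W w"
  using weight_pos[of w] by (intro set_diam_le gauge_dist_cylinder) auto

text \<open>Take the longest prefix that is common to all points of \<open>U\<close>. Two of the
  points differ at the next letter, and their distance is the weight of this prefix.\<close>

lemma hull_cylinder:
  assumes U: "U \<subseteq> X" and xy: "x \<in> U" "y \<in> U" "x \<noteq> y"
  obtains n where "\<And>z. z \<in> U \<Longrightarrow> seq_prefix z n = seq_prefix x n" "W (seq_prefix x n) \<le> set_diam d U"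
proof -
  define P where "P n \<longleftrightarrow> (\<exists>u\<in>U. \<exists>v\<in>U. u n \<noteq> v n)" for n
  define n where "n = (LEAST n. P n)"
  obtain j where "x j \<noteq> y j" using xy(3) by (auto simp: fun_eq_iff)
  then have ex: "\<exists>n. P n" using xy unfolding P_def by blast
  have "P n" unfolding n_def by (rule LeastI_ex[OF ex])
  then obtain u v where uv: "u \<in> U" "v \<in> U" "u n \<noteq> v n" unfolding P_def by blast
  have same: "seq_prefix z n = seq_prefix z' n" if "z \<in> U" "z' \<in> U" for z z'
    unfolding seq_prefix_eq_iff using not_less_Least[of _ P] that unfolding n_def P_def by blast
  have uvX: "u \<in> X" "v \<in> X" "u \<noteq> v" using uv U by auto
  obtain k where k: "d u v = W (seq_prefix u k)" "seq_prefix u k = seq_prefix v k" "u k \<noteq> v k"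
    using gauge_dist_prefix[OF uvX] by blast
  have "k \<le> n" using k(2) uv(3) unfolding seq_prefix_eq_iff by (metis not_less)
  moreover have "n \<le> k" using k(3) same[OF uv(1,2)] unfolding seq_prefix_eq_iff by (metis not_less)
  ultimately have "d u v = W (seq_prefix x n)" using k(1) same[OF uv(1) xy(1)] by simp
  then have "W (seq_prefix x n) \<le> set_diam d U" using set_diam_ge[OF U uv(1,2)] by simp
  then show ?thesis using that same xy(1) by blast
qed

section \<open>The mass distribution principle\<close>

text \<open>The mass distribution principle for the image under \<open>F\<close> of a probability
  measure. A set of a cover can be enlarged to a cylinder, whose mass is at most \<open>c\<close>
  times the power of its diameter; since the total mass is 1, the sum over a cover cannot be
  small.\<close>

lemma mass_distribution:
  fixes F :: "'i \<Rightarrow> nat \<Rightarrow> nat"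
  assumes P: "prob_space P" and F: "\<And>\<omega>. \<omega> \<in> space P \<Longrightarrow> F \<omega> \<in> E" and E: "E \<subseteq> X"
    and meas: "\<And>n w. {\<omega> \<in> space P. seq_prefix (F \<omega>) n = w} \<in> sets P"
    and s: "s > 0" and c: "c > 0"
    and mass: "\<And>\<omega> n. \<omega> \<in> space P \<Longrightarrow>
      emeasure P {\<omega>' \<in> space P. seq_prefix (F \<omega>') n = seq_prefix (F \<omega>) n} \<le> ennreal (c * W (seq_prefix (F \<omega>) n) powr s)"
  shows "hausdorff_outer_measure X d s E \<noteq> 0"
proof
  interpret prob_space P by (rule P)
  obtain a where a: "a > 0" "\<And>x n. x \<in> X \<Longrightarrow> W (seq_prefix x n) \<le> exp (- a * real n)" using weight_decay by blast
  \<comment> \<open>The extra \<open>e\<close> is for sets with a single point: their diameter is 0,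
    and they are enclosed in arbitrarily long cylinders.\<close>
  have cover: "\<exists>B\<in>sets P. {\<omega> \<in> space P. F \<omega> \<in> U} \<subseteq> B \<and> emeasure P B \<le> ennreal (c * set_diam d U powr s + e)"
    if U: "U \<subseteq> X" and e: "e > 0" for U e
  proof (cases "\<exists>\<omega>\<in>space P. F \<omega> \<in> U")
    case False
    then show ?thesis by (intro bexI[of _ "{}"]) auto
  next
    case True
    then obtain \<omega> where \<omega>: "\<omega> \<in> space P" "F \<omega> \<in> U" by blast
    let ?B = "\<lambda>n. {\<omega>' \<in> space P. seq_prefix (F \<omega>') n = seq_prefix (F \<omega>) n}"
    have "\<exists>n. {\<omega> \<in> space P. F \<omega> \<in> U} \<subseteq> ?B n \<and> c * W (seq_prefix (F \<omega>) n) powr s \<le> c * set_diam d U powr s + e"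
    proof (cases "\<exists>y\<in>U. y \<noteq> F \<omega>")
      case True
      then obtain y where "y \<in> U" "F \<omega> \<noteq> y" by blast
      then obtain n where n: "\<And>z. z \<in> U \<Longrightarrow> seq_prefix z n = seq_prefix (F \<omega>) n" "W (seq_prefix (F \<omega>) n) \<le> set_diam d U"
        using hull_cylinder[OF U \<omega>(2)] by metis
      have "0 \<le> W (seq_prefix (F \<omega>) n)" using weight_pos[OF seq_prefix_admissible, of "F \<omega>" n] \<omega>(2) U by auto
      then have "W (seq_prefix (F \<omega>) n) powr s \<le> set_diam d U powr s" using n(2) s by (intro powr_mono2) auto
      then have "c * W (seq_prefix (F \<omega>) n) powr s \<le> c * set_diam d U powr s" using c by simp
      then have "c * W (seq_prefix (F \<omega>) n) powr s \<le> c * set_diam d U powr s + e" using e by linarith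
      moreover have "{\<omega> \<in> space P. F \<omega> \<in> U} \<subseteq> ?B n" using n(1) by auto
      ultimately show ?thesis by blast
    next
      case False
      have x: "F \<omega> \<in> X" using \<omega>(2) U by blast
      have "(\<lambda>n. exp (- a * s * real n)) \<longlonglongrightarrow> 0"
      proof -
        have "exp (- a * s) < 1" using a s by simp
        then have "(\<lambda>n. exp (- a * s) ^ n) \<longlonglongrightarrow> 0" by (intro LIMSEQ_realpow_zero) auto
        then show ?thesis by (simp add: exp_of_nat_mult[symmetric] mult.commute)
      qed
      then have "eventually (\<lambda>n. exp (- a * s * real n) < e / c) sequentially" using e c by (intro order_tendstoD) auto
      then obtain n where n: "exp (- a * s * real n) < e / c" by (auto simp: eventually_sequentially)
      have "0 \<le> W (seq_prefix (F \<omega>) n)" using weight_pos[OF seq_prefix_admissible, of "F \<omega>" n] x by auto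
      then have "W (seq_prefix (F \<omega>) n) powr s \<le> exp (- a * real n) powr s" using a(2)[OF x] s by (intro powr_mono2) auto
      also have "\<dots> = exp (- a * s * real n)" by (simp add: powr_def mult_ac)
      finally have "c * W (seq_prefix (F \<omega>) n) powr s \<le> c * (e / c)" using n c by (intro mult_left_mono) auto
      then have "c * W (seq_prefix (F \<omega>) n) powr s \<le> c * set_diam d U powr s + e"
        using c by (simp add: add_increasing)
      moreover have "{\<omega> \<in> space P. F \<omega> \<in> U} \<subseteq> ?B n" using False by auto
      ultimately show ?thesis by blast
    qed
    then obtain n where n: "{\<omega> \<in> space P. F \<omega> \<in> U} \<subseteq> ?B n" "c * W (seq_prefix (F \<omega>) n) powr s \<le> c * set_diam d U powr s + e" by blast
    have "emeasure P (?B n) \<le> ennreal (c * set_diam d U powr s + e)"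
      using mass[OF \<omega>(1), of n] n(2) by (meson ennreal_leI order_trans)
    then show ?thesis using n(1) meas by blast
  qed
  assume zero: "hausdorff_outer_measure X d s E = 0"
  have "hausdorff_premeasure X d s 1 E \<le> hausdorff_outer_measure X d s E"
    unfolding hausdorff_outer_measure_def by (rule SUP_upper) simp
  then have "hausdorff_premeasure X d s 1 E < ennreal (1 / (4 * c))" using zero c by simp
  then obtain U where U: "E \<subseteq> (\<Union>i. U i)" "\<And>i. U i \<subseteq> X" "(\<Sum>i. ennreal (set_diam d (U i) powr s)) < ennreal (1 / (4 * c))"
    unfolding hausdorff_premeasure_def INF_less_iff by auto
  \<comment> \<open>The extra terms sum up to one half.\<close>
  have "\<forall>i. \<exists>B. B \<in> sets P \<and> {\<omega> \<in> space P. F \<omega> \<in> U i} \<subseteq> B \<and> emeasure P B \<le> ennreal (c * set_diam d (U i) powr s + (1/2) ^ (i + 2))"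
  proof
    fix i
    have "(0::real) < (1/2) ^ (i + 2)" by simp
    from cover[OF U(2)[of i] this]
    show "\<exists>B. B \<in> sets P \<and> {\<omega> \<in> space P. F \<omega> \<in> U i} \<subseteq> B \<and> emeasure P B \<le> ennreal (c * set_diam d (U i) powr s + (1/2) ^ (i + 2))"
      by blast
  qed
  from choice[OF this] obtain B where "\<forall>i. B i \<in> sets P \<and> {\<omega> \<in> space P. F \<omega> \<in> U i} \<subseteq> B i \<and>
    emeasure P (B i) \<le> ennreal (c * set_diam d (U i) powr s + (1/2) ^ (i + 2))" ..
  then have B: "\<And>i. B i \<in> sets P" "\<And>i. {\<omega> \<in> space P. F \<omega> \<in> U i} \<subseteq> B i"
    "\<And>i. emeasure P (B i) \<le> ennreal (c * set_diam d (U i) powr s + (1/2) ^ (i + 2))" by blast+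
  have "space P \<subseteq> (\<Union>i. B i)"
  proof
    fix \<omega> assume \<omega>: "\<omega> \<in> space P"
    then obtain i where "F \<omega> \<in> U i" using F U(1) by blast
    then show "\<omega> \<in> (\<Union>i. B i)" using B(2) \<omega> by blast
  qed
  then have "1 \<le> emeasure P (\<Union>i. B i)" using emeasure_space_1 emeasure_mono[of "space P" "\<Union>i. B i" P] B(1) by auto
  also have "\<dots> \<le> (\<Sum>i. emeasure P (B i))" using B(1) by (intro emeasure_subadditive_countably) auto
  also have "\<dots> \<le> (\<Sum>i. ennreal c * ennreal (set_diam d (U i) powr s) + ennreal ((1/2) ^ (i + 2)))"
    using B(3) c by (intro suminf_le) (auto simp: ennreal_mult'[symmetric] ennreal_plus[symmetric] simp del: ennreal_plus)
  also have "\<dots> = (\<Sum>i. ennreal c * ennreal (set_diam d (U i) powr s)) + (\<Sum>i. ennreal ((1/2) ^ (i + 2)))"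
    by (intro suminf_add[symmetric]) auto
  also have "(\<Sum>i. ennreal c * ennreal (set_diam d (U i) powr s)) = ennreal c * (\<Sum>i. ennreal (set_diam d (U i) powr s))"
    by (rule ennreal_suminf_cmult)
  also have "(\<Sum>i. ennreal ((1/2) ^ (i + 2))) = ennreal (1/2)"
  proof (rule suminf_ennreal_eq)
    have "(\<lambda>i. (1/4) * (1/2::real) ^ i) sums (1/4 * (1 / (1 - 1/2)))" by (intro sums_mult geometric_sums) simp
    then show "(\<lambda>i. (1/2::real) ^ (i + 2)) sums (1/2)" by (simp add: power_add mult.commute)
  qed simp
  finally have "1 \<le> ennreal c * (\<Sum>i. ennreal (set_diam d (U i) powr s)) + ennreal (1/2)" .
  also have "\<dots> \<le> ennreal c * ennreal (1 / (4 * c)) + ennreal (1/2)"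
    using U(3) by (intro add_mono mult_left_mono) auto
  also have "ennreal c * ennreal (1 / (4 * c)) = ennreal (1/4)" using c by (simp add: ennreal_mult'[symmetric])
  also have "ennreal (1/4) + ennreal (1/2) = ennreal (1/4 + 1/2)" by (rule ennreal_plus[symmetric]) simp_all
  finally have "ennreal 1 \<le> ennreal (1/4 + 1/2)" by simp
  then show False by (subst (asm) ennreal_le_iff) simp_all
qed

end

section \<open>Moran sets\<close>

locale moran = sft +
  fixes len :: "nat \<Rightarrow> nat" and D :: "nat \<Rightarrow> nat list set"
  assumes D_finite: "\<And>i. finite (D i)" and D_nonempty: "\<And>i. D i \<noteq> {}" and D_loops: "\<And>i. D i \<subseteq> loops"
    and D_length: "\<And>i u. u \<in> D i \<Longrightarrow> length u = len i" and len_pos: "\<And>i. len i \<ge> 1"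
begin

definition start :: "nat \<Rightarrow> nat" where "start i = (\<Sum>j<i. len j)"

text \<open>Since blocks are not empty, the first \<open>n + 1\<close> of them contain the letter
  with index \<open>n\<close>.\<close>

definition glue :: "(nat \<Rightarrow> nat list) \<Rightarrow> nat \<Rightarrow> nat" where
  "glue b n = concat (map b [0..<Suc n]) ! n"

abbreviation codes :: "(nat \<Rightarrow> nat list) set" where "codes \<equiv> Pi\<^sub>E UNIV D"

lemma start_simps [simp]: "start 0 = 0" "start (Suc i) = start i + len i"
  by (simp_all add: start_def)

lemma start_ge: "i \<le> start i"
proof (induction i)
  case (Suc i)
  then show ?case using len_pos[of i] by simp
qed simp

lemma start_mono: "i \<le> j \<Longrightarrow> start i \<le> start j"
  unfolding start_def by (rule sum_mono2) auto

lemma block_of: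
  obtains i where "start i \<le> n" "n < start (Suc i)"
proof -
  define i where "i = (LEAST i. n < start (Suc i))"
  have "n < start (Suc n)" using start_ge[of "Suc n"] by linarith
  then have 1: "n < start (Suc i)" unfolding i_def by (rule LeastI)
  have "start i \<le> n"
  proof (cases i)
    case (Suc k)
    then have "\<not> n < start (Suc k)" using not_less_Least[of k "\<lambda>i. n < start (Suc i)"] unfolding i_def by simp
    then show ?thesis using Suc by simp
  qed simp
  then show ?thesis using 1 that by blast
qed

lemma codeD: "b \<in> codes \<Longrightarrow> b i \<in> D i"
  by (auto simp: PiE_def)

lemma length_concat_code: "b \<in> codes \<Longrightarrow> length (concat (map b [0..<i])) = start i"
  by (induction i) (auto simp: D_length[OF codeD])

lemma glue_nth:
  assumes b: "b \<in> codes" and n: "n < start i"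
  shows "glue b n = concat (map b [0..<i]) ! n"
proof -
  have mono: "concat (map b [0..<k]) ! n = concat (map b [0..<l]) ! n" if "n < start k" "k \<le> l" for k l
    using that(2)
  proof (induction rule: dec_induct)
    case (step l)
    have "n < start l" using that(1) start_mono[OF step(1)] by linarith
    then show ?case using step length_concat_code[OF b, of l] by (simp add: nth_append)
  qed simp
  have "n < start (Suc n)" using start_ge[of "Suc n"] by linarith
  show ?thesis
  proof (cases "Suc n \<le> i")
    case True
    show ?thesis unfolding glue_def by (rule mono[OF \<open>n < start (Suc n)\<close> True])
  next
    case False
    then have "i \<le> Suc n" by simp
    from mono[OF n this] show ?thesis unfolding glue_def by (rule sym)
  qed
qed

lemma prefix_glue:
  assumes b: "b \<in> codes"
  shows "seq_prefix (glue b) (start i) = concat (map b [0..<i])"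
  using glue_nth[OF b, of _ i] length_concat_code[OF b, of i] by (auto intro!: nth_equalityI)

lemma prefix_glue_shift:
  assumes b: "b \<in> codes"
  shows "seq_prefix ((shift ^^ start i) (glue b)) (len i) = b i"
proof -
  have "seq_prefix (glue b) (start i + len i) = concat (map b [0..<i]) @ b i"
    using prefix_glue[OF b, of "Suc i"] by simp
  then show ?thesis unfolding seq_prefix_add prefix_glue[OF b] by simp
qed

lemma glue_in_X:
  assumes b: "b \<in> codes"
  shows "glue b \<in> X"
  unfolding subshift_iff
proof
  fix n
  have "concat (map b [0..<Suc n]) \<in> loops"
    using D_loops codeD[OF b] by (intro concat_loops) auto
  then have "seq_prefix (glue b) (start (Suc n)) \<in> adm" unfolding prefix_glue[OF b] by (simp add: loops_def)
  then have "take n (seq_prefix (glue b) (start (Suc n))) \<in> adm" by (rule admissible_take)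
  moreover have "n \<le> start (Suc n)" using start_ge[of "Suc n"] by linarith
  ultimately show "seq_prefix (glue b) n \<in> adm" by (simp add: take_seq_prefix del: start_simps)
qed

definition code_measure :: "(nat \<Rightarrow> nat list) measure" where
  "code_measure = PiM UNIV (\<lambda>i. uniform_count_measure (D i))"

lemma product_codes: "product_prob_space (\<lambda>i. uniform_count_measure (D i))"
proof -
  have "prob_space (uniform_count_measure (D i))" for i
    using D_finite D_nonempty by (intro prob_space_uniform_count_measure)
  then show ?thesis
    unfolding product_prob_space_def product_prob_space_axioms_def product_sigma_finite_def
    using prob_space_imp_sigma_finite by blast
qed

lemma prob_code_measure: "prob_space code_measure"
  unfolding code_measure_def using D_finite D_nonempty
  by (intro prob_space_PiM prob_space_uniform_count_measure)

lemma space_code_measure: "space code_measure = codes"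
  by (simp add: code_measure_def space_PiM space_uniform_count_measure)

lemma code_cylinder:
  assumes v: "\<And>j. j < i \<Longrightarrow> v j \<in> D j"
  shows "{b \<in> codes. \<forall>j<i. b j = v j} \<in> sets code_measure"
    "emeasure code_measure {b \<in> codes. \<forall>j<i. b j = v j} = ennreal (\<Prod>j<i. 1 / real (card (D j)))"
proof -
  interpret product_prob_space "\<lambda>i. uniform_count_measure (D i)" UNIV by (rule product_codes)
  have eq: "{b \<in> codes. \<forall>j<i. b j = v j} = prod_emb UNIV (\<lambda>i. uniform_count_measure (D i)) {..<i} (Pi\<^sub>E {..<i} (\<lambda>j. {v j}))"
    by (auto simp: prod_emb_def space_uniform_count_measure PiE_def Pi_def extensional_def restrict_def)
  have sets: "{v j} \<in> sets (uniform_count_measure (D j))" if "j < i" for j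
    using v[OF that] by (simp add: sets_uniform_count_measure)
  show "{b \<in> codes. \<forall>j<i. b j = v j} \<in> sets code_measure"
    unfolding eq code_measure_def using sets by (intro sets_PiM_I) auto
  have "emeasure code_measure {b \<in> codes. \<forall>j<i. b j = v j} = (\<Prod>j<i. emeasure (uniform_count_measure (D j)) {v j})"
    unfolding eq code_measure_def using sets by (intro emeasure_PiM_emb) auto
  also have "\<dots> = (\<Prod>j<i. ennreal (1 / real (card (D j))))"
  proof (intro prod.cong refl)
    fix j assume "j \<in> {..<i}"
    then have "{v j} \<subseteq> D j" using v by simp
    then show "emeasure (uniform_count_measure (D j)) {v j} = ennreal (1 / real (card (D j)))"
      using D_finite[of j] by (subst emeasure_uniform_count_measure) auto
  qed
  also have "\<dots> = ennreal (\<Prod>j<i. 1 / real (card (D j)))" by (intro prod_ennreal) simp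
  finally show "emeasure code_measure {b \<in> codes. \<forall>j<i. b j = v j} = ennreal (\<Prod>j<i. 1 / real (card (D j)))" .
qed

lemma glue_measurable:
  "{b \<in> space code_measure. seq_prefix (glue b) n = w} \<in> sets code_measure"
proof -
  define V where "V = {v \<in> Pi\<^sub>E {..<n} D. take n (concat (map v [0..<n])) = w}"
  have fV: "finite V" unfolding V_def using D_finite by (intro finite_subset[OF _ finite_PiE[of "{..<n}" D]]) auto
  have eq: "{b \<in> codes. seq_prefix (glue b) n = w} = (\<Union>v\<in>V. {b \<in> codes. \<forall>j<n. b j = v j})"
  proof -
    have pre: "seq_prefix (glue b) n = take n (concat (map b [0..<n]))" if "b \<in> codes" for b
      using prefix_glue[OF that, of n] take_seq_prefix[OF start_ge[of n], of "glue b"] by simp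
    show ?thesis
    proof (intro equalityI subsetI)
      fix b assume "b \<in> {b \<in> codes. seq_prefix (glue b) n = w}"
      then have b: "b \<in> codes" "take n (concat (map b [0..<n])) = w" using pre by auto
      define v where "v = restrict b {..<n}"
      have mv: "map v [0..<n] = map b [0..<n]" by (simp add: v_def)
      have "v \<in> Pi\<^sub>E {..<n} D" using b(1) by (auto simp: v_def PiE_def Pi_def extensional_def)
      then have "v \<in> V" using b(2) unfolding V_def mem_Collect_eq mv by blast
      moreover have "\<forall>j<n. b j = v j" by (simp add: v_def)
      ultimately show "b \<in> (\<Union>v\<in>V. {b \<in> codes. \<forall>j<n. b j = v j})" using b(1) by blast
    next
      fix b assume "b \<in> (\<Union>v\<in>V. {b \<in> codes. \<forall>j<n. b j = v j})"
      then obtain v where v: "v \<in> V" "b \<in> codes" "\<forall>j<n. b j = v j" by blast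
      then have mv: "map v [0..<n] = map b [0..<n]" by simp
      have "take n (concat (map v [0..<n])) = w" using v(1) unfolding V_def by blast
      then have "take n (concat (map b [0..<n])) = w" unfolding mv .
      then show "b \<in> {b \<in> codes. seq_prefix (glue b) n = w}" using pre[OF v(2)] v(2) by simp
    qed
  qed
  have meas: "{b \<in> codes. \<forall>j<n. b j = v j} \<in> sets code_measure" if "v \<in> V" for v
  proof (rule code_cylinder(1))
    have "v \<in> Pi\<^sub>E {..<n} D" using that unfolding V_def by blast
    then show "v j \<in> D j" if "j < n" for j using that PiE_mem[of v "{..<n}" D j] by simp
  qed
  show ?thesis unfolding space_code_measure eq using fV meas by (rule sets.finite_UN)
qed

text \<open>The prefix determines the first \<open>i\<close> blocks.\<close>

lemma glue_mass:
  assumes b: "b \<in> codes" and n: "start i \<le> n"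
  shows "emeasure code_measure {b' \<in> space code_measure. seq_prefix (glue b') n = seq_prefix (glue b) n}
    \<le> ennreal (exp (- (\<Sum>j<i. ln (real (card (D j))))))"
proof -
  have "{b' \<in> codes. seq_prefix (glue b') n = seq_prefix (glue b) n} \<subseteq> {b' \<in> codes. \<forall>j<i. b' j = b j}"
  proof
    fix b' assume "b' \<in> {b' \<in> codes. seq_prefix (glue b') n = seq_prefix (glue b) n}"
    then have b': "b' \<in> codes" "seq_prefix (glue b') n = seq_prefix (glue b) n" by auto
    then have "seq_prefix (glue b') (start i) = seq_prefix (glue b) (start i)" using n seq_prefix_mono by blast
    then have eq: "concat (map b' [0..<i]) = concat (map b [0..<i])" unfolding prefix_glue[OF b'(1)] prefix_glue[OF b] .
    have "map b' [0..<i] = map b [0..<i]"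
    proof (rule concat_injective[OF eq])
      show "\<forall>(x, y)\<in>set (zip (map b' [0..<i]) (map b [0..<i])). length x = length y"
        using D_length[OF codeD[OF b]] D_length[OF codeD[OF b'(1)]] by (auto simp: set_zip)
    qed simp
    then show "b' \<in> {b' \<in> codes. \<forall>j<i. b' j = b j}" using b'(1) by simp
  qed
  then have "emeasure code_measure {b' \<in> codes. seq_prefix (glue b') n = seq_prefix (glue b) n}
      \<le> emeasure code_measure {b' \<in> codes. \<forall>j<i. b' j = b j}"
    by (rule emeasure_mono) (rule code_cylinder(1)[OF codeD[OF b]])
  also have "\<dots> = ennreal (\<Prod>j<i. 1 / real (card (D j)))" by (rule code_cylinder(2)[OF codeD[OF b]])
  also have "(\<Prod>j<i. 1 / real (card (D j))) = (\<Prod>j<i. exp (- ln (real (card (D j)))))"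
  proof (intro prod.cong refl)
    fix j
    have "real (card (D j)) > 0" using D_finite[of j] D_nonempty[of j] by (simp add: card_gt_0_iff)
    then show "1 / real (card (D j)) = exp (- ln (real (card (D j))))" by (simp add: exp_minus inverse_eq_divide)
  qed
  also have "\<dots> = exp (- (\<Sum>j<i. ln (real (card (D j)))))" by (simp add: exp_sum sum_negf[symmetric])
  finally show ?thesis unfolding space_code_measure .
qed

lemma birkhoff_glue:
  fixes F :: "(nat \<Rightarrow> nat) \<Rightarrow> 'b::real_normed_vector"
  assumes b: "b \<in> codes"
    and F: "\<And>j y. y \<in> X \<Longrightarrow> seq_prefix y (len j) = b j \<Longrightarrow> norm ((\<Sum>i<len j. F ((shift ^^ i) y)) - real (len j) *\<^sub>R \<mu>) \<le> e j"
  shows "norm ((\<Sum>i<start k. F ((shift ^^ i) (glue b))) - real (start k) *\<^sub>R \<mu>) \<le> (\<Sum>j<k. e j)"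
proof (induction k)
  case (Suc k)
  let ?y = "(shift ^^ start k) (glue b)"
  have y: "?y \<in> X" using glue_in_X[OF b] by (rule shift_pow_subshift)
  have eq: "(\<Sum>i<start (Suc k). F ((shift ^^ i) (glue b))) - real (start (Suc k)) *\<^sub>R \<mu>
     = ((\<Sum>i<start k. F ((shift ^^ i) (glue b))) - real (start k) *\<^sub>R \<mu>) + ((\<Sum>i<len k. F ((shift ^^ i) ?y)) - real (len k) *\<^sub>R \<mu>)"
    by (simp add: birkhoff_add scaleR_left_distrib)
  show ?case unfolding eq using norm_triangle_le[OF add_mono[OF Suc F[OF y prefix_glue_shift[OF b]]]] by simp
qed simp

end

text \<open>The condition \<open>delta_len\<close> allows for a constant error in each block,
  \<open>slow\<close> for an arbitrary behaviour in the last, incomplete block of a prefix.\<close>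

locale typical_moran = moran +
  fixes \<delta> :: "nat \<Rightarrow> real" and h :: real
  assumes delta_pos: "\<And>i. \<delta> i > 0" and delta_lim: "\<delta> \<longlonglongrightarrow> 0" and delta_len: "\<And>i. \<delta> i * real (len i) \<ge> 1"
    and slow: "(\<lambda>i. real (len i) / real (start i)) \<longlonglongrightarrow> 0"
    and many: "\<And>i. real (len i) * (h - \<delta> i) \<le> ln (real (card (D i)))"
begin

text \<open>Only finitely many \<open>\<delta> j\<close> exceed \<open>\<eta>\<close>.\<close>

lemma small_weight:
  assumes \<eta>: "\<eta> > 0"
  obtains c where "c \<ge> 0" "\<And>i. (\<Sum>j<i. \<delta> j * real (len j)) \<le> \<eta> * real (start i) + c"
proof -
  obtain J where J: "\<And>j. j \<ge> J \<Longrightarrow> \<delta> j < \<eta>"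
    using order_tendstoD(2)[OF delta_lim \<eta>] by (auto simp: eventually_sequentially)
  show ?thesis
  proof (rule that[of "\<Sum>j<J. \<delta> j * real (len j)"])
    show "0 \<le> (\<Sum>j<J. \<delta> j * real (len j))" by (intro sum_nonneg mult_nonneg_nonneg[OF less_imp_le[OF delta_pos] of_nat_0_le_iff])
    fix i
    have "(\<Sum>j<i. \<delta> j * real (len j)) \<le> (\<Sum>j<i. \<eta> * real (len j) + (if j < J then \<delta> j * real (len j) else 0))"
    proof (rule sum_mono)
      fix j
      show "\<delta> j * real (len j) \<le> \<eta> * real (len j) + (if j < J then \<delta> j * real (len j) else 0)"
        using J[of j] \<eta> by (auto simp: not_less intro!: mult_right_mono)
    qed
    also have "\<dots> = \<eta> * real (start i) + (\<Sum>j<i. if j < J then \<delta> j * real (len j) else 0)"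
      by (simp add: sum.distrib start_def sum_distrib_left)
    also have "(\<Sum>j<i. if j < J then \<delta> j * real (len j) else 0) = (\<Sum>j\<in>{..<i} \<inter> {..<J}. \<delta> j * real (len j))"
      by (simp add: sum.If_cases lessThan_def Int_def)
    also have "\<dots> \<le> (\<Sum>j<J. \<delta> j * real (len j))"
      by (intro sum_mono2 mult_nonneg_nonneg[OF less_imp_le[OF delta_pos] of_nat_0_le_iff]) auto
    finally show "(\<Sum>j<i. \<delta> j * real (len j)) \<le> \<eta> * real (start i) + (\<Sum>j<J. \<delta> j * real (len j))" by simp
  qed
qed

lemma slow_bound:
  assumes e: "e > 0"
  obtains I where "\<And>i. i \<ge> I \<Longrightarrow> real (len i) \<le> e * real (start i)"
proof -
  obtain I where I: "\<And>i. i \<ge> I \<Longrightarrow> real (len i) / real (start i) < e"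
    using order_tendstoD(2)[OF slow e] by (auto simp: eventually_sequentially)
  show ?thesis
  proof (rule that[of "Suc I"])
    fix i assume i: "i \<ge> Suc I"
    then have "real (start i) > 0" using start_ge[of i] by simp
    then show "real (len i) \<le> e * real (start i)" using I[of i] i by (simp add: field_simps)
  qed
qed

text \<open>The blocks that are completed before position \<open>n\<close> contain all but a small
  fraction of the first \<open>n\<close> letters.\<close>

lemma many_digits:
  assumes \<eta>: "\<eta> > 0" and h0: "h \<ge> 0"
  obtains N where "\<And>n i. n \<ge> N \<Longrightarrow> start i \<le> n \<Longrightarrow> n < start (Suc i) \<Longrightarrow> real n * (h - \<eta>) \<le> (\<Sum>j<i. ln (real (card (D j))))"
proof -
  define e where "e = \<eta> / 3"
  have e: "e > 0" using \<eta> by (simp add: e_def)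
  obtain c where c: "c \<ge> 0" "\<And>i. (\<Sum>j<i. \<delta> j * real (len j)) \<le> e * real (start i) + c" using small_weight[OF e] by blast
  have "e / (h + 1) > 0" using e h0 by simp
  then obtain I where I: "\<And>i. i \<ge> I \<Longrightarrow> real (len i) \<le> e / (h + 1) * real (start i)" using slow_bound by blast
  obtain N0 :: nat where N0: "c / e < real N0" using reals_Archimedean2 by blast
  show ?thesis
  proof (rule that[of "max N0 (start I)"])
    fix n i assume n: "n \<ge> max N0 (start I)" "start i \<le> n" "n < start (Suc i)"
    have iI: "i \<ge> I"
    proof (rule ccontr)
      assume "\<not> i \<ge> I"
      then have "start (Suc i) \<le> start I" by (intro start_mono) simp
      then show False using n by simp
    qed
    have "(\<Sum>j<i. real (len j) * h) - (\<Sum>j<i. \<delta> j * real (len j)) \<le> (\<Sum>j<i. ln (real (card (D j))))"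
      unfolding sum_subtractf[symmetric] using many by (intro sum_mono) (simp add: algebra_simps)
    moreover have "(\<Sum>j<i. real (len j) * h) = real (start i) * h" by (simp add: start_def sum_distrib_right)
    moreover have "real (start i) * h \<ge> real n * h - e * real n"
    proof -
      have "(real n - real (start i)) * h \<le> real (len i) * h" using n(3) h0 by (intro mult_right_mono) auto
      also have "\<dots> \<le> (e / (h + 1) * real (start i)) * (h + 1)" using I[OF iI] h0 by (intro mult_mono) auto
      also have "\<dots> = e * real (start i)" using h0 by simp
      also have "\<dots> \<le> e * real n" using n(2) e by simp
      finally show ?thesis by (simp add: algebra_simps)
    qed
    moreover have "c \<le> e * real n"
    proof -
      have "c / e < real n" using N0 n(1) by simp
      then show ?thesis using e by (simp add: field_simps)
    qed
    moreover have "e * real (start i) \<le> e * real n" using n(2) e by simp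
    ultimately have "real n * h - 3 * (e * real n) \<le> (\<Sum>j<i. ln (real (card (D j))))" using c(2)[of i] by linarith
    then show "real n * (h - \<eta>) \<le> (\<Sum>j<i. ln (real (card (D j))))" by (simp add: e_def algebra_simps)
  qed
qed

text \<open>The approximating Birkhoff sum is cut at the block boundaries. Each block contributes an
  error of \<open>K\<close>, which is at most \<open>K\<close> times \<open>\<delta> j len
  j\<close>, besides the errors per letter. The incomplete block at the end is estimated
  trivially.\<close>

lemma glue_averages:
  fixes \<theta> :: "nat \<Rightarrow> (nat \<Rightarrow> nat) \<Rightarrow> 'b::real_normed_vector"
  assumes aa: "asymp_additive A \<theta>" and \<eta>: "\<eta> > 0"
    and typl: "\<And>i x. x \<in> X \<Longrightarrow> seq_prefix x (len i) \<in> D i \<Longrightarrow> norm (\<theta> (len i) x - real (len i) *\<^sub>R \<mu>) \<le> \<delta> i * real (len i)"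
  obtains N where "\<And>n b. n \<ge> N \<Longrightarrow> b \<in> codes \<Longrightarrow> norm (\<theta> n (glue b) - real n *\<^sub>R \<mu>) \<le> \<eta> * real n"
proof -
  define e where "e = \<eta> / 5"
  have e: "e > 0" using \<eta> by (simp add: e_def)
  obtain q G K where K: "K \<ge> 0" and G: "\<And>n x. n \<ge> 1 \<Longrightarrow> x \<in> X \<Longrightarrow>
    norm (\<theta> n x - (\<Sum>i<n. G (seq_prefix ((shift ^^ i) x) q))) \<le> e * real n + K"
    using asymp_additiveD[OF aa e] by metis
  let ?F = "\<lambda>x. G (seq_prefix x q)"
  define B where "B = word_bound q G + norm \<mu>"
  have B: "B \<ge> 0" using word_bound_nonneg[of q G] by (simp add: B_def)
  have "e / (K + 1) > 0" using e K by simp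
  then obtain c where c: "c \<ge> 0" "\<And>i. (\<Sum>j<i. \<delta> j * real (len j)) \<le> e / (K + 1) * real (start i) + c" using small_weight by blast
  have "e / (B + 1) > 0" using e B by simp
  then obtain I where I: "\<And>i. i \<ge> I \<Longrightarrow> real (len i) \<le> e / (B + 1) * real (start i)" using slow_bound by blast
  define C where "C = K + (K + 1) * c"
  obtain N0 :: nat where N0: "C / e < real N0" using reals_Archimedean2 by blast
  show ?thesis
  proof (rule that[of "Suc (max N0 (start I))"])
    fix n b assume n: "n \<ge> Suc (max N0 (start I))" and b: "b \<in> codes"
    obtain i where i: "start i \<le> n" "n < start (Suc i)" by (rule block_of)
    have iI: "i \<ge> I"
    proof (rule ccontr)
      assume "\<not> i \<ge> I"
      then have "start (Suc i) \<le> start I" by (intro start_mono) simp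
      then show False using n i by simp
    qed
    have x: "glue b \<in> X" by (rule glue_in_X[OF b])
    have 1: "norm (\<theta> n (glue b) - (\<Sum>i<n. ?F ((shift ^^ i) (glue b)))) \<le> e * real n + K" using n x by (intro G) auto
    have 2: "norm ((\<Sum>j<start i. ?F ((shift ^^ j) (glue b))) - real (start i) *\<^sub>R \<mu>)
      \<le> (\<Sum>j<i. (e * real (len j) + K) + \<delta> j * real (len j))"
    proof (rule birkhoff_glue[OF b])
      fix j y assume y: "y \<in> X" "seq_prefix y (len j) = b j"
      have a: "norm ((\<Sum>i<len j. ?F ((shift ^^ i) y)) - \<theta> (len j) y) \<le> e * real (len j) + K"
        using G[OF len_pos[of j] y(1)] by (simp add: norm_minus_commute)
      have t: "norm (\<theta> (len j) y - real (len j) *\<^sub>R \<mu>) \<le> \<delta> j * real (len j)"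
        using typl[OF y(1)] codeD[OF b, of j] y(2) by simp
      show "norm ((\<Sum>i<len j. ?F ((shift ^^ i) y)) - real (len j) *\<^sub>R \<mu>) \<le> (e * real (len j) + K) + \<delta> j * real (len j)"
        using norm_triangle_le[OF add_mono[OF a t]] by simp
    qed
    have K': "(\<Sum>j<i. (e * real (len j) + K) + \<delta> j * real (len j)) \<le> e * real (start i) + (K + 1) * (\<Sum>j<i. \<delta> j * real (len j))"
    proof -
      have "(\<Sum>j<i. (e * real (len j) + K) + \<delta> j * real (len j)) \<le> (\<Sum>j<i. e * real (len j) + (K + 1) * (\<delta> j * real (len j)))"
      proof (rule sum_mono)
        fix j
        have "K * 1 \<le> K * (\<delta> j * real (len j))" using K delta_len[of j] by (intro mult_left_mono)
        then show "(e * real (len j) + K) + \<delta> j * real (len j) \<le> e * real (len j) + (K + 1) * (\<delta> j * real (len j))"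
          by (simp add: distrib_right)
      qed
      then show ?thesis by (simp add: sum.distrib sum_distrib_left start_def)
    qed
    have K2: "(K + 1) * (\<Sum>j<i. \<delta> j * real (len j)) \<le> e * real (start i) + (K + 1) * c"
    proof -
      have "(K + 1) * (\<Sum>j<i. \<delta> j * real (len j)) \<le> (K + 1) * (e / (K + 1) * real (start i) + c)" using c(2)[of i] K by (intro mult_left_mono) auto
      also have "\<dots> = e * real (start i) + (K + 1) * c" using K by (simp add: distrib_left)
      finally show ?thesis .
    qed
    define r where "r = n - start i"
    have nr: "n = start i + r" "r \<le> len i" using i by (auto simp: r_def)
    let ?y = "(shift ^^ start i) (glue b)"
    have 3: "norm ((\<Sum>j<r. ?F ((shift ^^ j) ?y)) - real r *\<^sub>R \<mu>) \<le> e * real (start i)"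
    proof -
      have "norm ((\<Sum>j<r. ?F ((shift ^^ j) ?y)) - real r *\<^sub>R \<mu>) \<le> norm (\<Sum>j<r. ?F ((shift ^^ j) ?y)) + norm (real r *\<^sub>R \<mu>)" by (rule norm_triangle_ineq4)
      also have "\<dots> \<le> real r * word_bound q G + real r * norm \<mu>" using shift_pow_subshift[OF x] by (intro add_mono norm_birkhoff_le) auto
      also have "\<dots> = real r * B" by (simp add: B_def distrib_left)
      also have "\<dots> \<le> (e / (B + 1) * real (start i)) * (B + 1)" using I[OF iI] nr(2) B by (intro mult_mono) auto
      also have "\<dots> = e * real (start i)" using B by simp
      finally show ?thesis .
    qed
    have split: "(\<Sum>i<n. ?F ((shift ^^ i) (glue b))) - real n *\<^sub>R \<mu>
       = ((\<Sum>j<start i. ?F ((shift ^^ j) (glue b))) - real (start i) *\<^sub>R \<mu>) + ((\<Sum>j<r. ?F ((shift ^^ j) ?y)) - real r *\<^sub>R \<mu>)"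
      unfolding nr(1) birkhoff_add[of ?F] by (simp add: scaleR_left_distrib)
    have 4: "norm ((\<Sum>i<n. ?F ((shift ^^ i) (glue b))) - real n *\<^sub>R \<mu>) \<le> (e * real (start i) + (e * real (start i) + (K + 1) * c)) + e * real (start i)"
      unfolding split using 2 K' K2 3 by (intro norm_triangle_le) linarith
    have "norm (\<theta> n (glue b) - real n *\<^sub>R \<mu>) \<le> (e * real n + K) + ((e * real (start i) + (e * real (start i) + (K + 1) * c)) + e * real (start i))"
      using norm_triangle_le[OF add_mono[OF 1 4]] by simp
    also have "\<dots> = e * real n + 3 * (e * real (start i)) + C" by (simp add: C_def)
    also have "\<dots> \<le> e * real n + 3 * (e * real n) + e * real n"
    proof (intro add_mono order_refl)
      show "3 * (e * real (start i)) \<le> 3 * (e * real n)" using i(1) e by simp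
      have "C / e < real n" using N0 n by linarith
      then show "C \<le> e * real n" using e by (simp add: field_simps)
    qed
    also have "\<dots> = \<eta> * real n" by (simp add: e_def)
    finally show "norm (\<theta> n (glue b) - real n *\<^sub>R \<mu>) \<le> \<eta> * real n" .
  qed
qed

end

text \<open>The largest \<open>k \<le> i\<close> with \<open>k (l k) \<le> i\<close>: one waits
  until the length \<open>l k\<close> is short in comparison with the time \<open>i\<close>.\<close>

lemma slow_index:
  fixes l :: "nat \<Rightarrow> nat"
  obtains k :: "nat \<Rightarrow> nat" where "filterlim k at_top sequentially" "\<forall>i. k i * l (k i) \<le> i"
proof -
  define k where "k i = Max {k. k \<le> i \<and> k * l k \<le> i}" for i
  have fin: "finite {k. k \<le> i \<and> k * l k \<le> i}" for i by simp
  have ne: "{k. k \<le> i \<and> k * l k \<le> i} \<noteq> {}" for i using zero_le by (auto intro!: exI[of _ 0])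
  have 1: "k i * l (k i) \<le> i" for i using Max_in[OF fin ne] unfolding k_def by blast
  have 2: "filterlim k at_top sequentially"
  proof (rule filterlim_at_top[THEN iffD2], rule allI)
    fix Z :: nat
    show "eventually (\<lambda>i. Z \<le> k i) sequentially"
    proof (rule eventually_sequentiallyI)
      fix i assume "Z + Z * l Z \<le> i"
      then have "Z \<in> {k. k \<le> i \<and> k * l k \<le> i}" by auto
      then show "Z \<le> k i" unfolding k_def using fin by (intro Max_ge)
    qed
  qed
  show ?thesis using that[OF 2] 1 by blast
qed

context neg_potential
begin

text \<open>Blocks of precision \<open>1 / (k + 1)\<close> exist for every \<open>k\<close>. They
  are used so often that the length of the next better blocks is negligible when it is their
  turn.\<close>

lemma typical_moran_exists:
  fixes \<theta> :: "nat \<Rightarrow> (nat \<Rightarrow> nat) \<Rightarrow> 'b::euclidean_space"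
  assumes M: "M \<in> invariant_measures A" and aa: "asymp_additive A \<theta>"
  obtains len D \<delta> where "typical_moran A len D \<delta> (entropy_rate (word_prob M))"
    "\<forall>i. \<forall>u\<in>D i. \<forall>x\<in>X. seq_prefix x (len i) = u \<longrightarrow>
      norm (\<theta> (len i) x - real (len i) *\<^sub>R asymptotic_mean \<theta> M) \<le> \<delta> i * real (len i)"
proof -
  let ?h = "entropy_rate (word_prob M)" and ?\<mu> = "asymptotic_mean \<theta> M"
  define \<epsilon> where "\<epsilon> k = 1 / real (Suc k)" for k
  have \<epsilon>: "\<epsilon> k > 0" for k by (simp add: \<epsilon>_def)
  define P where "P k lW \<longleftrightarrow> (case lW of (l, Ws) \<Rightarrow> real l \<ge> 1 / \<epsilon> k \<and> l \<ge> 1 \<and> finite Ws \<and> Ws \<noteq> {} \<and> Ws \<subseteq> loops \<and>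
    (\<forall>u\<in>Ws. length u = l) \<and> real l * (?h - \<epsilon> k) \<le> ln (real (card Ws)) \<and>
    (\<forall>u\<in>Ws. \<forall>x\<in>X. seq_prefix x l = u \<longrightarrow> norm (\<theta> l x - real l *\<^sub>R ?\<mu>) \<le> \<epsilon> k * real l))" for k lW
  have "\<forall>k. \<exists>lW. P k lW"
  proof
    fix k
    show "\<exists>lW. P k lW"
    proof (rule typical_loops[OF M aa \<epsilon>[of k]])
      fix l Ws
      assume "real l \<ge> 1 / \<epsilon> k" "l \<ge> 1" "finite Ws" "Ws \<noteq> {}" "Ws \<subseteq> loops" "\<And>u. u \<in> Ws \<Longrightarrow> length u = l"
        "real l * (?h - \<epsilon> k) \<le> ln (real (card Ws))"
        "\<And>u x. u \<in> Ws \<Longrightarrow> x \<in> X \<Longrightarrow> seq_prefix x l = u \<Longrightarrow> norm (\<theta> l x - real l *\<^sub>R ?\<mu>) \<le> \<epsilon> k * real l"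
      then have "P k (l, Ws)" unfolding P_def by simp
      then show ?thesis by blast
    qed
  qed
  from choice[OF this] obtain lW where lW: "\<And>k. P k (lW k)" by blast
  define l where "l k = fst (lW k)" for k
  define V where "V k = snd (lW k)" for k
  have lV: "real (l k) \<ge> 1 / \<epsilon> k" "l k \<ge> 1" "finite (V k)" "V k \<noteq> {}" "V k \<subseteq> loops"
    "\<forall>u\<in>V k. length u = l k" "real (l k) * (?h - \<epsilon> k) \<le> ln (real (card (V k)))"
    "\<forall>u\<in>V k. \<forall>x\<in>X. seq_prefix x (l k) = u \<longrightarrow> norm (\<theta> (l k) x - real (l k) *\<^sub>R ?\<mu>) \<le> \<epsilon> k * real (l k)" for k
    using lW[of k] unfolding P_def l_def V_def by (simp_all add: case_prod_unfold)
  obtain k where k0: "filterlim k at_top sequentially" "\<forall>i. k i * l (k i) \<le> i" by (rule slow_index[of l])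
  note k = k0(1) k0(2)[rule_format]
  define len D \<delta> where "len = l \<circ> k" and "D = V \<circ> k" and "\<delta> = \<epsilon> \<circ> k"
  interpret moran A len D
    using lV by unfold_locales (auto simp: len_def D_def)
  have "typical_moran A len D \<delta> ?h"
  proof unfold_locales
    show "\<delta> i > 0" for i by (simp add: \<delta>_def \<epsilon>)
    have \<epsilon>0: "\<epsilon> \<longlonglongrightarrow> 0" unfolding \<epsilon>_def using LIMSEQ_inverse_real_of_nat by (simp add: inverse_eq_divide)
    show "\<delta> \<longlonglongrightarrow> 0" unfolding \<delta>_def comp_def using filterlim_compose[OF \<epsilon>0 k(1)] .
    show "1 \<le> \<delta> i * real (len i)" for i
      using lV(1)[of "k i"] \<epsilon>[of "k i"] by (simp add: \<delta>_def len_def field_simps)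
    show "real (len i) * (?h - \<delta> i) \<le> ln (real (card (D i)))" for i
      using lV(7)[of "k i"] by (simp add: len_def D_def \<delta>_def)
    have kr: "filterlim (\<lambda>i. real (k i)) at_top sequentially"
      using k(1) by (rule filterlim_compose[OF filterlim_real_sequentially])
    have inv: "(\<lambda>i. 1 / real (k i)) \<longlonglongrightarrow> 0"
      by (rule tendsto_divide_0[OF tendsto_const filterlim_at_top_imp_at_infinity[OF kr]])
    have ev: "eventually (\<lambda>i. norm (real (len i) / real (start i)) \<le> 1 / real (k i)) sequentially"
    proof -
      have "eventually (\<lambda>i. 1 \<le> k i) sequentially" using k(1) by (simp add: filterlim_at_top)
      then show ?thesis
      proof eventually_elim
        case (elim i)
        have "k i * len i \<le> start i" using k(2)[of i] start_ge[of i] by (simp add: len_def)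
        then have le: "real (k i) * real (len i) \<le> real (start i)" by (metis of_nat_le_iff of_nat_mult)
        have "1 * 1 \<le> k i * len i" using elim len_pos[of i] by (intro mult_le_mono)
        then have "start i > 0" using \<open>k i * len i \<le> start i\<close> by linarith
        then show ?case using le elim by (simp add: field_simps)
      qed
    qed
    show "(\<lambda>i. real (len i) / real (start i)) \<longlonglongrightarrow> 0"
      by (rule Lim_null_comparison[OF ev inv])
  qed
  then show ?thesis
  proof (rule that)
    show "\<forall>i. \<forall>u\<in>D i. \<forall>x\<in>X. seq_prefix x (len i) = u \<longrightarrow> norm (\<theta> (len i) x - real (len i) *\<^sub>R ?\<mu>) \<le> \<delta> i * real (len i)"
      using lV(8) unfolding D_def len_def \<delta>_def comp_def by blast
  qed
qed

lemma asymptotic_mean_psi_bounds: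
  assumes M: "M \<in> invariant_measures A" and n: "\<And>n x. n \<ge> 1 \<Longrightarrow> x \<in> X \<Longrightarrow> \<psi> n x \<le> - a * real n" "\<And>n x. n \<ge> 1 \<Longrightarrow> x \<in> X \<Longrightarrow> - b * real n \<le> \<psi> n x"
  shows "- b \<le> asymptotic_mean \<psi> M" "asymptotic_mean \<psi> M \<le> - a"
proof -
  interpret prob_space M using invD[OF M] by simp
  have sp: "space M = X" by (rule invD(3)[OF M])
  note lim = asymptotic_mean_tendsto[OF M psi_asymp_additive]
  have int: "integrable M (\<lambda>x. \<psi> k x /\<^sub>R real k)" if "k \<ge> 1" for k
    using continuous_integrable[OF M psi_continuous[OF that]] by simp
  have "- b \<le> (\<integral>x. \<psi> k x /\<^sub>R real k \<partial>M) \<and> (\<integral>x. \<psi> k x /\<^sub>R real k \<partial>M) \<le> - a" if k: "k \<ge> 1" for k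
  proof
    have "(\<integral>x. - b \<partial>M) \<le> (\<integral>x. \<psi> k x /\<^sub>R real k \<partial>M)"
      using n(2)[OF k] k sp by (intro integral_mono int) (auto simp: field_simps)
    then show "- b \<le> (\<integral>x. \<psi> k x /\<^sub>R real k \<partial>M)" by (simp add: prob_space)
    have "(\<integral>x. \<psi> k x /\<^sub>R real k \<partial>M) \<le> (\<integral>x. - a \<partial>M)"
      using n(1)[OF k] k sp by (intro integral_mono int) (auto simp: field_simps)
    then show "(\<integral>x. \<psi> k x /\<^sub>R real k \<partial>M) \<le> - a" by (simp add: prob_space)
  qed
  then show "- b \<le> asymptotic_mean \<psi> M" "asymptotic_mean \<psi> M \<le> - a"
    using LIMSEQ_le_const[OF lim] LIMSEQ_le_const2[OF lim] by blast+
qed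

lemma hausdorff_dim_nonneg: "hausdorff_dim X d E \<ge> 0"
  unfolding hausdorff_dim_def by (rule Inf_greatest) auto

text \<open>All points of the Moran set have averages converging to the means of \<open>M\<close>,
  uniformly. Hence a prefix of length \<open>n\<close> has a weight of about \<open>exp (- P
  n)\<close>, whereas its mass is at most about \<open>exp (- h n)\<close>.\<close>

lemma level_set_dimension_ge:
  fixes \<phi> :: "nat \<Rightarrow> (nat \<Rightarrow> nat) \<Rightarrow> real ^ 'd"
  assumes M: "M \<in> invariant_measures A" and aa: "asymp_additive A \<phi>"
  shows "level_set A \<phi> (asymptotic_mean \<phi> M) \<noteq> {}"
    "ereal (entropy_rate (word_prob M) / - asymptotic_mean \<psi> M) \<le> hausdorff_dim X d (level_set A \<phi> (asymptotic_mean \<phi> M))"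
proof -
  let ?\<alpha> = "asymptotic_mean \<phi> M"
  define P where "P = - asymptotic_mean \<psi> M"
  define h where "h = entropy_rate (word_prob M)"
  have h0: "h \<ge> 0" unfolding h_def by (rule entropy_rate_limit(3)[OF stationary_word_prob[OF M]])
  obtain a b where ab: "0 < a" "a \<le> b"
    "\<And>n x. n \<ge> 1 \<Longrightarrow> x \<in> X \<Longrightarrow> \<psi> n x \<le> - a * real n"
    "\<And>n x. n \<ge> 1 \<Longrightarrow> x \<in> X \<Longrightarrow> - b * real n \<le> \<psi> n x" using psi_steps by metis
  have P: "P > 0" using asymptotic_mean_psi_bounds(2)[OF M ab(3,4)] ab(1) by (simp add: P_def)
  define \<theta> where "\<theta> n x = (\<phi> n x, \<psi> n x)" for n x
  have aa\<theta>: "asymp_additive A \<theta>" unfolding \<theta>_def using aa psi_asymp_additive by (rule asymp_additive_Pair)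
  have mean: "asymptotic_mean \<theta> M = (?\<alpha>, - P)"
    unfolding \<theta>_def P_def using asymptotic_mean_Pair[OF M aa psi_asymp_additive] by simp
  obtain len D \<delta> where tm: "typical_moran A len D \<delta> h" and
    typl': "\<forall>i. \<forall>u\<in>D i. \<forall>x\<in>X. seq_prefix x (len i) = u \<longrightarrow>
      norm (\<theta> (len i) x - real (len i) *\<^sub>R asymptotic_mean \<theta> M) \<le> \<delta> i * real (len i)"
    unfolding h_def by (rule typical_moran_exists[OF M aa\<theta>])
  have typl: "norm (\<theta> (len i) x - real (len i) *\<^sub>R asymptotic_mean \<theta> M) \<le> \<delta> i * real (len i)"
    if "x \<in> X" "seq_prefix x (len i) \<in> D i" for i x using typl' that by blast
  interpret typical_moran A len D \<delta> h by (rule tm)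
  have avg: "\<exists>N. \<forall>n\<ge>N. \<forall>b\<in>codes. norm (\<phi> n (glue b) - real n *\<^sub>R ?\<alpha>) \<le> \<eta> * real n \<and> - (P + \<eta>) * real n \<le> \<psi> n (glue b)"
    if \<eta>: "\<eta> > 0" for \<eta>
  proof -
    obtain N where N: "\<And>n b. n \<ge> N \<Longrightarrow> b \<in> codes \<Longrightarrow> norm (\<theta> n (glue b) - real n *\<^sub>R asymptotic_mean \<theta> M) \<le> \<eta> * real n"
      using glue_averages[OF aa\<theta> \<eta> typl] by blast
    show ?thesis
    proof (intro exI[of _ N] allI impI ballI)
      fix n b assume "n \<ge> N" "b \<in> codes"
      from N[OF this] have *: "norm (\<phi> n (glue b) - real n *\<^sub>R ?\<alpha>, \<psi> n (glue b) + real n * P) \<le> \<eta> * real n"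
        by (simp add: mean \<theta>_def)
      have "norm (\<phi> n (glue b) - real n *\<^sub>R ?\<alpha>) \<le> \<eta> * real n" by (rule order_trans[OF norm_fst_le *])
      moreover have "\<bar>\<psi> n (glue b) + real n * P\<bar> \<le> \<eta> * real n"
        using order_trans[OF norm_snd_le *] by simp
      ultimately show "norm (\<phi> n (glue b) - real n *\<^sub>R ?\<alpha>) \<le> \<eta> * real n \<and> - (P + \<eta>) * real n \<le> \<psi> n (glue b)"
        by (auto simp: abs_le_iff algebra_simps)
    qed
  qed
  have in_level: "glue b \<in> level_set A \<phi> ?\<alpha>" if b: "b \<in> codes" for b
  proof -
    have "(\<lambda>n. \<phi> n (glue b) /\<^sub>R real n) \<longlonglongrightarrow> ?\<alpha>"
    proof (rule LIMSEQ_I)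
      fix r :: real assume "r > 0"
      then have "r / 2 > 0" by simp
      from avg[OF this] obtain N where N: "\<And>n. n \<ge> N \<Longrightarrow> norm (\<phi> n (glue b) - real n *\<^sub>R ?\<alpha>) \<le> r / 2 * real n" using b by blast
      show "\<exists>N. \<forall>n\<ge>N. norm (\<phi> n (glue b) /\<^sub>R real n - ?\<alpha>) < r"
      proof (intro exI[of _ "Suc N"] allI impI)
        fix n assume n: "Suc N \<le> n"
        then have n0: "real n > 0" by simp
        have "\<phi> n (glue b) /\<^sub>R real n - ?\<alpha> = (\<phi> n (glue b) - real n *\<^sub>R ?\<alpha>) /\<^sub>R real n"
          using n0 by (simp add: scaleR_diff_right)
        then have "norm (\<phi> n (glue b) /\<^sub>R real n - ?\<alpha>) = norm (\<phi> n (glue b) - real n *\<^sub>R ?\<alpha>) / real n"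
          by (simp add: divide_inverse mult.commute)
        also have "\<dots> \<le> (r / 2 * real n) / real n" using N[of n] n by (intro divide_right_mono) auto
        also have "\<dots> < r" using n0 \<open>r > 0\<close> by simp
        finally show "norm (\<phi> n (glue b) /\<^sub>R real n - ?\<alpha>) < r" .
      qed
    qed
    then show ?thesis using glue_in_X[OF b] by (simp add: level_set_def)
  qed
  have "codes \<noteq> {}" using D_nonempty by (simp add: PiE_eq_empty_iff)
  then show "level_set A \<phi> ?\<alpha> \<noteq> {}" using in_level by blast
  have pos: "hausdorff_outer_measure X d s (level_set A \<phi> ?\<alpha>) \<noteq> 0" if s: "0 < s" "s < h / P" for s
  proof -
    have sP: "s * P < h" using s P by (simp add: field_simps)
    \<comment> \<open>Chosen such that \<open>exp (- (P + \<eta>) n)\<close> to the power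
      \<open>s\<close> equals \<open>exp (- (h - \<eta>) n)\<close>.\<close>
    define \<eta> where "\<eta> = (h - s * P) / (1 + s)"
    have \<eta>: "\<eta> > 0" using sP s by (simp add: \<eta>_def)
    have \<eta>eq: "s * (P + \<eta>) = h - \<eta>" using s by (simp add: \<eta>_def field_simps)
    obtain N1 where N1: "\<And>n b. n \<ge> N1 \<Longrightarrow> b \<in> codes \<Longrightarrow> - (P + \<eta>) * real n \<le> \<psi> n (glue b)" using avg[OF \<eta>] by blast
    obtain N2 where N2: "\<And>n i. n \<ge> N2 \<Longrightarrow> start i \<le> n \<Longrightarrow> n < start (Suc i) \<Longrightarrow> real n * (h - \<eta>) \<le> (\<Sum>j<i. ln (real (card (D j))))"
      using many_digits[OF \<eta> h0] by blast
    define N where "N = Suc (max N1 N2)"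
    \<comment> \<open>This constant takes care of the prefixes that are shorter than
      \<open>N\<close>.\<close>
    define c where "c = exp (b * real N * s)"
    have b0: "b > 0" using ab by linarith
    have c: "c \<ge> 1" using b0 s by (simp add: c_def)
    show ?thesis
    proof (rule mass_distribution[where P = code_measure and F = glue and c = c])
      show "prob_space code_measure" by (rule prob_code_measure)
      show "glue \<omega> \<in> level_set A \<phi> ?\<alpha>" if "\<omega> \<in> space code_measure" for \<omega> using in_level that space_code_measure by simp
      show "level_set A \<phi> ?\<alpha> \<subseteq> X" by (auto simp: level_set_def)
      show "{\<omega> \<in> space code_measure. seq_prefix (glue \<omega>) n = w} \<in> sets code_measure" for n w by (rule glue_measurable)
      show "0 < s" "0 < c" using s c by auto
      fix \<omega> n assume "\<omega> \<in> space code_measure"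
      then have \<omega>: "\<omega> \<in> codes" by (simp add: space_code_measure)
      have x: "glue \<omega> \<in> X" by (rule glue_in_X[OF \<omega>])
      let ?E = "{\<omega>' \<in> space code_measure. seq_prefix (glue \<omega>') n = seq_prefix (glue \<omega>) n}"
      show "emeasure code_measure ?E \<le> ennreal (c * W (seq_prefix (glue \<omega>) n) powr s)"
      proof (cases "n \<ge> N")
        case True
        obtain i where i: "start i \<le> n" "n < start (Suc i)" by (rule block_of)
        have "emeasure code_measure ?E \<le> ennreal (exp (- (\<Sum>j<i. ln (real (card (D j))))))" by (rule glue_mass[OF \<omega> i(1)])
        also have "\<dots> \<le> ennreal (c * W (seq_prefix (glue \<omega>) n) powr s)"
        proof (rule ennreal_leI)
          have "exp (- (P + \<eta>) * real n) \<le> exp (\<psi> n (glue \<omega>))" using N1[of n \<omega>] True \<omega> by (simp add: N_def)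
          also have "\<dots> \<le> W (seq_prefix (glue \<omega>) n)" using True x by (intro weight_ge) (simp_all add: N_def)
          finally have "exp (- (P + \<eta>) * real n) powr s \<le> W (seq_prefix (glue \<omega>) n) powr s" using s by (intro powr_mono2) auto
          moreover have "exp (- (P + \<eta>) * real n) powr s = exp (- (real n * (h - \<eta>)))"
            unfolding \<eta>eq[symmetric] by (simp add: powr_def) (simp add: algebra_simps)
          moreover have "exp (- (\<Sum>j<i. ln (real (card (D j))))) \<le> exp (- (real n * (h - \<eta>)))"
            using N2[of n i] i True by (simp add: N_def)
          ultimately have "exp (- (\<Sum>j<i. ln (real (card (D j))))) \<le> 1 * W (seq_prefix (glue \<omega>) n) powr s" by linarith
          also have "\<dots> \<le> c * W (seq_prefix (glue \<omega>) n) powr s" using c by (intro mult_right_mono) auto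
          finally show "exp (- (\<Sum>j<i. ln (real (card (D j))))) \<le> c * W (seq_prefix (glue \<omega>) n) powr s" .
        qed
        finally show ?thesis .
      next
        case False
        have "exp (- b * real N) \<le> W (seq_prefix (glue \<omega>) n)"
        proof (cases "n = 0")
          case True then show ?thesis using b0 by simp
        next
          case n0: False
          have "- b * real N \<le> - b * real n" using False b0 by simp
          also have "\<dots> \<le> \<psi> n (glue \<omega>)" using ab(4)[of n "glue \<omega>"] n0 x by simp
          finally have "exp (- b * real N) \<le> exp (\<psi> n (glue \<omega>))" by simp
          also have "\<dots> \<le> W (seq_prefix (glue \<omega>) n)" using n0 x by (intro weight_ge) auto
          finally show ?thesis .
        qed
        then have "exp (- b * real N) powr s \<le> W (seq_prefix (glue \<omega>) n) powr s" using s by (intro powr_mono2) auto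
        then have "c * exp (- b * real N) powr s \<le> c * W (seq_prefix (glue \<omega>) n) powr s" using c by (intro mult_left_mono) auto
        moreover have "c * exp (- b * real N) powr s = 1" by (simp add: c_def powr_def exp_add[symmetric] algebra_simps)
        ultimately have "ennreal 1 \<le> ennreal (c * W (seq_prefix (glue \<omega>) n) powr s)" by (intro ennreal_leI) simp
        moreover have "emeasure code_measure ?E \<le> 1"
          using prob_space.emeasure_le_1[OF prob_code_measure] by simp
        ultimately show ?thesis by (simp add: order_trans)
      qed
    qed
  qed
  show "ereal (entropy_rate (word_prob M) / - asymptotic_mean \<psi> M) \<le> hausdorff_dim X d (level_set A \<phi> ?\<alpha>)"
    unfolding hausdorff_dim_def h_def[symmetric] P_def[symmetric]
  proof (rule Inf_greatest)
    fix z assume "z \<in> {ereal s |s. 0 < s \<and> hausdorff_outer_measure X d s (level_set A \<phi> ?\<alpha>) = 0}"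
    then obtain s where "z = ereal s" "0 < s" "hausdorff_outer_measure X d s (level_set A \<phi> ?\<alpha>) = 0" by blast
    then show "ereal (h / P) \<le> z" using pos[of s] by force
  qed
qed

end

section \<open>Limits of empirical measures\<close>

text \<open>Jensen's inequality, by the tangent at the average.\<close>

lemma eta_average:
  assumes n: "n \<ge> 1" and p: "\<And>i. p i \<ge> 0"
  shows "(\<Sum>i<n. eta (p i)) \<le> real n * eta ((\<Sum>i<n. p i) / real n)"
proof -
  define a where "a = (\<Sum>i<n. p i) / real n"
  have sum: "(\<Sum>i<n. p i) = real n * a" using n by (simp add: a_def)
  have a0: "a \<ge> 0" unfolding a_def using p by (intro divide_nonneg_nonneg sum_nonneg) auto
  show ?thesis
  proof (cases "a = 0")
    case True
    then have "(\<Sum>i<n. p i) = 0" using sum by simp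
    then have "\<forall>i\<in>{..<n}. p i = 0" using p by (subst (asm) sum_nonneg_eq_0_iff) auto
    then show ?thesis using True by (simp add: a_def[symmetric])
  next
    case False
    then have a: "a > 0" using a0 by simp
    have "eta (p i) \<le> - (p i * ln a) + (a - p i)" for i by (rule eta_le_tangent[OF p a])
    then have "(\<Sum>i<n. eta (p i)) \<le> (\<Sum>i<n. - (p i * ln a) + (a - p i))" by (intro sum_mono)
    also have "\<dots> = - ((\<Sum>i<n. p i) * ln a) + (real n * a - (\<Sum>i<n. p i))"
      by (simp add: sum.distrib sum_subtractf sum_negf sum_distrib_right)
    also have "\<dots> = real n * eta a" unfolding sum by (simp add: eta_def)
    finally show ?thesis by (simp add: a_def)
  qed
qed

lemma tendsto_coordinate:
  fixes X :: "nat \<Rightarrow> 'i \<Rightarrow> 'a::topological_space"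
  assumes "X \<longlonglongrightarrow> x"
  shows "(\<lambda>k. X k i) \<longlonglongrightarrow> x i"
proof -
  have "continuous_on UNIV (\<lambda>f :: 'i \<Rightarrow> 'a. f i)" by (rule continuous_on_product_coordinates)
  from continuous_on_tendsto_compose[OF this assms] show ?thesis by simp
qed

context sft
begin

text \<open>The word probabilities of the average of the point masses at the first \<open>l\<close>
  points of the orbits of all points in \<open>S\<close>. For words of length \<open>q\<close> the
  last \<open>q - 1\<close> of these windows extend beyond the first \<open>l\<close>
  letters.\<close>

definition empirical :: "(nat \<Rightarrow> nat) set \<Rightarrow> nat \<Rightarrow> nat list \<Rightarrow> real" where
  "empirical S l w = (\<Sum>i<l. real (card {x \<in> S. seq_prefix ((shift ^^ i) x) (length w) = w}) / real (card S)) / real l"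

context
  fixes S :: "(nat \<Rightarrow> nat) set" and l :: nat
  assumes S: "finite S" "S \<noteq> {}" "S \<subseteq> X" and l: "l \<ge> 1"
begin

lemma cardS: "real (card S) > 0" using S by (simp add: card_gt_0_iff)

lemma frequency_indicator:
  "real (card {x \<in> S. P x}) = (\<Sum>x\<in>S. if P x then 1 else 0)"
  using S(1) by (simp add: sum.If_cases Int_def)

lemma empirical_sum:
  "empirical S l w = (\<Sum>x\<in>S. \<Sum>i<l. if seq_prefix ((shift ^^ i) x) (length w) = w then 1 else 0) / (real (card S) * real l)"
proof -
  have "empirical S l w = (\<Sum>i<l. \<Sum>x\<in>S. if seq_prefix ((shift ^^ i) x) (length w) = w then 1 else 0) / (real (card S) * real l)"
    unfolding empirical_def frequency_indicator by (simp add: sum_divide_distrib[symmetric])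
  then show ?thesis by (subst sum.swap)
qed

lemma empirical_bounds: "0 \<le> empirical S l w" "empirical S l w \<le> 1"
proof -
  show "0 \<le> empirical S l w" unfolding empirical_def by (intro divide_nonneg_nonneg sum_nonneg) auto
  have "(\<Sum>i<l. real (card {x \<in> S. seq_prefix ((shift ^^ i) x) (length w) = w}) / real (card S)) \<le> (\<Sum>i<l. 1)"
    using cardS card_mono[OF S(1)] by (intro sum_mono) (auto simp: divide_le_eq_1)
  then show "empirical S l w \<le> 1" using l by (simp add: empirical_def divide_le_eq_1)
qed

lemma empirical_Nil: "empirical S l [] = 1"
  using cardS l by (simp add: empirical_def)

lemma empirical_inadmissible: "w \<notin> adm \<Longrightarrow> empirical S l w = 0"
proof -
  assume w: "w \<notin> adm"
  have "seq_prefix ((shift ^^ i) x) (length w) \<noteq> w" if "x \<in> S" for i x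
    using seq_prefix_admissible[OF shift_pow_subshift, of x A i "length w"] that S(3) w by auto
  then have "(\<Sum>x\<in>S. \<Sum>i<l. if seq_prefix ((shift ^^ i) x) (length w) = w then 1 else 0 :: real) = 0"
    by (intro sum.neutral ballI) auto
  then show ?thesis by (simp add: empirical_sum)
qed

lemma empirical_weighted:
  fixes G :: "nat list \<Rightarrow> 'b::real_vector"
  shows "(\<Sum>w\<in>words q. empirical S l w *\<^sub>R G w) = (\<Sum>x\<in>S. \<Sum>i<l. G (seq_prefix ((shift ^^ i) x) q)) /\<^sub>R (real (card S) * real l)"
proof -
  have "(\<Sum>w\<in>words q. empirical S l w *\<^sub>R G w)
    = (\<Sum>w\<in>words q. (\<Sum>x\<in>S. \<Sum>i<l. (if seq_prefix ((shift ^^ i) x) q = w then G w else 0)) /\<^sub>R (real (card S) * real l))"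
  proof (intro sum.cong refl)
    fix w assume "w \<in> words q"
    then have len: "length w = q" by (simp add: words_def)
    have "(\<Sum>x\<in>S. \<Sum>i<l. if seq_prefix ((shift ^^ i) x) q = w then 1 else 0 :: real) *\<^sub>R G w
       = (\<Sum>x\<in>S. \<Sum>i<l. (if seq_prefix ((shift ^^ i) x) q = w then G w else 0))"
      unfolding scaleR_sum_left by (intro sum.cong refl) auto
    then show "empirical S l w *\<^sub>R G w = (\<Sum>x\<in>S. \<Sum>i<l. (if seq_prefix ((shift ^^ i) x) q = w then G w else 0)) /\<^sub>R (real (card S) * real l)"
      unfolding empirical_sum len by (simp add: divide_inverse mult.commute scaleR_scaleR[symmetric] del: scaleR_scaleR)
  qed
  also have "\<dots> = (\<Sum>w\<in>words q. \<Sum>x\<in>S. \<Sum>i<l. (if seq_prefix ((shift ^^ i) x) q = w then G w else 0)) /\<^sub>R (real (card S) * real l)"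
    by (simp add: scaleR_sum_right)
  also have "(\<Sum>w\<in>words q. \<Sum>x\<in>S. \<Sum>i<l. (if seq_prefix ((shift ^^ i) x) q = w then G w else 0))
     = (\<Sum>x\<in>S. \<Sum>w\<in>words q. \<Sum>i<l. (if seq_prefix ((shift ^^ i) x) q = w then G w else 0))" by (rule sum.swap)
  also have "\<dots> = (\<Sum>x\<in>S. \<Sum>i<l. \<Sum>w\<in>words q. (if seq_prefix ((shift ^^ i) x) q = w then G w else 0))"
    by (intro sum.cong refl sum.swap)
  also have "\<dots> = (\<Sum>x\<in>S. \<Sum>i<l. G (seq_prefix ((shift ^^ i) x) q))"
  proof (intro sum.cong refl)
    fix x i assume "x \<in> S"
    then have "seq_prefix ((shift ^^ i) x) q \<in> words q" using S(3) by (intro prefix_in_words shift_pow_subshift) auto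
    then show "(\<Sum>w\<in>words q. (if seq_prefix ((shift ^^ i) x) q = w then G w else 0)) = G (seq_prefix ((shift ^^ i) x) q)"
      by simp
  qed
  finally show ?thesis .
qed

lemma letter_less: "x \<in> S \<Longrightarrow> x i < m"
  using S(3) by (auto simp: subshift_def)

lemma empirical_append: "(\<Sum>a<m. empirical S l (w @ [a])) = empirical S l w"
proof -
  have "(\<Sum>a<m. empirical S l (w @ [a]))
    = (\<Sum>a<m. \<Sum>x\<in>S. \<Sum>i<l. if seq_prefix ((shift ^^ i) x) (length w) = w \<and> x (length w + i) = a then 1 else 0) / (real (card S) * real l)"
    unfolding empirical_sum sum_divide_distrib[symmetric] by (simp add: seq_prefix_Suc shift_pow)
  also have "(\<Sum>a<m. \<Sum>x\<in>S. \<Sum>i<l. if seq_prefix ((shift ^^ i) x) (length w) = w \<and> x (length w + i) = a then 1 else 0 :: real)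
    = (\<Sum>x\<in>S. \<Sum>a<m. \<Sum>i<l. if seq_prefix ((shift ^^ i) x) (length w) = w \<and> x (length w + i) = a then 1 else 0)" by (rule sum.swap)
  also have "\<dots> = (\<Sum>x\<in>S. \<Sum>i<l. \<Sum>a<m. if seq_prefix ((shift ^^ i) x) (length w) = w \<and> x (length w + i) = a then 1 else 0)"
    by (intro sum.cong refl sum.swap)
  also have "\<dots> = (\<Sum>x\<in>S. \<Sum>i<l. if seq_prefix ((shift ^^ i) x) (length w) = w then 1 else 0)"
    using letter_less by (intro sum.cong refl) auto
  finally show ?thesis by (simp add: empirical_sum)
qed

text \<open>Shifting all windows by one position only exchanges the first one for a new last
  one.\<close>

lemma empirical_Cons: "\<bar>(\<Sum>a<m. empirical S l (a # w)) - empirical S l w\<bar> \<le> 1 / real l"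
proof -
  define f where "f x i = (if seq_prefix ((shift ^^ i) x) (length w) = w then 1 else 0 :: real)" for x i
  have "(\<Sum>a<m. empirical S l (a # w))
    = (\<Sum>a<m. \<Sum>x\<in>S. \<Sum>i<l. if x i = a \<and> seq_prefix ((shift ^^ Suc i) x) (length w) = w then 1 else 0) / (real (card S) * real l)"
    unfolding empirical_sum sum_divide_distrib[symmetric] by (simp add: seq_prefix_Suc_Cons) (simp add: shift_pow)
  also have "(\<Sum>a<m. \<Sum>x\<in>S. \<Sum>i<l. if x i = a \<and> seq_prefix ((shift ^^ Suc i) x) (length w) = w then 1 else 0 :: real)
    = (\<Sum>x\<in>S. \<Sum>a<m. \<Sum>i<l. if x i = a \<and> seq_prefix ((shift ^^ Suc i) x) (length w) = w then 1 else 0)" by (rule sum.swap)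
  also have "\<dots> = (\<Sum>x\<in>S. \<Sum>i<l. \<Sum>a<m. if x i = a \<and> seq_prefix ((shift ^^ Suc i) x) (length w) = w then 1 else 0)"
    by (intro sum.cong refl sum.swap)
  also have "\<dots> = (\<Sum>x\<in>S. \<Sum>i<l. f x (Suc i))"
  proof (intro sum.cong refl)
    fix x i assume "x \<in> S"
    then have "x i < m" by (rule letter_less)
    moreover have "(\<Sum>a<m. if x i = a \<and> seq_prefix ((shift ^^ Suc i) x) (length w) = w then 1 else 0 :: real)
      = (\<Sum>a<m. if x i = a then f x (Suc i) else 0)" by (intro sum.cong refl) (auto simp: f_def)
    ultimately show "(\<Sum>a<m. if x i = a \<and> seq_prefix ((shift ^^ Suc i) x) (length w) = w then 1 else 0 :: real) = f x (Suc i)" by simp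
  qed
  finally have 1: "(\<Sum>a<m. empirical S l (a # w)) = (\<Sum>x\<in>S. \<Sum>i<l. f x (Suc i)) / (real (card S) * real l)" .
  have "(\<Sum>a<m. empirical S l (a # w)) - empirical S l w = (\<Sum>x\<in>S. f x l - f x 0) / (real (card S) * real l)"
  proof -
    have "(\<Sum>i<l. f x (Suc i)) - (\<Sum>i<l. f x i) = f x l - f x 0" for x
      by (simp add: sum_subtractf[symmetric] sum_lessThan_telescope)
    then show ?thesis unfolding 1
      unfolding empirical_sum f_def[symmetric] diff_divide_distrib[symmetric] sum_subtractf[symmetric] by simp
  qed
  also have "\<bar>\<dots>\<bar> \<le> (\<Sum>x\<in>S. 1) / (real (card S) * real l)"
    unfolding abs_divide using cardS l
    by (intro frac_le order_trans[OF sum_abs] sum_mono) (auto simp: f_def)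
  also have "\<dots> = 1 / real l" using cardS by simp
  finally show ?thesis .
qed

text \<open>Segments of length \<open>l\<close> are cut into blocks of length \<open>q\<close>, with
  each of the \<open>q\<close> possible offsets, and the resulting \<open>q\<close> upper bounds for
  the entropy \<open>ln (card S)\<close> are added. Then every position starts exactly one of the
  blocks, up to a bounded number of exceptions, and concavity of \<open>eta\<close> allows to
  average over the positions.\<close>

lemma empirical_entropy:
  assumes inj: "inj_on (\<lambda>x. seq_prefix x l) S" and q: "q \<ge> 1"
  shows "ln (real (card S)) \<le> 2 * (real q * ln (real m)) + real l * (block_entropy (empirical S l) q / real q)"
proof -
  let ?P = "uniform_count_measure S"
  interpret prob_space ?P using S by (intro prob_space_uniform_count_measure)
  have sp: "space ?P = S" by (simp add: space_uniform_count_measure)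
  have simple: "simple_function ?P Y" for Y :: "(nat \<Rightarrow> nat) \<Rightarrow> 'c"
    using S(1) by (simp add: simple_function_def sp sets_uniform_count_measure)
  have law: "law Y v = real (card {x \<in> S. Y x = v}) / real (card S)" for Y :: "(nat \<Rightarrow> nat) \<Rightarrow> 'c" and v
  proof -
    have "Y -` {v} \<inter> space ?P = {x \<in> S. Y x = v}" using sp by auto
    then show ?thesis using S(1) unfolding law_def by (simp add: measure_uniform_count_measure)
  qed
  define c where "c = real (card S)"
  have c: "c > 0" using cardS by (simp add: c_def)
  have "shannon (\<lambda>x. seq_prefix x l) = shannon (\<lambda>x. x)"
    using inj by (intro shannon_cong_fibres) (auto simp: sp inj_on_def)
  also have "\<dots> = (\<Sum>x\<in>S. eta (1 / c))" unfolding shannon_def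
  proof (intro sum.cong arg_cong[of _ _ eta])
    show "(\<lambda>x. x) ` space ?P = S" by (simp add: sp)
    fix x assume "x \<in> S"
    then have "{y \<in> S. y = x} = {x}" by auto
    then show "law (\<lambda>x. x) x = 1 / c" by (simp add: law c_def)
  qed
  also have "\<dots> = ln c" using c by (simp add: eta_def ln_div c_def[symmetric])
  finally have whole: "shannon (\<lambda>x. seq_prefix x l) = ln c" .
  define f where "f i = shannon (\<lambda>x. seq_prefix ((shift ^^ i) x) q)" for i
  have prefix_le: "shannon (\<lambda>x. seq_prefix ((shift ^^ i) x) n) \<le> real n * ln (real m)" for i n
  proof -
    have "shannon (\<lambda>x. seq_prefix ((shift ^^ i) x) n) \<le> ln (real (card (words n)))"
      using S(3) by (intro shannon_le_ln_card simple) (auto simp: sp)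
    also have "\<dots> \<le> ln (real (m ^ n))"
    proof -
      have "card (words n) \<le> m ^ n" unfolding words_def by (rule card_admissible_le)
      moreover have "card (words n) > 0" using X_nonempty by (auto simp: card_gt_0_iff)
      ultimately show ?thesis using m_pos by (subst ln_le_cancel_iff) auto
    qed
    finally show ?thesis using m_pos by (simp add: ln_realpow)
  qed
  have f_le: "f i \<le> real q * ln (real m)" for i unfolding f_def by (rule prefix_le)
  have step: "shannon (\<lambda>x. seq_prefix x (j + t * q)) \<le> real j * ln (real m) + (\<Sum>s<t. f (j + s * q))" for j t
  proof (induction t)
    case 0
    then show ?case using prefix_le[of 0 j] by simp
  next
    case (Suc t)
    have "shannon (\<lambda>x. seq_prefix x (j + Suc t * q)) = shannon (\<lambda>x. (seq_prefix x (j + t * q), seq_prefix ((shift ^^ (j + t * q)) x) q))"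
    proof (rule shannon_cong_fibres)
      fix x y
      have e: "j + Suc t * q = (j + t * q) + q" by simp
      show "seq_prefix x (j + Suc t * q) = seq_prefix y (j + Suc t * q) \<longleftrightarrow>
        (seq_prefix x (j + t * q), seq_prefix ((shift ^^ (j + t * q)) x) q) = (seq_prefix y (j + t * q), seq_prefix ((shift ^^ (j + t * q)) y) q)"
        unfolding e seq_prefix_add by simp
    qed
    also have "\<dots> \<le> shannon (\<lambda>x. seq_prefix x (j + t * q)) + f (j + t * q)"
      unfolding f_def by (intro shannon_pair_le simple)
    finally show ?case using Suc by simp
  qed
  \<comment> \<open>With this number of blocks, the segment of length \<open>l\<close> is covered
    whatever the offset.\<close>
  define t where "t = l div q + 1"
  have tq: "l \<le> t * q" "t * q \<le> l + q"
  proof -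
    have 1: "l div q * q + l mod q = l" by (rule div_mult_mod_eq)
    have 2: "l mod q < q" using q by simp
    have 3: "t * q = l div q * q + q" by (simp add: t_def add_mult_distrib)
    show "l \<le> t * q" "t * q \<le> l + q" using 1 2 3 by linarith+
  qed
  have "ln c \<le> real q * ln (real m) + (\<Sum>s<t. f (j + s * q))" if j: "j < q" for j
  proof -
    have "shannon (\<lambda>x. seq_prefix x l) \<le> shannon (\<lambda>x. (seq_prefix x (j + t * q), seq_prefix x l))"
      by (intro shannon_mono_pair simple)
    also have "\<dots> = shannon (\<lambda>x. seq_prefix x (j + t * q))"
    proof (rule shannon_cong_fibres)
      fix x y
      have "l \<le> j + t * q" using tq by simp
      then show "((seq_prefix x (j + t * q), seq_prefix x l) = (seq_prefix y (j + t * q), seq_prefix y l)) = (seq_prefix x (j + t * q) = seq_prefix y (j + t * q))"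
        using seq_prefix_mono by blast
    qed
    also have "\<dots> \<le> real j * ln (real m) + (\<Sum>s<t. f (j + s * q))" by (rule step)
    also have "real j * ln (real m) \<le> real q * ln (real m)" using j m_pos by (intro mult_right_mono) auto
    finally show ?thesis unfolding whole by simp
  qed
  then have "(\<Sum>j<q. ln c) \<le> (\<Sum>j<q. real q * ln (real m) + (\<Sum>s<t. f (j + s * q)))" by (intro sum_mono) simp
  then have "real q * ln c \<le> real q * (real q * ln (real m)) + (\<Sum>j<q. \<Sum>s<t. f (j + s * q))"
    by (simp add: sum.distrib)
  also have "(\<Sum>j<q. \<Sum>s<t. f (j + s * q)) = (\<Sum>i<t * q. f i)"
  proof -
    have "(\<Sum>j<q. \<Sum>s<t. f (j + s * q)) = (\<Sum>s<t. \<Sum>j<q. f (j + s * q))" by (rule sum.swap)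
    also have "\<dots> = (\<Sum>s<t. sum f {s * q..<s * q + q})"
    proof (rule sum.cong[OF refl])
      fix s
      show "(\<Sum>j<q. f (j + s * q)) = sum f {s * q..<s * q + q}"
        using sum.shift_bounds_nat_ivl[of f 0 "s * q" q] by (simp add: lessThan_atLeast0 add.commute)
    qed
    also have "\<dots> = (\<Sum>i<t * q. f i)" by (rule sum.nat_group)
    finally show ?thesis .
  qed
  also have "(\<Sum>i<t * q. f i) = (\<Sum>i<l. f i) + (\<Sum>i\<in>{l..<t * q}. f i)"
    using tq(1) sum.atLeastLessThan_concat[of 0 l "t * q" f] by (simp add: lessThan_atLeast0)
  also have "(\<Sum>i\<in>{l..<t * q}. f i) \<le> real q * (real q * ln (real m))"
  proof -
    have "(\<Sum>i\<in>{l..<t * q}. f i) \<le> (\<Sum>i\<in>{l..<t * q}. real q * ln (real m))" by (intro sum_mono f_le)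
    also have "\<dots> = real (t * q - l) * (real q * ln (real m))" by simp
    also have "\<dots> \<le> real q * (real q * ln (real m))"
    proof (intro mult_right_mono)
      have "t * q - l \<le> q" using tq(2) by linarith
      then show "real (t * q - l) \<le> real q" by (simp only: of_nat_le_iff)
    qed (use m_pos in simp)
    finally show ?thesis .
  qed
  also have "(\<Sum>i<l. f i) \<le> real l * block_entropy (empirical S l) q"
  proof -
    have "f i = (\<Sum>w\<in>words q. eta (real (card {x \<in> S. seq_prefix ((shift ^^ i) x) q = w}) / real (card S)))" for i
    proof -
      have "f i = (\<Sum>w\<in>words q. eta (law (\<lambda>x. seq_prefix ((shift ^^ i) x) q) w))"
        unfolding f_def using S(3) by (intro shannon_superset) (auto simp: sp)
      then show ?thesis by (simp add: law)
    qed
    then have "(\<Sum>i<l. f i) = (\<Sum>w\<in>words q. \<Sum>i<l. eta (real (card {x \<in> S. seq_prefix ((shift ^^ i) x) q = w}) / real (card S)))"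
      by (simp add: sum.swap[of _ "words q"])
    also have "\<dots> \<le> (\<Sum>w\<in>words q. real l * eta (empirical S l w))"
    proof (rule sum_mono)
      fix w assume "w \<in> words q"
      then have "length w = q" by (simp add: words_def)
      then show "(\<Sum>i<l. eta (real (card {x \<in> S. seq_prefix ((shift ^^ i) x) q = w}) / real (card S))) \<le> real l * eta (empirical S l w)"
        unfolding empirical_def using eta_average[OF l, of "\<lambda>i. real (card {x \<in> S. seq_prefix ((shift ^^ i) x) q = w}) / real (card S)"] by simp
    qed
    finally show ?thesis by (simp add: block_entropy_def sum_distrib_left)
  qed
  finally have "real q * ln c \<le> real q * (real q * ln (real m)) + (real l * block_entropy (empirical S l) q + real q * (real q * ln (real m)))"
    by simp
  then have "ln c \<le> (real q * (real q * ln (real m)) + (real l * block_entropy (empirical S l) q + real q * (real q * ln (real m)))) / real q"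
    using q by (simp add: field_simps)
  also have "\<dots> = 2 * (real q * ln (real m)) + real l * (block_entropy (empirical S l) q / real q)"
    using q by (simp add: add_divide_distrib)
  finally show ?thesis by (simp add: c_def)
qed

end

text \<open>Empirical frequencies lie in a compact cube, and any limit is stationary because
  shifting changes them by at most \<open>1 / l\<close>. The averages pass to the limit, and so does
  the entropy estimate for each fixed block length \<open>q\<close>.\<close>

lemma empirical_limit:
  fixes \<theta> :: "nat \<Rightarrow> (nat \<Rightarrow> nat) \<Rightarrow> 'b::euclidean_space"
  assumes aa: "asymp_additive A \<theta>" and l: "filterlim l at_top sequentially" "\<And>k. l k \<ge> 1"
    and S: "\<And>k. finite (S k)" "\<And>k. S k \<noteq> {}" "\<And>k. S k \<subseteq> X" "\<And>k. inj_on (\<lambda>x. seq_prefix x (l k)) (S k)"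
    and mean: "\<And>k x. x \<in> S k \<Longrightarrow> norm (\<theta> (l k) x - real (l k) *\<^sub>R \<mu>) \<le> e k * real (l k)" and e: "e \<longlonglongrightarrow> 0"
    and h: "\<And>k. real (l k) * hk k \<le> ln (real (card (S k)))" "hk \<longlonglongrightarrow> h"
  obtains M where "M \<in> invariant_measures A" "asymptotic_mean \<theta> M = \<mu>" "h \<le> entropy_rate (word_prob M)"
proof -
  define g where "g k = empirical (S k) (l k)" for k
  note ctx = S(1-3) l(2)
  have bd: "0 \<le> g k w" "g k w \<le> 1" for k w unfolding g_def by (rule empirical_bounds[OF ctx])+
  have "compact (Pi\<^sub>E (UNIV :: nat list set) (\<lambda>_. {0..1::real}))" by (intro compact_PiE_UNIV compact_Icc)
  then have "seq_compact (Pi\<^sub>E (UNIV :: nat list set) (\<lambda>_. {0..1::real}))" by (simp add: compact_eq_seq_compact_metric)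
  moreover have "\<forall>k. g k \<in> Pi\<^sub>E (UNIV :: nat list set) (\<lambda>_. {0..1::real})" using bd by auto
  ultimately obtain G r where r: "strict_mono r" and lim: "(g \<circ> r) \<longlonglongrightarrow> G" unfolding seq_compact_def by metis
  have limw: "(\<lambda>k. g (r k) w) \<longlonglongrightarrow> G w" for w using tendsto_coordinate[OF lim, of w] by simp
  have lr: "filterlim (\<lambda>k. l (r k)) at_top sequentially"
    using filterlim_compose[OF l(1) filterlim_subseq[OF r]] .
  have over_l: "(\<lambda>k. c / real (l (r k))) \<longlonglongrightarrow> 0" for c
    by (rule tendsto_divide_0[OF tendsto_const filterlim_at_top_imp_at_infinity[OF filterlim_compose[OF filterlim_real_sequentially lr]]])
  have er: "(\<lambda>k. e (r k)) \<longlonglongrightarrow> 0" using LIMSEQ_subseq_LIMSEQ[OF e r] by (simp add: comp_def)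
  have st: "stationary G" unfolding stationary_def
  proof (intro conjI allI impI)
    have "g k [] = 1" for k unfolding g_def by (rule empirical_Nil[OF ctx])
    then show "G [] = 1" using limw[of "[]"] by (simp add: LIMSEQ_const_iff)
    show "0 \<le> G w" for w using LIMSEQ_le_const[OF limw[of w]] bd by blast
    show "G w = 0" if "w \<notin> adm" for w
    proof -
      have "g k w = 0" for k unfolding g_def by (rule empirical_inadmissible[OF ctx that])
      then show ?thesis using limw[of w] by (simp add: LIMSEQ_const_iff)
    qed
    show "G w = (\<Sum>a<m. G (w @ [a]))" for w
    proof -
      have "(\<lambda>k. \<Sum>a<m. g (r k) (w @ [a])) \<longlonglongrightarrow> (\<Sum>a<m. G (w @ [a]))" by (intro tendsto_sum limw)
      moreover have "(\<Sum>a<m. g k (w @ [a])) = g k w" for k unfolding g_def by (rule empirical_append[OF ctx])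
      ultimately show ?thesis using LIMSEQ_unique[OF limw[of w]] by simp
    qed
    show "G w = (\<Sum>a<m. G (a # w))" for w
    proof -
      have "(\<lambda>k. (\<Sum>a<m. g (r k) (a # w)) - g (r k) w) \<longlonglongrightarrow> (\<Sum>a<m. G (a # w)) - G w" by (intro tendsto_diff tendsto_sum limw)
      moreover have "(\<lambda>k. (\<Sum>a<m. g (r k) (a # w)) - g (r k) w) \<longlonglongrightarrow> 0"
      proof (rule Lim_null_comparison[OF _ over_l[of 1]])
        show "\<forall>\<^sub>F k in sequentially. norm ((\<Sum>a<m. g (r k) (a # w)) - g (r k) w) \<le> 1 / real (l (r k))"
          unfolding g_def using empirical_Cons[OF ctx] by (intro always_eventually allI) simp
      qed
      ultimately show ?thesis using LIMSEQ_unique by fastforce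
    qed
  qed
  obtain M where M: "M \<in> invariant_measures A" and wp: "\<And>w. word_prob M w = G w" using measure_of_stationary[OF st] by blast
  have wpG: "word_prob M = G" using wp by (rule ext)
  have "norm (asymptotic_mean \<theta> M - \<mu>) \<le> 2 * \<eta>" if \<eta>: "\<eta> > 0" for \<eta>
  proof -
    obtain q F K where K: "K \<ge> 0" and F: "\<And>n x. n \<ge> 1 \<Longrightarrow> x \<in> X \<Longrightarrow>
      norm (\<theta> n x - (\<Sum>i<n. F (seq_prefix ((shift ^^ i) x) q))) \<le> \<eta> * real n + K"
      using asymp_additiveD[OF aa \<eta>] by metis
    have 1: "norm (asymptotic_mean \<theta> M - (\<Sum>w\<in>words q. G w *\<^sub>R F w)) \<le> \<eta>"
      using asymptotic_mean_approx[OF M aa F] wpG by simp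
    have close: "norm ((\<Sum>w\<in>words q. g k w *\<^sub>R F w) - \<mu>) \<le> (e k + \<eta>) + K / real (l k)" for k
    proof -
      define c where "c = real (card (S k))"
      define L where "L = real (l k)"
      have c: "c > 0" using S(1,2)[of k] by (simp add: c_def card_gt_0_iff)
      have L: "L > 0" using l(2)[of k] by (simp add: L_def)
      have "(\<Sum>w\<in>words q. g k w *\<^sub>R F w) - \<mu> = (\<Sum>x\<in>S k. (\<Sum>i<l k. F (seq_prefix ((shift ^^ i) x) q)) - L *\<^sub>R \<mu>) /\<^sub>R (c * L)"
      proof -
        have s: "(\<Sum>x\<in>S k. L *\<^sub>R \<mu>) = (c * L) *\<^sub>R \<mu>" by (simp add: sum_constant_scaleR c_def)
        have "inverse (c * L) * (c * L) = 1" using c L by (intro left_inverse) simp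
        then have "((c * L) *\<^sub>R \<mu>) /\<^sub>R (c * L) = \<mu>" by (simp only: scaleR_scaleR scaleR_one)
        then show ?thesis unfolding g_def empirical_weighted[OF ctx] sum_subtractf s scaleR_diff_right
          by (simp only: c_def L_def)
      qed
      also have "norm \<dots> = norm (\<Sum>x\<in>S k. (\<Sum>i<l k. F (seq_prefix ((shift ^^ i) x) q)) - L *\<^sub>R \<mu>) / (c * L)"
        using c L by (simp add: divide_inverse mult.commute)
      also have "\<dots> \<le> (\<Sum>x\<in>S k. (e k + \<eta>) * L + K) / (c * L)"
      proof (intro divide_right_mono order_trans[OF norm_sum] sum_mono)
        fix x assume x: "x \<in> S k"
        then have xX: "x \<in> X" using S(3) by blast
        have a: "norm ((\<Sum>i<l k. F (seq_prefix ((shift ^^ i) x) q)) - \<theta> (l k) x) \<le> \<eta> * L + K"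
          using F[OF l(2)[of k] xX] by (simp add: norm_minus_commute L_def)
        have b: "norm (\<theta> (l k) x - L *\<^sub>R \<mu>) \<le> e k * L" using mean[OF x] by (simp add: L_def)
        show "norm ((\<Sum>i<l k. F (seq_prefix ((shift ^^ i) x) q)) - L *\<^sub>R \<mu>) \<le> (e k + \<eta>) * L + K"
          using norm_triangle_le[OF add_mono[OF a b]] by (simp add: algebra_simps)
      qed (use c L in simp)
      also have "\<dots> = (e k + \<eta>) + K / L" using c L by (simp add: c_def[symmetric] field_simps)
      finally show ?thesis by (simp add: L_def)
    qed
    have "norm ((\<Sum>w\<in>words q. G w *\<^sub>R F w) - \<mu>) \<le> (0 + \<eta>) + 0"
    proof (rule LIMSEQ_le)
      show "(\<lambda>k. norm ((\<Sum>w\<in>words q. g (r k) w *\<^sub>R F w) - \<mu>)) \<longlonglongrightarrow> norm ((\<Sum>w\<in>words q. G w *\<^sub>R F w) - \<mu>)"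
        by (intro tendsto_intros limw)
      show "(\<lambda>k. (e (r k) + \<eta>) + K / real (l (r k))) \<longlonglongrightarrow> (0 + \<eta>) + 0" by (intro tendsto_add er tendsto_const over_l)
    qed (use close in blast)
    then show ?thesis using norm_triangle_le[OF add_mono[OF 1]] by fastforce
  qed
  note small = this
  have "norm (asymptotic_mean \<theta> M - \<mu>) \<le> 0"
  proof (rule field_le_epsilon)
    fix r :: real assume "r > 0"
    then show "norm (asymptotic_mean \<theta> M - \<mu>) \<le> 0 + r" using small[of "r / 2"] by simp
  qed
  then have am: "asymptotic_mean \<theta> M = \<mu>" by simp
  have "h \<le> block_entropy G q / real q" if q: "q \<ge> 1" for q
  proof (rule LIMSEQ_le)
    show "(\<lambda>k. hk (r k)) \<longlonglongrightarrow> h" using LIMSEQ_subseq_LIMSEQ[OF h(2) r] by (simp add: comp_def)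
    have "(\<lambda>k. 2 * (real q * ln (real m)) / real (l (r k)) + (\<Sum>w\<in>words q. eta (g (r k) w)) / real q)
      \<longlonglongrightarrow> 0 + (\<Sum>w\<in>words q. eta (G w)) / real q"
      using q by (intro tendsto_add over_l tendsto_divide tendsto_sum tendsto_const tendsto_eta limw bd) auto
    then show "(\<lambda>k. 2 * (real q * ln (real m)) / real (l (r k)) + (\<Sum>w\<in>words q. eta (g (r k) w)) / real q) \<longlonglongrightarrow> block_entropy G q / real q"
      by (simp add: block_entropy_def)
    have "hk k \<le> 2 * (real q * ln (real m)) / real (l k) + (\<Sum>w\<in>words q. eta (g k w)) / real q" for k
    proof -
      have "real (l k) * hk k \<le> 2 * (real q * ln (real m)) + real (l k) * (block_entropy (g k) q / real q)"
        using h(1)[of k] empirical_entropy[OF ctx S(4) q, of k] unfolding g_def by linarith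
      then have "hk k \<le> (2 * (real q * ln (real m)) + real (l k) * (block_entropy (g k) q / real q)) / real (l k)"
        using l(2)[of k] by (subst pos_le_divide_eq) (auto simp: mult.commute)
      also have "\<dots> = 2 * (real q * ln (real m)) / real (l k) + block_entropy (g k) q / real q"
        using l(2)[of k] by (simp add: add_divide_distrib)
      finally show ?thesis by (simp add: block_entropy_def)
    qed
    then show "\<exists>N. \<forall>k\<ge>N. hk (r k) \<le> 2 * (real q * ln (real m)) / real (l (r k)) + (\<Sum>w\<in>words q. eta (g (r k) w)) / real q" by blast
  qed
  then have "h \<le> entropy_rate G" using LIMSEQ_le_const[OF entropy_rate_limit(1)[OF st]] by blast
  then show ?thesis using that[OF M am] wpG by simp
qed

text \<open>The largest error on \<open>S k\<close> is a null sequence.\<close>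

lemma empirical_limit_uniform:
  fixes \<theta> :: "nat \<Rightarrow> (nat \<Rightarrow> nat) \<Rightarrow> 'b::euclidean_space"
  assumes aa: "asymp_additive A \<theta>" and l: "filterlim l at_top sequentially" "\<And>k. l k \<ge> 1"
    and S: "\<And>k. finite (S k)" "\<And>k. S k \<noteq> {}" "\<And>k. S k \<subseteq> X" "\<And>k. inj_on (\<lambda>x. seq_prefix x (l k)) (S k)"
    and mean: "\<And>\<eta>. \<eta> > 0 \<Longrightarrow> eventually (\<lambda>k. \<forall>x\<in>S k. norm (\<theta> (l k) x - real (l k) *\<^sub>R \<mu>) \<le> \<eta> * real (l k)) sequentially"
    and h: "\<And>k. real (l k) * hk k \<le> ln (real (card (S k)))" "hk \<longlonglongrightarrow> h"
  obtains M where "M \<in> invariant_measures A" "asymptotic_mean \<theta> M = \<mu>" "h \<le> entropy_rate (word_prob M)"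
proof -
  define e where "e k = Max ((\<lambda>x. norm (\<theta> (l k) x - real (l k) *\<^sub>R \<mu>) / real (l k)) ` S k)" for k
  have lpos: "real (l k) > 0" for k using l(2)[of k] by simp
  have bound: "norm (\<theta> (l k) x - real (l k) *\<^sub>R \<mu>) \<le> e k * real (l k)" if "x \<in> S k" for k x
  proof -
    have "norm (\<theta> (l k) x - real (l k) *\<^sub>R \<mu>) / real (l k) \<le> e k" unfolding e_def using S(1) that by (intro Max_ge) auto
    then show ?thesis using lpos[of k] by (simp add: pos_divide_le_eq)
  qed
  have "e \<longlonglongrightarrow> 0"
  proof (rule LIMSEQ_I)
    fix r :: real assume r: "r > 0"
    then have "r / 2 > 0" by simp
    from mean[OF this] obtain N where N: "\<And>k x. k \<ge> N \<Longrightarrow> x \<in> S k \<Longrightarrow> norm (\<theta> (l k) x - real (l k) *\<^sub>R \<mu>) \<le> r / 2 * real (l k)"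
      unfolding eventually_sequentially by blast
    show "\<exists>N. \<forall>k\<ge>N. norm (e k - 0) < r"
    proof (intro exI[of _ N] allI impI)
      fix k assume k: "k \<ge> N"
      have "e k \<in> (\<lambda>x. norm (\<theta> (l k) x - real (l k) *\<^sub>R \<mu>) / real (l k)) ` S k" unfolding e_def using S(1,2) by (intro Max_in) auto
      then obtain x where x: "x \<in> S k" "e k = norm (\<theta> (l k) x - real (l k) *\<^sub>R \<mu>) / real (l k)" by blast
      have "e k \<le> r / 2" unfolding x(2) using N[OF k x(1)] lpos[of k] by (simp add: pos_divide_le_eq)
      moreover have "e k \<ge> 0" unfolding x(2) by simp
      ultimately show "norm (e k - 0) < r" using r by simp
    qed
  qed
  from empirical_limit[OF aa l S bound this h] show ?thesis using that by blast
qed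

end

section \<open>Counting balls\<close>

context neg_potential
begin

abbreviation balls :: "nat \<Rightarrow> nat list set" where "balls n \<equiv> ball_words A \<psi> n"

lemma ballsD:
  assumes "u \<in> balls n"
  shows "u \<in> adm" "W u \<le> exp (- real n)" "u \<noteq> [] \<Longrightarrow> W (butlast u) > exp (- real n)"
  using assms by (auto simp: ball_words_def)

lemma balls_nonempty_word: "u \<in> balls n \<Longrightarrow> n \<ge> 1 \<Longrightarrow> u \<noteq> []"
  using ballsD(2)[of u n] by auto

text \<open>The weight of a word decreases exponentially in its length, at rates between
  \<open>a\<close> and \<open>b\<close>.\<close>

lemma ball_length:
  obtains a b where "0 < a" "0 < b"
    "\<And>n u. n \<ge> 1 \<Longrightarrow> u \<in> balls n \<Longrightarrow> real (length u) \<le> real n / a + 1"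
    "\<And>n u. n \<ge> 1 \<Longrightarrow> u \<in> balls n \<Longrightarrow> real n \<le> b * real (length u)"
proof -
  obtain a where a: "a > 0" "\<And>x n. x \<in> X \<Longrightarrow> W (seq_prefix x n) \<le> exp (- a * real n)" using weight_decay by blast
  obtain a' b where ab: "0 < a'" "a' \<le> b" "\<And>n x. n \<ge> 1 \<Longrightarrow> x \<in> X \<Longrightarrow> - b * real n \<le> \<psi> n x" using psi_steps by metis
  show ?thesis
  proof (rule that[OF a(1), of b])
    show "0 < b" using ab by linarith
    fix n u assume n: "n \<ge> (1::nat)" and u: "u \<in> balls n"
    have ne: "u \<noteq> []" by (rule balls_nonempty_word[OF u n])
    obtain x where x: "x \<in> X" "seq_prefix x (length u) = u" using extend_word[OF ballsD(1)[OF u]] by blast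
    have "butlast u = seq_prefix x (length u - 1)"
      using take_seq_prefix[of "length u - 1" "length u" x] x(2) by (simp add: butlast_conv_take)
    then have "exp (- real n) < W (seq_prefix x (length u - 1))" using ballsD(3)[OF u ne] by (simp only:)
    then have "exp (- real n) < exp (- a * real (length u - 1))" using a(2)[OF x(1)] by (rule less_le_trans)
    then have "a * real (length u - 1) < real n" by simp
    then have "real (length u - 1) \<le> real n / a" using a(1) by (simp add: field_simps)
    moreover have "real (length u) = real (length u - 1) + 1" using ne by (cases u) simp_all
    ultimately show "real (length u) \<le> real n / a + 1" by linarith
    have len: "length u \<ge> 1" using ne by (simp add: Suc_le_eq)
    have "exp (- b * real (length u)) \<le> exp (\<psi> (length u) x)" using ab(3)[OF len x(1)] by simp
    also have "\<dots> \<le> W u" using weight_ge[OF len x(1)] x(2) by simp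
    also have "\<dots> \<le> exp (- real n)" by (rule ballsD(2)[OF u])
    finally show "real n \<le> b * real (length u)" by simp
  qed
qed

text \<open>The word is the shortest prefix whose weight is at most \<open>exp (-
  n)\<close>.\<close>

lemma ball_cover:
  assumes x: "x \<in> X"
  obtains k where "seq_prefix x k \<in> balls n"
proof -
  obtain a where a: "a > 0" "\<And>x n. x \<in> X \<Longrightarrow> W (seq_prefix x n) \<le> exp (- a * real n)" using weight_decay by blast
  obtain j :: nat where "real n / a < real j" using reals_Archimedean2 by blast
  then have "real n < a * real j" using a(1) by (simp add: field_simps)
  then have "exp (- a * real j) \<le> exp (- real n)" by simp
  then have ex: "\<exists>k. W (seq_prefix x k) \<le> exp (- real n)" using a(2)[OF x, of j] order_trans by blast
  define k where "k = (LEAST k. W (seq_prefix x k) \<le> exp (- real n))"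
  have 1: "W (seq_prefix x k) \<le> exp (- real n)" unfolding k_def by (rule LeastI_ex[OF ex])
  have "seq_prefix x k = [] \<or> W (butlast (seq_prefix x k)) > exp (- real n)"
  proof (cases k)
    case (Suc i)
    then have "\<not> W (seq_prefix x i) \<le> exp (- real n)" using not_less_Least[of i "\<lambda>k. W (seq_prefix x k) \<le> exp (- real n)"] unfolding k_def by simp
    then show ?thesis using Suc by (simp add: seq_prefix_Suc)
  qed simp
  then have "seq_prefix x k \<in> balls n" using 1 x by (simp add: ball_words_def seq_prefix_admissible)
  then show ?thesis using that by blast
qed

lemma finite_balls: "finite (balls n)"
proof (cases "n = 0")
  case True
  have "u = []" if "u \<in> balls 0" for u
  proof (rule ccontr)
    assume ne: "u \<noteq> []"
    have "u = butlast u @ [last u]" using ne by simp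
    then have "butlast u \<in> adm" using ballsD(1)[OF that] admissible_append by metis
    then show False using ballsD(3)[OF that ne] weight_le_1[of "butlast u"] by simp
  qed
  then have "balls n \<subseteq> {[]}" using True by blast
  then show ?thesis by (rule finite_subset) simp
next
  case False
  obtain a where a: "\<And>n u. n \<ge> 1 \<Longrightarrow> u \<in> balls n \<Longrightarrow> real (length u) \<le> real n / a + 1" using ball_length by metis
  have "balls n \<subseteq> (\<Union>k\<le>nat \<lfloor>real n / a + 1\<rfloor>. words k)"
  proof
    fix u assume u: "u \<in> balls n"
    have "length u \<le> nat \<lfloor>real n / a + 1\<rfloor>" using a[OF _ u] False by (intro le_nat_floor) auto
    then show "u \<in> (\<Union>k\<le>nat \<lfloor>real n / a + 1\<rfloor>. words k)" using ballsD(1)[OF u] by (auto simp: words_def)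
  qed
  then show ?thesis by (rule finite_subset) auto
qed

lemma balls_nonempty: "balls n \<noteq> {}"
  using ball_cover X_nonempty by blast

lemma card_balls_pos: "card (balls n) \<ge> 1"
  using finite_balls[of n] balls_nonempty[of n] by (simp add: Suc_le_eq card_gt_0_iff)

lemma card_balls_le:
  obtains c where "\<And>n. n \<ge> 1 \<Longrightarrow> ln (real (card (balls n))) \<le> c * real n"
proof -
  obtain a where a: "0 < a" "\<And>n u. n \<ge> 1 \<Longrightarrow> u \<in> balls n \<Longrightarrow> real (length u) \<le> real n / a + 1" using ball_length by metis
  define c where "c = 1 / a + 2 + (1 / a + 1) * ln (real m)"
  have m1: "real m \<ge> 1" using m_pos by simp
  show ?thesis
  proof (rule that[of c])
    fix n :: nat assume n: "n \<ge> 1"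
    define L where "L = nat \<lfloor>real n / a + 1\<rfloor>"
    have L: "real L \<le> real n / a + 1" using a(1) unfolding L_def by (intro of_nat_floor) simp
    have "balls n \<subseteq> (\<Union>k\<le>L. words k)"
    proof
      fix u assume u: "u \<in> balls n"
      have "length u \<le> L" unfolding L_def using a(2)[OF n u] by (rule le_nat_floor)
      then show "u \<in> (\<Union>k\<le>L. words k)" using ballsD(1)[OF u] by (auto simp: words_def)
    qed
    then have "card (balls n) \<le> card (\<Union>k\<le>L. words k)" by (intro card_mono) auto
    also have "\<dots> \<le> (\<Sum>k\<le>L. card (words k))" by (intro card_UN_le) simp
    also have "\<dots> \<le> (\<Sum>k\<le>L. m ^ L)"
    proof (intro sum_mono)
      fix k assume "k \<in> {..L}"
      then have "m ^ k \<le> m ^ L" using m_pos by (intro power_increasing) auto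
      then show "card (words k) \<le> m ^ L" using card_admissible_le[of A k] by (simp add: words_def)
    qed
    also have "\<dots> = (L + 1) * m ^ L" by simp
    finally have "real (card (balls n)) \<le> real ((L + 1) * m ^ L)" by (simp only: of_nat_le_iff)
    then have "ln (real (card (balls n))) \<le> ln (real ((L + 1) * m ^ L))"
      using card_balls_pos[of n] m_pos by (subst ln_le_cancel_iff) auto
    also have "\<dots> = ln (real L + 1) + real L * ln (real m)"
    proof -
      have "real ((L + 1) * m ^ L) = (real L + 1) * real m ^ L" by (simp only: of_nat_mult of_nat_add of_nat_power of_nat_1)
      moreover have "ln ((real L + 1) * real m ^ L) = ln (real L + 1) + ln (real m ^ L)" using m_pos by (intro ln_mult_pos) auto
      ultimately show ?thesis using m_pos by (simp only: ln_realpow of_nat_0_less_iff)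
    qed
    also have "ln (real L + 1) \<le> real L" using ln_add_one_self_le_self[of "real L"] by (simp add: add.commute)
    also have "real L + real L * ln (real m) = real L * (1 + ln (real m))" by (simp add: distrib_left)
    also have "\<dots> \<le> (real n / a + 1) * (1 + ln (real m))" using L m1 by (intro mult_right_mono) auto
    also have "\<dots> \<le> (real n / a + real n) * (1 + ln (real m))" using n m1 by (intro mult_right_mono) auto
    also have "\<dots> \<le> c * real n"
    proof -
      have "c * real n - (real n / a + real n) * (1 + ln (real m)) = real n" by (simp add: c_def algebra_simps)
      then show ?thesis using n by linarith
    qed
    finally show "ln (real (card (balls n))) \<le> c * real n" by simp
  qed
qed

text \<open>The weight of \<open>u\<close> is at most \<open>exp (- n)\<close> while that of its
  predecessor is larger. One letter changes \<open>\<psi>\<close> by a bounded amount, and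
  \<open>\<psi>\<close> varies little on a cylinder.\<close>

lemma psi_on_ball:
  assumes \<eta>: "\<eta> > 0"
  obtains K where "K \<ge> 0" "\<And>n u x. n \<ge> 1 \<Longrightarrow> u \<in> balls n \<Longrightarrow> x \<in> cylinder A u \<Longrightarrow> \<bar>\<psi> (length u) x + real n\<bar> \<le> \<eta> * real (length u) + K"
proof -
  obtain K where K: "K \<ge> 0" "\<And>n x y. n \<ge> 1 \<Longrightarrow> x \<in> X \<Longrightarrow> y \<in> X \<Longrightarrow> seq_prefix x n = seq_prefix y n \<Longrightarrow>
    norm (\<psi> n x - \<psi> n y) \<le> \<eta> * real n + K" using small_variation[OF psi_asymp_additive \<eta>] by blast
  obtain a b where ab: "0 < a" "a \<le> b"
    "\<And>n x. n \<ge> 1 \<Longrightarrow> x \<in> X \<Longrightarrow> \<psi> n x - b \<le> \<psi> (Suc n) x"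
    "\<And>n x. n \<ge> 1 \<Longrightarrow> x \<in> X \<Longrightarrow> - b * real n \<le> \<psi> n x" using psi_steps by metis
  show ?thesis
  proof (rule that[of "K + b"])
    show "0 \<le> K + b" using K ab by simp
    fix n u x assume n: "n \<ge> (1::nat)" and u: "u \<in> balls n" and x: "x \<in> cylinder A u"
    have ne: "u \<noteq> []" by (rule balls_nonempty_word[OF u n])
    have xX: "x \<in> X" "seq_prefix x (length u) = u" using x by (auto simp: cylinder_def)
    have len: "length u \<ge> 1" using ne by (simp add: Suc_le_eq)
    have "exp (\<psi> (length u) x) \<le> W u" using weight_ge[OF len xX(1)] unfolding xX(2) .
    then have "exp (\<psi> (length u) x) \<le> exp (- real n)" using ballsD(2)[OF u] by (rule order_trans)
    then have up: "\<psi> (length u) x \<le> - real n" by simp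
    have lo: "- real n - (\<eta> * real (length u) + (K + b)) \<le> \<psi> (length u) x"
    proof (cases "length u = 1")
      case True
      then have "- b \<le> \<psi> (length u) x" using ab(4)[OF len xX(1)] by simp
      moreover have "0 \<le> \<eta> * real (length u)" using \<eta> by simp
      ultimately show ?thesis using K(1) by linarith
    next
      case False
      define k where "k = length u - 1"
      have k: "k \<ge> 1" "length u = Suc k" using False len by (auto simp: k_def)
      have bl: "butlast u = seq_prefix x k"
        using take_seq_prefix[of k "length u" x] xX(2) by (simp add: butlast_conv_take k_def)
      have "seq_prefix x k \<noteq> []" using k by (metis length_seq_prefix list.size(3) not_one_le_zero)
      moreover have "seq_prefix x k \<in> adm" using xX(1) by (rule seq_prefix_admissible)
      moreover have "exp (- real n) < W (seq_prefix x k)" using ballsD(3)[OF u ne] bl by simp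
      ultimately obtain y where y: "y \<in> cylinder A (seq_prefix x k)" "exp (- real n) < exp (\<psi> (length (seq_prefix x k)) y)"
        using weight_attained by blast
      then have y': "y \<in> X" "seq_prefix y k = seq_prefix x k" "- real n < \<psi> k y" by (auto simp: cylinder_def)
      have "\<bar>\<psi> k x - \<psi> k y\<bar> \<le> \<eta> * real k + K" using K(2)[OF k(1) xX(1) y'(1)] y'(2) by simp
      moreover have "\<psi> k x - b \<le> \<psi> (length u) x" using ab(3)[OF k(1) xX(1)] k(2) by simp
      moreover have "\<eta> * real k \<le> \<eta> * real (length u)" using \<eta> k(2) by simp
      ultimately show ?thesis using y'(3) by linarith
    qed
    have "0 \<le> \<eta> * real (length u) + (K + b)" using \<eta> K(1) ab by simp
    then show "\<bar>\<psi> (length u) x + real n\<bar> \<le> \<eta> * real (length u) + (K + b)" using up lo by linarith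
  qed
qed

lemma popular_length:
  assumes C: "finite C" "C \<noteq> {}" and len: "\<And>u. u \<in> C \<Longrightarrow> length u \<le> L"
  obtains l where "card C \<le> (L + 1) * card {u \<in> C. length u = l}" "{u \<in> C. length u = l} \<noteq> {}"
proof -
  let ?f = "\<lambda>j. card {u \<in> C. length u = j}"
  have "Max (?f ` {..L}) \<in> ?f ` {..L}" by (intro Max_in) auto
  then obtain l where l0: "Max (?f ` {..L}) = ?f l" by blast
  have l: "?f j \<le> ?f l" if "j \<in> {..L}" for j unfolding l0[symmetric] using that by (intro Max_ge) auto
  have "C = (\<Union>j\<in>{..L}. {u \<in> C. length u = j})" using len by auto
  then have "card C \<le> (\<Sum>j\<in>{..L}. card {u \<in> C. length u = j})" using card_UN_le[of "{..L}" "\<lambda>j. {u \<in> C. length u = j}"] by simp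
  also have "\<dots> \<le> (\<Sum>j\<in>{..L}. card {u \<in> C. length u = l})" using l by (intro sum_mono)
  also have "\<dots> = (L + 1) * card {u \<in> C. length u = l}" by simp
  finally have le: "card C \<le> (L + 1) * card {u \<in> C. length u = l}" .
  moreover have "card C > 0" using C by (simp add: card_gt_0_iff)
  ultimately have "card {u \<in> C. length u = l} > 0" by (metis gr0I mult_0_right not_less0 le_zero_eq)
  then have "{u \<in> C. length u = l} \<noteq> {}" by (auto simp: card_gt_0_iff)
  then show ?thesis using that le by blast
qed

text \<open>The words of balls of radius \<open>exp (- n)\<close> have lengths at most linear in
  \<open>n\<close>. Keeping only the most popular length \<open>l\<close> costs a factor that is
  linear in \<open>n\<close>, which is negligible. Along a subsequence \<open>n / l\<close>
  converges to some \<open>P\<close>. For the empirical limit of points from the balls, \<open>-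
  P\<close> is the mean of \<open>\<psi>\<close>, and the entropy is at least \<open>P
  t\<close>.\<close>

lemma measure_of_ball_families:
  fixes \<phi> :: "nat \<Rightarrow> (nat \<Rightarrow> nat) \<Rightarrow> 'b::euclidean_space"
  assumes aa: "asymp_additive A \<phi>" and n: "filterlim n at_top sequentially" "\<And>k. n k \<ge> 1"
    and C: "\<And>k. C k \<subseteq> balls (n k)" "\<And>k. exp (real (n k) * s k) \<le> real (card (C k))" "s \<longlonglongrightarrow> t"
    and \<epsilon>: "\<epsilon> \<longlonglongrightarrow> 0" "\<And>k u. u \<in> C k \<Longrightarrow> \<exists>x\<in>cylinder A u. norm (\<phi> (length u) x /\<^sub>R real (length u) - \<alpha>) \<le> \<epsilon> k"
  obtains M where "M \<in> invariant_measures A" "asymptotic_mean \<phi> M = \<alpha>"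
    "t \<le> entropy_rate (word_prob M) / - asymptotic_mean \<psi> M"
proof -
  obtain a b where ab: "0 < a" "0 < b"
    "\<And>n u. n \<ge> 1 \<Longrightarrow> u \<in> balls n \<Longrightarrow> real (length u) \<le> real n / a + 1"
    "\<And>n u. n \<ge> 1 \<Longrightarrow> u \<in> balls n \<Longrightarrow> real n \<le> b * real (length u)" using ball_length by blast
  have fC: "finite (C k)" for k using C(1) finite_balls finite_subset by blast
  have neC: "C k \<noteq> {}" for k
  proof -
    have "exp (real (n k) * s k) > 0" by simp
    then have "real (card (C k)) > 0" using C(2)[of k] by linarith
    then show ?thesis by auto
  qed
  define L where "L k = nat \<lfloor>real (n k) / a + 1\<rfloor>" for k
  define c where "c = 1 / a + 2"
  have c: "c > 0" using ab(1) by (simp add: c_def add_pos_pos)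
  have L: "real (L k + 1) \<le> c * real (n k)" for k
  proof -
    have "real (L k) \<le> real (n k) / a + 1" unfolding L_def using ab(1) by (intro of_nat_floor) simp
    moreover have "1 \<le> real (n k)" using n(2)[of k] by simp
    ultimately show ?thesis by (simp add: c_def algebra_simps)
  qed
  have "\<forall>k. \<exists>l. card (C k) \<le> (L k + 1) * card {u \<in> C k. length u = l} \<and> {u \<in> C k. length u = l} \<noteq> {}"
  proof
    fix k
    have "length u \<le> L k" if "u \<in> C k" for u
      unfolding L_def using ab(3)[OF n(2)[of k] subsetD[OF C(1) that]] by (rule le_nat_floor)
    from popular_length[OF fC neC this]
    show "\<exists>l. card (C k) \<le> (L k + 1) * card {u \<in> C k. length u = l} \<and> {u \<in> C k. length u = l} \<noteq> {}" by blast
  qed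
  from choice[OF this] obtain l where l: "\<And>k. card (C k) \<le> (L k + 1) * card {u \<in> C k. length u = l k}" "\<And>k. {u \<in> C k. length u = l k} \<noteq> {}" by blast
  define D where "D k = {u \<in> C k. length u = l k}" for k
  have D: "finite (D k)" "D k \<noteq> {}" "D k \<subseteq> balls (n k)" "\<And>u. u \<in> D k \<Longrightarrow> length u = l k" "D k \<subseteq> C k" for k
    using fC[of k] l(2)[of k] C(1)[of k] by (auto simp: D_def)
  define pt where "pt k u = (SOME x. x \<in> cylinder A u \<and> norm (\<phi> (length u) x /\<^sub>R real (length u) - \<alpha>) \<le> \<epsilon> k)" for k u
  have pt: "pt k u \<in> cylinder A u" "norm (\<phi> (length u) (pt k u) /\<^sub>R real (length u) - \<alpha>) \<le> \<epsilon> k" if "u \<in> D k" for k u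
  proof -
    have "\<exists>x. x \<in> cylinder A u \<and> norm (\<phi> (length u) x /\<^sub>R real (length u) - \<alpha>) \<le> \<epsilon> k" using \<epsilon>(2)[of u k] that D(5) by blast
    from someI_ex[OF this] show "pt k u \<in> cylinder A u" "norm (\<phi> (length u) (pt k u) /\<^sub>R real (length u) - \<alpha>) \<le> \<epsilon> k"
      unfolding pt_def by blast+
  qed
  have ptX: "pt k u \<in> X" "seq_prefix (pt k u) (l k) = u" if "u \<in> D k" for k u
    using pt(1)[OF that] D(4)[OF that] by (auto simp: cylinder_def)
  define S where "S k = pt k ` D k" for k
  have inj: "inj_on (pt k) (D k)" for k by (rule inj_onI) (metis ptX(2))
  have cardS: "card (S k) = card (D k)" for k unfolding S_def by (rule card_image[OF inj])
  have l1: "l k \<ge> 1" for k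
  proof -
    obtain u where u: "u \<in> D k" using D(2) by blast
    then have "u \<noteq> []" using D(3) n(2) balls_nonempty_word by blast
    then show ?thesis using D(4)[OF u] by (cases u) auto
  qed
  have nl: "real (n k) \<le> b * real (l k)" for k
  proof -
    obtain u where u: "u \<in> D k" using D(2) by blast
    then show ?thesis using ab(4)[OF n(2)[of k], of u] D(3,4) by auto
  qed
  define p where "p k = real (n k) / real (l k)" for k
  have "p k \<in> {0..b}" for k using nl[of k] l1[of k] by (auto simp: p_def pos_divide_le_eq)
  then obtain P r where P: "P \<in> {0..b}" and r: "strict_mono r" and lim: "(p \<circ> r) \<longlonglongrightarrow> P"
    using compact_Icc[of 0 b] unfolding compact_eq_seq_compact_metric seq_compact_def by metis
  have nr: "filterlim (\<lambda>k. n (r k)) at_top sequentially" using filterlim_compose[OF n(1) filterlim_subseq[OF r]] .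
  have nr': "filterlim (\<lambda>k. real (n (r k))) at_top sequentially" using filterlim_compose[OF filterlim_real_sequentially nr] .
  have lr': "filterlim (\<lambda>k. real (l (r k))) at_top sequentially"
  proof (rule filterlim_at_top_mono)
    show "filterlim (\<lambda>k. real (n (r k)) / b) at_top sequentially"
      using ab(2) filterlim_tendsto_pos_mult_at_top[OF tendsto_const[of "1 / b"] _ nr'] by simp
    show "eventually (\<lambda>k. real (n (r k)) / b \<le> real (l (r k))) sequentially"
      using nl ab(2) by (intro always_eventually allI) (simp add: pos_divide_le_eq mult.commute)
  qed
  have lr: "filterlim (\<lambda>k. l (r k)) at_top sequentially"
  proof (rule filterlim_at_top[THEN iffD2], rule allI)
    fix Z :: nat
    have "eventually (\<lambda>k. real Z \<le> real (l (r k))) sequentially" using lr' unfolding filterlim_at_top by blast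
    then show "eventually (\<lambda>k. Z \<le> l (r k)) sequentially" by (simp only: of_nat_le_iff)
  qed
  have over_l: "(\<lambda>k. K / real (l (r k))) \<longlonglongrightarrow> 0" for K
    by (rule tendsto_divide_0[OF tendsto_const filterlim_at_top_imp_at_infinity[OF lr']])
  define \<theta> where "\<theta> n x = (\<phi> n x, \<psi> n x)" for n x
  have aa\<theta>: "asymp_additive A \<theta>" unfolding \<theta>_def using aa psi_asymp_additive by (rule asymp_additive_Pair)
  have mean: "eventually (\<lambda>k. \<forall>x\<in>S (r k). norm (\<theta> (l (r k)) x - real (l (r k)) *\<^sub>R (\<alpha>, - P)) \<le> \<eta> * real (l (r k))) sequentially"
    if \<eta>: "\<eta> > 0" for \<eta>
  proof -
    define e where "e = \<eta> / 4"
    have e: "e > 0" using \<eta> by (simp add: e_def)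
    obtain K where K: "K \<ge> 0" "\<And>n u x. n \<ge> 1 \<Longrightarrow> u \<in> balls n \<Longrightarrow> x \<in> cylinder A u \<Longrightarrow> \<bar>\<psi> (length u) x + real n\<bar> \<le> e * real (length u) + K"
      using psi_on_ball[OF e] by blast
    have "eventually (\<lambda>k. \<epsilon> (r k) < e) sequentially"
      using order_tendstoD(2)[OF LIMSEQ_subseq_LIMSEQ[OF \<epsilon>(1) r] e] by (simp add: comp_def)
    moreover have "eventually (\<lambda>k. K / real (l (r k)) < e) sequentially" using order_tendstoD(2)[OF over_l e] .
    moreover have "eventually (\<lambda>k. dist (p (r k)) P < e) sequentially" using tendstoD[OF lim e] by (simp add: comp_def)
    ultimately show ?thesis
    proof eventually_elim
      case (elim k)
      let ?l = "real (l (r k))"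
      have lpos: "?l > 0" using l1[of "r k"] by simp
      show ?case
      proof
        fix x assume "x \<in> S (r k)"
        then obtain u where u: "u \<in> D (r k)" "x = pt (r k) u" by (auto simp: S_def)
        note lu = D(4)[OF u(1)]
        have "\<phi> (l (r k)) x - ?l *\<^sub>R \<alpha> = ?l *\<^sub>R (\<phi> (l (r k)) x /\<^sub>R ?l - \<alpha>)"
          using lpos by (simp add: scaleR_diff_right)
        then have "norm (\<phi> (l (r k)) x - ?l *\<^sub>R \<alpha>) = ?l * norm (\<phi> (l (r k)) x /\<^sub>R ?l - \<alpha>)" by simp
        also have "\<dots> \<le> ?l * e" using pt(2)[OF u(1)] elim(1) lu u(2) by (intro mult_left_mono) auto
        finally have 1: "norm (\<phi> (l (r k)) x - ?l *\<^sub>R \<alpha>) \<le> e * ?l" by (simp add: mult.commute)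
        have "u \<in> balls (n (r k))" using u(1) D(3) by blast
        from K(2)[OF n(2) this] have "\<bar>\<psi> (l (r k)) x + real (n (r k))\<bar> \<le> e * ?l + K" using pt(1)[OF u(1)] u(2) lu by simp
        moreover have "K \<le> e * ?l" using elim(2) lpos by (simp add: pos_divide_less_eq)
        moreover have "\<bar>real (n (r k)) - ?l * P\<bar> \<le> e * ?l"
        proof -
          have "real (n (r k)) - ?l * P = ?l * (p (r k) - P)" using lpos by (simp add: p_def right_diff_distrib)
          then have "\<bar>real (n (r k)) - ?l * P\<bar> = ?l * \<bar>p (r k) - P\<bar>" by (simp add: abs_mult)
          also have "\<dots> \<le> ?l * e" using elim(3) by (intro mult_left_mono) (auto simp: dist_real_def)
          finally show ?thesis by (simp add: mult.commute)
        qed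
        ultimately have 2: "norm (\<psi> (l (r k)) x - ?l * - P) \<le> 3 * (e * ?l)" unfolding real_norm_def by linarith
        have "norm (\<theta> (l (r k)) x - ?l *\<^sub>R (\<alpha>, - P)) = norm (\<phi> (l (r k)) x - ?l *\<^sub>R \<alpha>, \<psi> (l (r k)) x - ?l * - P)" by (simp add: \<theta>_def)
        also have "\<dots> \<le> norm (\<phi> (l (r k)) x - ?l *\<^sub>R \<alpha>) + norm (\<psi> (l (r k)) x - ?l * - P)" by (rule norm_Pair_le)
        also have "\<dots> \<le> e * ?l + 3 * (e * ?l)" using 1 2 by (rule add_mono)
        also have "\<dots> = \<eta> * ?l" by (simp add: e_def)
        finally show "norm (\<theta> (l (r k)) x - ?l *\<^sub>R (\<alpha>, - P)) \<le> \<eta> * ?l" .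
      qed
    qed
  qed
  \<comment> \<open>A lower bound for the logarithm of the number of remaining balls, per
    letter.\<close>
  define hk where "hk k = p k * (s k - ln (c * real (n k)) / real (n k))" for k
  have many: "real (l k) * hk k \<le> ln (real (card (S k)))" for k
  proof -
    have n0: "real (n k) > 0" using n(2)[of k] by simp
    have Dpos: "real (card (D k)) > 0" using D(1,2)[of k] by (simp add: card_gt_0_iff)
    have "real (card (C k)) \<le> real ((L k + 1) * card (D k))" using l(1)[of k] unfolding D_def by (simp only: of_nat_le_iff)
    also have "\<dots> = real (L k + 1) * real (card (D k))" by (simp only: of_nat_mult)
    also have "\<dots> \<le> (c * real (n k)) * real (card (D k))" using L[of k] by (intro mult_right_mono) auto
    finally have "exp (real (n k) * s k) \<le> (c * real (n k)) * real (card (D k))" using C(2)[of k] by linarith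
    then have "ln (exp (real (n k) * s k)) \<le> ln ((c * real (n k)) * real (card (D k)))"
      using c n0 Dpos by (subst ln_le_cancel_iff) auto
    then have "real (n k) * s k \<le> ln (c * real (n k)) + ln (real (card (D k)))" using c n0 Dpos by (subst (asm) ln_mult_pos) auto
    moreover have "real (l k) * hk k = real (n k) * s k - ln (c * real (n k))"
      using l1[of k] n0 by (simp add: hk_def p_def field_simps)
    ultimately show ?thesis using cardS[of k] by simp
  qed
  have hlim: "(\<lambda>k. hk (r k)) \<longlonglongrightarrow> P * (t - 0)" unfolding hk_def
  proof (intro tendsto_mult tendsto_diff)
    show "(\<lambda>k. p (r k)) \<longlonglongrightarrow> P" using lim by (simp add: comp_def)
    show "(\<lambda>k. s (r k)) \<longlonglongrightarrow> t" using LIMSEQ_subseq_LIMSEQ[OF C(3) r] by (simp add: comp_def)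
    have "(\<lambda>k. ln c / real (n (r k)) + ln (real (n (r k))) / real (n (r k))) \<longlonglongrightarrow> 0 + 0"
      by (intro tendsto_add filterlim_compose[OF lim_ln_over_n nr] tendsto_divide_0[OF tendsto_const filterlim_at_top_imp_at_infinity[OF nr']])
    moreover have "ln c / real (n k) + ln (real (n k)) / real (n k) = ln (c * real (n k)) / real (n k)" for k
      using c n(2)[of k] by (subst ln_mult_pos) (auto simp: add_divide_distrib)
    ultimately show "(\<lambda>k. ln (c * real (n (r k))) / real (n (r k))) \<longlonglongrightarrow> 0" by simp
  qed
  obtain M where M: "M \<in> invariant_measures A" "asymptotic_mean \<theta> M = (\<alpha>, - P)" "P * (t - 0) \<le> entropy_rate (word_prob M)"
  proof (rule empirical_limit_uniform[OF aa\<theta> lr])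
    show "1 \<le> l (r k)" for k by (rule l1)
    show "finite (S (r k))" "S (r k) \<noteq> {}" for k using D(1,2) by (simp_all add: S_def)
    show "S (r k) \<subseteq> X" for k using ptX(1) by (auto simp: S_def)
    show "inj_on (\<lambda>x. seq_prefix x (l (r k))) (S (r k))" for k
      by (rule inj_onI) (auto simp: S_def ptX(2))
    show "real (l (r k)) * hk (r k) \<le> ln (real (card (S (r k))))" for k by (rule many)
  qed (use mean hlim in auto)
  have m1: "asymptotic_mean \<phi> M = \<alpha>" "asymptotic_mean \<psi> M = - P"
    using asymptotic_mean_Pair[OF M(1) aa psi_asymp_additive] M(2) unfolding \<theta>_def by simp_all
  obtain a' b' where ab': "0 < a'" "\<And>n x. n \<ge> 1 \<Longrightarrow> x \<in> X \<Longrightarrow> \<psi> n x \<le> - a' * real n" "\<And>n x. n \<ge> 1 \<Longrightarrow> x \<in> X \<Longrightarrow> - b' * real n \<le> \<psi> n x"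
    using psi_steps by metis
  have "P > 0" using asymptotic_mean_psi_bounds(2)[OF M(1) ab'(2,3)] m1(2) ab'(1) by simp
  then have "t \<le> entropy_rate (word_prob M) / - asymptotic_mean \<psi> M"
    using M(3) m1(2) by (simp add: pos_le_divide_eq mult.commute)
  then show ?thesis using that[OF M(1) m1(1)] by simp
qed

end

section \<open>Upper bounds for dimensions\<close>

text \<open>Sets of measure zero are closed under countable unions: the \<open>N\<close>-th set is
  covered at cost \<open>e / 2 ^ (N + 1)\<close>, and these covers are merged into a single
  sequence.\<close>

lemma hausdorff_null:
  fixes G :: "nat \<Rightarrow> 'a set"
  assumes E: "E \<subseteq> (\<Union>N. G N)" and s: "s > 0"
    and cov: "\<And>N \<delta> e. \<delta> > 0 \<Longrightarrow> e > 0 \<Longrightarrow> \<exists>\<U>. finite \<U> \<and> G N \<subseteq> \<Union>\<U> \<and> (\<forall>U\<in>\<U>. U \<subseteq> X \<and> diam_le d \<delta> U) \<and> (\<Sum>U\<in>\<U>. set_diam d U powr s) \<le> e"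
  shows "hausdorff_outer_measure X d s E = 0"
proof -
  have small: "hausdorff_premeasure X d s \<delta> E \<le> ennreal e" if \<delta>: "\<delta> > 0" and e: "e > 0" for \<delta> e
  proof -
    have "\<forall>N. \<exists>\<U>. finite \<U> \<and> G N \<subseteq> \<Union>\<U> \<and> (\<forall>U\<in>\<U>. U \<subseteq> X \<and> diam_le d \<delta> U) \<and> (\<Sum>U\<in>\<U>. set_diam d U powr s) \<le> e * (1 / 2) ^ Suc N"
      using e by (intro allI cov \<delta> mult_pos_pos) auto
    from choice[OF this] obtain \<U> where "\<forall>N. finite (\<U> N) \<and> G N \<subseteq> \<Union>(\<U> N) \<and> (\<forall>U\<in>\<U> N. U \<subseteq> X \<and> diam_le d \<delta> U) \<and> (\<Sum>U\<in>\<U> N. set_diam d U powr s) \<le> e * (1 / 2) ^ Suc N" ..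
    then have \<U>: "\<And>N. finite (\<U> N)" "\<And>N. G N \<subseteq> \<Union>(\<U> N)" "\<And>N U. U \<in> \<U> N \<Longrightarrow> U \<subseteq> X \<and> diam_le d \<delta> U"
      "\<And>N. (\<Sum>U\<in>\<U> N. set_diam d U powr s) \<le> e * (1 / 2) ^ Suc N" by simp_all
    have "\<forall>N. \<exists>p. \<U> N = fst p ` {i::nat. i < snd p} \<and> inj_on (fst p) {i. i < snd p}"
    proof
      fix N
      obtain k f where "\<U> N = f ` {i::nat. i < k}" "inj_on f {i. i < k}" using finite_imp_nat_seg_image_inj_on[OF \<U>(1)[of N]] by blast
      then show "\<exists>p. \<U> N = fst p ` {i::nat. i < snd p} \<and> inj_on (fst p) {i. i < snd p}" by (intro exI[of _ "(f, k)"]) simp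
    qed
    from choice[OF this] obtain p where p: "\<And>N. \<U> N = fst (p N) ` {i::nat. i < snd (p N)}" "\<And>N. inj_on (fst (p N)) {i. i < snd (p N)}" by blast
    define V where "V N i = (if i < snd (p N) then fst (p N) i else {})" for N i
    define U where "U j = (case prod_decode j of (N, i) \<Rightarrow> V N i)" for j
    have V: "V N i \<subseteq> X \<and> diam_le d \<delta> (V N i)" for N i
      using \<U>(3)[of "V N i" N] p(1)[of N] by (cases "i < snd (p N)") (auto simp: V_def diam_le_def)
    have row: "(\<Sum>i. ennreal (set_diam d (V N i) powr s)) \<le> ennreal (e * (1 / 2) ^ Suc N)" for N
    proof -
      have "(\<Sum>i. ennreal (set_diam d (V N i) powr s)) = (\<Sum>i\<in>{i. i < snd (p N)}. ennreal (set_diam d (V N i) powr s))"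
        by (rule suminf_finite) (auto simp: V_def set_diam_def)
      also have "\<dots> = ennreal (\<Sum>i\<in>{i. i < snd (p N)}. set_diam d (fst (p N) i) powr s)"
        by (simp add: V_def sum_ennreal)
      also have "(\<Sum>i\<in>{i. i < snd (p N)}. set_diam d (fst (p N) i) powr s) = (\<Sum>U\<in>\<U> N. set_diam d U powr s)"
        unfolding p(1) by (simp add: sum.reindex[OF p(2)])
      finally show ?thesis using \<U>(4)[of N] by (simp add: ennreal_leI)
    qed
    have "E \<subseteq> (\<Union>j. U j)"
    proof
      fix x assume "x \<in> E"
      then obtain N where "x \<in> G N" using E by blast
      then obtain i where i: "i < snd (p N)" "x \<in> fst (p N) i" using \<U>(2)[of N] p(1)[of N] by blast
      then have "x \<in> U (prod_encode (N, i))" by (simp add: U_def V_def)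
      then show "x \<in> (\<Union>j. U j)" by blast
    qed
    moreover have "\<forall>j. U j \<subseteq> X \<and> diam_le d \<delta> (U j)" unfolding U_def using V by (auto split: prod.split)
    ultimately have "hausdorff_premeasure X d s \<delta> E \<le> (\<Sum>j. ennreal (set_diam d (U j) powr s))"
      unfolding hausdorff_premeasure_def by (intro INF_lower) auto
    also have "\<dots> = (\<Sum>j. (\<lambda>(N, i). ennreal (set_diam d (V N i) powr s)) (prod_decode j))"
      by (simp add: U_def case_prod_beta)
    also have "\<dots> = (\<Sum>N. \<Sum>i. ennreal (set_diam d (V N i) powr s))" by (rule suminf_ennreal_2dimen) simp
    also have "\<dots> \<le> (\<Sum>N. ennreal (e * (1 / 2) ^ Suc N))" by (intro suminf_le row) auto
    also have "\<dots> = ennreal (e * 1)" using e by (intro suminf_ennreal_eq sums_mult power_half_series) auto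
    finally show ?thesis by simp
  qed
  have "hausdorff_premeasure X d s \<delta> E = 0" if \<delta>: "\<delta> > 0" for \<delta>
  proof -
    have "hausdorff_premeasure X d s \<delta> E \<le> 0" by (rule ennreal_le_epsilon) (use small[OF \<delta>] in simp)
    then show ?thesis by simp
  qed
  then show ?thesis unfolding hausdorff_outer_measure_def by (simp add: SUP_eq_const)
qed

lemma hausdorff_premeasure_mono: "E \<subseteq> F \<Longrightarrow> hausdorff_premeasure X d s \<delta> E \<le> hausdorff_premeasure X d s \<delta> F"
  unfolding hausdorff_premeasure_def by (intro INF_superset_mono) auto

lemma hausdorff_dim_mono:
  assumes "E \<subseteq> F"
  shows "hausdorff_dim X d E \<le> hausdorff_dim X d F"
proof -
  have "hausdorff_outer_measure X d s E \<le> hausdorff_outer_measure X d s F" for s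
    unfolding hausdorff_outer_measure_def by (intro SUP_mono) (use hausdorff_premeasure_mono[OF assms] in blast)
  then show ?thesis unfolding hausdorff_dim_def
  proof (intro Inf_superset_mono subsetI)
    fix r assume "r \<in> {ereal s |s. 0 < s \<and> hausdorff_outer_measure X d s F = 0}"
    then obtain s where s: "r = ereal s" "0 < s" "hausdorff_outer_measure X d s F = 0" by blast
    then have "hausdorff_outer_measure X d s E = 0" using \<open>hausdorff_outer_measure X d s E \<le> hausdorff_outer_measure X d s F\<close> by simp
    then show "r \<in> {ereal s |s. 0 < s \<and> hausdorff_outer_measure X d s E = 0}" using s by blast
  qed
qed

lemma hausdorff_dim_leI:
  assumes "z \<ge> 0" "\<And>e. e > 0 \<Longrightarrow> hausdorff_outer_measure X d (z + e) E = 0"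
  shows "hausdorff_dim X d E \<le> ereal z"
proof (rule ereal_le_epsilon2)
  fix e :: real assume e: "e > 0"
  have "hausdorff_dim X d E \<le> ereal (z + e)"
    unfolding hausdorff_dim_def by (rule Inf_lower) (use assms(1) assms(2)[OF e] e in auto)
  then show "hausdorff_dim X d E \<le> ereal z + ereal e" by simp
qed

lemma frequently_less_Liminf:
  fixes f :: "'a \<Rightarrow> 'b::complete_linorder"
  assumes "Liminf F f < t"
  shows "frequently (\<lambda>n. f n < t) F"
  using assms Liminf_bounded[of t f F] unfolding frequently_def by (auto simp: not_less)

lemma ereal_log_ge: "0 < r \<Longrightarrow> ereal r \<le> c \<Longrightarrow> ereal (ln r) \<le> ereal_log c"
  by (cases c) (auto simp: ereal_log_def)

lemma ereal_log_le: "0 < r \<Longrightarrow> c \<le> ereal r \<Longrightarrow> ereal_log c \<le> ereal (ln r)"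
  by (cases c) (auto simp: ereal_log_def)

lemma ereal_log_card: "n > 0 \<Longrightarrow> c > 0 \<Longrightarrow> ereal_log (ereal (real c)) / ereal (real n) = ereal (ln (real c) / real n)"
  by (simp add: ereal_log_def)

lemma ereal_log_card_0: "n > 0 \<Longrightarrow> ereal_log (ereal (real 0)) / ereal (real n) = - \<infinity>"
  by (simp add: ereal_log_def)

lemma Lim_at_right_mono:
  fixes g :: "real \<Rightarrow> ereal"
  assumes mono: "\<And>e e'. 0 < e \<Longrightarrow> e \<le> e' \<Longrightarrow> g e \<le> g e'"
  shows "Lim (at_right 0) g = (INF e\<in>{0<..}. g e)"
proof (rule tendsto_Lim)
  show "(g \<longlongrightarrow> (INF e\<in>{0<..}. g e)) (at_right 0)"
  proof (rule order_tendstoI)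
    fix a assume a: "a < (INF e\<in>{0<..}. g e)"
    have "a < g e" if "e > 0" for e using a that by (meson INF_lower greaterThan_iff less_le_trans)
    then show "eventually (\<lambda>e. a < g e) (at_right 0)" by (intro eventually_at_right_less[THEN eventually_mono]) auto
  next
    fix a assume "(INF e\<in>{0<..}. g e) < a"
    then obtain e where e: "e > 0" "g e < a" by (auto simp: INF_less_iff)
    have "eventually (\<lambda>e'. e' \<in> {0<..<e}) (at_right 0)" using e(1) by (rule eventually_at_right_real)
    then show "eventually (\<lambda>e. g e < a) (at_right 0)"
    proof eventually_elim
      case (elim e')
      then have "g e' \<le> g e" by (intro mono) auto
      then show ?case using e(2) by (rule le_less_trans)
    qed
  qed
qed simp

context neg_potential
begin

lemma diam_le_cylinder: "w \<in> adm \<Longrightarrow> W w \<le> \<delta> \<Longrightarrow> diam_le d \<delta> (cylinder A w)"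
  unfolding diam_le_def using gauge_dist_cylinder order_trans by blast

lemma cylinder_subset_X: "cylinder A w \<subseteq> X"
  by (auto simp: cylinder_def)

lemma ball_cover_X: "X \<subseteq> (\<Union>u\<in>balls n. cylinder A u)"
proof
  fix x assume x: "x \<in> X"
  then obtain k where "seq_prefix x k \<in> balls n" using ball_cover by blast
  then show "x \<in> (\<Union>u\<in>balls n. cylinder A u)" using in_cylinder_prefix[OF x] by blast
qed

text \<open>For an exponent \<open>z + e\<close> above the lower limit there are infinitely many
  \<open>n\<close> for which \<open>G N\<close> is covered by at most \<open>exp (n (z + e /
  2))\<close> cylinders of diameter at most \<open>exp (- n)\<close>. The cost \<open>exp (- n e /
  2)\<close> tends to 0.\<close>

lemma hausdorff_dim_le_liminf:
  fixes f :: "nat \<Rightarrow> ereal" and G :: "nat \<Rightarrow> (nat \<Rightarrow> nat) set"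
  assumes E: "E \<subseteq> (\<Union>N. G N)" and f0: "0 \<le> liminf f"
    and G: "\<And>N. eventually (\<lambda>n. \<exists>C\<subseteq>balls n. G N \<subseteq> (\<Union>u\<in>C. cylinder A u) \<and> ereal_log (ereal (real (card C))) / ereal (real n) \<le> f n) sequentially"
  shows "hausdorff_dim X d E \<le> liminf f"
proof (rule ereal_le_real)
  fix z assume z: "liminf f \<le> ereal z"
  from order_trans[OF f0 this] have z0: "z \<ge> 0" by simp
  show "hausdorff_dim X d E \<le> ereal z"
  proof (rule hausdorff_dim_leI[OF z0])
    fix e :: real assume e: "e > 0"
    show "hausdorff_outer_measure X d (z + e) E = 0"
    proof (rule hausdorff_null[OF E])
      show "z + e > 0" using z0 e by simp
      fix N and \<delta> e0 :: real assume \<delta>: "\<delta> > 0" and e0: "e0 > 0"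
      have "(\<lambda>n. exp (- (real n * 1))) \<longlonglongrightarrow> 0" and "(\<lambda>n. exp (- (real n * (e / 2)))) \<longlonglongrightarrow> 0"
        using e by real_asymp+
      then have ev: "eventually (\<lambda>n. exp (- (real n * 1)) < \<delta>) sequentially" "eventually (\<lambda>n. exp (- (real n * (e / 2))) < e0) sequentially"
        using \<delta> e0 by (auto dest: order_tendstoD(2))
      have "liminf f < ereal (z + e / 2)" using z e by (rule_tac le_less_trans) auto
      from frequently_eventually_frequently[OF frequently_less_Liminf[OF this] eventually_conj[OF eventually_conj[OF ev] eventually_conj[OF G[of N] eventually_gt_at_top[of 0]]]]
      have "\<exists>n. f n < ereal (z + e / 2) \<and> (exp (- (real n * 1)) < \<delta> \<and> exp (- (real n * (e / 2))) < e0) \<and>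
        ((\<exists>C\<subseteq>balls n. G N \<subseteq> (\<Union>u\<in>C. cylinder A u) \<and> ereal_log (ereal (real (card C))) / ereal (real n) \<le> f n) \<and> 0 < n)"
        by (rule frequently_ex)
      then obtain n where n: "f n < ereal (z + e / 2)" "exp (- real n) < \<delta>" "exp (- (real n * (e / 2))) < e0" "n > 0"
        "\<exists>C\<subseteq>balls n. G N \<subseteq> (\<Union>u\<in>C. cylinder A u) \<and> ereal_log (ereal (real (card C))) / ereal (real n) \<le> f n"
        unfolding mult_1_right by blast
      from n(5) obtain C where C: "C \<subseteq> balls n" "G N \<subseteq> (\<Union>u\<in>C. cylinder A u)" "ereal_log (ereal (real (card C))) / ereal (real n) \<le> f n" by blast
      have fC: "finite C" using C(1) finite_balls finite_subset by blast
      have card: "real (card C) \<le> exp (real n * (z + e / 2))"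
      proof (cases "card C = 0")
        case False
        have "ereal (ln (real (card C)) / real n) \<le> f n"
          using C(3) ereal_log_card[of n "card C"] n(4) False by simp
        then have "ereal (ln (real (card C)) / real n) < ereal (z + e / 2)" using n(1) by (rule le_less_trans)
        then have "ln (real (card C)) \<le> real n * (z + e / 2)" using n(4) by (simp add: pos_divide_less_eq mult.commute)
        then have "exp (ln (real (card C))) \<le> exp (real n * (z + e / 2))" by simp
        then show ?thesis using False by simp
      qed simp
      have u: "u \<in> adm" "W u \<le> exp (- real n)" if "u \<in> C" for u using ballsD(1,2) C(1) that by blast+
      have "(\<Sum>U\<in>cylinder A ` C. set_diam d U powr (z + e)) \<le> (\<Sum>u\<in>C. set_diam d (cylinder A u) powr (z + e))"
        using sum_image_le[OF fC, of "\<lambda>U. set_diam d U powr (z + e)" "cylinder A"] by (simp add: comp_def)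
      also have "\<dots> \<le> (\<Sum>u\<in>C. exp (- (real n * (z + e))))"
      proof (intro sum_mono)
        fix v assume v: "v \<in> C"
        have "set_diam d (cylinder A v) \<le> exp (- real n)" using set_diam_cylinder[OF u(1)[OF v]] u(2)[OF v] by (rule order_trans)
        then have "set_diam d (cylinder A v) powr (z + e) \<le> exp (- real n) powr (z + e)"
          using z0 e set_diam_nonneg[OF cylinder_subset_X] by (intro powr_mono2) auto
        then show "set_diam d (cylinder A v) powr (z + e) \<le> exp (- (real n * (z + e)))" by (simp add: powr_def mult.commute)
      qed
      also have "\<dots> = real (card C) * exp (- (real n * (z + e)))" by simp
      also have "\<dots> \<le> exp (real n * (z + e / 2)) * exp (- (real n * (z + e)))" using card by (intro mult_right_mono) auto
      also have "\<dots> = exp (- (real n * (e / 2)))" by (simp add: exp_add[symmetric] algebra_simps)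
      finally have sum: "(\<Sum>U\<in>cylinder A ` C. set_diam d U powr (z + e)) \<le> e0" using n(3) by linarith
      have "diam_le d \<delta> (cylinder A v)" if "v \<in> C" for v using u[OF that] n(2) by (intro diam_le_cylinder) auto
      then show "\<exists>\<U>. finite \<U> \<and> G N \<subseteq> \<Union>\<U> \<and> (\<forall>U\<in>\<U>. U \<subseteq> X \<and> diam_le d \<delta> U) \<and> (\<Sum>U\<in>\<U>. set_diam d U powr (z + e)) \<le> e0"
        using fC C(2) sum cylinder_subset_X by (intro exI[of _ "cylinder A ` C"]) auto
    qed
  qed
qed

lemma hausdorff_dim_le_growth: "hausdorff_dim X d X \<le> liminf (\<lambda>n. ereal (ball_growth A \<psi> n))"
proof (rule hausdorff_dim_le_liminf)
  show "X \<subseteq> (\<Union>N::nat. X)" by blast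
  have "0 \<le> ball_growth A \<psi> n" for n
    unfolding ball_growth_def using card_balls_pos[of n] by (intro divide_nonneg_nonneg ln_ge_zero) auto
  then show "0 \<le> liminf (\<lambda>n. ereal (ball_growth A \<psi> n))" by (intro Liminf_bounded always_eventually) auto
  have "eventually (\<lambda>n::nat. n > 0) sequentially" by (rule eventually_gt_at_top)
  then show "eventually (\<lambda>n. \<exists>C\<subseteq>balls n. X \<subseteq> (\<Union>u\<in>C. cylinder A u) \<and> ereal_log (ereal (real (card C))) / ereal (real n) \<le> ereal (ball_growth A \<psi> n)) sequentially"
  proof eventually_elim
    case (elim n)
    have "card (balls n) > 0" using card_balls_pos[of n] by linarith
    then show ?case using ball_cover_X[of n] ereal_log_card[OF elim, of "card (balls n)"] by (intro exI[of _ "balls n"]) (simp add: ball_growth_def)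
  qed
qed

definition count_rate :: "(nat \<Rightarrow> (nat \<Rightarrow> nat) \<Rightarrow> real ^ 'd) \<Rightarrow> real ^ 'd \<Rightarrow> real \<Rightarrow> nat \<Rightarrow> ereal" where
  "count_rate \<phi> \<alpha> \<epsilon> n = ereal_log (ereal (real (level_count A \<psi> \<phi> \<alpha> n \<epsilon>))) / ereal (real n)"

lemma count_rate_mono:
  assumes "\<epsilon> \<le> \<epsilon>'" "n > 0"
  shows "count_rate \<phi> \<alpha> \<epsilon> n \<le> count_rate \<phi> \<alpha> \<epsilon>' n"
proof -
  have le: "level_count A \<psi> \<phi> \<alpha> n \<epsilon> \<le> level_count A \<psi> \<phi> \<alpha> n \<epsilon>'"
    unfolding level_count_def using finite_balls[of n] assms(1) by (intro card_mono) (auto intro: less_le_trans)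
  show ?thesis
  proof (cases "level_count A \<psi> \<phi> \<alpha> n \<epsilon> = 0")
    case True
    then show ?thesis using ereal_log_card_0[OF assms(2)] by (simp add: count_rate_def)
  next
    case False
    then show ?thesis using le assms(2) unfolding count_rate_def
      by (subst (1 2) ereal_log_card) (auto intro!: divide_right_mono)
  qed
qed

lemma Lambda_INF:
  "Lambda_lower A \<psi> \<phi> \<alpha> = (INF \<epsilon>\<in>{0<..}. liminf (count_rate \<phi> \<alpha> \<epsilon>))"
  "Lambda_upper A \<psi> \<phi> \<alpha> = (INF \<epsilon>\<in>{0<..}. limsup (count_rate \<phi> \<alpha> \<epsilon>))"
proof -
  have ev: "eventually (\<lambda>n. count_rate \<phi> \<alpha> \<epsilon> n \<le> count_rate \<phi> \<alpha> \<epsilon>' n) sequentially" if "\<epsilon> \<le> \<epsilon>'" for \<epsilon> \<epsilon>'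
    using eventually_gt_at_top[of 0] by eventually_elim (rule count_rate_mono[OF that])
  show "Lambda_lower A \<psi> \<phi> \<alpha> = (INF \<epsilon>\<in>{0<..}. liminf (count_rate \<phi> \<alpha> \<epsilon>))"
    unfolding Lambda_lower_def count_rate_def[symmetric] by (intro Lim_at_right_mono Liminf_mono ev)
  show "Lambda_upper A \<psi> \<phi> \<alpha> = (INF \<epsilon>\<in>{0<..}. limsup (count_rate \<phi> \<alpha> \<epsilon>))"
    unfolding Lambda_upper_def count_rate_def[symmetric] by (intro Lim_at_right_mono Limsup_mono ev)
qed

lemma Lambda_lower_le_upper: "Lambda_lower A \<psi> \<phi> \<alpha> \<le> Lambda_upper A \<psi> \<phi> \<alpha>"
  unfolding Lambda_INF by (intro INF_mono) (use Liminf_le_Limsup[OF sequentially_bot] in blast)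

text \<open>The level set is the union over \<open>N\<close> of its points whose averages are
  \<open>\<epsilon>\<close>-close to \<open>\<alpha>\<close> from time \<open>N\<close> on. Once all
  words of balls of radius \<open>exp (- n)\<close> are longer than \<open>N\<close>, the balls
  around such points are counted.\<close>

lemma spectrum_dim_le_Lambda:
  assumes ne: "level_set A \<phi> \<alpha> \<noteq> {}"
  shows "spectrum_dim A \<psi> \<phi> \<alpha> \<le> Lambda_lower A \<psi> \<phi> \<alpha>"
  unfolding Lambda_INF
proof (rule INF_greatest)
  fix \<epsilon> :: real assume "\<epsilon> \<in> {0<..}"
  then have \<epsilon>: "\<epsilon> > 0" by simp
  define G where "G N = {x \<in> X. \<forall>k\<ge>N. norm (\<phi> k x /\<^sub>R real k - \<alpha>) < \<epsilon>}" for N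
  define C where "C n = {u \<in> balls n. \<exists>x\<in>cylinder A u. norm (\<phi> (length u) x /\<^sub>R real (length u) - \<alpha>) < \<epsilon>}" for n
  have count: "count_rate \<phi> \<alpha> \<epsilon> n = ereal_log (ereal (real (card (C n)))) / ereal (real n)" for n
    by (simp add: count_rate_def level_count_def C_def)
  have E: "level_set A \<phi> \<alpha> \<subseteq> (\<Union>N. G N)"
  proof
    fix x assume x: "x \<in> level_set A \<phi> \<alpha>"
    then have "(\<lambda>n. \<phi> n x /\<^sub>R real n) \<longlonglongrightarrow> \<alpha>" by (simp add: level_set_def)
    from LIMSEQ_D[OF this \<epsilon>] show "x \<in> (\<Union>N. G N)" using x by (auto simp: level_set_def G_def)
  qed
  obtain b where b: "0 < b" "\<And>n u. n \<ge> 1 \<Longrightarrow> u \<in> balls n \<Longrightarrow> real n \<le> b * real (length u)" using ball_length by metis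
  have cov: "eventually (\<lambda>n. n > 0 \<and> G N \<subseteq> (\<Union>u\<in>C n. cylinder A u)) sequentially" for N
  proof -
    obtain n0 :: nat where n0: "b * real N < real n0" using reals_Archimedean2 by blast
    show ?thesis
    proof (rule eventually_sequentiallyI[of "max 1 n0"], intro conjI subsetI)
      fix n assume n: "max 1 n0 \<le> n"
      then show "0 < n" by simp
      fix x assume x: "x \<in> G N"
      then have xX: "x \<in> X" by (simp add: G_def)
      obtain k where k: "seq_prefix x k \<in> balls n" using ball_cover[OF xX] by blast
      have "b * real N < b * real k" using b(2)[OF _ k] n n0 by simp
      then have "N \<le> k" using b(1) by simp
      then have "norm (\<phi> k x /\<^sub>R real k - \<alpha>) < \<epsilon>" using x by (simp add: G_def)
      then have "seq_prefix x k \<in> C n" using k in_cylinder_prefix[OF xX, of k] by (auto simp: C_def)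
      then show "x \<in> (\<Union>u\<in>C n. cylinder A u)" using in_cylinder_prefix[OF xX] by blast
    qed
  qed
  obtain x N where x: "x \<in> G N" using ne E by blast
  show "spectrum_dim A \<psi> \<phi> \<alpha> \<le> liminf (count_rate \<phi> \<alpha> \<epsilon>)"
  proof (rule hausdorff_dim_le_liminf[OF E])
    show "0 \<le> liminf (count_rate \<phi> \<alpha> \<epsilon>)"
    proof (rule Liminf_bounded)
      show "eventually (\<lambda>n. 0 \<le> count_rate \<phi> \<alpha> \<epsilon> n) sequentially"
        using cov[of N]
      proof eventually_elim
        case (elim n)
        then have "C n \<noteq> {}" using x by blast
        moreover have "finite (C n)" using finite_balls by (simp add: C_def)
        ultimately have "card (C n) > 0" by (simp add: card_gt_0_iff)
        then show ?case using elim unfolding count by (subst ereal_log_card) auto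
      qed
    qed
    fix N
    show "eventually (\<lambda>n. \<exists>C\<subseteq>balls n. G N \<subseteq> (\<Union>u\<in>C. cylinder A u) \<and> ereal_log (ereal (real (card C))) / ereal (real n) \<le> count_rate \<phi> \<alpha> \<epsilon> n) sequentially"
      using cov[of N]
    proof eventually_elim
      case (elim n)
      then show ?case unfolding count by (intro exI[of _ "C n"]) (auto simp: C_def)
    qed
  qed
qed

lemma covering_number_ge_1: "1 \<le> covering_number X d \<delta> X"
  unfolding covering_number_def
proof (rule INF_greatest)
  fix \<U> assume \<U>: "\<U> \<in> {\<U>. finite \<U> \<and> X \<subseteq> \<Union>\<U> \<and> (\<forall>U\<in>\<U>. U \<subseteq> X \<and> diam_le d \<delta> U)}"
  then have "\<U> \<noteq> {}" using X_nonempty by auto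
  then have "card \<U> > 0" using \<U> by (simp add: card_gt_0_iff)
  then show "1 \<le> ereal (real (card \<U>))" by simp
qed

text \<open>A cover by \<open>k\<close> sets of diameter at most \<open>\<delta>\<close> has cost at
  most \<open>k\<close> times a power of \<open>\<delta>\<close>.\<close>

lemma hausdorff_dim_le_lower_box_dim: "hausdorff_dim X d X \<le> lower_box_dim X d X"
proof (rule ereal_le_real)
  fix z assume z: "lower_box_dim X d X \<le> ereal z"
  have unit: "eventually (\<lambda>\<delta>::real. \<delta> \<in> {0<..<1}) (at_right 0)" by (rule eventually_at_right_real) simp
  have "0 \<le> lower_box_dim X d X" unfolding lower_box_dim_def
  proof (rule Liminf_bounded, use unit in eventually_elim)
    case (elim \<delta>)
    have "0 \<le> ereal_log (covering_number X d \<delta> X)" using ereal_log_ge[of 1 "covering_number X d \<delta> X"] covering_number_ge_1 by (simp add: one_ereal_def zero_ereal_def)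
    then show ?case using elim by (cases "ereal_log (covering_number X d \<delta> X)") (auto intro: divide_nonneg_neg)
  qed
  from order_trans[OF this z] have z0: "z \<ge> 0" by simp
  show "hausdorff_dim X d X \<le> ereal z"
  proof (rule hausdorff_dim_leI[OF z0])
    fix e :: real assume e: "e > 0"
    show "hausdorff_outer_measure X d (z + e) X = 0"
    proof (rule hausdorff_null[where G = "\<lambda>N. X"])
      show "z + e > 0" using z0 e by simp
      fix N and \<delta>0 e0 :: real assume \<delta>0: "\<delta>0 > 0" and e0: "e0 > 0"
      have "((\<lambda>\<delta>. \<delta> powr (e / 2)) \<longlongrightarrow> 0) (at_right 0)" using e by real_asymp
      then have ev: "eventually (\<lambda>\<delta>::real. \<delta> powr (e / 2) < e0) (at_right 0)" using e0 by (rule order_tendstoD(2))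
      have ev': "eventually (\<lambda>\<delta>. \<delta> \<in> {0<..<\<delta>0}) (at_right 0)" using \<delta>0 by (rule eventually_at_right_real)
      have "lower_box_dim X d X < ereal (z + e / 2)" using z e by (rule_tac le_less_trans) auto
      then have "frequently (\<lambda>\<delta>. ereal_log (covering_number X d \<delta> X) / ereal (- ln \<delta>) < ereal (z + e / 2)) (at_right 0)"
        unfolding lower_box_dim_def by (rule frequently_less_Liminf)
      from frequently_eventually_frequently[OF this eventually_conj[OF eventually_conj[OF ev ev'] unit]]
      obtain \<delta> where \<delta>: "ereal_log (covering_number X d \<delta> X) / ereal (- ln \<delta>) < ereal (z + e / 2)" "\<delta> powr (e / 2) < e0" "0 < \<delta>" "\<delta> < \<delta>0" "\<delta> < 1"
        using frequently_ex by (metis (mono_tags, lifting) greaterThanLessThan_iff)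
      have L: "- ln \<delta> > 0" using \<delta>(3,5) by simp
      have "covering_number X d \<delta> X < ereal (exp ((z + e / 2) * - ln \<delta>))"
      proof (rule ccontr)
        assume "\<not> ?thesis"
        then have "ereal (ln (exp ((z + e / 2) * - ln \<delta>))) \<le> ereal_log (covering_number X d \<delta> X)" by (intro ereal_log_ge) (auto simp: not_less)
        then have "ereal ((z + e / 2) * - ln \<delta>) / ereal (- ln \<delta>) \<le> ereal_log (covering_number X d \<delta> X) / ereal (- ln \<delta>)"
          using L by (intro ereal_divide_right_mono) auto
        moreover have "ereal ((z + e / 2) * - ln \<delta>) / ereal (- ln \<delta>) = ereal (z + e / 2)" using L by simp
        ultimately show False using \<delta>(1) by (metis less_le_not_le)
      qed
      then obtain \<U> where \<U>: "finite \<U>" "X \<subseteq> \<Union>\<U>" "\<And>U. U \<in> \<U> \<Longrightarrow> U \<subseteq> X \<and> diam_le d \<delta> U" "real (card \<U>) < exp ((z + e / 2) * - ln \<delta>)"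
        unfolding covering_number_def INF_less_iff by auto
      have "(\<Sum>U\<in>\<U>. set_diam d U powr (z + e)) \<le> (\<Sum>U\<in>\<U>. \<delta> powr (z + e))"
      proof (intro sum_mono powr_mono2)
        fix U assume U: "U \<in> \<U>"
        show "set_diam d U \<le> \<delta>" using \<U>(3)[OF U] \<delta>(3) by (intro set_diam_le) (auto simp: diam_le_def)
        show "0 \<le> set_diam d U" using \<U>(3)[OF U] set_diam_nonneg by blast
      qed (use z0 e in simp)
      also have "\<dots> = real (card \<U>) * \<delta> powr (z + e)" by simp
      also have "\<dots> \<le> exp ((z + e / 2) * - ln \<delta>) * \<delta> powr (z + e)" using \<U>(4) by (intro mult_right_mono) auto
      also have "\<dots> = \<delta> powr (e / 2)" using \<delta>(3) by (simp add: powr_def exp_add[symmetric] algebra_simps)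
      finally have sum: "(\<Sum>U\<in>\<U>. set_diam d U powr (z + e)) \<le> e0" using \<delta>(2) by linarith
      have "diam_le d \<delta>0 U" if "U \<in> \<U>" for U using \<U>(3)[OF that] \<delta>(4) unfolding diam_le_def by fastforce
      then show "\<exists>\<U>. finite \<U> \<and> X \<subseteq> \<Union>\<U> \<and> (\<forall>U\<in>\<U>. U \<subseteq> X \<and> diam_le d \<delta>0 U) \<and> (\<Sum>U\<in>\<U>. set_diam d U powr (z + e)) \<le> e0"
        using \<U> sum by blast
    qed blast
  qed
qed

text \<open>A radius \<open>\<delta>\<close> is compared with \<open>exp (- n)\<close> for
  \<open>n\<close> the upper integer part of \<open>- ln \<delta>\<close>.\<close>

lemma upper_box_dim_le_growth:
  assumes lim: "ball_growth A \<psi> \<longlonglongrightarrow> G"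
  shows "upper_box_dim X d X \<le> ereal G"
proof -
  define n where "n \<delta> = nat \<lceil>- ln \<delta>\<rceil>" for \<delta> :: real
  have unit: "eventually (\<lambda>\<delta>::real. \<delta> \<in> {0<..<1}) (at_right 0)" by (rule eventually_at_right_real) simp
  have le: "eventually (\<lambda>\<delta>. ereal_log (covering_number X d \<delta> X) / ereal (- ln \<delta>) \<le> ereal (ball_growth A \<psi> (n \<delta>) * (real (n \<delta>) / - ln \<delta>))) (at_right 0)"
    using unit
  proof eventually_elim
    case (elim \<delta>)
    then have L: "- ln \<delta> > 0" by simp
    then have n: "- ln \<delta> \<le> real (n \<delta>)" "n \<delta> > 0" unfolding n_def by linarith+
    have "exp (- real (n \<delta>)) \<le> exp (ln \<delta>)" using n(1) by (subst exp_le_cancel_iff) linarith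
    also have "\<dots> = \<delta>" using elim by (intro exp_ln) auto
    finally have \<delta>: "exp (- real (n \<delta>)) \<le> \<delta>" .
    have "diam_le d \<delta> (cylinder A u)" if "u \<in> balls (n \<delta>)" for u
      using ballsD(1,2)[OF that] \<delta> by (intro diam_le_cylinder) auto
    then have "covering_number X d \<delta> X \<le> ereal (real (card (cylinder A ` balls (n \<delta>))))"
      unfolding covering_number_def using finite_balls ball_cover_X cylinder_subset_X by (intro INF_lower) auto
    also have "\<dots> \<le> ereal (real (card (balls (n \<delta>))))" using card_image_le[OF finite_balls] by simp
    finally have "ereal_log (covering_number X d \<delta> X) \<le> ereal (ln (real (card (balls (n \<delta>)))))"
      using card_balls_pos[of "n \<delta>"] by (intro ereal_log_le) auto
    then have "ereal_log (covering_number X d \<delta> X) / ereal (- ln \<delta>) \<le> ereal (ln (real (card (balls (n \<delta>))))) / ereal (- ln \<delta>)"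
      using L by (intro ereal_divide_right_mono) auto
    also have "\<dots> = ereal (ball_growth A \<psi> (n \<delta>) * (real (n \<delta>) / - ln \<delta>))" using L n(2) by (simp add: ball_growth_def)
    finally show ?case .
  qed
  have "filterlim (\<lambda>\<delta>::real. nat \<lceil>- ln \<delta>\<rceil>) at_top (at_right 0)" by real_asymp
  then have nlim: "filterlim n at_top (at_right 0)" by (simp add: n_def[abs_def])
  have "((\<lambda>\<delta>::real. real (nat \<lceil>- ln \<delta>\<rceil>) / - ln \<delta>) \<longlongrightarrow> 1) (at_right 0)" by real_asymp
  then have "((\<lambda>\<delta>. real (n \<delta>) / - ln \<delta>) \<longlongrightarrow> 1) (at_right 0)" by (simp add: n_def[abs_def])
  from tendsto_mult[OF filterlim_compose[OF lim nlim] this]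
  have "((\<lambda>\<delta>. ball_growth A \<psi> (n \<delta>) * (real (n \<delta>) / - ln \<delta>)) \<longlongrightarrow> G) (at_right 0)" by simp
  then have "((\<lambda>\<delta>. ereal (ball_growth A \<psi> (n \<delta>) * (real (n \<delta>) / - ln \<delta>))) \<longlongrightarrow> ereal G) (at_right 0)" by (rule tendsto_ereal)
  then have "Limsup (at_right 0) (\<lambda>\<delta>. ereal (ball_growth A \<psi> (n \<delta>) * (real (n \<delta>) / - ln \<delta>))) = ereal G" by (intro lim_imp_Limsup) auto
  then show ?thesis using Limsup_mono[OF le] by (simp add: upper_box_dim_def)
qed

end

section \<open>The spectrum\<close>

lemma frequently_Limsup_greater:
  fixes f :: "'a \<Rightarrow> 'b::complete_linorder"
  assumes "t < Limsup F f"
  shows "frequently (\<lambda>n. t < f n) F"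
  using assms Limsup_bounded[of f t F] unfolding frequently_def by (auto simp: not_less)

context sft
begin

text \<open>A convex combination of word probabilities is stationary. The mean is linear in word
  probabilities, up to \<open>\<eta>\<close>, and block entropies are concave because
  \<open>eta\<close> is.\<close>

lemma mixture:
  fixes \<theta> :: "nat \<Rightarrow> (nat \<Rightarrow> nat) \<Rightarrow> 'b::euclidean_space"
  assumes M: "M1 \<in> invariant_measures A" "M2 \<in> invariant_measures A" and s: "0 \<le> s" "s \<le> 1" and aa: "asymp_additive A \<theta>"
  obtains M where "M \<in> invariant_measures A"
    "asymptotic_mean \<theta> M = s *\<^sub>R asymptotic_mean \<theta> M1 + (1 - s) *\<^sub>R asymptotic_mean \<theta> M2"
    "s * entropy_rate (word_prob M1) + (1 - s) * entropy_rate (word_prob M2) \<le> entropy_rate (word_prob M)"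
proof -
  define g where "g w = s * word_prob M1 w + (1 - s) * word_prob M2 w" for w
  note st = stationary_word_prob[OF M(1)] stationary_word_prob[OF M(2)]
  have g: "stationary g" unfolding stationary_def
  proof (intro conjI allI impI)
    show "g [] = 1" using stationaryD(1)[OF st(1)] stationaryD(1)[OF st(2)] by (simp add: g_def)
    show "0 \<le> g w" for w using s stationaryD(2)[OF st(1)] stationaryD(2)[OF st(2)] by (simp add: g_def)
    show "g w = 0" if "w \<notin> adm" for w using stationaryD(3)[OF st(1) that] stationaryD(3)[OF st(2) that] by (simp add: g_def)
    show "g w = (\<Sum>a<m. g (w @ [a]))" for w
      unfolding g_def sum.distrib sum_distrib_left[symmetric] stationaryD(4)[OF st(1)] stationaryD(4)[OF st(2)] ..
    show "g w = (\<Sum>a<m. g (a # w))" for w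
      unfolding g_def sum.distrib sum_distrib_left[symmetric] stationaryD(5)[OF st(1)] stationaryD(5)[OF st(2)] ..
  qed
  obtain N where N: "N \<in> invariant_measures A" "\<And>w. word_prob N w = g w" using measure_of_stationary[OF g] by blast
  have wN: "word_prob N = g" using N(2) by (rule ext)
  let ?m = "s *\<^sub>R asymptotic_mean \<theta> M1 + (1 - s) *\<^sub>R asymptotic_mean \<theta> M2"
  have "norm (asymptotic_mean \<theta> N - ?m) \<le> 0 + e" if e: "e > 0" for e
  proof -
    have "e / 2 > 0" using e by simp
    from asymp_additiveD[OF aa this] obtain q G K where G: "\<And>n x. n \<ge> 1 \<Longrightarrow> x \<in> X \<Longrightarrow>
      norm (\<theta> n x - (\<Sum>i<n. G (seq_prefix ((shift ^^ i) x) q))) \<le> (e / 2) * real n + K" by metis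
    define S where "S M = (\<Sum>w\<in>words q. word_prob M w *\<^sub>R G w)" for M
    have app: "norm (asymptotic_mean \<theta> M - S M) \<le> e / 2" if "M \<in> invariant_measures A" for M
      unfolding S_def using asymptotic_mean_approx[OF that aa G] by blast
    have SN: "S N = s *\<^sub>R S M1 + (1 - s) *\<^sub>R S M2"
      unfolding S_def wN g_def by (simp add: scaleR_add_left sum.distrib scaleR_sum_right)
    have "asymptotic_mean \<theta> N - ?m = (asymptotic_mean \<theta> N - S N) - (s *\<^sub>R (asymptotic_mean \<theta> M1 - S M1) + (1 - s) *\<^sub>R (asymptotic_mean \<theta> M2 - S M2))"
      unfolding SN scaleR_diff_right by simp
    then have "norm (asymptotic_mean \<theta> N - ?m) \<le> norm (asymptotic_mean \<theta> N - S N) + norm (s *\<^sub>R (asymptotic_mean \<theta> M1 - S M1) + (1 - s) *\<^sub>R (asymptotic_mean \<theta> M2 - S M2))"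
      by (simp only: norm_triangle_ineq4)
    also have "\<dots> \<le> e / 2 + (s * (e / 2) + (1 - s) * (e / 2))"
    proof (intro add_mono order_trans[OF norm_triangle_ineq])
      show "norm (asymptotic_mean \<theta> N - S N) \<le> e / 2" by (rule app[OF N(1)])
      show "norm (s *\<^sub>R (asymptotic_mean \<theta> M1 - S M1)) \<le> s * (e / 2)" using s app[OF M(1)] by (simp add: mult_left_mono del: times_divide_eq_right)
      show "norm ((1 - s) *\<^sub>R (asymptotic_mean \<theta> M2 - S M2)) \<le> (1 - s) * (e / 2)" using s app[OF M(2)] by (simp add: mult_left_mono del: times_divide_eq_right)
    qed
    also have "\<dots> = e" by (simp only: distrib_right[symmetric]) simp
    finally show ?thesis by simp
  qed
  then have "norm (asymptotic_mean \<theta> N - ?m) \<le> 0" by (rule field_le_epsilon)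
  then have mean: "asymptotic_mean \<theta> N = ?m" by simp
  have "s * entropy_rate (word_prob M1) + (1 - s) * entropy_rate (word_prob M2) \<le> entropy_rate g"
  proof (rule LIMSEQ_le)
    show "(\<lambda>n. s * (block_entropy (word_prob M1) n / real n) + (1 - s) * (block_entropy (word_prob M2) n / real n))
      \<longlonglongrightarrow> s * entropy_rate (word_prob M1) + (1 - s) * entropy_rate (word_prob M2)"
      by (intro tendsto_intros entropy_rate_limit(1) st)
    show "(\<lambda>n. block_entropy g n / real n) \<longlonglongrightarrow> entropy_rate g" by (rule entropy_rate_limit(1)[OF g])
    have "s * block_entropy (word_prob M1) n + (1 - s) * block_entropy (word_prob M2) n \<le> block_entropy g n" for n
      unfolding block_entropy_def sum_distrib_left sum.distrib[symmetric] g_def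
      by (intro sum_mono eta_concave s stationaryD(2)[OF st(1)] stationaryD(2)[OF st(2)])
    from divide_right_mono[OF this, of "real n" for n]
    have "s * (block_entropy (word_prob M1) n / real n) + (1 - s) * (block_entropy (word_prob M2) n / real n) \<le> block_entropy g n / real n" for n
      by (simp add: add_divide_distrib)
    then show "\<exists>N. \<forall>n\<ge>N. s * (block_entropy (word_prob M1) n / real n) + (1 - s) * (block_entropy (word_prob M2) n / real n) \<le> block_entropy g n / real n"
      by blast
  qed
  then show ?thesis using that[OF N(1) mean] by (simp add: wN)
qed

end

context neg_potential
begin

lemma mean_psi_range:
  obtains a b where "0 < a" "\<And>M. M \<in> invariant_measures A \<Longrightarrow> a \<le> - asymptotic_mean \<psi> M"
    "\<And>M. M \<in> invariant_measures A \<Longrightarrow> - asymptotic_mean \<psi> M \<le> b"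
proof (rule psi_steps)
  fix a b assume a: "0 < a" and up: "\<And>n x. n \<ge> 1 \<Longrightarrow> x \<in> X \<Longrightarrow> \<psi> n x \<le> - a * real n"
    and lo: "\<And>n x. n \<ge> 1 \<Longrightarrow> x \<in> X \<Longrightarrow> - b * real n \<le> \<psi> n x"
  show ?thesis
  proof (rule that[OF a])
    fix M assume "M \<in> invariant_measures A"
    from asymptotic_mean_psi_bounds[OF this up lo] show "a \<le> - asymptotic_mean \<psi> M" "- asymptotic_mean \<psi> M \<le> b" by simp_all
  qed
qed

definition dim_ratio :: "(nat \<Rightarrow> nat) measure \<Rightarrow> real" where
  "dim_ratio M = entropy_rate (word_prob M) / - asymptotic_mean \<psi> M"

lemma entropy_quotient:
  assumes M: "M \<in> invariant_measures A"
  shows "measure_entropy M shift / ereal (- asymptotic_mean \<psi> M) = ereal (dim_ratio M)"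
proof (rule mean_psi_range)
  fix a assume "0 < a" "\<And>M. M \<in> invariant_measures A \<Longrightarrow> a \<le> - asymptotic_mean \<psi> M"
  from less_le_trans[OF this(1) this(2)[OF M]] show ?thesis using kolmogorov_sinai[OF M] by (simp add: dim_ratio_def)
qed

text \<open>For \<open>\<epsilon> = 1 / (k + 1)\<close> there are arbitrarily large \<open>n\<close>
  with a growth rate of at least \<open>L - \<epsilon>\<close>. The counted balls for such a choice
  are the families from which a measure is constructed.\<close>

lemma Lambda_upper_attained:
  assumes aa: "asymp_additive A \<phi>" and ninf: "Lambda_upper A \<psi> \<phi> \<alpha> \<noteq> - \<infinity>"
  obtains M where "M \<in> invariant_measures A" "asymptotic_mean \<phi> M = \<alpha>" "Lambda_upper A \<psi> \<phi> \<alpha> \<le> ereal (dim_ratio M)"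
proof -
  define C where "C \<epsilon> n = {u \<in> balls n. \<exists>x\<in>cylinder A u. norm (\<phi> (length u) x /\<^sub>R real (length u) - \<alpha>) < \<epsilon>}" for \<epsilon> n
  have count: "count_rate \<phi> \<alpha> \<epsilon> n = ereal_log (ereal (real (card (C \<epsilon> n)))) / ereal (real n)" for \<epsilon> n
    by (simp add: count_rate_def level_count_def C_def)
  obtain c where c: "\<And>n. n \<ge> 1 \<Longrightarrow> ln (real (card (balls n))) \<le> c * real n" using card_balls_le by metis
  have "Lambda_upper A \<psi> \<phi> \<alpha> \<le> limsup (count_rate \<phi> \<alpha> 1)" unfolding Lambda_INF by (rule INF_lower) simp
  also have "\<dots> \<le> ereal c"
  proof (rule Limsup_bounded)
    show "eventually (\<lambda>n. count_rate \<phi> \<alpha> 1 n \<le> ereal c) sequentially"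
      using eventually_gt_at_top[of 0]
    proof eventually_elim
      case (elim n)
      show ?case
      proof (cases "card (C 1 n) = 0")
        case True
        then show ?thesis using ereal_log_card_0[OF elim] by (simp add: count)
      next
        case False
        have "card (C 1 n) \<le> card (balls n)" using finite_balls by (intro card_mono) (auto simp: C_def)
        then have "ln (real (card (C 1 n))) \<le> ln (real (card (balls n)))" using False by (subst ln_le_cancel_iff) auto
        also have "\<dots> \<le> c * real n" using c[of n] elim by simp
        finally show ?thesis using False elim unfolding count by (subst ereal_log_card) (auto simp: pos_divide_le_eq)
      qed
    qed
  qed
  finally have "Lambda_upper A \<psi> \<phi> \<alpha> \<noteq> \<infinity>" by auto
  then obtain L where L: "Lambda_upper A \<psi> \<phi> \<alpha> = ereal L" using ninf by (cases "Lambda_upper A \<psi> \<phi> \<alpha>") auto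
  define \<epsilon> where "\<epsilon> k = 1 / (real k + 1)" for k
  have \<epsilon>: "\<epsilon> k > 0" for k by (simp add: \<epsilon>_def)
  have \<epsilon>0: "\<epsilon> \<longlonglongrightarrow> 0" unfolding \<epsilon>_def[abs_def] by real_asymp
  have "\<exists>n. k + 1 \<le> n \<and> exp (real n * (L - \<epsilon> k)) \<le> real (card (C (\<epsilon> k) n))" for k
  proof -
    have lim: "ereal L \<le> limsup (count_rate \<phi> \<alpha> (\<epsilon> k))" unfolding L[symmetric] Lambda_INF by (rule INF_lower) (simp add: \<epsilon>)
    have "ereal (L - \<epsilon> k) < ereal L" using \<epsilon>[of k] by simp
    from less_le_trans[OF this lim] have "ereal (L - \<epsilon> k) < limsup (count_rate \<phi> \<alpha> (\<epsilon> k))" .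
    from frequently_ex[OF frequently_eventually_frequently[OF frequently_Limsup_greater[OF this] eventually_ge_at_top[of "k + 1"]]]
    obtain n where n: "ereal (L - \<epsilon> k) < count_rate \<phi> \<alpha> (\<epsilon> k) n" "k + 1 \<le> n" by blast
    then have n0: "n > 0" by simp
    have ne: "card (C (\<epsilon> k) n) \<noteq> 0"
    proof
      assume z: "card (C (\<epsilon> k) n) = 0"
      show False using n(1) unfolding count z ereal_log_card_0[OF n0] by simp
    qed
    then have "L - \<epsilon> k < ln (real (card (C (\<epsilon> k) n))) / real n" using n(1) n0 ereal_log_card[OF n0, of "card (C (\<epsilon> k) n)"] by (simp add: count)
    then have "real n * (L - \<epsilon> k) \<le> ln (real (card (C (\<epsilon> k) n)))" using n0 by (simp add: pos_less_divide_eq mult.commute)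
    then have "exp (real n * (L - \<epsilon> k)) \<le> exp (ln (real (card (C (\<epsilon> k) n))))" by simp
    then show ?thesis using n(2) ne by (intro exI[of _ n]) simp
  qed
  then have "\<forall>k. \<exists>n. k + 1 \<le> n \<and> exp (real n * (L - \<epsilon> k)) \<le> real (card (C (\<epsilon> k) n))" ..
  from choice[OF this] obtain n where n: "\<forall>k. k + 1 \<le> n k \<and> exp (real (n k) * (L - \<epsilon> k)) \<le> real (card (C (\<epsilon> k) (n k)))" ..
  obtain M where "M \<in> invariant_measures A" "asymptotic_mean \<phi> M = \<alpha>" "L \<le> entropy_rate (word_prob M) / - asymptotic_mean \<psi> M"
  proof (rule measure_of_ball_families[OF aa, of n "\<lambda>k. C (\<epsilon> k) (n k)" "\<lambda>k. L - \<epsilon> k" L \<epsilon> \<alpha>])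
    show "filterlim n at_top sequentially"
      by (rule filterlim_at_top_mono[OF filterlim_ident]) (use n in \<open>auto intro!: always_eventually simp: Suc_le_eq less_imp_le\<close>)
    show "1 \<le> n k" for k using spec[OF n, of k] by simp
    show "C (\<epsilon> k) (n k) \<subseteq> balls (n k)" for k by (auto simp: C_def)
    show "exp (real (n k) * (L - \<epsilon> k)) \<le> real (card (C (\<epsilon> k) (n k)))" for k using n by blast
    show "(\<lambda>k. L - \<epsilon> k) \<longlonglongrightarrow> L" using tendsto_diff[OF tendsto_const \<epsilon>0, of L] by simp
    show "\<exists>x\<in>cylinder A u. norm (\<phi> (length u) x /\<^sub>R real (length u) - \<alpha>) \<le> \<epsilon> k" if "u \<in> C (\<epsilon> k) (n k)" for k u
      using that by (auto simp: C_def intro: less_imp_le)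
  qed (rule \<epsilon>0)
  then show ?thesis using that L by (simp add: dim_ratio_def)
qed

lemma spectrum_dim_ge:
  assumes "asymp_additive A \<phi>" "M \<in> invariant_measures A"
  shows "ereal (dim_ratio M) \<le> spectrum_dim A \<psi> \<phi> (asymptotic_mean \<phi> M)"
  unfolding dim_ratio_def using level_set_dimension_ge(2)[OF assms(2,1)] .

text \<open>For a nonempty level set, the growth rates are bounded below by its dimension. In
  particular, they are not \<open>- \<infinity>\<close>.\<close>

lemma level_set_nonempty_attained:
  assumes aa: "asymp_additive A \<phi>" and ne: "level_set A \<phi> \<alpha> \<noteq> {}"
  obtains M where "M \<in> invariant_measures A" "asymptotic_mean \<phi> M = \<alpha>" "Lambda_upper A \<psi> \<phi> \<alpha> \<le> ereal (dim_ratio M)"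
proof -
  have "0 \<le> spectrum_dim A \<psi> \<phi> \<alpha>" by (rule hausdorff_dim_nonneg)
  also have "\<dots> \<le> Lambda_lower A \<psi> \<phi> \<alpha>" by (rule spectrum_dim_le_Lambda[OF ne])
  also have "\<dots> \<le> Lambda_upper A \<psi> \<phi> \<alpha>" by (rule Lambda_lower_le_upper)
  finally have "Lambda_upper A \<psi> \<phi> \<alpha> \<noteq> - \<infinity>" by auto
  from Lambda_upper_attained[OF aa this] show ?thesis using that by blast
qed

lemma level_set_nonempty_iff:
  assumes aa: "asymp_additive A \<phi>"
  shows "level_set A \<phi> \<alpha> \<noteq> {} \<longleftrightarrow> \<alpha> \<in> mean_set A \<phi>"
proof
  assume "level_set A \<phi> \<alpha> \<noteq> {}"
  from level_set_nonempty_attained[OF aa this] show "\<alpha> \<in> mean_set A \<phi>" unfolding mean_set_def by blast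
next
  assume "\<alpha> \<in> mean_set A \<phi>"
  then show "level_set A \<phi> \<alpha> \<noteq> {}" unfolding mean_set_def using level_set_dimension_ge(1)[OF _ aa] by blast
qed

text \<open>The chain of inequalities that starts and ends with the dimension of the level set; the
  last link is the lower bound for the measure \<open>M\<close> that attains the upper growth
  rate.\<close>

lemma spectrum_eq:
  assumes aa: "asymp_additive A \<phi>" and \<alpha>: "\<alpha> \<in> mean_set A \<phi>"
  obtains M where "M \<in> invariant_measures A" "asymptotic_mean \<phi> M = \<alpha>" "spectrum_dim A \<psi> \<phi> \<alpha> = ereal (dim_ratio M)"
    "Lambda_lower A \<psi> \<phi> \<alpha> = ereal (dim_ratio M)" "Lambda_upper A \<psi> \<phi> \<alpha> = ereal (dim_ratio M)"
    "variational A \<psi> \<phi> \<alpha> = ereal (dim_ratio M)"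
proof -
  have ne: "level_set A \<phi> \<alpha> \<noteq> {}" using level_set_nonempty_iff[OF aa] \<alpha> by blast
  obtain M where M: "M \<in> invariant_measures A" "asymptotic_mean \<phi> M = \<alpha>" "Lambda_upper A \<psi> \<phi> \<alpha> \<le> ereal (dim_ratio M)"
    using level_set_nonempty_attained[OF aa ne] by blast
  have ge: "ereal (dim_ratio M) \<le> spectrum_dim A \<psi> \<phi> \<alpha>" using spectrum_dim_ge[OF aa M(1)] M(2) by simp
  note le = spectrum_dim_le_Lambda[OF ne] Lambda_lower_le_upper[of \<phi> \<alpha>] M(3)
  have eq: "spectrum_dim A \<psi> \<phi> \<alpha> = ereal (dim_ratio M)" "Lambda_lower A \<psi> \<phi> \<alpha> = ereal (dim_ratio M)" "Lambda_upper A \<psi> \<phi> \<alpha> = ereal (dim_ratio M)"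
    using ge le by (meson order_antisym order_trans)+
  have "variational A \<psi> \<phi> \<alpha> = ereal (dim_ratio M)"
  proof (rule antisym)
    show "variational A \<psi> \<phi> \<alpha> \<le> ereal (dim_ratio M)" unfolding variational_def
    proof (rule SUP_least)
      fix M' assume M': "M' \<in> {M \<in> invariant_measures A. asymptotic_mean \<phi> M = \<alpha>}"
      then have "ereal (dim_ratio M') \<le> ereal (dim_ratio M)" using spectrum_dim_ge[OF aa, of M'] eq(1) by auto
      then show "measure_entropy M' shift / ereal (- asymptotic_mean \<psi> M') \<le> ereal (dim_ratio M)" using M' entropy_quotient[of M'] by simp
    qed
    show "ereal (dim_ratio M) \<le> variational A \<psi> \<phi> \<alpha>" unfolding variational_def entropy_quotient[OF M(1), symmetric]
      by (rule SUP_upper) (use M in simp)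
  qed
  then show ?thesis using that M(1,2) eq by blast
qed

lemma spectrum_mixture:
  fixes \<phi> :: "nat \<Rightarrow> (nat \<Rightarrow> nat) \<Rightarrow> real ^ 'd"
  assumes aa: "asymp_additive A \<phi>" and M: "M1 \<in> invariant_measures A" "M2 \<in> invariant_measures A" and s: "0 \<le> s" "s \<le> 1"
  obtains M where "M \<in> invariant_measures A"
    "asymptotic_mean \<phi> M = s *\<^sub>R asymptotic_mean \<phi> M1 + (1 - s) *\<^sub>R asymptotic_mean \<phi> M2"
    "asymptotic_mean \<psi> M = s * asymptotic_mean \<psi> M1 + (1 - s) * asymptotic_mean \<psi> M2"
    "s * entropy_rate (word_prob M1) + (1 - s) * entropy_rate (word_prob M2) \<le> entropy_rate (word_prob M)"
proof -
  define \<theta> where "\<theta> n x = (\<phi> n x, \<psi> n x)" for n x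
  have aa\<theta>: "asymp_additive A \<theta>" unfolding \<theta>_def using aa psi_asymp_additive by (rule asymp_additive_Pair)
  have P: "asymptotic_mean \<theta> M = (asymptotic_mean \<phi> M, asymptotic_mean \<psi> M)" if "M \<in> invariant_measures A" for M
    unfolding \<theta>_def by (rule asymptotic_mean_Pair[OF that aa psi_asymp_additive])
  obtain M where M': "M \<in> invariant_measures A" "asymptotic_mean \<theta> M = s *\<^sub>R asymptotic_mean \<theta> M1 + (1 - s) *\<^sub>R asymptotic_mean \<theta> M2"
    "s * entropy_rate (word_prob M1) + (1 - s) * entropy_rate (word_prob M2) \<le> entropy_rate (word_prob M)"
    using mixture[OF M s aa\<theta>] by blast
  show ?thesis by (rule that[OF M'(1) _ _ M'(3)]) (use M'(2) P[OF M'(1)] P[OF M(1)] P[OF M(2)] in simp_all)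
qed

lemma convex_mean_set:
  fixes \<phi> :: "nat \<Rightarrow> (nat \<Rightarrow> nat) \<Rightarrow> real ^ 'd"
  assumes aa: "asymp_additive A \<phi>"
  shows "convex (mean_set A \<phi>)"
  unfolding convex_alt
proof (intro ballI allI impI)
  fix \<alpha> \<beta> and u :: real assume \<alpha>: "\<alpha> \<in> mean_set A \<phi>" "\<beta> \<in> mean_set A \<phi>" and u: "0 \<le> u \<and> u \<le> 1"
  obtain M1 M2 where M: "M1 \<in> invariant_measures A" "M2 \<in> invariant_measures A" "\<alpha> = asymptotic_mean \<phi> M1" "\<beta> = asymptotic_mean \<phi> M2"
    using \<alpha> unfolding mean_set_def by blast
  obtain M where "M \<in> invariant_measures A" "asymptotic_mean \<phi> M = u *\<^sub>R \<beta> + (1 - u) *\<^sub>R \<alpha>"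
    using spectrum_mixture[OF aa M(2,1)] u unfolding M(3,4) by blast
  then show "(1 - u) *\<^sub>R \<alpha> + u *\<^sub>R \<beta> \<in> mean_set A \<phi>" unfolding mean_set_def by (metis add.commute image_eqI)
qed

text \<open>Let \<open>M1\<close> and \<open>M2\<close> be maximising measures for
  \<open>\<alpha>\<close> and \<open>\<beta>\<close>, with means \<open>- P\<close> and \<open>-
  Q\<close> of \<open>\<psi>\<close>. In a mixture with weights proportional to \<open>t / P\<close>
  and \<open>(1 - t) / Q\<close>, the quotient of entropy and mean is at least the average of the
  two quotients with weights \<open>t\<close> and \<open>1 - t\<close>. So \<open>1 / P\<close> and
  \<open>1 / Q\<close> are suitable factors, and they are bounded uniformly.\<close>

lemma weakly_concave_spectrum:
  fixes \<phi> :: "nat \<Rightarrow> (nat \<Rightarrow> nat) \<Rightarrow> real ^ 'd"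
  assumes aa: "asymp_additive A \<phi>"
  shows "weakly_concave_on (mean_set A \<phi>) (\<lambda>\<alpha>. real_of_ereal (spectrum_dim A \<psi> \<phi> \<alpha>))"
proof -
  obtain a b where ab: "0 < a" "\<And>M. M \<in> invariant_measures A \<Longrightarrow> a \<le> - asymptotic_mean \<psi> M"
    "\<And>M. M \<in> invariant_measures A \<Longrightarrow> - asymptotic_mean \<psi> M \<le> b" using mean_psi_range by metis
  define c where "c = max 1 (max b (1 / a))"
  have c: "c \<ge> 1" "b \<le> c" "1 / a \<le> c" by (auto simp: c_def)
  let ?D = "\<lambda>\<alpha>. real_of_ereal (spectrum_dim A \<psi> \<phi> \<alpha>)"
  have range: "1 / P \<in> {1 / c..c}" if "a \<le> P" "P \<le> b" for P
  proof -
    have "1 / c \<le> 1 / P" using that ab(1) c by (intro divide_left_mono) auto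
    moreover have "1 / P \<le> 1 / a" using that ab(1) by (intro divide_left_mono) auto
    ultimately show ?thesis using c by auto
  qed
  have "\<exists>\<gamma>1\<in>{1 / c..c}. \<exists>\<gamma>2\<in>{1 / c..c}. \<forall>t\<in>{0..1}. t * ?D \<alpha> + (1 - t) * ?D \<beta>
    \<le> ?D (((t * \<gamma>1) *\<^sub>R \<alpha> + ((1 - t) * \<gamma>2) *\<^sub>R \<beta>) /\<^sub>R (t * \<gamma>1 + (1 - t) * \<gamma>2))"
    if \<alpha>: "\<alpha> \<in> mean_set A \<phi>" and \<beta>: "\<beta> \<in> mean_set A \<phi>" for \<alpha> \<beta>
  proof -
    obtain M1 where M1: "M1 \<in> invariant_measures A" "asymptotic_mean \<phi> M1 = \<alpha>" "spectrum_dim A \<psi> \<phi> \<alpha> = ereal (dim_ratio M1)"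
      using spectrum_eq[OF aa \<alpha>] by blast
    obtain M2 where M2: "M2 \<in> invariant_measures A" "asymptotic_mean \<phi> M2 = \<beta>" "spectrum_dim A \<psi> \<phi> \<beta> = ereal (dim_ratio M2)"
      using spectrum_eq[OF aa \<beta>] by blast
    define P Q where "P = - asymptotic_mean \<psi> M1" and "Q = - asymptotic_mean \<psi> M2"
    have PQ: "a \<le> P" "P \<le> b" "a \<le> Q" "Q \<le> b" using ab(2,3) M1(1) M2(1) by (auto simp: P_def Q_def)
    have pos: "P > 0" "Q > 0" using PQ ab(1) by linarith+
    show ?thesis
    proof (rule bexI[OF _ range[OF PQ(1,2)]], rule bexI[OF _ range[OF PQ(3,4)]], rule ballI)
      fix t :: real assume t: "t \<in> {0..1}"
      define w where "w = t / P + (1 - t) / Q"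
      have nn: "t / P \<ge> 0" "(1 - t) / Q \<ge> 0" using t pos by auto
      have "w > 0"
      proof (cases "t = 0")
        case False
        then have "t / P > 0" using t pos by simp
        then show ?thesis using nn by (simp add: w_def)
      qed (use pos in \<open>simp add: w_def\<close>)
      define s where "s = (t / P) / w"
      have s1: "1 - s = ((1 - t) / Q) / w"
      proof -
        have "s + ((1 - t) / Q) / w = 1" unfolding s_def add_divide_distrib[symmetric] w_def[symmetric] using \<open>w > 0\<close> by simp
        then show ?thesis by linarith
      qed
      have s: "0 \<le> s" unfolding s_def by (rule divide_nonneg_pos[OF nn(1) \<open>w > 0\<close>])
      have s': "0 \<le> 1 - s" unfolding s1 by (rule divide_nonneg_pos[OF nn(2) \<open>w > 0\<close>])
      obtain M where M: "M \<in> invariant_measures A" "asymptotic_mean \<phi> M = s *\<^sub>R \<alpha> + (1 - s) *\<^sub>R \<beta>"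
        "asymptotic_mean \<psi> M = s * asymptotic_mean \<psi> M1 + (1 - s) * asymptotic_mean \<psi> M2"
        "s * entropy_rate (word_prob M1) + (1 - s) * entropy_rate (word_prob M2) \<le> entropy_rate (word_prob M)"
        using spectrum_mixture[OF aa M1(1) M2(1) s] s' unfolding M1(2) M2(2) by auto
      have h: "entropy_rate (word_prob M1) = P * dim_ratio M1" "entropy_rate (word_prob M2) = Q * dim_ratio M2"
        using pos by (auto simp: dim_ratio_def P_def Q_def)
      have "- asymptotic_mean \<psi> M = s * P + (1 - s) * Q" using M(3) by (simp add: P_def Q_def)
      also have "\<dots> = (t + (1 - t)) / w" unfolding s1 unfolding s_def using pos by (simp add: add_divide_distrib[symmetric])
      finally have den: "- asymptotic_mean \<psi> M = 1 / w" by simp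
      have "(t * dim_ratio M1 + (1 - t) * dim_ratio M2) / w \<le> entropy_rate (word_prob M)"
        using M(4) pos unfolding h s1 unfolding s_def by (simp add: add_divide_distrib)
      then have "t * dim_ratio M1 + (1 - t) * dim_ratio M2 \<le> dim_ratio M"
        unfolding dim_ratio_def[of M] den using \<open>w > 0\<close> by (simp add: pos_divide_le_eq)
      moreover have "dim_ratio M \<le> ?D (asymptotic_mean \<phi> M)"
      proof -
        have "asymptotic_mean \<phi> M \<in> mean_set A \<phi>" using M(1) by (simp add: mean_set_def)
        then obtain M' where "spectrum_dim A \<psi> \<phi> (asymptotic_mean \<phi> M) = ereal (dim_ratio M')" using spectrum_eq[OF aa] by metis
        then show ?thesis using spectrum_dim_ge[OF aa M(1)] by simp
      qed
      moreover have "asymptotic_mean \<phi> M = ((t * (1 / P)) *\<^sub>R \<alpha> + ((1 - t) * (1 / Q)) *\<^sub>R \<beta>) /\<^sub>R (t * (1 / P) + (1 - t) * (1 / Q))"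
      proof -
        have wt: "t * (1 / P) + (1 - t) * (1 / Q) = w" by (simp add: w_def)
        show ?thesis unfolding wt M(2) s1 unfolding s_def by (simp add: scaleR_add_right divide_inverse mult_ac)
      qed
      ultimately show "t * ?D \<alpha> + (1 - t) * ?D \<beta> \<le> ?D (((t * (1 / P)) *\<^sub>R \<alpha> + ((1 - t) * (1 / Q)) *\<^sub>R \<beta>) /\<^sub>R (t * (1 / P) + (1 - t) * (1 / Q)))"
        using M1(3) M2(3) by simp
    qed
  qed
  then show ?thesis unfolding weakly_concave_on_def using convex_mean_set[OF aa] c(1) by blast
qed

text \<open>For the zero potential all balls are counted.\<close>

lemma growth_attained:
  obtains M where "M \<in> invariant_measures A" "limsup (\<lambda>n. ereal (ball_growth A \<psi> n)) \<le> ereal (dim_ratio M)"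
proof -
  define \<phi> :: "nat \<Rightarrow> (nat \<Rightarrow> nat) \<Rightarrow> real ^ 1" where "\<phi> n x = 0" for n x
  have aa: "asymp_additive A \<phi>" unfolding asymp_additive_def \<phi>_def
    by (auto intro!: exI[of _ "\<lambda>_. 0 :: real ^ 1"] exI[of _ "0 :: real"])
  have count: "count_rate \<phi> 0 \<epsilon> n = ereal (ball_growth A \<psi> n)" if "\<epsilon> > 0" "n > 0" for \<epsilon> n
  proof -
    have "\<exists>x. x \<in> cylinder A u" if "u \<in> balls n" for u using cylinder_nonempty[OF ballsD(1)[OF that]] by blast
    then have "{u \<in> balls n. \<exists>x\<in>cylinder A u. norm (\<phi> (length u) x /\<^sub>R real (length u) - 0) < \<epsilon>} = balls n"
      using that by (auto simp: \<phi>_def)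
    then have "level_count A \<psi> \<phi> 0 n \<epsilon> = card (balls n)" by (simp only: level_count_def)
    moreover have "card (balls n) > 0" using card_balls_pos[of n] by linarith
    ultimately show ?thesis using ereal_log_card[OF that(2)] by (simp only: count_rate_def ball_growth_def)
  qed
  have "limsup (count_rate \<phi> 0 \<epsilon>) = limsup (\<lambda>n. ereal (ball_growth A \<psi> n))" if "\<epsilon> > 0" for \<epsilon>
    by (intro Limsup_eq eventually_mono[OF eventually_gt_at_top[of 0]] count[OF that])
  then have "Lambda_upper A \<psi> \<phi> 0 = (INF \<epsilon>\<in>{0::real<..}. limsup (\<lambda>n. ereal (ball_growth A \<psi> n)))"
    unfolding Lambda_INF by (intro INF_cong) auto
  then have L: "Lambda_upper A \<psi> \<phi> 0 = limsup (\<lambda>n. ereal (ball_growth A \<psi> n))" by simp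
  have "0 \<le> ereal (ball_growth A \<psi> n)" for n
    unfolding ball_growth_def using card_balls_pos[of n] by (simp add: divide_nonneg_nonneg)
  then have "0 \<le> liminf (\<lambda>n. ereal (ball_growth A \<psi> n))" by (intro Liminf_bounded always_eventually) auto
  also have "\<dots> \<le> limsup (\<lambda>n. ereal (ball_growth A \<psi> n))" by (rule Liminf_le_Limsup) simp
  finally have "Lambda_upper A \<psi> \<phi> 0 \<noteq> - \<infinity>" unfolding L by auto
  from Lambda_upper_attained[OF aa this] show ?thesis using that L by metis
qed

text \<open>The upper growth rate of the balls is at most the dimension of a level set, which is at
  most the Hausdorff dimension of the space and hence at most the lower growth rate. So all these
  numbers are equal.\<close>

lemma full_dimension:
  fixes \<phi> :: "nat \<Rightarrow> (nat \<Rightarrow> nat) \<Rightarrow> real ^ 'd"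
  assumes aa: "asymp_additive A \<phi>"
  obtains G where "hausdorff_dim X d X = ereal G" "ball_growth A \<psi> \<longlonglongrightarrow> G" "lower_box_dim X d X = ereal G" "upper_box_dim X d X = ereal G"
    "\<exists>\<alpha>\<in>mean_set A \<phi>. spectrum_dim A \<psi> \<phi> \<alpha> = ereal G"
proof -
  let ?g = "\<lambda>n. ereal (ball_growth A \<psi> n)"
  obtain M where M: "M \<in> invariant_measures A" "limsup ?g \<le> ereal (dim_ratio M)" using growth_attained by blast
  define \<alpha> where "\<alpha> = asymptotic_mean \<phi> M"
  have \<alpha>: "\<alpha> \<in> mean_set A \<phi>" using M(1) by (simp add: \<alpha>_def mean_set_def)
  obtain M' where M': "spectrum_dim A \<psi> \<phi> \<alpha> = ereal (dim_ratio M')" using spectrum_eq[OF aa \<alpha>] by blast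
  define G where "G = dim_ratio M'"
  have 1: "limsup ?g \<le> ereal G" using M(2) spectrum_dim_ge[OF aa M(1)] M' unfolding \<alpha>_def[symmetric] G_def by (metis order_trans)
  have 2: "ereal G \<le> hausdorff_dim X d X" unfolding G_def M'[symmetric] by (rule hausdorff_dim_mono) (auto simp: level_set_def)
  have 3: "hausdorff_dim X d X \<le> liminf ?g" by (rule hausdorff_dim_le_growth)
  have 4: "liminf ?g \<le> limsup ?g" by (rule Liminf_le_Limsup) simp
  have dim: "hausdorff_dim X d X = ereal G" "liminf ?g = ereal G" "limsup ?g = ereal G"
    using 1 2 3 4 by (meson order_antisym order_trans)+
  have "?g \<longlonglongrightarrow> ereal G" by (rule Liminf_eq_Limsup) (use dim in auto)
  then have lim: "ball_growth A \<psi> \<longlonglongrightarrow> G" by simp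
  have lo: "ereal G \<le> lower_box_dim X d X" using hausdorff_dim_le_lower_box_dim dim(1) by simp
  have mid: "lower_box_dim X d X \<le> upper_box_dim X d X" unfolding lower_box_dim_def upper_box_dim_def by (rule Liminf_le_Limsup) simp
  note up = upper_box_dim_le_growth[OF lim]
  have "lower_box_dim X d X = ereal G" "upper_box_dim X d X = ereal G" using lo mid up by (meson order_antisym order_trans)+
  then show ?thesis using that dim(1) lim \<alpha> M' by (auto simp: G_def)
qed

end

theorem theorem2p2:
  fixes A :: "nat mat"
    and \<Psi> :: "nat \<Rightarrow> (nat \<Rightarrow> nat) \<Rightarrow> real"
    and \<Phi> :: "nat \<Rightarrow> (nat \<Rightarrow> nat) \<Rightarrow> real ^ 'd"
  assumes "primitive_01_mat A"
    and "\<Psi> \<in> Caa_neg A"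
    and "\<Phi> \<in> Caa_vec A"
  shows
    "(\<forall>\<alpha>. level_set A \<Phi> \<alpha> \<noteq> {} \<longleftrightarrow> \<alpha> \<in> mean_set A \<Phi>) \<and>
     (\<forall>\<alpha>\<in>mean_set A \<Phi>.
        \<bar>spectrum_dim A \<Psi> \<Phi> \<alpha>\<bar> \<noteq> \<infinity> \<and>
        spectrum_dim A \<Psi> \<Phi> \<alpha> = Lambda_lower A \<Psi> \<Phi> \<alpha> \<and>
        spectrum_dim A \<Psi> \<Phi> \<alpha> = Lambda_upper A \<Psi> \<Phi> \<alpha> \<and>
        spectrum_dim A \<Psi> \<Phi> \<alpha> = variational A \<Psi> \<Phi> \<alpha>) \<and>
     weakly_concave_on (mean_set A \<Phi>) (\<lambda>\<alpha>. real_of_ereal (spectrum_dim A \<Psi> \<Phi> \<alpha>)) \<and>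
     (let dim_H = hausdorff_dim (subshift A) (gauge_dist A \<Psi>) (subshift A) in
        lower_box_dim (subshift A) (gauge_dist A \<Psi>) (subshift A) = dim_H \<and>
        upper_box_dim (subshift A) (gauge_dist A \<Psi>) (subshift A) = dim_H \<and>
        convergent (ball_growth A \<Psi>) \<and> dim_H = ereal (ball_growth_rate A \<Psi>) \<and>
        (\<exists>\<alpha>\<in>mean_set A \<Phi>. spectrum_dim A \<Psi> \<Phi> \<alpha> = dim_H) \<and>
        (\<forall>\<alpha>\<in>mean_set A \<Phi>. spectrum_dim A \<Psi> \<Phi> \<alpha> \<le> dim_H))"
proof -
  interpret neg_potential A \<Psi> by unfold_locales (fact assms(1,2))+
  have aa: "asymp_additive A \<Phi>" using assms(3) by (rule Caa_vec_asymp_additive)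
  have spectrum: "\<forall>\<alpha>\<in>mean_set A \<Phi>. \<bar>spectrum_dim A \<Psi> \<Phi> \<alpha>\<bar> \<noteq> \<infinity> \<and> spectrum_dim A \<Psi> \<Phi> \<alpha> = Lambda_lower A \<Psi> \<Phi> \<alpha> \<and>
      spectrum_dim A \<Psi> \<Phi> \<alpha> = Lambda_upper A \<Psi> \<Phi> \<alpha> \<and> spectrum_dim A \<Psi> \<Phi> \<alpha> = variational A \<Psi> \<Phi> \<alpha>"
  proof
    fix \<alpha> assume \<alpha>: "\<alpha> \<in> mean_set A \<Phi>"
    obtain M where "spectrum_dim A \<Psi> \<Phi> \<alpha> = ereal (dim_ratio M)" "Lambda_lower A \<Psi> \<Phi> \<alpha> = ereal (dim_ratio M)"
      "Lambda_upper A \<Psi> \<Phi> \<alpha> = ereal (dim_ratio M)" "variational A \<Psi> \<Phi> \<alpha> = ereal (dim_ratio M)"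
      using spectrum_eq[OF aa \<alpha>] by blast
    then show "\<bar>spectrum_dim A \<Psi> \<Phi> \<alpha>\<bar> \<noteq> \<infinity> \<and> spectrum_dim A \<Psi> \<Phi> \<alpha> = Lambda_lower A \<Psi> \<Phi> \<alpha> \<and>
      spectrum_dim A \<Psi> \<Phi> \<alpha> = Lambda_upper A \<Psi> \<Phi> \<alpha> \<and> spectrum_dim A \<Psi> \<Phi> \<alpha> = variational A \<Psi> \<Phi> \<alpha>" by simp
  qed
  have le: "\<forall>\<alpha>\<in>mean_set A \<Phi>. spectrum_dim A \<Psi> \<Phi> \<alpha> \<le> hausdorff_dim X d X"
    by (intro ballI hausdorff_dim_mono) (auto simp: level_set_def)
  obtain G where G: "hausdorff_dim X d X = ereal G" "ball_growth A \<Psi> \<longlonglongrightarrow> G" "lower_box_dim X d X = ereal G"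
    "upper_box_dim X d X = ereal G" "\<exists>\<alpha>\<in>mean_set A \<Phi>. spectrum_dim A \<Psi> \<Phi> \<alpha> = ereal G"
    using full_dimension[OF aa] by blast
  have "convergent (ball_growth A \<Psi>)" "ball_growth_rate A \<Psi> = G"
    using G(2) unfolding ball_growth_rate_def by (auto intro: convergentI limI)
  then show ?thesis
    unfolding Let_def G(1)[symmetric]
    using level_set_nonempty_iff[OF aa] spectrum weakly_concave_spectrum[OF aa] le G(1,3-5)[folded G(1)]
    by (intro conjI allI) (assumption | simp add: G(1))+
qed

end
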